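(* Let $(\xi_k)_{k\in\mathbb N_0}$ be independent identically distributed real random variables with $\mathbb E[\xi_0]=0$ and $\mathbb E[\xi_0^2]=1$ (in particular $\mathbb P[\xi_0=0]<1$). Let $\gamma>0$, let $L$ be a function slowly varying at $+\infty$, and let $(c_k)_{k\in\mathbb N_0}$ be a deterministic real sequence with $c_n^2=\frac{n^{\gamma-1}}{\Gamma(\gamma)}L(n)$ for all $n\ge 1$. Let $f(z)=\sum_{k=0}^\infty \xi_k c_k z^k$, which with probability $1$ is an analytic function on the open unit disk, and for $r\in(0,1)$ let $N[0,r]$ be the number of real zeroes of $f$ in $[0,r]$. Then $$\lim_{r\uparrow 1}\frac{\mathbb E\, N[0,r]}{-\log(1-r)}=\frac{\sqrt{\gamma}}{2\pi}.$$
   Context: $\mathbb N_0=\{0,1,2,\dots\}$; $\Gamma$ is the Gamma function. A function $L(t)$, defined for $t>0$, is called slowly varying at $+\infty$ if $L(t)>0$ for all sufficiently large $t$ and $\lim_{t\to+\infty}L(\lambda t)/L(t)=1$ for every $\lambda>0$.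
   Formalization: The slowly varying function L is additionally assumed Lebesgue measurable on t>0; with the definition as given, non-measurable L exist for which the series has radius of convergence 0 almost surely, so the claim fails. *)

theory Defs
  imports "HOL-Probability.Probability" "HOL-Complex_Analysis.Complex_Analysis"
begin

text \<open>Only the values of \<open>L\<close> on the positive half-line matter. Measurability of \<open>L\<close>, which is
  part of the usual definition in the theory of regular variation, is not included here.\<close>

definition slowly_varying :: "(real \<Rightarrow> real) \<Rightarrow> bool" where
  "slowly_varying L \<longleftrightarrow>
     (\<forall>\<^sub>F t in at_top. L t > 0) \<and>
     (\<forall>a>0. ((\<lambda>t. L (a * t) / L t) \<longlongrightarrow> 1) at_top)"

definition random_taylor :: "(nat \<Rightarrow> 'a \<Rightarrow> real) \<Rightarrow> (nat \<Rightarrow> real) \<Rightarrow> 'a \<Rightarrow> complex \<Rightarrow> complex" where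
  "random_taylor \<xi> c \<omega> z = (\<Sum>k. of_real (\<xi> k \<omega> * c k) * z ^ k)"

text \<open>The number of distinct zeros of \<open>f\<close> in the real interval \<open>[0, r]\<close>; it is \<open>\<infinity>\<close> if there are
  infinitely many, for instance if \<open>f\<close> vanishes identically.\<close>

definition num_real_zeros :: "(complex \<Rightarrow> complex) \<Rightarrow> real \<Rightarrow> ennreal" where
  "num_real_zeros f r =
     emeasure (count_space UNIV) {x :: real. 0 \<le> x \<and> x \<le> r \<and> f (complex_of_real x) = 0}"

end

theory Submission
  imports Defs "HOL-Real_Asymp.Real_Asymp"
begin

text \<open>
  Put \<open>x = exp (- s)\<close> and \<open>X s = f (exp (- s))\<close>. The variance of \<open>X s\<close> is \<open>V (2 * s)\<close>, where \<open>V\<close> is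
  regularly varying of index \<open>- \<gamma>\<close> at \<open>0\<close>. Hence the normalised pair \<open>(X s, X (s exp (- h)))\<close> has a
  Gaussian limit with correlation \<open>sech (h / 2) powr \<gamma>\<close>, and the probability of a sign change
  between the two points tends to \<open>arccos (sech (h / 2) powr \<gamma>) / \<pi>\<close>, which is asymptotic to
  \<open>h * sqrt \<gamma> / (2 * \<pi>)\<close> as \<open>h\<close> tends to \<open>0\<close>.

  A sign change forces a zero, and an interval with exactly one zero and no sign change has a
  multiple zero or a zero at an end point. So it remains to show that the expected number of zeros
  in excess of sign changes is \<open>o(h)\<close> per interval. By Jensen's inequality, \<open>m\<close> zeros near \<open>s\<close> force
  \<open>X s\<close> to be smaller by a factor \<open>q ^ m\<close> than the mean square of \<open>f\<close> on a circle, and a small ball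
  estimate for \<open>X s\<close> makes this unlikely. The grid points \<open>s = exp (- h j)\<close> up to \<open>1 - r\<close>
  number about \<open>- ln (1 - r) / h\<close>; summing and letting \<open>h\<close> tend to \<open>0\<close> gives the limit.
\<close>

section \<open>Uniform convergence for slowly varying functions\<close>

text \<open>Only two moments are assumed, so there need be no density and no Kac-Rice formula;
  everything passes through characteristic functions. These control \<open>X s\<close> only down to
  the scale \<open>s powr \<kappa>\<close> relative to its standard deviation, and this dictates how
  the sum over \<open>m\<close> of the probability of \<open>m\<close> zeros near \<open>s\<close>
  is split. For \<open>m\<close> up to order \<open>ln (1 / s)\<close>, an error
  \<open>s powr \<kappa>\<close> per term is harmless. Up to order \<open>1 / s ^ 4\<close>, a bound
  of order \<open>s ^ 5\<close> comes from \<open>d\<close> weakly correlated points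
  \<open>l ^ i * s\<close> used together. Beyond that, many zeros force a whole block of
  coefficients to be small or the series to be huge, which is exponentially unlikely. An interval of
  relative length \<open>h = p ^ 3 / 2\<close> below \<open>s\<close> lies within
  \<open>p ^ 3\<close> times the radius \<open>s / 2\<close> of a circle about \<open>s\<close>, so
  Jensen's factor is \<open>(p ^ 3) ^ m\<close>. Against a small ball level
  \<open>p ^ (2 * m)\<close> this leaves a probability of order \<open>p ^ (2 * m)\<close>, hence
  \<open>p ^ 4\<close> for the leading case \<open>m = 2\<close>; the cube is what makes the excess
  \<open>o(h)\<close>. The zeros away from \<open>1\<close> contribute a bounded amount, which
  vanishes after division by \<open>- ln (1 - r)\<close>.\<close>

lemma measure_scaled_real:
  fixes S :: "real set"
  assumes "S \<in> sets lebesgue" "l > 0"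
  shows "(*) l ` S \<in> sets lebesgue" "emeasure lebesgue ((*) l ` S) = ennreal l * emeasure lebesgue S"
proof -
  have eq: "(*) l ` S = (\<lambda>x. 0 + (\<Sum>j\<in>Basis. (l * (x \<bullet> j)) *\<^sub>R j)) ` S"
    by simp
  have "(*) l ` S = (\<lambda>x. x / l) -` S \<inter> space lebesgue"
    using assms(2) by (force simp: image_iff)
  also have "\<dots> = (*\<^sub>R) (1/l) -` S \<inter> space lebesgue" by (auto simp: divide_inverse mult.commute)
  also have "\<dots> \<in> sets lebesgue"
    using assms lebesgue_measurable_scaling measurable_sets by blast
  finally show "(*) l ` S \<in> sets lebesgue" .
  show "emeasure lebesgue ((*) l ` S) = ennreal l * emeasure lebesgue S"
    using emeasure_lebesgue_affine[of l 0 S] assms by simp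
qed

lemma emeasure_increasing_eventually_gt:
  fixes U :: "nat \<Rightarrow> real set"
  assumes "\<And>n. U n \<in> sets lebesgue" "incseq U" "(\<Union>n. U n) = {a..b}" "m < b - a" "0 \<le> m" "a \<le> b"
  shows "\<forall>\<^sub>F n in sequentially. emeasure lebesgue (U n) > ennreal m"
proof -
  have "(\<lambda>n. emeasure lebesgue (U n)) \<longlonglongrightarrow> emeasure lebesgue (\<Union>n. U n)"
    using assms by (intro Lim_emeasure_incseq) auto
  also have "emeasure lebesgue (\<Union>n. U n) = ennreal (b - a)"
    using assms by simp
  finally show ?thesis
    using order_tendstoD(1)[of "\<lambda>n. emeasure lebesgue (U n)" "ennreal (b-a)" sequentially "ennreal m"] assms
    by (simp add: ennreal_less_iff)
qed

text \<open>The condition on every \<open>m \<ge> n\<close> makes the sets increase with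
  \<open>n\<close>; pointwise convergence then becomes convergence of measure, as in Egorov's
  theorem.\<close>

definition near_ratio :: "(real \<Rightarrow> real) \<Rightarrow> real \<Rightarrow> (nat \<Rightarrow> real) \<Rightarrow> real \<Rightarrow> real \<Rightarrow> nat \<Rightarrow> real set" where
  "near_ratio L \<eta> y a b n = {u\<in>{a..b}. \<forall>m\<ge>n. \<bar>L (u * y m) / L (y m) - 1\<bar> < \<eta>}"

lemma near_ratio_large:
  fixes L :: "real \<Rightarrow> real"
  assumes L: "slowly_varying L" "L \<in> borel_measurable (lebesgue_on {0<..})"
    and y: "filterlim y at_top sequentially" "\<And>n. y n > 0" and a: "0 < a" "a \<le> b" and "\<eta> > 0"
    and m: "0 \<le> m" "m < b - a"
  shows "\<forall>\<^sub>F n in sequentially. near_ratio L \<eta> y a b n \<in> sets lebesgue \<and>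
           emeasure lebesgue (near_ratio L \<eta> y a b n) > ennreal m"
proof -
  let ?U = "near_ratio L \<eta> y a b"
  \<comment> \<open>Extension by \<open>0\<close> gives a function measurable on the whole line; all
    arguments \<open>y n * u\<close> with \<open>u\<close> in \<open>[a, b]\<close> are positive, so
    the sets do not change.\<close>
  define L' where "L' = (\<lambda>x. if x \<in> {0<..} then L x else 0)"
  have L': "L' \<in> borel_measurable lebesgue"
    using L(2) borel_measurable_if[of "{0<..}" L] unfolding L'_def by simp
  have comp: "(\<lambda>u. L' (y n * u)) \<in> borel_measurable lebesgue" for n
    using measurable_compose[OF lebesgue_measurable_scaling L', of "y n"] by simp
  have Ueq: "?U n = (\<Inter>m\<in>{n..}. {u\<in>space lebesgue. \<bar>L' (y m * u) / L (y m) - 1\<bar> < \<eta>}) \<inter> {a..b}" for n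
    using a y(2) unfolding near_ratio_def L'_def by (auto simp: mult.commute) 
  have meas: "?U n \<in> sets lebesgue" for n
  proof -
    have "{u\<in>space lebesgue. \<bar>L' (y m * u) / L (y m) - 1\<bar> < \<eta>} \<in> sets lebesgue" for m
      using comp by measurable
    moreover have "{a..b} \<in> sets lebesgue" by simp
    ultimately show ?thesis unfolding Ueq 
      by (intro sets.Int sets.countable_INT'') auto
  qed
  have inc: "incseq ?U" unfolding incseq_def near_ratio_def by fastforce
  have un: "(\<Union>n. ?U n) = {a..b}"
  proof (intro equalityI subsetI)
    fix u assume u: "u \<in> {a..b}"
    then have "((\<lambda>t. L (u * t) / L t) \<longlongrightarrow> 1) at_top"
      using L(1) a unfolding slowly_varying_def by auto
    then have "(\<lambda>n. L (u * y n) / L (y n)) \<longlonglongrightarrow> 1"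
      using y(1) filterlim_compose by blast
    then have "\<forall>\<^sub>F n in sequentially. \<bar>L (u * y n) / L (y n) - 1\<bar> < \<eta>"
      using \<open>\<eta> > 0\<close> by (auto simp: tendsto_iff dist_real_def)
    then show "u \<in> (\<Union>n. ?U n)" using u
      unfolding eventually_sequentially near_ratio_def by auto
  qed (auto simp: near_ratio_def)
  show ?thesis
    using emeasure_increasing_eventually_gt[OF meas inc un m(2,1) a(2)] meas by simp
qed

text \<open>If the convergence failed along \<open>x n\<close> with factors \<open>l n\<close>, the factors good for \<open>x n\<close> and
  \<open>l n\<close> times those good for \<open>l n * x n\<close> would both fill more than half of \<open>[1, 8]\<close>; a common
  point gives a contradiction.\<close>

lemma slowly_varying_uniform:
  fixes L :: "real \<Rightarrow> real"
  assumes L: "slowly_varying L" "L \<in> borel_measurable (lebesgue_on {0<..})" and "\<delta> > 0"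
  shows "\<exists>X>0. \<forall>x\<ge>X. \<forall>l\<in>{1..2}. \<bar>L (l * x) / L x - 1\<bar> < \<delta>"
proof (rule ccontr)
  assume neg: "\<not> ?thesis"
  obtain X0 where X0: "X0 > 0" "\<And>x. x \<ge> X0 \<Longrightarrow> L x > 0"
    using L(1) unfolding slowly_varying_def eventually_at_top_linorder
    by (metis dual_order.trans linorder_le_cases zero_less_one order_less_le_trans)
  have "\<forall>n::nat. \<exists>x l. x \<ge> real n + X0 \<and> l \<in> {1..2} \<and> \<bar>L (l * x) / L x - 1\<bar> \<ge> \<delta>"
  proof
    fix n :: nat
    have "real n + X0 > 0" using X0 by simp
    then have "\<not> (\<forall>x\<ge>real n + X0. \<forall>l\<in>{1..2}. \<bar>L (l * x) / L x - 1\<bar> < \<delta>)" using neg by blast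
    then show "\<exists>x l. x \<ge> real n + X0 \<and> l \<in> {1..2} \<and> \<bar>L (l * x) / L x - 1\<bar> \<ge> \<delta>"
      by (meson linorder_not_less)
  qed
  then obtain x l where xl: "\<And>n. x n \<ge> real n + X0" "\<And>n. l n \<in> {1..2}" 
      "\<And>n. \<bar>L (l n * x n) / L (x n) - 1\<bar> \<ge> \<delta>" by metis
  have xpos: "x n > 0" for n using xl(1)[of n] X0 by linarith
  have lx: "l n * x n \<ge> x n" for n using xl(2)[of n] xpos[of n] by simp
  have fx: "filterlim x at_top sequentially"
    by (rule filterlim_at_top_mono[OF filterlim_real_sequentially]) (use xl(1) X0 in \<open>auto intro!: always_eventually\<close>,
      smt (verit) xl(1))
  have flx: "filterlim (\<lambda>n. l n * x n) at_top sequentially"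
    by (rule filterlim_at_top_mono[OF fx]) (use lx in auto)
  \<comment> \<open>If \<open>A / B\<close> and \<open>A / D\<close> are within
    \<open>\<eta> \<le> 1/4\<close> of \<open>1\<close>, then \<open>B / D\<close> is within
    \<open>4 * \<eta>\<close> of \<open>1\<close>.\<close>
  define \<eta> where "\<eta> = min \<delta> 1 / 4"
  have \<eta>: "\<eta> > 0" "\<eta> \<le> 1/4" "4 * \<eta> \<le> \<delta>" using \<open>\<delta> > 0\<close> unfolding \<eta>_def by auto
  \<comment> \<open>A factor \<open>l n\<close> between \<open>1\<close> and \<open>2\<close> maps
    \<open>[1, 4]\<close> into \<open>[1, 8]\<close>, an interval of length \<open>7\<close>, and
    does not shrink measures. Measure above \<open>6\<close> for \<open>?U n\<close> and above
    \<open>2\<close> for \<open>?V n\<close> therefore forces \<open>?U n\<close> to meet the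
    dilated \<open>?V n\<close>.\<close>
  let ?U = "near_ratio L \<eta> x 1 8" and ?V = "near_ratio L \<eta> (\<lambda>n. l n * x n) 1 4"
  have lxpos: "l n * x n > 0" for n using lx[of n] xpos[of n] by linarith
  have "\<forall>\<^sub>F n in sequentially. ?U n \<in> sets lebesgue \<and> emeasure lebesgue (?U n) > ennreal 6"
    by (rule near_ratio_large[OF L fx xpos]) (use \<eta>(1) in auto)
  moreover have "\<forall>\<^sub>F n in sequentially. ?V n \<in> sets lebesgue \<and> emeasure lebesgue (?V n) > ennreal 2"
    by (rule near_ratio_large[OF L flx lxpos]) (use \<eta>(1) in auto)
  ultimately have "\<forall>\<^sub>F n in sequentially. (?U n \<in> sets lebesgue \<and> emeasure lebesgue (?U n) > ennreal 6) \<and>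
      (?V n \<in> sets lebesgue \<and> emeasure lebesgue (?V n) > ennreal 2)"
    by (rule eventually_conj)
  then obtain n where n: "?U n \<in> sets lebesgue" "emeasure lebesgue (?U n) > ennreal 6"
      "?V n \<in> sets lebesgue" "emeasure lebesgue (?V n) > ennreal 2"
    unfolding eventually_sequentially by blast
  define W where "W = (*) (l n) ` ?V n"
  have ln: "1 \<le> l n" "l n \<le> 2" using xl(2)[of n] by auto
  have W: "W \<in> sets lebesgue" "emeasure lebesgue W = ennreal (l n) * emeasure lebesgue (?V n)"
    using measure_scaled_real[OF n(3), of "l n"] ln unfolding W_def by auto
  have "ennreal 1 * emeasure lebesgue (?V n) \<le> emeasure lebesgue W"
    unfolding W(2) using ln by (intro mult_right_mono ennreal_leI) auto
  then have W2: "emeasure lebesgue W > ennreal 2" using n(4) by simp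
  have sub: "?U n \<union> W \<subseteq> {1..8}"
  proof -
    have "l n * v \<in> {1..8}" if "v \<in> {1..4}" for v
      using mult_mono[of 1 "l n" 1 v] mult_mono[of "l n" 2 v 4] that ln by auto
    then show ?thesis unfolding W_def near_ratio_def by auto
  qed
  have "?U n \<inter> W \<noteq> {}"
  proof
    assume "?U n \<inter> W = {}"
    then have "emeasure lebesgue (?U n) + emeasure lebesgue W = emeasure lebesgue (?U n \<union> W)"
      using n W by (intro plus_emeasure) auto
    also have "\<dots> \<le> emeasure lebesgue {1..8::real}"
      using sub by (intro emeasure_mono) auto
    also have "\<dots> = ennreal 7" by simp
    finally have "emeasure lebesgue (?U n) + emeasure lebesgue W \<le> ennreal 7" .
    moreover have "ennreal 6 + ennreal 2 \<le> emeasure lebesgue (?U n) + emeasure lebesgue W"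
      using n(2) W2 by (intro add_mono) auto
    ultimately have "ennreal 6 + ennreal 2 \<le> ennreal 7" by order
    then show False by (simp flip: ennreal_plus ennreal_numeral)
  qed
  then obtain v where v: "v \<in> ?V n" "l n * v \<in> ?U n" unfolding W_def by auto
  define A where "A = L (v * (l n * x n))"
  have "A = L (l n * v * x n)" unfolding A_def by (simp add: mult_ac)
  with v have 1: "\<bar>A / L (l n * x n) - 1\<bar> < \<eta>" and 2: "\<bar>A / L (x n) - 1\<bar> < \<eta>"
    unfolding near_ratio_def A_def by auto
  define B D where "B = L (l n * x n)" and "D = L (x n)"
  have "x n \<ge> X0" using xl(1)[of n] by simp
  then have "L (x n) > 0" "L (l n * x n) > 0" using X0(2) order_trans[OF _ lx[of n]] by auto
  then have pos: "B > 0" "D > 0" unfolding B_def D_def by auto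
  have "(1-\<eta>) * B < A" "A < (1+\<eta>) * B" "(1-\<eta>)*D < A" "A < (1+\<eta>)*D"
    using 1 2 pos unfolding B_def[symmetric] D_def[symmetric] abs_less_iff
    by (auto simp: field_simps)
  then have ineq: "(1-\<eta>) * B < (1+\<eta>) * D" "(1-\<eta>)*D < (1+\<eta>)*B" by auto
  define q where "q = B / D"
  have "(1-\<eta>) * q < 1+\<eta>" "1-\<eta> < (1+\<eta>)*q"
    using ineq pos unfolding q_def by (auto simp: field_simps)
  moreover have "1 + \<eta> \<le> (1-\<eta>) * (1 + 4*\<eta>)" "(1+\<eta>) * (1 - 4*\<eta>) \<le> 1 - \<eta>"
    using \<eta> mult_left_mono[of "\<eta>" "1/4" \<eta>] by (simp_all add: algebra_simps)
  ultimately have "(1-\<eta>) * q < (1-\<eta>) * (1 + 4*\<eta>)" "(1+\<eta>) * (1 - 4*\<eta>) < (1+\<eta>)*q" by linarith+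
  then have "q < 1 + 4*\<eta>" "1 - 4 * \<eta> < q" using \<eta> by (auto simp: mult_less_cancel_left)
  then have "\<bar>L (l n * x n) / L (x n) - 1\<bar> < \<delta>" using \<eta> unfolding q_def B_def D_def by linarith
  then show False using xl(3)[of n] by simp
qed

section \<open>Regularly varying coefficients\<close>

text \<open>Regular variation as seen along the integers. \<open>ratio_Suc\<close> and
  \<open>ratio_mult\<close> yield the behaviour of the generating function \<open>V\<close> near
  \<open>0\<close>; \<open>doubling\<close> serves to show that no single term dominates
  \<open>V\<close>.\<close>

locale regvar_coeffs =
  fixes c :: "nat \<Rightarrow> real" and \<gamma> :: real
  assumes gamma_pos: "\<gamma> > 0"
    and nonzero: "\<forall>\<^sub>F n in sequentially. c n \<noteq> 0"
    and ratio_Suc: "(\<lambda>n. (c (Suc n))\<^sup>2 / (c n)\<^sup>2) \<longlonglongrightarrow> 1"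
    and ratio_mult: "\<And>p. p \<ge> 1 \<Longrightarrow> (\<lambda>n. (c (p * n))\<^sup>2 / (c n)\<^sup>2) \<longlonglongrightarrow> real p powr (\<gamma> - 1)"
    and doubling: "\<exists>C>0. \<exists>K. \<forall>j\<ge>K. \<forall>k\<in>{j..2 * j}. (c k)\<^sup>2 \<le> C * (c j)\<^sup>2"

text \<open>The limit in \<open>ratio_mult\<close> is pointwise and follows from the definition. In
  \<open>ratio_Suc\<close> the factor \<open>Suc n / n\<close> moves with \<open>n\<close>, and in
  \<open>doubling\<close> it ranges over \<open>[1, 2]\<close>; both rest on uniform convergence
  over that interval.\<close>

lemma slowly_varying_imp_regvar_coeffs:
  assumes "\<gamma> > 0" and L: "slowly_varying L" "L \<in> borel_measurable (lebesgue_on {0<..})"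
    and c: "\<And>n. n \<ge> 1 \<Longrightarrow> (c n)\<^sup>2 = real n powr (\<gamma> - 1) / Gamma \<gamma> * L (real n)"
  shows "regvar_coeffs c \<gamma>"
proof
  have G: "Gamma \<gamma> > 0" using \<open>\<gamma> > 0\<close> by (rule Gamma_real_pos)
  have "\<forall>\<^sub>F t in at_top. L t > 0" using L(1) unfolding slowly_varying_def by simp
  then have Lpos: "\<forall>\<^sub>F n in sequentially. L (real n) > 0"
    using filterlim_real_sequentially unfolding filterlim_iff by blast
  show "\<forall>\<^sub>F n in sequentially. c n \<noteq> 0"
    using Lpos eventually_ge_at_top[of 1]
  proof eventually_elim
    case (elim n)
    then have "(c n)\<^sup>2 > 0" using c[of n] G by simp
    then show ?case by auto
  qed
  have quot: "(c k)\<^sup>2 / (c j)\<^sup>2 = (real k / real j) powr (\<gamma> - 1) * (L (real k) / L (real j))" if "k \<ge> 1" "j \<ge> 1" for k j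
    using that G by (simp add: c powr_divide)
  show "(\<lambda>n. (c (Suc n))\<^sup>2 / (c n)\<^sup>2) \<longlonglongrightarrow> 1"
  proof -
    have "(\<lambda>n. real (Suc n) / real n) \<longlonglongrightarrow> 1" using LIMSEQ_Suc_n_over_n by simp
    then have "(\<lambda>n. (real (Suc n) / real n) powr (\<gamma> - 1)) \<longlonglongrightarrow> 1 powr (\<gamma> - 1)"
      by (intro tendsto_intros) auto
    moreover have "(\<lambda>n. L (real (Suc n)) / L (real n)) \<longlonglongrightarrow> 1"
      unfolding tendsto_iff
    proof (intro allI impI)
      fix e :: real assume "e > 0"
      then obtain X where X: "X > 0" "\<And>x l. x \<ge> X \<Longrightarrow> l\<in>{1..2} \<Longrightarrow> \<bar>L (l * x) / L x - 1\<bar> < e"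
        using slowly_varying_uniform[OF L] by blast
      show "\<forall>\<^sub>F n in sequentially. dist (L (real (Suc n)) / L (real n)) 1 < e"
        using eventually_ge_at_top[of "nat \<lceil>X\<rceil>"] eventually_ge_at_top[of 1]
      proof eventually_elim
        case (elim n)
        then have "real n \<ge> X" by linarith
        moreover have "real (Suc n) / real n \<in> {1..2}" using elim by (auto simp: field_simps)
        moreover have "real (Suc n) / real n * real n = real (Suc n)" using elim by auto
        ultimately show ?case using X(2)[of "real n" "real (Suc n) / real n"] unfolding dist_real_def by metis
      qed
    qed
    ultimately have "(\<lambda>n. (real (Suc n) / real n) powr (\<gamma> - 1) * (L (real (Suc n)) / L (real n))) \<longlonglongrightarrow> 1 powr (\<gamma> - 1) * 1"
      by (rule tendsto_mult)
    then have "(\<lambda>n. (real (Suc n) / real n) powr (\<gamma> - 1) * (L (real (Suc n)) / L (real n))) \<longlonglongrightarrow> 1" by simp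
    then show ?thesis
      by (rule Lim_transform_eventually)
        (rule eventually_mono[OF eventually_ge_at_top[of 1]], simp del: of_nat_Suc add: quot)
  qed
  show "(\<lambda>n. (c (p * n))\<^sup>2 / (c n)\<^sup>2) \<longlonglongrightarrow> real p powr (\<gamma> - 1)" if "p \<ge> 1" for p
  proof -
    have "((\<lambda>t. L (real p * t) / L t) \<longlongrightarrow> 1) at_top"
      using L(1) that unfolding slowly_varying_def by auto
    then have "(\<lambda>n. L (real p * real n) / L (real n)) \<longlonglongrightarrow> 1"
      using filterlim_compose filterlim_real_sequentially by blast
    then have "(\<lambda>n. real p powr (\<gamma> - 1) * (L (real p * real n) / L (real n))) \<longlonglongrightarrow> real p powr (\<gamma> - 1) * 1"
      by (intro tendsto_intros)
    then have "(\<lambda>n. real p powr (\<gamma> - 1) * (L (real p * real n) / L (real n))) \<longlonglongrightarrow> real p powr (\<gamma> - 1)" by simp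
    then show ?thesis
      by (rule Lim_transform_eventually)
        (rule eventually_mono[OF eventually_ge_at_top[of 1]], use that in \<open>simp add: quot\<close>)
  qed
  show "\<exists>C>0. \<exists>K. \<forall>j\<ge>K. \<forall>k\<in>{j..2 * j}. (c k)\<^sup>2 \<le> C * (c j)\<^sup>2"
  proof -
    obtain X where X: "X > 0" "\<And>x l. x \<ge> X \<Longrightarrow> l\<in>{1..2} \<Longrightarrow> \<bar>L (l * x) / L x - 1\<bar> < 1"
      using slowly_varying_uniform[OF L, of 1] by auto
    obtain N where N: "\<And>n. n \<ge> N \<Longrightarrow> L (real n) > 0" using Lpos unfolding eventually_sequentially by auto
    define K where "K = Max {1, N, nat \<lceil>X\<rceil>}"
    have "(c k)\<^sup>2 \<le> (2 powr \<bar>\<gamma> - 1\<bar> * 2) * (c j)\<^sup>2" if j: "j \<ge> K" and k: "k \<in> {j..2 * j}" for j k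
    proof -
      have j1: "j \<ge> 1" "j \<ge> N" "real j \<ge> X" using j unfolding K_def by auto
      define l where "l = real k / real j"
      have l: "l \<in> {1..2}" using k j1 unfolding l_def by (auto simp: field_simps)
      have kj: "real k = l * real j" using j1 unfolding l_def by simp
      have Lj: "L (real j) > 0" using N j1 by simp
      have "L (real k) / L (real j) \<le> 2" using X(2)[OF j1(3) l] unfolding kj by linarith
      moreover have "l powr (\<gamma> - 1) \<le> l powr \<bar>\<gamma> - 1\<bar>" using l by (intro powr_mono) auto
      moreover have "l powr \<bar>\<gamma> - 1\<bar> \<le> 2 powr \<bar>\<gamma> - 1\<bar>" using l by (intro powr_mono2) auto
      moreover have "L (real k) / L (real j) \<ge> 0" using N[of k] k j1 Lj by simp
      ultimately have "l powr (\<gamma> - 1) * (L (real k) / L (real j)) \<le> 2 powr \<bar>\<gamma> - 1\<bar> * 2"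
        by (intro mult_mono) auto
      then have "(c k)\<^sup>2 / (c j)\<^sup>2 \<le> 2 powr \<bar>\<gamma> - 1\<bar> * 2"
        using quot[of k j] k j1 unfolding l_def by auto
      moreover have "(c j)\<^sup>2 > 0" using c[of j] j1 Lj G by simp
      ultimately show ?thesis by (simp add: field_simps)
    qed
    then show ?thesis by (intro exI[of _ "2 powr \<bar>\<gamma> - 1\<bar> * 2"] conjI exI[of _ K]) simp_all
  qed
qed fact

section \<open>Convergence of the Laplace transform of the squared coefficients\<close>

context regvar_coeffs
begin

text \<open>The covariance kernel in disguise: the weights of \<open>X s\<close> and
  \<open>X t\<close> multiply and sum to \<open>V (s + t)\<close>, so that one function of one
  variable carries all variances and correlations.\<close>

definition V :: "real \<Rightarrow> real" where
  "V u = (\<Sum>k. (c k)\<^sup>2 * exp (- (u * real k)))"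

lemma ratio_abs_Suc: "(\<lambda>n. \<bar>c (Suc n)\<bar> / \<bar>c n\<bar>) \<longlonglongrightarrow> 1"
proof -
  have "(\<lambda>n. sqrt ((c (Suc n))\<^sup>2 / (c n)\<^sup>2)) \<longlonglongrightarrow> sqrt 1"
    by (intro tendsto_real_sqrt ratio_Suc)
  then show ?thesis by (simp add: real_sqrt_divide)
qed

lemma summable_geometric_ratio:
  fixes b :: "nat \<Rightarrow> real"
  assumes "\<forall>\<^sub>F n in sequentially. b n \<noteq> 0" "(\<lambda>n. \<bar>b (Suc n)\<bar> / \<bar>b n\<bar>) \<longlonglongrightarrow> 1" "0 \<le> q" "q < 1"
  shows "summable (\<lambda>n. \<bar>b n\<bar> * q ^ n)"
proof (cases "q = 0")
  case True
  then show ?thesis by (intro summable_comparison_test_ev[OF _ summable_zero])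
      (auto intro!: eventually_mono[OF eventually_gt_at_top[of 0]] simp: zero_power)
next
  case False
  define d where "d = (1 + q) / 2"
  have d: "q < d" "d < 1" using assms unfolding d_def by auto
  have "\<forall>\<^sub>F n in sequentially. \<bar>b (Suc n)\<bar> / \<bar>b n\<bar> < d / q"
    using d False assms by (intro order_tendstoD(2)[OF assms(2)]) auto
  with assms(1) have "\<forall>\<^sub>F n in sequentially. \<bar>b (Suc n)\<bar> * q \<le> d * \<bar>b n\<bar>"
  proof eventually_elim
    case (elim n)
    then show ?case using False assms by (auto simp: field_simps)
  qed
  then obtain N where N: "\<And>n. n \<ge> N \<Longrightarrow> \<bar>b (Suc n)\<bar> * q \<le> d * \<bar>b n\<bar>"
    unfolding eventually_sequentially by auto
  show ?thesis
  proof (rule summable_ratio_test[of d N])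
    fix n assume "n \<ge> N"
    then have "(\<bar>b (Suc n)\<bar> * q) * q ^ n \<le> (d * \<bar>b n\<bar>) * q ^ n"
      using N assms by (intro mult_right_mono) auto
    then show "norm (\<bar>b (Suc n)\<bar> * q ^ Suc n) \<le> d * norm (\<bar>b n\<bar> * q ^ n)"
      using assms by (simp add: abs_mult mult_ac)
  qed (use d in auto)
qed

lemma exp_minus_mult_nat: "exp (- (u * real k)) = exp (- u) ^ k"
  by (simp add: exp_of_nat_mult [symmetric] mult.commute)

lemma summable_abs_coeffs: "0 \<le> q \<Longrightarrow> q < 1 \<Longrightarrow> summable (\<lambda>n. \<bar>c n\<bar> * q ^ n)"
  by (rule summable_geometric_ratio[OF nonzero ratio_abs_Suc])

lemma summable_abs_coeffs_exp: "u > 0 \<Longrightarrow> summable (\<lambda>n. \<bar>c n\<bar> * exp (- (u * real n)))"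
  unfolding exp_minus_mult_nat by (rule summable_abs_coeffs) auto

lemma summable_V: "u > 0 \<Longrightarrow> summable (\<lambda>n. (c n)\<^sup>2 * exp (- (u * real n)))"
proof -
  assume "u > 0"
  have "summable (\<lambda>n. \<bar>(c n)\<^sup>2\<bar> * exp (-u) ^ n)"
    by (rule summable_geometric_ratio) (use nonzero ratio_Suc \<open>u > 0\<close> in auto)
  then show ?thesis unfolding exp_minus_mult_nat by simp
qed

lemma V_pos: "u > 0 \<Longrightarrow> V u > 0"
proof -
  assume "u > 0"
  obtain n where "c n \<noteq> 0" using nonzero unfolding eventually_sequentially by blast
  then show ?thesis unfolding V_def
    by (intro suminf_pos2[OF summable_V, where i = n]) (use \<open>u > 0\<close> in auto)
qed

lemma V_antimono: "0 < u \<Longrightarrow> u \<le> v \<Longrightarrow> V v \<le> V u"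
  unfolding V_def
  by (intro suminf_le summable_V mult_left_mono) (auto intro: mult_right_mono)

lemma V_term_le: "0 < u \<Longrightarrow> (c k)\<^sup>2 * exp (- (u * real k)) \<le> V u"
  unfolding V_def using sum_le_suminf[OF summable_V, of u "{k}"] by simp

end

section \<open>Regular variation of \<open>V\<close> at \<open>0\<close>\<close>

context regvar_coeffs
begin

text \<open>Induction on the offset: moving by one index costs a factor that tends to
  \<open>1\<close>.\<close>

lemma ratio_block: 
  assumes "p \<ge> 1"
  shows "(\<lambda>n. (c (p * n + i))\<^sup>2 / (c n)\<^sup>2) \<longlonglongrightarrow> real p powr (\<gamma> - 1)"
proof (induction i)
  case 0
  then show ?case using ratio_mult[OF assms] by simp
next
  case (Suc i)
  have f: "filterlim (\<lambda>n. p * n + i) at_top sequentially"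
    using assms by (intro filterlim_at_top_mono[OF filterlim_ident] always_eventually allI)
      (simp add: trans_le_add1)
  have "(\<lambda>n. (c (Suc (p * n + i)))\<^sup>2 / (c (p * n + i))\<^sup>2) \<longlonglongrightarrow> 1"
    using filterlim_compose[OF ratio_Suc f] .
  from tendsto_mult[OF this Suc]
  have "(\<lambda>n. (c (Suc (p * n + i)))\<^sup>2 / (c (p * n + i))\<^sup>2 * ((c (p * n + i))\<^sup>2 / (c n)\<^sup>2)) \<longlonglongrightarrow> real p powr (\<gamma> - 1)"
    by simp
  then show ?case
  proof (rule Lim_transform_eventually)
    have "\<forall>\<^sub>F n in sequentially. c (p * n + i) \<noteq> 0"
      using nonzero f unfolding filterlim_iff by blast
    then show "\<forall>\<^sub>F n in sequentially. (c (Suc (p * n + i)))\<^sup>2 / (c (p * n + i))\<^sup>2 * ((c (p * n + i))\<^sup>2 / (c n)\<^sup>2)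
      = (c (p * n + Suc i))\<^sup>2 / (c n)\<^sup>2"
      by eventually_elim simp
  qed
qed

text \<open>Compares all \<open>p\<close> coefficients of the block starting at \<open>p * j\<close>
  with the single coefficient \<open>c j\<close>. The squares in the block then sum to about
  \<open>real p powr \<gamma>\<close> times the square of \<open>c j\<close>, the extra power of
  \<open>p\<close> being the length of the block.\<close>

lemma block_bounds:
  assumes p: "p \<ge> 1" and \<delta>: "0 < \<delta>"
  shows "\<exists>J\<ge>1. \<forall>j\<ge>J. c j \<noteq> 0 \<and> (\<forall>i<p. (1 - \<delta>) * real p powr (\<gamma> - 1) * (c j)\<^sup>2 \<le> (c (p * j + i))\<^sup>2 \<and> 
           (c (p * j + i))\<^sup>2 \<le> (1 + \<delta>) * real p powr (\<gamma> - 1) * (c j)\<^sup>2)"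
proof -
  let ?w = "real p powr (\<gamma> - 1)"
  have w: "?w > 0" using p by simp
  have "\<forall>\<^sub>F n in sequentially. (c (p * n + i))\<^sup>2 / (c n)\<^sup>2 > (1 - \<delta>) * ?w \<and> (c (p * n + i))\<^sup>2 / (c n)\<^sup>2 < (1 + \<delta>) * ?w" for i
    using w \<delta> by (intro eventually_conj order_tendstoD[OF ratio_block[OF p]]) (auto simp: algebra_simps)
  then have "\<forall>\<^sub>F n in sequentially. \<forall>i\<in>{..<p}. (c (p * n + i))\<^sup>2 / (c n)\<^sup>2 > (1 - \<delta>) * ?w \<and> (c (p * n + i))\<^sup>2 / (c n)\<^sup>2 < (1 + \<delta>) * ?w"
    by (intro eventually_ball_finite) auto
  with nonzero have "\<forall>\<^sub>F j in sequentially. c j \<noteq> 0 \<and> (\<forall>i<p. (1 - \<delta>) * ?w * (c j)\<^sup>2 \<le> (c (p * j + i))\<^sup>2 \<and> 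
           (c (p * j + i))\<^sup>2 \<le> (1 + \<delta>) * ?w * (c j)\<^sup>2)"
  proof eventually_elim
    case (elim n)
    then have "(c n)\<^sup>2 > 0" by simp
    with elim show ?case by (auto simp: field_simps less_imp_le)
  qed
  then obtain J where "\<forall>j\<ge>J. c j \<noteq> 0 \<and> (\<forall>i<p. (1 - \<delta>) * ?w * (c j)\<^sup>2 \<le> (c (p * j + i))\<^sup>2 \<and> 
           (c (p * j + i))\<^sup>2 \<le> (1 + \<delta>) * ?w * (c j)\<^sup>2)"
    unfolding eventually_sequentially by blast
  then show ?thesis by (intro exI[of _ "max 1 J"]) auto
qed

lemma sum_block_const:
  fixes p j :: nat
  assumes "p \<ge> 1"
  shows "(\<Sum>k\<in>{j * p..<j * p + p}. g k) = (\<Sum>i<p. g (p * j + i))"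
  by (rule sum.reindex_bij_witness[of _ "\<lambda>i. p * j + i" "\<lambda>k. k - p * j"]) (auto simp: mult.commute)

lemma powr_block: "p \<ge> 1 \<Longrightarrow> real p * real p powr (\<gamma> - 1) = real p powr \<gamma>"
  using powr_mult_base[of "real p" "\<gamma> - 1"] by simp

text \<open>For large \<open>p\<close> each block of length \<open>p\<close> has at least the weight
  of the single term that it dilates. A convergent series would then have a tail from
  \<open>p * J\<close> at least as large as its tail from \<open>J\<close>, although the positive
  term at \<open>J\<close> is missing from it.\<close>

lemma not_summable_square: "\<not> summable (\<lambda>k. (c k)\<^sup>2)"
proof
  assume summ: "summable (\<lambda>k. (c k)\<^sup>2)"
  \<comment> \<open>Makes \<open>real p powr \<gamma> \<ge> 2\<close>, which compensates the factor
    \<open>1/2\<close> lost in \<open>block_bounds\<close>.\<close>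
  define p :: nat where "p = max 2 (nat \<lceil>2 powr (1/\<gamma>)\<rceil>)"
  have p: "p \<ge> 2" "real p \<ge> 2 powr (1/\<gamma>)" unfolding p_def by linarith+
  have "real p powr \<gamma> \<ge> (2 powr (1/\<gamma>)) powr \<gamma>" using gamma_pos p by (intro powr_mono2) auto
  then have p2: "real p powr \<gamma> \<ge> 2" using gamma_pos by (simp add: powr_powr)
  obtain J where J: "J \<ge> 1" "\<And>j. j \<ge> J \<Longrightarrow> c j \<noteq> 0"
     "\<And>j i. j \<ge> J \<Longrightarrow> i < p \<Longrightarrow> (1 - 1/2) * real p powr (\<gamma> - 1) * (c j)\<^sup>2 \<le> (c (p * j + i))\<^sup>2"
    using block_bounds[of p "1/2"] p by auto
  define a where "a k = (c k)\<^sup>2" for k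
  have sa: "summable (\<lambda>k. a (k + n))" for n using summable_ignore_initial_segment[OF summ] unfolding a_def .
  have "(\<lambda>k. a (k + p * J)) sums (\<Sum>k. a (k + p * J))" using sa summable_sums by blast
  from sums_group[OF this, of p] p
  have grp: "(\<lambda>n. \<Sum>i<p. a (p * n + i + p * J)) sums (\<Sum>k. a (k + p * J))"
    by (simp add: sum_block_const)
  have "a (j + J) \<le> (\<Sum>i<p. a (p * j + i + p * J))" for j
  proof -
    have "1/2 * (real p * real p powr (\<gamma> - 1)) * a (j + J) = (\<Sum>i<p. (1 - 1/2) * real p powr (\<gamma> - 1) * (c (j + J))\<^sup>2)"
      unfolding a_def by simp
    also have "\<dots> \<le> (\<Sum>i<p. a (p * j + i + p * J))"
      using J(3)[of "j + J"] unfolding a_def by (intro sum_mono) (auto simp: algebra_simps)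
    finally have "1/2 * (real p powr \<gamma>) * a (j + J) \<le> (\<Sum>i<p. a (p * j + i + p * J))"
      using powr_block[of p] p by simp
    moreover have "1 * a (j + J) \<le> (1/2 * (real p powr \<gamma>)) * a (j + J)"
      using p2 unfolding a_def by (intro mult_right_mono) auto
    ultimately show ?thesis by simp
  qed
  then have "(\<Sum>j. a (j + J)) \<le> (\<Sum>k. a (k + p * J))"
    using grp suminf_le[OF _ sa[of J], of "\<lambda>j. \<Sum>i<p. a (p * j + i + p * J)"] by (simp add: sums_iff)
  also have "(\<Sum>k. a (k + p * J)) \<le> (\<Sum>k. a (k + 1 + J))"
  proof -
    define n where "n = p * J - (1 + J)"
    have "p * J \<ge> 2 * J" using p by (intro mult_right_mono) auto
    then have n: "p * J = n + (1 + J)" using J(1) unfolding n_def by linarith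
    have "(\<Sum>k. a (k + 1 + J)) = (\<Sum>k. a (k + n + 1 + J)) + (\<Sum>k<n. a (k + 1 + J))"
      using suminf_split_initial_segment[of "\<lambda>k. a (k + 1 + J)" n] sa[of "1 + J"] by (simp add: add_ac)
    moreover have "(\<Sum>k<n. a (k + 1 + J)) \<ge> 0" unfolding a_def by (intro sum_nonneg) auto
    ultimately show ?thesis unfolding n by (simp add: add_ac)
  qed
  also have "(\<Sum>k. a (k + 1 + J)) = (\<Sum>j. a (j + J)) - a J"
    using suminf_split_initial_segment[of "\<lambda>k. a (k + J)" 1] sa[of J] by (simp add: add_ac)
  finally have "a J \<le> 0" by simp
  then show False using J(2)[of J] unfolding a_def by simp
qed

text \<open>This is what makes additive constants, such as the one in
  \<open>V_dilate_bounds\<close>, negligible against \<open>V\<close>.\<close>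

lemma V_at_top: "filterlim V at_top (at_right 0)"
  unfolding filterlim_at_top
proof
  fix Z :: real
  have "\<exists>n. (\<Sum>k<n. (c k)\<^sup>2) > Z"
  proof (rule ccontr)
    assume "\<not> ?thesis"
    then have "\<And>n. (\<Sum>k<n. (c k)\<^sup>2) \<le> Z" by (auto simp: not_less)
    then have "summable (\<lambda>k. (c k)\<^sup>2)" by (intro bounded_imp_summable[of _ Z]) (auto simp: lessThan_Suc_atMost[symmetric] simp del: sum.lessThan_Suc)
    then show False using not_summable_square by simp
  qed
  then obtain n where n: "(\<Sum>k<n. (c k)\<^sup>2) > Z" by blast
  have "((\<lambda>u. \<Sum>k<n. (c k)\<^sup>2 * exp (- (u * real k))) \<longlongrightarrow> (\<Sum>k<n. (c k)\<^sup>2 * exp (- (0 * real k)))) (at_right 0)"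
    by (intro tendsto_intros)
  then have "\<forall>\<^sub>F u in at_right 0. (\<Sum>k<n. (c k)\<^sup>2 * exp (- (u * real k))) > Z"
    using n by (intro order_tendstoD(1)) auto
  then show "\<forall>\<^sub>F u in at_right 0. Z \<le> V u"
    using eventually_at_right_less[of 0]
  proof eventually_elim
    case (elim u)
    then have "(\<Sum>k<n. (c k)\<^sup>2 * exp (- (u * real k))) \<le> V u"
      unfolding V_def by (intro sum_le_suminf summable_V) auto
    then show ?case using elim by simp
  qed
qed

text \<open>The series for \<open>V u\<close> is grouped into blocks of length \<open>p\<close>.
  Within block \<open>j\<close> the coefficients are close to a multiple of \<open>c j\<close>, and
  the exponentials lie between \<open>exp (- (u * real p))\<close> times the \<open>j\<close>-th
  exponential of \<open>V (real p * u)\<close> and that exponential itself. The finitely many blocks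
  before \<open>J\<close> go into the constant \<open>D\<close>.\<close>

lemma V_dilate_bounds:
  assumes p: "p \<ge> 1" and \<delta>: "0 < \<delta>" "\<delta> < 1"
  shows "\<exists>D\<ge>0. \<forall>u>0. V u \<le> D + (1 + \<delta>) * real p powr \<gamma> * V (real p * u) \<and>
     (1 - \<delta>) * real p powr \<gamma> * exp (- (u * real p)) * V (real p * u) \<le> V u + D"
proof -
  obtain J where J: "J \<ge> 1" 
     "\<And>j i. j \<ge> J \<Longrightarrow> i < p \<Longrightarrow> (1 - \<delta>) * real p powr (\<gamma> - 1) * (c j)\<^sup>2 \<le> (c (p * j + i))\<^sup>2"
     "\<And>j i. j \<ge> J \<Longrightarrow> i < p \<Longrightarrow> (c (p * j + i))\<^sup>2 \<le> (1 + \<delta>) * real p powr (\<gamma> - 1) * (c j)\<^sup>2"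
    using block_bounds[OF p \<delta>(1)] by auto
  \<comment> \<open>One constant serves both inequalities: the first summand bounds an early block
    of \<open>V u\<close>, the second an early term of the dilated series.\<close>
  define A where "A j = (\<Sum>i<p. (c (p * j + i))\<^sup>2) + (1 - \<delta>) * real p powr \<gamma> * (c j)\<^sup>2" for j
  have A0: "A j \<ge> 0" for j unfolding A_def using \<delta> by (intro add_nonneg_nonneg sum_nonneg mult_nonneg_nonneg) auto
  define E where "E j = (if j < J then A j else 0)" for j
  have E: "E sums (\<Sum>j<J. A j)" unfolding E_def using sums_If_finite_set[of "{..<J}" A] by simp
  show ?thesis
  proof (intro exI[of _ "\<Sum>j<J. A j"] conjI allI impI)
    show "(\<Sum>j<J. A j) \<ge> 0" using A0 by (intro sum_nonneg) auto
    fix u :: real assume u: "u > 0"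
    define B where "B j = (\<Sum>i<p. (c (p * j + i))\<^sup>2 * exp (- (u * real (p * j + i))))" for j
    have "(\<lambda>k. (c k)\<^sup>2 * exp (- (u * real k))) sums V u"
      unfolding V_def using summable_V[OF u] summable_sums by blast
    from sums_group[OF this, of p] p have B: "B sums V u"
      unfolding B_def by (simp add: sum_block_const)
    have pu: "real p * u > 0" using p u by simp
    define G where "G j = (c j)\<^sup>2 * exp (- (real p * u * real j))" for j
    have G: "G sums V (real p * u)"
      unfolding V_def G_def using summable_V[OF pu] summable_sums by blast
    have low: "B j \<ge> 0" for j unfolding B_def by (intro sum_nonneg) auto
    have up: "B j \<le> E j + (1 + \<delta>) * real p powr \<gamma> * G j" for j
    proof (cases "j < J")
      case True
      have "B j \<le> (\<Sum>i<p. (c (p * j + i))\<^sup>2 * 1)" unfolding B_def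
        using u by (intro sum_mono mult_left_mono) auto
      also have "\<dots> \<le> A j" unfolding A_def using \<delta> by simp
      also have "\<dots> \<le> E j + (1 + \<delta>) * real p powr \<gamma> * G j"
        using True \<delta> unfolding E_def G_def by simp
      finally show ?thesis .
    next
      case False
      have "B j \<le> (\<Sum>i<p. ((1 + \<delta>) * real p powr (\<gamma> - 1) * (c j)\<^sup>2) * exp (- (real p * u * real j)))"
        unfolding B_def using J(3)[of j] False u \<delta> by (intro sum_mono mult_mono) (auto simp: algebra_simps)
      also have "\<dots> = (1 + \<delta>) * (real p * real p powr (\<gamma> - 1)) * G j" unfolding G_def by simp
      finally show ?thesis using False unfolding powr_block[OF p] E_def by simp
    qed
    have lo: "(1 - \<delta>) * real p powr \<gamma> * exp (- (u * real p)) * G j \<le> B j + E j" for j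
    proof (cases "j < J")
      case True
      have "exp (- (u * real p)) * G j \<le> 1 * (c j)\<^sup>2" unfolding G_def
      proof (rule mult_mono)
        show "(c j)\<^sup>2 * exp (- (real p * u * real j)) \<le> (c j)\<^sup>2"
          using mult_left_mono[of "exp (- (real p * u * real j))" 1 "(c j)\<^sup>2"] u by simp
      qed (use u in auto)
      then have "(1 - \<delta>) * real p powr \<gamma> * (exp (- (u * real p)) * G j) \<le> (1 - \<delta>) * real p powr \<gamma> * (1 * (c j)\<^sup>2)"
        using \<delta> by (intro mult_left_mono) auto
      also have "\<dots> \<le> A j" unfolding A_def by (auto intro: sum_nonneg)
      finally show ?thesis using True low[of j] unfolding E_def by (simp add: mult_ac)
    next
      case False
      have "(1 - \<delta>) * (real p * real p powr (\<gamma> - 1)) * exp (- (u * real p)) * G j =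
         (\<Sum>i<p. ((1 - \<delta>) * real p powr (\<gamma> - 1) * (c j)\<^sup>2) * (exp (- (u * real p)) * exp (- (real p * u * real j))))"
        unfolding G_def by simp
      also have "\<dots> \<le> B j"
        unfolding B_def
      proof (intro sum_mono mult_mono)
        fix i assume i: "i \<in> {..<p}"
        then have "u * real i \<le> u * real p" using u by (intro mult_left_mono) auto
        then show "exp (- (u * real p)) * exp (- (real p * u * real j)) \<le> exp (- (u * real (p * j + i)))"
          by (simp add: exp_add[symmetric] algebra_simps)
      qed (use False J(2)[of j] \<delta> in auto)
      finally show ?thesis using False unfolding powr_block[OF p] E_def by simp
    qed
    show "V u \<le> (\<Sum>j<J. A j) + (1 + \<delta>) * real p powr \<gamma> * V (real p * u)"
      by (rule sums_le[OF up B sums_add[OF E sums_mult[OF G]]])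
    show "(1 - \<delta>) * real p powr \<gamma> * exp (- (u * real p)) * V (real p * u) \<le> V u + (\<Sum>j<J. A j)"
      by (rule sums_le[OF lo sums_mult[OF G] sums_add[OF B E]])
  qed
qed

lemma filterlim_mult_at_right_0: "(l::real) > 0 \<Longrightarrow> filterlim (\<lambda>u. l * u) (at_right 0) (at_right 0)"
  by (rule filterlim_times_pos[OF filterlim_ident]) auto

text \<open>Division of \<open>V_dilate_bounds\<close> by \<open>V (real p * u)\<close> removes the
  constant in the limit, and \<open>\<delta>\<close> is arbitrary.\<close>

lemma V_dilate_nat:
  assumes p: "p \<ge> 1"
  shows "((\<lambda>u. V u / V (real p * u)) \<longlongrightarrow> real p powr \<gamma>) (at_right 0)"
proof -
  let ?w = "real p powr \<gamma>"
  have w: "?w > 0" using p by simp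
  have Vp: "filterlim (\<lambda>u. V (real p * u)) at_top (at_right 0)"
    using filterlim_compose[OF V_at_top filterlim_mult_at_right_0[of "real p"]] p by simp
  have small: "((\<lambda>u. D / V (real p * u)) \<longlongrightarrow> 0) (at_right 0)" for D
    by (rule real_tendsto_divide_at_top[OF tendsto_const Vp])
  have pos: "\<forall>\<^sub>F u in at_right (0::real). u > 0 \<and> V (real p * u) > 0"
    using eventually_at_right_less[of 0] by eventually_elim (use p V_pos in auto)
  show ?thesis
  proof (rule order_tendstoI)
    fix y assume y: "?w < y"
    define \<delta> where "\<delta> = min (1/2) ((y / ?w - 1) / 2)"
    have \<delta>: "0 < \<delta>" "\<delta> < 1" "\<delta> \<le> (y / ?w - 1) / 2" using y w unfolding \<delta>_def by (auto simp: field_simps min_def)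
    have "(1 + \<delta>) * ?w \<le> (1 + (y / ?w - 1) / 2) * ?w" using \<delta> w by (intro mult_right_mono) auto
    also have "\<dots> = (?w + y) / 2" using w by (simp add: field_simps)
    also have "\<dots> < y" using y by simp
    finally have lt: "(1 + \<delta>) * ?w < y" .
    obtain D where D: "\<And>u. u > 0 \<Longrightarrow> V u \<le> D + (1 + \<delta>) * ?w * V (real p * u)"
      using V_dilate_bounds[OF p \<delta>(1,2)] by blast
    have "((\<lambda>u. D / V (real p * u) + (1 + \<delta>) * ?w) \<longlongrightarrow> 0 + (1 + \<delta>) * ?w) (at_right 0)"
      by (intro tendsto_intros small)
    then have "\<forall>\<^sub>F u in at_right 0. D / V (real p * u) + (1 + \<delta>) * ?w < y"
      using lt by (intro order_tendstoD(2)) auto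
    with pos show "\<forall>\<^sub>F u in at_right 0. V u / V (real p * u) < y"
    proof eventually_elim
      case (elim u)
      have "V u / V (real p * u) \<le> (D + (1 + \<delta>) * ?w * V (real p * u)) / V (real p * u)"
        using D[of u] elim by (intro divide_right_mono) auto
      also have "\<dots> = D / V (real p * u) + (1 + \<delta>) * ?w" using elim by (simp add: add_divide_distrib)
      finally show ?case using elim by simp
    qed
  next
    fix y assume y: "y < ?w"
    define \<delta> where "\<delta> = min (1/2) ((1 - y / ?w) / 2)"
    have \<delta>: "0 < \<delta>" "\<delta> < 1" "\<delta> \<le> (1 - y / ?w) / 2" using y w unfolding \<delta>_def by (auto simp: field_simps min_def)
    have "(1 - \<delta>) * ?w \<ge> (1 - (1 - y / ?w) / 2) * ?w" using \<delta> w by (intro mult_right_mono) auto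
    moreover have "(1 - (1 - y / ?w) / 2) * ?w = (?w + y) / 2" using w by (simp add: field_simps)
    moreover have "(?w + y) / 2 > y" using y by simp
    ultimately have lt: "(1 - \<delta>) * ?w > y" by linarith
    obtain D where D: "\<And>u. u > 0 \<Longrightarrow> (1 - \<delta>) * ?w * exp (- (u * real p)) * V (real p * u) \<le> V u + D"
      using V_dilate_bounds[OF p \<delta>(1,2)] by blast
    have "((\<lambda>u. (1 - \<delta>) * ?w * exp (- (u * real p)) - D / V (real p * u)) \<longlongrightarrow> (1 - \<delta>) * ?w * exp (- (0 * real p)) - 0) (at_right 0)"
      by (intro tendsto_intros small)
    then have "\<forall>\<^sub>F u in at_right 0. (1 - \<delta>) * ?w * exp (- (u * real p)) - D / V (real p * u) > y"
      using lt by (intro order_tendstoD(1)) auto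
    with pos show "\<forall>\<^sub>F u in at_right 0. V u / V (real p * u) > y"
    proof eventually_elim
      case (elim u)
      have "(1 - \<delta>) * ?w * exp (- (u * real p)) * V (real p * u) - D \<le> V u" using D[of u] elim by simp
      then have "((1 - \<delta>) * ?w * exp (- (u * real p)) * V (real p * u) - D) / V (real p * u) \<le> V u / V (real p * u)"
        using elim by (intro divide_right_mono) auto
      moreover have "((1 - \<delta>) * ?w * exp (- (u * real p)) * V (real p * u) - D) / V (real p * u) =
         (1 - \<delta>) * ?w * exp (- (u * real p)) - D / V (real p * u)" using elim by (simp add: diff_divide_distrib)
      ultimately show ?case using elim by simp
    qed
  qed
qed

text \<open>For rational factors the limit follows by dividing two integer dilations; monotonicity of
  \<open>V\<close> extends it to real factors.\<close>

lemma V_regularly_varying: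
  assumes l: "l > 0"
  shows "((\<lambda>u. V (l * u) / V u) \<longlongrightarrow> l powr (- \<gamma>)) (at_right 0)"
proof -
  have rat: "((\<lambda>u. V (r * u) / V u) \<longlongrightarrow> r powr (- \<gamma>)) (at_right 0)" if r0: "r \<in> \<rat>" "r > 0" for r
  proof -
    obtain p q :: nat where pq: "q \<noteq> 0" "\<bar>r\<bar> = real p / real q"
      using Rats_abs_nat_div_natE[OF r0(1)] by blast
    then have r: "r = real p / real q" using r0 by auto
    then have p: "p \<ge> 1" and q: "q \<ge> 1" using r0 pq by (auto simp: Suc_le_eq intro!: gr0I)
    have f: "filterlim (\<lambda>u. (1 / real q) * u) (at_right 0) (at_right 0)"
      using filterlim_mult_at_right_0[of "1 / real q"] q by simp
    have "((\<lambda>u. (V u / V (real q * u)) / (V u / V (real p * u))) \<longlongrightarrow> real q powr \<gamma> / real p powr \<gamma>) (at_right 0)"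
      using p by (intro tendsto_divide V_dilate_nat q) auto
    from filterlim_compose[OF this f]
    have "((\<lambda>u. (V ((1 / real q) * u) / V (real q * ((1 / real q) * u))) / (V ((1 / real q) * u) / V (real p * ((1 / real q) * u)))) \<longlongrightarrow>
        real q powr \<gamma> / real p powr \<gamma>) (at_right 0)" .
    moreover have "real q powr \<gamma> / real p powr \<gamma> = r powr (- \<gamma>)"
      unfolding r using p q by (simp add: powr_divide powr_minus divide_simps)
    moreover have "\<forall>\<^sub>F u in at_right 0. (V ((1 / real q) * u) / V (real q * ((1 / real q) * u))) / (V ((1 / real q) * u) / V (real p * ((1 / real q) * u)))
       = V (r * u) / V u"
      using eventually_at_right_less[of 0]
    proof eventually_elim
      case (elim u)
      have "V ((1 / real q) * u) > 0" using elim q by (intro V_pos) auto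
      moreover have "V (real q * ((1 / real q) * u)) = V u" "V (real p * ((1 / real q) * u)) = V (r * u)"
        using q r by (auto simp: mult.commute)
      moreover have "V u > 0" using elim by (rule V_pos)
      ultimately show ?case by (simp add: field_simps)
    qed
    ultimately show ?thesis by (simp only: Lim_transform_eventually)
  qed
  have cont: "((\<lambda>r. r powr (-\<gamma>)) \<longlongrightarrow> l powr (-\<gamma>)) (at l)"
    using l by (intro tendsto_intros) auto
  show ?thesis
  proof (rule order_tendstoI)
    fix y assume "y < l powr (-\<gamma>)"
    then have "\<forall>\<^sub>F r in at l. r powr (-\<gamma>) > y" using cont order_tendstoD(1) by blast
    then have "\<forall>\<^sub>F r in at_right l. r powr (-\<gamma>) > y" by (rule eventually_at_split[THEN iffD1, THEN conjunct2])
    then obtain b where b: "b > l" "\<And>r. l < r \<Longrightarrow> r < b \<Longrightarrow> r powr (-\<gamma>) > y"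
      unfolding eventually_at_right_field by blast
    obtain r where r: "r \<in> \<rat>" "l < r" "r < b" using Rats_dense_in_real[OF b(1)] by blast
    have "\<forall>\<^sub>F u in at_right 0. V (r * u) / V u > y"
      using b r l by (intro order_tendstoD(1)[OF rat]) auto
    then show "\<forall>\<^sub>F u in at_right 0. V (l * u) / V u > y"
      using eventually_at_right_less[of 0]
    proof eventually_elim
      case (elim u)
      have "V (r * u) / V u \<le> V (l * u) / V u" using elim r l V_pos[of u]
        by (intro divide_right_mono V_antimono) auto
      then show ?case using elim by simp
    qed
  next
    fix y assume "l powr (-\<gamma>) < y"
    then have "\<forall>\<^sub>F r in at l. r powr (-\<gamma>) < y" using cont order_tendstoD(2) by blast
    then have "\<forall>\<^sub>F r in at_left l. r powr (-\<gamma>) < y" by (rule eventually_at_split[THEN iffD1, THEN conjunct1])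
    then obtain b where b: "b < l" "\<And>r. b < r \<Longrightarrow> r < l \<Longrightarrow> r powr (-\<gamma>) < y"
      unfolding eventually_at_left_field by blast
    have "max b 0 < l" using b l by simp
    then obtain r where r: "r \<in> \<rat>" "max b 0 < r" "r < l" using Rats_dense_in_real by blast
    have "\<forall>\<^sub>F u in at_right 0. V (r * u) / V u < y"
      using b r l by (intro order_tendstoD(2)[OF rat]) auto
    then show "\<forall>\<^sub>F u in at_right 0. V (l * u) / V u < y"
      using eventually_at_right_less[of 0]
    proof eventually_elim
      case (elim u)
      have "V (r * u) / V u \<ge> V (l * u) / V u" using elim r l V_pos[of u]
        by (intro divide_right_mono V_antimono) auto
      then show ?case using elim by simp
    qed
  qed
qed

end

section \<open>Potter bounds and the size of single terms\<close>

context regvar_coeffs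
begin

text \<open>Bounds of Potter type. Halving the argument multiplies \<open>V\<close> by nearly
  \<open>2 powr \<gamma>\<close>, hence by a factor between \<open>2 powr (\<gamma> / 2)\<close> and
  \<open>2 powr (2 * \<gamma>)\<close> near \<open>0\<close>; this is iterated from \<open>v\<close>
  down to \<open>u\<close>.\<close>

lemma V_ratio_bounds:
  "\<exists>v0>0. \<forall>u v. 0 < u \<longrightarrow> u \<le> v \<longrightarrow> v \<le> v0 \<longrightarrow>
      (v / u) powr (\<gamma> / 2) * V v \<le> 2 powr (\<gamma> / 2) * V u \<and> V u \<le> (2 * (v / u)) powr (2 * \<gamma>) * V v"
proof -
  have half: "((\<lambda>u. V ((1/2) * u) / V u) \<longlongrightarrow> (1/2) powr (- \<gamma>)) (at_right 0)"
    by (rule V_regularly_varying) simp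
  have e: "(1/2::real) powr (- \<gamma>) = 2 powr \<gamma>" by (simp add: powr_minus powr_divide)
  have "\<forall>\<^sub>F u in at_right 0. V ((1/2) * u) / V u > 2 powr (\<gamma>/2) \<and> V ((1/2) * u) / V u < 2 powr (2 * \<gamma>)"
    by (intro eventually_conj order_tendstoD[OF half]) (use gamma_pos in \<open>auto simp: e\<close>)
  then obtain v0 where v0: "v0 > 0" "\<And>u. 0 < u \<Longrightarrow> u < v0 \<Longrightarrow> V ((1/2) * u) / V u > 2 powr (\<gamma>/2) \<and> V ((1/2) * u) / V u < 2 powr (2 * \<gamma>)"
    unfolding eventually_at_right_field by auto
  have step: "2 powr (\<gamma>/2) * V u \<le> V (u / 2)" "V (u / 2) \<le> 2 powr (2 * \<gamma>) * V u" if "0 < u" "u < v0" for u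
    using v0(2)[OF that] V_pos[OF that(1)] by (auto simp: field_simps)
  have it: "(2 powr (\<gamma>/2)) ^ n * V v \<le> V (v / 2 ^ n) \<and> V (v / 2 ^ n) \<le> (2 powr (2 * \<gamma>)) ^ n * V v" if v: "0 < v" "v < v0" for v n
  proof (induction n)
    case 0 show ?case by simp
  next
    case (Suc n)
    have "v / 2 ^ n \<le> v" using v by (simp add: divide_le_eq)
    then have vn: "0 < v / 2 ^ n" "v / 2 ^ n < v0" using v by auto
    have 1: "2 powr (\<gamma>/2) * ((2 powr (\<gamma>/2)) ^ n * V v) \<le> 2 powr (\<gamma>/2) * V (v / 2 ^ n)"
      using Suc by (intro mult_left_mono) auto
    have 2: "2 powr (2 * \<gamma>) * V (v / 2 ^ n) \<le> 2 powr (2 * \<gamma>) * ((2 powr (2 * \<gamma>)) ^ n * V v)"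
      using Suc by (intro mult_left_mono) auto
    have "v / 2 ^ n / 2 = v / 2 ^ Suc n" by simp
    moreover have "V (v / 2 ^ n / 2) \<ge> 2 powr (\<gamma>/2) * ((2 powr (\<gamma>/2)) ^ n * V v)"
      "V (v / 2 ^ n / 2) \<le> 2 powr (2 * \<gamma>) * ((2 powr (2 * \<gamma>)) ^ n * V v)"
      using order_trans[OF 1 step(1)[OF vn]] order_trans[OF step(2)[OF vn] 2] .
    ultimately show ?case by (simp only: power_Suc mult.assoc)
  qed
  show ?thesis
  \<comment> \<open>Half of \<open>v0\<close>, because a single halving is controlled only for
    arguments strictly below \<open>v0\<close>.\<close>
  proof (intro exI[of _ "v0/2"] conjI allI impI)

    fix u v assume uv: "0 < u" "u \<le> v" "v \<le> v0 / 2"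
    \<comment> \<open>\<open>n\<close> is the number of complete halvings between \<open>v\<close>
      and \<open>u\<close>. The incomplete one that remains is paid for by the extra factor
      \<open>2\<close> on either side, through monotonicity of \<open>V\<close>.\<close>
    define x where "x = log 2 (v / u)"
    have x: "x \<ge> 0" "v / u = 2 powr x" using uv unfolding x_def by auto
    define n where "n = nat \<lfloor>x\<rfloor>"
    have n: "real n \<le> x" "x \<le> real (Suc n)" using x unfolding n_def by linarith+
    have v: "0 < v" "v < v0" using uv v0 by auto
    have p2: "2 powr real n = 2 ^ n" "2 powr real (Suc n) = 2 ^ Suc n" by (simp_all only: powr_realpow zero_less_numeral)
    have "2 ^ n \<le> v / u" unfolding x(2) p2[symmetric] using n by (intro powr_mono) auto
    then have un: "u \<le> v / 2 ^ n" using uv by (simp add: field_simps)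
    have "v / u \<le> 2 ^ Suc n" unfolding x(2) p2(2)[symmetric] using n by (intro powr_mono) auto
    then have uSn: "v / 2 ^ Suc n \<le> u" using uv by (simp add: field_simps)
    have "(v / u) powr (\<gamma> / 2) * V v \<le> (2 powr (\<gamma>/2) * (2 powr (\<gamma>/2)) ^ n) * V v"
    proof (rule mult_right_mono)
      have "(v / u) powr (\<gamma> / 2) \<le> (2 powr real (Suc n)) powr (\<gamma> / 2)"
        using \<open>v / u \<le> 2 ^ Suc n\<close> uv gamma_pos unfolding p2(2) by (intro powr_mono2) auto
      also have "\<dots> = (2 powr (\<gamma>/2)) powr (real (Suc n))" by (simp add: powr_powr mult.commute)
      also have "\<dots> = (2 powr (\<gamma>/2)) ^ Suc n" by (rule powr_realpow) simp
      finally show "(v / u) powr (\<gamma> / 2) \<le> 2 powr (\<gamma>/2) * (2 powr (\<gamma>/2)) ^ n" by simp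
    qed (use V_pos[OF v(1)] in auto)
    also have "\<dots> \<le> 2 powr (\<gamma>/2) * V (v / 2 ^ n)"
      using it[OF v, of n] by (simp add: mult.assoc)
    also have "\<dots> \<le> 2 powr (\<gamma>/2) * V u"
      using V_antimono[OF uv(1) un] by simp
    finally show "(v / u) powr (\<gamma> / 2) * V v \<le> 2 powr (\<gamma> / 2) * V u" .
    have "V u \<le> V (v / 2 ^ Suc n)"
      using uSn v by (intro V_antimono) auto
    also have "\<dots> \<le> (2 powr (2 * \<gamma>)) ^ Suc n * V v" using it[OF v, of "Suc n"] by simp
    also have "(2 powr (2 * \<gamma>)) ^ Suc n = (2 powr (2 * \<gamma>)) powr (real (Suc n))"
      by (rule powr_realpow[symmetric]) simp
    also have "\<dots> = (2 powr real (Suc n)) powr (2 * \<gamma>)" by (simp add: powr_powr mult.commute)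
    also have "\<dots> \<le> (2 * (v / u)) powr (2 * \<gamma>)"
      using \<open>2 ^ n \<le> v / u\<close> gamma_pos unfolding p2(2) by (intro powr_mono2) auto
    finally show "V u \<le> (2 * (v / u)) powr (2 * \<gamma>) * V v" 
      using V_pos[OF v(1)] by simp
  qed (use v0 in auto)
qed

lemma V_poly_bound: "\<exists>B C v0. C > 0 \<and> v0 > 0 \<and> B > 0 \<and> (\<forall>u. 0 < u \<longrightarrow> u \<le> v0 \<longrightarrow> V u \<le> C * u powr (- B))"
proof -
  obtain v0 where v0: "v0 > 0" "\<And>u. 0 < u \<Longrightarrow> u \<le> v0 \<Longrightarrow> V u \<le> (2 * (v0 / u)) powr (2 * \<gamma>) * V v0"
    using V_ratio_bounds by blast
  show ?thesis
  proof (rule exI[of _ "2 * \<gamma>"], rule exI[of _ "(2 * v0) powr (2 * \<gamma>) * V v0"], rule exI[of _ v0], intro conjI allI impI)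
    fix u assume u: "0 < u" "u \<le> v0"
    have "V u \<le> (2 * (v0 / u)) powr (2 * \<gamma>) * V v0" by (rule v0(2)[OF u])
    also have "(2 * (v0 / u)) powr (2 * \<gamma>) = (2 * v0) powr (2 * \<gamma>) * u powr (- (2 * \<gamma>))"
      using u v0(1) powr_divide[of "2 * v0" u "2 * \<gamma>"] by (simp add: powr_minus divide_inverse mult.assoc)
    finally show "V u \<le> (2 * v0) powr (2 * \<gamma>) * V v0 * u powr (- (2 * \<gamma>))" by (simp add: mult_ac)
  qed (use v0 V_pos gamma_pos in auto)
qed

text \<open>Since \<open>\<bar>c k\<bar> \<le> 1 + (c k)\<^sup>2\<close>, the sum is at most a
  geometric series plus \<open>V u\<close>.\<close>

lemma abs_coeffs_exp_le:
  assumes "u > 0" "u \<le> 1"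
  shows "(\<Sum>k. \<bar>c k\<bar> * exp (- (u * real k))) \<le> 2 / u + V u"
proof -
  have g: "(\<lambda>k. exp (- (u * real k))) sums (1 / (1 - exp (-u)))"
    unfolding exp_minus_mult_nat using assms by (intro geometric_sums) auto
  have "(\<Sum>k. \<bar>c k\<bar> * exp (- (u * real k))) \<le> (\<Sum>k. exp (- (u * real k)) + (c k)\<^sup>2 * exp (- (u * real k)))"
  proof (intro suminf_le summable_abs_coeffs_exp summable_add summable_V)
    fix k
    have "\<bar>c k\<bar> \<le> 1 + (c k)\<^sup>2"
      by (cases "\<bar>c k\<bar> \<le> 1") (use self_le_power[of "\<bar>c k\<bar>" 2] in \<open>auto intro: add_increasing2\<close>)
    then have "\<bar>c k\<bar> * exp (- (u * real k)) \<le> (1 + (c k)\<^sup>2) * exp (- (u * real k))"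
      by (intro mult_right_mono) auto
    then show "\<bar>c k\<bar> * exp (- (u * real k)) \<le> exp (- (u * real k)) + (c k)\<^sup>2 * exp (- (u * real k))"
      by (simp add: algebra_simps)
  qed (use assms g in \<open>auto simp: sums_iff\<close>)
  also have "\<dots> = 1 / (1 - exp (-u)) + V u"
    unfolding V_def using g summable_V[OF assms(1)] by (subst suminf_add[symmetric]) (auto simp: sums_iff)
  also have "1 / (1 - exp (-u)) \<le> 2 / u"
  proof -
    have "(1 + u) * (1 - u / 2) \<ge> 1" using assms mult_left_mono[of u 1 u] by (simp add: algebra_simps)
    moreover have "(1 + u) * (1 - u / 2) \<le> exp u * (1 - u / 2)"
      using assms exp_ge_add_one_self[of u] by (intro mult_right_mono) auto
    ultimately have "exp (-u) \<le> 1 - u / 2" by (simp add: exp_minus field_simps)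
    then show ?thesis using assms by (simp add: field_simps)
  qed
  finally show ?thesis by simp
qed

text \<open>Needed for the first moment of \<open>majorant\<close> at radii close to
  \<open>1\<close>.\<close>

lemma abs_coeffs_poly_bound:
  "\<exists>B C v0. C > 0 \<and> v0 > 0 \<and> B > 0 \<and> (\<forall>u. 0 < u \<longrightarrow> u \<le> v0 \<longrightarrow> (\<Sum>k. \<bar>c k\<bar> * exp (- (u * real k))) \<le> C * u powr (- B))"
proof -
  obtain B C v0 where B: "C > 0" "v0 > 0" "B > 0" "\<And>u. 0 < u \<Longrightarrow> u \<le> v0 \<Longrightarrow> V u \<le> C * u powr (- B)"
    using V_poly_bound by blast
  show ?thesis
  proof (rule exI[of _ "max 1 B"], rule exI[of _ "2 + C"], rule exI[of _ "min 1 v0"], intro conjI allI impI)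
    fix u :: real assume u: "0 < u" "u \<le> min 1 v0"
    have "(\<Sum>k. \<bar>c k\<bar> * exp (- (u * real k))) \<le> 2 / u + V u" using u by (intro abs_coeffs_exp_le) auto
    also have "\<dots> \<le> 2 * u powr (-1) + C * u powr (- B)" using u B(4)[of u] by (simp add: powr_minus divide_inverse)
    also have "\<dots> \<le> 2 * u powr (- max 1 B) + C * u powr (- max 1 B)"
      using u B by (intro add_mono mult_left_mono powr_mono') auto
    finally show "(\<Sum>k. \<bar>c k\<bar> * exp (- (u * real k))) \<le> (2 + C) * u powr (- max 1 B)" by (simp add: algebra_simps)
  qed (use B in auto)
qed

text \<open>The Lindeberg condition: no single term carries a fixed part of \<open>V u\<close>.
  Indices up to \<open>1 / sqrt u\<close> are already visible in \<open>V (sqrt u)\<close>, which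
  the Potter bound makes smaller than \<open>V u\<close> by a power of \<open>u\<close>. For a
  larger index \<open>k\<close>, doubling provides about \<open>k / 2\<close> earlier terms of at
  least comparable size, so the term is at most a multiple of \<open>V u / k\<close>.\<close>

lemma max_weight:
  "\<exists>\<kappa> C v0. \<kappa> > 0 \<and> C > 0 \<and> v0 > 0 \<and> (\<forall>u. 0 < u \<longrightarrow> u \<le> v0 \<longrightarrow> (\<forall>k. (c k)\<^sup>2 * exp (- (u * real k)) \<le> C * u powr \<kappa> * V u))"
proof -
  obtain v1 where v1: "v1 > 0" "\<And>u v. 0 < u \<Longrightarrow> u \<le> v \<Longrightarrow> v \<le> v1 \<Longrightarrow> (v / u) powr (\<gamma> / 2) * V v \<le> 2 powr (\<gamma> / 2) * V u"
    using V_ratio_bounds by blast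
  obtain D K where D: "D > 0" "\<And>j k. j \<ge> K \<Longrightarrow> k \<in> {j..2 * j} \<Longrightarrow> (c k)\<^sup>2 \<le> D * (c j)\<^sup>2"
    using doubling by blast
  define \<kappa> where "\<kappa> = min (1/2) (\<gamma>/4)"
  \<comment> \<open>The square puts \<open>sqrt u\<close> into the range of the Potter bound, and
    the last entry ensures that an index beyond \<open>1 / sqrt u\<close> exceeds
    \<open>2 * K + 2\<close>, so that half of it is in the range of doubling.\<close>
  define v0 where "v0 = min 1 (min (v1\<^sup>2) (1 / (2 * real K + 2)\<^sup>2))"
  define C where "C = max (2 * D) (exp 1 * 2 powr (\<gamma> / 2))"
  show ?thesis
  proof (rule exI[of _ \<kappa>], rule exI[of _ C], rule exI[of _ v0], intro conjI allI impI)
    show "\<kappa> > 0" unfolding \<kappa>_def using gamma_pos by simp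
    show C0: "C > 0" unfolding C_def using D by simp
    show "v0 > 0" unfolding v0_def using v1 by simp
    fix u k assume u: "0 < u" "u \<le> v0"
    have Vu: "V u > 0" using u by (intro V_pos)
    have u1: "u \<le> 1" using u unfolding v0_def by simp
    have su: "sqrt u > 0" "sqrt u \<le> v1" "u \<le> sqrt u" "sqrt u * (2 * real K + 2) \<le> 1"
    proof -
      show "sqrt u > 0" using u by simp
      have "sqrt u \<le> sqrt (v1\<^sup>2)" using u unfolding v0_def by (intro real_sqrt_le_mono) auto
      then show "sqrt u \<le> v1" using v1 by simp
      have "sqrt u * sqrt u \<le> sqrt u * 1" using u1 u by (intro mult_left_mono) auto
      then show "u \<le> sqrt u" using u by simp
      have "sqrt u \<le> sqrt (1 / (2 * real K + 2)\<^sup>2)" using u unfolding v0_def by (intro real_sqrt_le_mono) auto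
      then have "sqrt u \<le> 1 / (2 * real K + 2)" by (simp add: real_sqrt_divide)
      then show "sqrt u * (2 * real K + 2) \<le> 1" by (simp add: field_simps)
    qed
    show "(c k)\<^sup>2 * exp (- (u * real k)) \<le> C * u powr \<kappa> * V u"
    proof (cases "real k * sqrt u \<le> 1")
      case True
      have "(c k)\<^sup>2 = exp (sqrt u * real k) * ((c k)\<^sup>2 * exp (- (sqrt u * real k)))"
        by (simp add: exp_minus)
      also have "\<dots> \<le> exp 1 * V (sqrt u)"
        using True su V_term_le[OF su(1)] by (intro mult_mono) (auto simp: mult.commute)
      finally have 1: "(c k)\<^sup>2 \<le> exp 1 * V (sqrt u)" .
      have "u powr (- (\<gamma> / 4)) = (sqrt u / u) powr (\<gamma> / 2)"
      proof -
        have "sqrt u / u = u powr (-1/2)"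
          using u powr_diff[of u "1/2" 1] by (simp add: powr_half_sqrt)
        then show ?thesis using u by (simp add: powr_powr)
      qed
      then have "u powr (- (\<gamma> / 4)) * V (sqrt u) \<le> 2 powr (\<gamma> / 2) * V u"
        using v1(2)[OF u(1) su(3,2)] by simp
      then have 2: "V (sqrt u) \<le> 2 powr (\<gamma> / 2) * u powr (\<gamma>/4) * V u"
        using u by (simp add: powr_minus field_simps)
      have "(c k)\<^sup>2 * exp (- (u * real k)) \<le> (c k)\<^sup>2 * 1" using u by (intro mult_left_mono) auto
      also have "\<dots> \<le> exp 1 * (2 powr (\<gamma> / 2) * u powr (\<gamma>/4) * V u)" using 1 2 by (simp add: order_trans)
      also have "\<dots> = (exp 1 * 2 powr (\<gamma> / 2)) * u powr (\<gamma>/4) * V u" by simp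
      also have "\<dots> \<le> C * u powr \<kappa> * V u"
        using u u1 Vu C0 by (intro mult_mono powr_mono') (auto simp: C_def \<kappa>_def)
      finally show ?thesis .
    next
      case False
      have "sqrt u * (2 * real K + 2) < sqrt u * real k" using su(4) False by (simp only: mult.commute[of "real k"] not_le)
      then have kK: "real k > 2 * real K + 2" by (simp only: mult_less_cancel_left_pos[OF su(1)])
      \<comment> \<open>Half of \<open>k\<close> rounded up: then \<open>k\<close> lies in
        \<open>{j..2 * j}\<close> for every \<open>j\<close> in \<open>{m..k}\<close>, and there are
        at least \<open>k / 2\<close> such \<open>j\<close>.\<close>
      define m where "m = (k + 1) div 2"
      have m: "m \<ge> K" "k \<le> 2 * m" "m \<le> k" "real k / 2 \<le> real (card {m..k})" 
        using kK unfolding m_def by auto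
      have "real k / 2 * ((c k)\<^sup>2 * exp (- (u * real k)) / D) \<le> real (card {m..k}) * ((c k)\<^sup>2 * exp (- (u * real k)) / D)"
        using m D by (intro mult_right_mono) auto
      also have "\<dots> = (\<Sum>j\<in>{m..k}. (c k)\<^sup>2 * exp (- (u * real k)) / D)" by simp
      also have "\<dots> \<le> (\<Sum>j\<in>{m..k}. (c j)\<^sup>2 * exp (- (u * real j)))"
      proof (rule sum_mono)
        fix j assume j: "j \<in> {m..k}"
        have "(c k)\<^sup>2 / D \<le> (c j)\<^sup>2" using D(2)[of j k] D(1) j m by (auto simp: field_simps)
        then have "(c k)\<^sup>2 / D * exp (- (u * real k)) \<le> (c j)\<^sup>2 * exp (- (u * real j))"
          using j u by (intro mult_mono) auto
        then show "(c k)\<^sup>2 * exp (- (u * real k)) / D \<le> (c j)\<^sup>2 * exp (- (u * real j))" by simp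
      qed
      also have "\<dots> \<le> V u" unfolding V_def by (intro sum_le_suminf summable_V u) auto
      finally have "(c k)\<^sup>2 * exp (- (u * real k)) \<le> 2 * D / real k * V u"
        using D kK by (simp add: field_simps)
      also have "\<dots> \<le> 2 * D * sqrt u * V u"
        using False kK D Vu by (intro mult_right_mono) (auto simp: field_simps)
      also have "sqrt u = u powr (1/2)" using u by (simp add: powr_half_sqrt)
      also have "2 * D * u powr (1/2) * V u \<le> C * u powr \<kappa> * V u"
        using u u1 Vu D C0 by (intro mult_mono powr_mono') (auto simp: C_def \<kappa>_def)
      finally show ?thesis .
    qed
  qed
qed

text \<open>Consecutive ratios are eventually above \<open>exp (-1)\<close>. A geometric lower bound
  is enough, because it will only be compared with powers of \<open>e / 8\<close>.\<close>

lemma coeff_lower: "\<exists>k0 c0. c0 > 0 \<and> (\<forall>k\<ge>k0. \<bar>c k\<bar> \<ge> c0 * exp (- real k))"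
proof -
  have "\<forall>\<^sub>F n in sequentially. \<bar>c (Suc n)\<bar> / \<bar>c n\<bar> > exp (-1)"
    by (intro order_tendstoD(1)[OF ratio_abs_Suc]) auto
  with nonzero have "\<forall>\<^sub>F n in sequentially. c n \<noteq> 0 \<and> \<bar>c (Suc n)\<bar> \<ge> exp (-1) * \<bar>c n\<bar>"
    by eventually_elim (auto simp: field_simps)
  then obtain N where N: "\<And>n. n \<ge> N \<Longrightarrow> c n \<noteq> 0" "\<And>n. n \<ge> N \<Longrightarrow> \<bar>c (Suc n)\<bar> \<ge> exp (-1) * \<bar>c n\<bar>"
    unfolding eventually_sequentially by blast
  have "\<bar>c (N + k)\<bar> \<ge> \<bar>c N\<bar> * exp (- real k)" for k
  proof (induction k)
    case (Suc k)
    have "\<bar>c N\<bar> * exp (- real (Suc k)) = exp (-1) * (\<bar>c N\<bar> * exp (- real k))"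
      by (simp add: exp_add[symmetric] algebra_simps)
    also have "\<dots> \<le> exp (-1) * \<bar>c (N + k)\<bar>" using Suc by (intro mult_left_mono) auto
    also have "\<dots> \<le> \<bar>c (N + Suc k)\<bar>" using N(2)[of "N + k"] by simp
    finally show ?case .
  qed simp
  then have "\<bar>c k\<bar> \<ge> \<bar>c N\<bar> * exp (- real k)" if "k \<ge> N" for k
  proof -
    have "\<bar>c N\<bar> * exp (- real k) \<le> \<bar>c N\<bar> * exp (- real (k - N))" by (intro mult_left_mono) auto
    also have "\<dots> \<le> \<bar>c k\<bar>" using \<open>\<And>k. \<bar>c (N + k)\<bar> \<ge> \<bar>c N\<bar> * exp (- real k)\<close>[of "k - N"] that by simp
    finally show ?thesis .
  qed
  then show ?thesis using N(1)[of N] by (intro exI[of _ N] exI[of _ "\<bar>c N\<bar>"]) auto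
qed

end

section \<open>Weighted sums of independent variables\<close>

lemma summable_square_of_abs:
  fixes a :: "nat \<Rightarrow> real"
  assumes "summable (\<lambda>k. \<bar>a k\<bar>)"
  shows "summable (\<lambda>k. (a k)\<^sup>2)"
proof (rule summable_comparison_test_ev[OF _ assms])
  have "(\<lambda>k. \<bar>a k\<bar>) \<longlonglongrightarrow> 0" by (rule summable_LIMSEQ_zero[OF assms])
  then have "\<forall>\<^sub>F k in sequentially. \<bar>a k\<bar> < 1" by (rule order_tendstoD(2)[OF _ zero_less_one])
  then show "\<forall>\<^sub>F k in sequentially. norm ((a k)\<^sup>2) \<le> \<bar>a k\<bar>"
  proof eventually_elim
    case (elim k)
    have "\<bar>a k\<bar> * \<bar>a k\<bar> \<le> \<bar>a k\<bar> * 1" using elim by (intro mult_left_mono) auto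
    then show ?case by (simp add: power2_eq_square)
  qed
qed

locale iid_standard = prob_space M for M :: "'a measure" +
  fixes \<xi> :: "nat \<Rightarrow> 'a \<Rightarrow> real"
  assumes indep: "indep_vars (\<lambda>_. borel) \<xi> UNIV"
    and ident: "\<And>k. distr M borel (\<xi> k) = distr M borel (\<xi> 0)"
    and integrable_0: "integrable M (\<xi> 0)" and mean_0: "expectation (\<xi> 0) = 0"
    and square_integrable_0: "integrable M (\<lambda>\<omega>. (\<xi> 0 \<omega>)\<^sup>2)"
    and second_moment_0: "expectation (\<lambda>\<omega>. (\<xi> 0 \<omega>)\<^sup>2) = 1"
begin

lemma measurable_xi [measurable]: "\<xi> k \<in> borel_measurable M"
  using indep unfolding indep_vars_def2 by simp

lemma transfer_integrable:
  assumes "f \<in> borel_measurable borel" "integrable M (\<lambda>\<omega>. f (\<xi> 0 \<omega>))"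
  shows "integrable M (\<lambda>\<omega>. (f (\<xi> k \<omega>) :: real))"
  using assms ident[of k] integrable_distr_eq[of "\<xi> k" M borel f] integrable_distr_eq[of "\<xi> 0" M borel f] by simp

lemma transfer_expectation:
  assumes "f \<in> borel_measurable borel"
  shows "expectation (\<lambda>\<omega>. (f (\<xi> k \<omega>) :: real)) = expectation (\<lambda>\<omega>. f (\<xi> 0 \<omega>))"
  using assms ident[of k] integral_distr[of "\<xi> k" M borel f] integral_distr[of "\<xi> 0" M borel f] by simp

lemma integrable_xi [simp]: "integrable M (\<xi> k)"
  using transfer_integrable[of "\<lambda>x. x"] integrable_0 by simp

lemma mean_xi [simp]: "expectation (\<xi> k) = 0"
  using transfer_expectation[of "\<lambda>x. x"] mean_0 by simp

lemma square_integrable_xi [simp]: "integrable M (\<lambda>\<omega>. (\<xi> k \<omega>)\<^sup>2)"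
  using transfer_integrable[of "\<lambda>x. x\<^sup>2"] square_integrable_0 by simp

lemma second_moment_xi [simp]: "expectation (\<lambda>\<omega>. (\<xi> k \<omega>)\<^sup>2) = 1"
  using transfer_expectation[of "\<lambda>x. x\<^sup>2"] second_moment_0 by simp

lemma abs_moment_le_1: "(\<integral>\<^sup>+\<omega>. ennreal \<bar>\<xi> k \<omega>\<bar> \<partial>M) \<le> 1"
proof -
  have "(\<integral>\<^sup>+\<omega>. ennreal \<bar>\<xi> k \<omega>\<bar> \<partial>M) = ennreal (expectation (\<lambda>\<omega>. \<bar>\<xi> k \<omega>\<bar>))"
    by (rule nn_integral_eq_integral) (auto intro: integrable_abs)
  also have "expectation (\<lambda>\<omega>. \<bar>\<xi> k \<omega>\<bar>) \<le> expectation (\<lambda>\<omega>. (1 + (\<xi> k \<omega>)\<^sup>2) / 2)"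
  proof (intro integral_mono)
    fix \<omega> 
    have "(\<bar>\<xi> k \<omega>\<bar> - 1)\<^sup>2 \<ge> 0" by simp
    then show "\<bar>\<xi> k \<omega>\<bar> \<le> (1 + (\<xi> k \<omega>)\<^sup>2) / 2" by (simp add: power2_diff)
  qed (auto intro: integrable_abs)
  also have "expectation (\<lambda>\<omega>. (1 + (\<xi> k \<omega>)\<^sup>2) / 2) = 1" by (simp add: prob_space)
  finally show ?thesis by (simp add: ennreal_leI)
qed

lemma expectation_product:
  "integrable M (\<lambda>\<omega>. \<xi> i \<omega> * \<xi> j \<omega>)" "expectation (\<lambda>\<omega>. \<xi> i \<omega> * \<xi> j \<omega>) = (if i = j then 1 else 0)"
proof -
  have "integrable M (\<lambda>\<omega>. \<xi> i \<omega> * \<xi> j \<omega>) \<and> expectation (\<lambda>\<omega>. \<xi> i \<omega> * \<xi> j \<omega>) = (if i = j then 1 else 0)"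
  proof (cases "i = j")
    case True then show ?thesis using square_integrable_xi[of i] second_moment_xi[of i] by (simp add: power2_eq_square)
  next
    case False
    have ind: "indep_vars (\<lambda>_. borel) \<xi> {i, j}" by (rule indep_vars_subset[OF indep]) auto
    have "integrable M (\<lambda>\<omega>. \<Prod>k\<in>{i, j}. \<xi> k \<omega>)" by (rule indep_vars_integrable[OF _ ind]) auto
    moreover have "expectation (\<lambda>\<omega>. \<Prod>k\<in>{i, j}. \<xi> k \<omega>) = (\<Prod>k\<in>{i, j}. expectation (\<xi> k))"
      by (rule indep_vars_lebesgue_integral[OF _ ind]) auto
    ultimately show ?thesis using False by simp
  qed
  then show "integrable M (\<lambda>\<omega>. \<xi> i \<omega> * \<xi> j \<omega>)" "expectation (\<lambda>\<omega>. \<xi> i \<omega> * \<xi> j \<omega>) = (if i = j then 1 else 0)" by auto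
qed

text \<open>Meaningful where the series converges, which is almost surely the case for summable
  weights; elsewhere it has the default value of \<open>suminf\<close>.\<close>

definition S :: "(nat \<Rightarrow> real) \<Rightarrow> 'a \<Rightarrow> real" where
  "S a \<omega> = (\<Sum>k. a k * \<xi> k \<omega>)"

lemma measurable_S [measurable]: "S a \<in> borel_measurable M"
  unfolding S_def by measurable

text \<open>Absolutely summable weights make the expected sum of absolute values finite, so the
  first absolute moment suffices and no martingale convergence enters.\<close>

lemma AE_summable:
  assumes "summable (\<lambda>k. \<bar>a k\<bar>)"
  shows "AE \<omega> in M. summable (\<lambda>k. \<bar>a k * \<xi> k \<omega>\<bar>)"
proof -
  have "(\<integral>\<^sup>+\<omega>. (\<Sum>k. ennreal \<bar>a k * \<xi> k \<omega>\<bar>) \<partial>M) = (\<Sum>k. \<integral>\<^sup>+\<omega>. ennreal \<bar>a k * \<xi> k \<omega>\<bar> \<partial>M)"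
    by (rule nn_integral_suminf) measurable
  also have "\<dots> = (\<Sum>k. ennreal \<bar>a k\<bar> * (\<integral>\<^sup>+\<omega>. ennreal \<bar>\<xi> k \<omega>\<bar> \<partial>M))"
    by (simp add: abs_mult ennreal_mult nn_integral_cmult)
  also have "\<dots> \<le> (\<Sum>k. ennreal \<bar>a k\<bar> * 1)"
    by (intro suminf_le mult_left_mono abs_moment_le_1) auto
  also have "\<dots> < \<infinity>" using assms by (simp add: suminf_ennreal2)
  finally have "(\<integral>\<^sup>+\<omega>. (\<Sum>k. ennreal \<bar>a k * \<xi> k \<omega>\<bar>) \<partial>M) \<noteq> \<infinity>" by simp
  then have "AE \<omega> in M. (\<Sum>k. ennreal \<bar>a k * \<xi> k \<omega>\<bar>) \<noteq> \<infinity>"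
    by (intro nn_integral_PInf_AE) auto
  then show ?thesis
    by eventually_elim (rule summable_suminf_not_top, auto)
qed

lemma expectation_partial_square:
  "(\<integral>\<^sup>+\<omega>. ennreal ((\<Sum>k<n. a k * \<xi> k \<omega>)\<^sup>2) \<partial>M) = ennreal (\<Sum>k<n. (a k)\<^sup>2)"
proof -
  have eq: "(\<Sum>k<n. a k * \<xi> k \<omega>)\<^sup>2 = (\<Sum>i<n. \<Sum>j<n. (a i * a j) * (\<xi> i \<omega> * \<xi> j \<omega>))" for \<omega>
    by (simp add: power2_eq_square sum_product mult_ac)
  have int: "integrable M (\<lambda>\<omega>. (\<Sum>k<n. a k * \<xi> k \<omega>)\<^sup>2)"
    unfolding eq by (intro Bochner_Integration.integrable_sum integrable_mult_right expectation_product)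
  have "(\<integral>\<^sup>+\<omega>. ennreal ((\<Sum>k<n. a k * \<xi> k \<omega>)\<^sup>2) \<partial>M) = ennreal (expectation (\<lambda>\<omega>. (\<Sum>k<n. a k * \<xi> k \<omega>)\<^sup>2))"
    by (rule nn_integral_eq_integral[OF int]) auto
  also have "expectation (\<lambda>\<omega>. (\<Sum>k<n. a k * \<xi> k \<omega>)\<^sup>2) = (\<Sum>i<n. \<Sum>j<n. (a i * a j) * (if i = j then 1 else 0))"
    unfolding eq 
    by (simp only: Bochner_Integration.integral_sum Bochner_Integration.integrable_sum integrable_mult_right
        expectation_product integral_mult_right_zero)
  also have "\<dots> = (\<Sum>k<n. (a k)\<^sup>2)"
    by (intro sum.cong refl) (simp add: power2_eq_square if_distrib[of "\<lambda>x. _ * x"] cong: if_cong)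
  finally show ?thesis .
qed

lemma AE_partial_sums:
  assumes "summable (\<lambda>k. \<bar>a k\<bar>)"
  shows "AE \<omega> in M. (\<lambda>n. \<Sum>k<n. a k * \<xi> k \<omega>) \<longlonglongrightarrow> S a \<omega>"
  using AE_summable[OF assms]
proof eventually_elim
  case (elim \<omega>)
  then have "summable (\<lambda>k. a k * \<xi> k \<omega>)" by (rule summable_rabs_cancel)
  then show ?case unfolding S_def by (rule summable_LIMSEQ)
qed

text \<open>Fatou's lemma along the partial sums gives an upper bound, and the later estimates use
  only this direction.\<close>

lemma second_moment_S:
  assumes "summable (\<lambda>k. \<bar>a k\<bar>)"
  shows "(\<integral>\<^sup>+\<omega>. ennreal ((S a \<omega>)\<^sup>2) \<partial>M) \<le> ennreal (\<Sum>k. (a k)\<^sup>2)"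
proof -
  have "(\<integral>\<^sup>+\<omega>. ennreal ((S a \<omega>)\<^sup>2) \<partial>M) = (\<integral>\<^sup>+\<omega>. liminf (\<lambda>n. ennreal ((\<Sum>k<n. a k * \<xi> k \<omega>)\<^sup>2)) \<partial>M)"
  proof (rule nn_integral_cong_AE, use AE_partial_sums[OF assms] in eventually_elim)
    case (elim \<omega>)
    then have "(\<lambda>n. ennreal ((\<Sum>k<n. a k * \<xi> k \<omega>)\<^sup>2)) \<longlonglongrightarrow> ennreal ((S a \<omega>)\<^sup>2)"
      by (intro tendsto_ennrealI tendsto_power)
    then show ?case by (intro lim_imp_Liminf[symmetric]) auto
  qed
  also have "\<dots> \<le> liminf (\<lambda>n. \<integral>\<^sup>+\<omega>. ennreal ((\<Sum>k<n. a k * \<xi> k \<omega>)\<^sup>2) \<partial>M)"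
    by (rule nn_integral_liminf) measurable
  also have "\<dots> = liminf (\<lambda>n. ennreal (\<Sum>k<n. (a k)\<^sup>2))" by (simp add: expectation_partial_square)
  also have "\<dots> = ennreal (\<Sum>k. (a k)\<^sup>2)"
    by (intro lim_imp_Liminf tendsto_ennrealI summable_LIMSEQ summable_square_of_abs assms) auto
  finally show ?thesis .
qed

section \<open>Characteristic functions of weighted sums\<close>

definition \<phi> :: "real \<Rightarrow> complex" where "\<phi> = char (distr M borel (\<xi> 0))"

lemma norm_phi_le_1: "norm (\<phi> u) \<le> 1"
  unfolding \<phi>_def by (intro real_distribution.cmod_char_le_1 real_distribution_distr) simp

lemma char_partial_sum:
  "(CLINT \<omega>|M. iexp (\<Sum>k<n. a k * \<xi> k \<omega>)) = (\<Prod>k<n. \<phi> (a k))"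
proof -
  have "indep_vars (\<lambda>_. borel) (\<lambda>k \<omega>. a k * \<xi> k \<omega>) {..<n}"
    by (rule indep_vars_compose2[where X = \<xi>, OF indep_vars_subset[OF indep]]) auto
  from char_distr_sum[OF this, of 1]
  have "(CLINT \<omega>|M. iexp (\<Sum>k<n. a k * \<xi> k \<omega>)) = (\<Prod>k<n. char (distr M borel (\<lambda>\<omega>. a k * \<xi> k \<omega>)) 1)"
    by (simp add: char_def integral_distr)
  also have "\<dots> = (\<Prod>k<n. \<phi> (a k))"
  proof (intro prod.cong refl)
    fix k
    have "char (distr M borel (\<lambda>\<omega>. a k * \<xi> k \<omega>)) 1 = (CLINT \<omega>|M. iexp (a k * \<xi> k \<omega>))"
      by (simp add: char_def integral_distr)
    also have "\<dots> = char (distr M borel (\<xi> k)) (a k)" by (simp add: char_def integral_distr)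
    finally show "char (distr M borel (\<lambda>\<omega>. a k * \<xi> k \<omega>)) 1 = \<phi> (a k)" unfolding \<phi>_def ident[of k] .
  qed
  finally show ?thesis .
qed

lemma char_series:
  assumes "summable (\<lambda>k. \<bar>a k\<bar>)"
  shows "(\<lambda>n. \<Prod>k<n. \<phi> (a k)) \<longlonglongrightarrow> (CLINT \<omega>|M. iexp (S a \<omega>))"
proof -
  have "(\<lambda>n. CLINT \<omega>|M. iexp (\<Sum>k<n. a k * \<xi> k \<omega>)) \<longlonglongrightarrow> (CLINT \<omega>|M. iexp (S a \<omega>))"
  proof (rule integral_dominated_convergence[where w = "\<lambda>_. 1"])
    show "AE \<omega> in M. (\<lambda>n. iexp (\<Sum>k<n. a k * \<xi> k \<omega>)) \<longlonglongrightarrow> iexp (S a \<omega>)"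
      using AE_partial_sums[OF assms] by eventually_elim (intro tendsto_intros)
  qed auto
  then show ?thesis unfolding char_partial_sum .
qed

text \<open>With only two moments the Taylor remainder is bounded by \<open>u ^ 2\<close> times the
  expectation of a minimum of a quadratic and a cubic term. The cubic term carries a factor
  \<open>\<bar>u\<bar>\<close>, so this expectation tends to \<open>0\<close> by dominated
  convergence.\<close>

lemma phi_quadratic:
  assumes "\<delta> > 0"
  shows "\<exists>u0>0. \<forall>u. \<bar>u\<bar> \<le> u0 \<longrightarrow> norm (\<phi> u - (1 - u\<^sup>2 / 2)) \<le> \<delta> * u\<^sup>2"
proof -
  define G where "G t = expectation (\<lambda>\<omega>. min (6 * (\<xi> 0 \<omega>)\<^sup>2) (t * \<bar>\<xi> 0 \<omega>\<bar> ^ 3))" for t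
  have int: "integrable M (\<lambda>\<omega>. min (6 * (\<xi> 0 \<omega>)\<^sup>2) (t * \<bar>\<xi> 0 \<omega>\<bar> ^ 3))" if "t \<ge> 0" for t
    by (rule Bochner_Integration.integrable_bound[of M "\<lambda>\<omega>. 6 * (\<xi> 0 \<omega>)\<^sup>2"]) (use that in auto)
  have "(\<lambda>n. G (1 / real (Suc n))) \<longlonglongrightarrow> expectation (\<lambda>\<omega>. 0)"
    unfolding G_def
  proof (rule integral_dominated_convergence[where w = "\<lambda>\<omega>. 6 * (\<xi> 0 \<omega>)\<^sup>2"])
    show "AE \<omega> in M. (\<lambda>n. min (6 * (\<xi> 0 \<omega>)\<^sup>2) (1 / real (Suc n) * \<bar>\<xi> 0 \<omega>\<bar> ^ 3)) \<longlonglongrightarrow> 0"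
    proof (rule AE_I2)
      fix \<omega>
      have "(\<lambda>n. 1 / real (Suc n) * \<bar>\<xi> 0 \<omega>\<bar> ^ 3) \<longlonglongrightarrow> 0 * \<bar>\<xi> 0 \<omega>\<bar> ^ 3"
        using LIMSEQ_inverse_real_of_nat by (intro tendsto_mult tendsto_const) (simp add: inverse_eq_divide)
      then have "(\<lambda>n. 1 / real (Suc n) * \<bar>\<xi> 0 \<omega>\<bar> ^ 3) \<longlonglongrightarrow> 0" by simp
      from tendsto_min[OF tendsto_const[of "6 * (\<xi> 0 \<omega>)\<^sup>2"] this]
      show "(\<lambda>n. min (6 * (\<xi> 0 \<omega>)\<^sup>2) (1 / real (Suc n) * \<bar>\<xi> 0 \<omega>\<bar> ^ 3)) \<longlonglongrightarrow> 0" by simp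
    qed
  qed auto
  then have "\<forall>\<^sub>F n in sequentially. G (1 / real (Suc n)) < 6 * \<delta>"
    using assms by (intro order_tendstoD(2)) auto
  then obtain n where n: "G (1 / real (Suc n)) < 6 * \<delta>" unfolding eventually_sequentially by blast
  have "norm (\<phi> u - (1 - u\<^sup>2 / 2)) \<le> \<delta> * u\<^sup>2" if u: "\<bar>u\<bar> \<le> 1 / real (Suc n)" for u
  proof -
    have "norm (\<phi> u - (1 - u\<^sup>2 * 1 / 2)) \<le> (u\<^sup>2 / 6) * G \<bar>u\<bar>"
      unfolding G_def \<phi>_def by (rule char_approx3') (auto simp: integrable_0 mean_0)
    also have "(u\<^sup>2 / 6) * G \<bar>u\<bar> \<le> (u\<^sup>2 / 6) * G (1 / real (Suc n))"
      unfolding G_def using u by (intro mult_left_mono integral_mono int min.mono mult_right_mono) auto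
    also have "(u\<^sup>2 / 6) * G (1 / real (Suc n)) \<le> (u\<^sup>2 / 6) * (6 * \<delta>)"
      using n by (intro mult_left_mono) auto
    also have "(u\<^sup>2 / 6) * (6 * \<delta>) = \<delta> * u\<^sup>2" by simp
    finally show ?thesis by (simp only: mult_1_right)
  qed
  then show ?thesis by (intro exI[of _ "1 / real (Suc n)"]) auto
qed

lemma phi_norm_bound: "\<exists>u0>0. \<forall>u. \<bar>u\<bar> \<le> u0 \<longrightarrow> norm (\<phi> u) \<le> exp (- u\<^sup>2 / 4)"
proof -
  obtain u0 where u0: "u0 > 0" "\<And>u. \<bar>u\<bar> \<le> u0 \<Longrightarrow> norm (\<phi> u - (1 - u\<^sup>2 / 2)) \<le> 1/4 * u\<^sup>2"
    using phi_quadratic[of "1/4"] by auto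
  have "norm (\<phi> u) \<le> exp (- u\<^sup>2 / 4)" if u: "\<bar>u\<bar> \<le> min u0 1" for u
  proof -
    have "u\<^sup>2 \<le> 1" using u by (simp add: abs_square_le_1)
    have "norm (\<phi> u) \<le> norm (\<phi> u - (1 - u\<^sup>2 / 2)) + norm (complex_of_real (1 - u\<^sup>2 / 2))"
      using norm_triangle_ineq[of "\<phi> u - (1 - u\<^sup>2 / 2)" "complex_of_real (1 - u\<^sup>2 / 2)"] by simp
    moreover have "norm (complex_of_real (1 - u\<^sup>2 / 2)) = 1 - u\<^sup>2 / 2"
      unfolding norm_of_real using \<open>u\<^sup>2 \<le> 1\<close> by simp
    ultimately have "norm (\<phi> u) \<le> 1 - u\<^sup>2 / 4" using u0(2)[of u] u by simp
    also have "\<dots> \<le> exp (- u\<^sup>2 / 4)" using exp_ge_add_one_self[of "- u\<^sup>2 / 4"] by simp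
    finally show ?thesis .
  qed
  then show ?thesis using u0 by (intro exI[of _ "min u0 1"]) auto
qed

lemma phi_gaussian:
  assumes "\<delta> > 0"
  shows "\<exists>u0>0. \<forall>u. \<bar>u\<bar> \<le> u0 \<longrightarrow> norm (\<phi> u - complex_of_real (exp (- u\<^sup>2 / 2))) \<le> \<delta> * u\<^sup>2"
proof -
  obtain u0 where u0: "u0 > 0" "\<And>u. \<bar>u\<bar> \<le> u0 \<Longrightarrow> norm (\<phi> u - (1 - u\<^sup>2 / 2)) \<le> \<delta>/2 * u\<^sup>2"
    using phi_quadratic[of "\<delta>/2"] assms by auto
  have "norm (\<phi> u - complex_of_real (exp (- u\<^sup>2 / 2))) \<le> \<delta> * u\<^sup>2" if u: "\<bar>u\<bar> \<le> min u0 (sqrt (2 * \<delta>))" for u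
  proof -
    define x where "x = u\<^sup>2 / 2"
    have x0: "x \<ge> 0" unfolding x_def by simp
    have "u\<^sup>2 \<le> (sqrt (2 * \<delta>))\<^sup>2" using u by (intro abs_le_square_iff[THEN iffD1]) auto
    then have x1: "x \<le> \<delta>" using assms unfolding x_def by simp
    have "exp (-x) \<ge> 1 - x" using exp_ge_add_one_self[of "-x"] by simp
    moreover have "exp (-x) \<le> 1 / (1 + x)"
      using exp_ge_add_one_self[of x] x0 by (simp add: exp_minus field_simps)
    moreover have "1 / (1 + x) \<le> 1 - x + x * x" using x0 by (simp add: field_simps)
    moreover have "x * x \<le> \<delta> * x" using x0 x1 by (intro mult_right_mono)
    ultimately have ex: "\<bar>(1 - x) - exp (-x)\<bar> \<le> \<delta> * x" by linarith
    have "norm (\<phi> u - complex_of_real (exp (- u\<^sup>2 / 2))) \<le> norm (\<phi> u - (1 - u\<^sup>2 / 2)) + norm (complex_of_real ((1 - x) - exp (-x)))"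
      using norm_triangle_ineq[of "\<phi> u - (1 - u\<^sup>2 / 2)" "complex_of_real ((1 - x) - exp (-x))"]
      unfolding x_def by (simp add: algebra_simps)
    also have "norm (complex_of_real ((1 - x) - exp (-x))) \<le> \<delta> * x" using ex by (simp only: norm_of_real)
    finally show ?thesis using u0(2)[of u] u unfolding x_def by simp
  qed
  then show ?thesis using u0 assms by (intro exI[of _ "min u0 (sqrt (2 * \<delta>))"]) auto
qed

text \<open>The threshold \<open>u0\<close> depends only on the law of \<open>\<xi> 0\<close>, so
  the bound is uniform over all weight sequences with small entries. This lets it be used at
  frequencies that grow as the weights shrink.\<close>

lemma char_series_decay:
  "\<exists>u0>0. \<forall>a. summable (\<lambda>k. \<bar>a k\<bar>) \<longrightarrow> (\<forall>k. \<bar>a k\<bar> \<le> u0) \<longrightarrow>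
      norm (CLINT \<omega>|M. iexp (S a \<omega>)) \<le> exp (- (\<Sum>k. (a k)\<^sup>2) / 4)"
proof -
  obtain u0 where u0: "u0 > 0" "\<And>u. \<bar>u\<bar> \<le> u0 \<Longrightarrow> norm (\<phi> u) \<le> exp (- u\<^sup>2 / 4)"
    using phi_norm_bound by blast
  have "norm (CLINT \<omega>|M. iexp (S a \<omega>)) \<le> exp (- (\<Sum>k. (a k)\<^sup>2) / 4)"
    if a: "summable (\<lambda>k. \<bar>a k\<bar>)" "\<And>k. \<bar>a k\<bar> \<le> u0" for a
  proof (rule LIMSEQ_le[OF tendsto_norm[OF char_series[OF a(1)]]])
    show "(\<lambda>n. exp (- (\<Sum>k<n. (a k)\<^sup>2) / 4)) \<longlonglongrightarrow> exp (- (\<Sum>k. (a k)\<^sup>2) / 4)"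
      by (intro tendsto_intros summable_LIMSEQ summable_square_of_abs a) auto
    have "norm (\<Prod>k<n. \<phi> (a k)) \<le> exp (- (\<Sum>k<n. (a k)\<^sup>2) / 4)" for n
    proof -
      have "norm (\<Prod>k<n. \<phi> (a k)) \<le> (\<Prod>k<n. exp (- (a k)\<^sup>2 / 4))"
        unfolding prod_norm[symmetric] by (intro prod_mono conjI u0(2) a(2) norm_ge_zero)
      also have "\<dots> = exp (\<Sum>k<n. - (a k)\<^sup>2 / 4)" by (simp add: exp_sum)
      also have "(\<Sum>k<n. - (a k)\<^sup>2 / 4) = - (\<Sum>k<n. (a k)\<^sup>2) / 4"
        by (simp add: sum_divide_distrib sum_negf)
      finally show ?thesis .
    qed
    then show "\<exists>N. \<forall>n\<ge>N. norm (\<Prod>k<n. \<phi> (a k)) \<le> exp (- (\<Sum>k<n. (a k)\<^sup>2) / 4)" by blast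
  qed
  then show ?thesis using u0(1) by blast
qed

text \<open>Lindeberg's comparison: factors of modulus at most \<open>1\<close> are exchanged one by
  one, and the errors of size \<open>\<delta>\<close> times the squared weight add up.\<close>

lemma char_series_gaussian:
  assumes "\<delta> > 0"
  shows "\<exists>u0>0. \<forall>a. summable (\<lambda>k. \<bar>a k\<bar>) \<longrightarrow> (\<forall>k. \<bar>a k\<bar> \<le> u0) \<longrightarrow>
      norm ((CLINT \<omega>|M. iexp (S a \<omega>)) - complex_of_real (exp (- (\<Sum>k. (a k)\<^sup>2) / 2))) \<le> \<delta> * (\<Sum>k. (a k)\<^sup>2)"
proof -
  obtain u0 where u0: "u0 > 0" "\<And>u. \<bar>u\<bar> \<le> u0 \<Longrightarrow> norm (\<phi> u - complex_of_real (exp (- u\<^sup>2 / 2))) \<le> \<delta> * u\<^sup>2"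
    using phi_gaussian[OF assms] by blast
  have "norm ((CLINT \<omega>|M. iexp (S a \<omega>)) - complex_of_real (exp (- (\<Sum>k. (a k)\<^sup>2) / 2))) \<le> \<delta> * (\<Sum>k. (a k)\<^sup>2)"
    if a: "summable (\<lambda>k. \<bar>a k\<bar>)" "\<And>k. \<bar>a k\<bar> \<le> u0" for a
  proof (rule LIMSEQ_le)
    show "(\<lambda>n. norm ((\<Prod>k<n. \<phi> (a k)) - complex_of_real (exp (- (\<Sum>k<n. (a k)\<^sup>2) / 2)))) \<longlonglongrightarrow>
       norm ((CLINT \<omega>|M. iexp (S a \<omega>)) - complex_of_real (exp (- (\<Sum>k. (a k)\<^sup>2) / 2)))"
      by (intro tendsto_intros char_series summable_LIMSEQ summable_square_of_abs a) auto
    show "(\<lambda>n. \<delta> * (\<Sum>k<n. (a k)\<^sup>2)) \<longlonglongrightarrow> \<delta> * (\<Sum>k. (a k)\<^sup>2)"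
      by (intro tendsto_intros summable_LIMSEQ summable_square_of_abs a)
    have "norm ((\<Prod>k<n. \<phi> (a k)) - complex_of_real (exp (- (\<Sum>k<n. (a k)\<^sup>2) / 2))) \<le> \<delta> * (\<Sum>k<n. (a k)\<^sup>2)" for n
    proof -
      have "exp (- (\<Sum>k<n. (a k)\<^sup>2) / 2) = (\<Prod>k<n. exp (- (a k)\<^sup>2 / 2))"
        by (simp add: exp_sum[symmetric] sum_divide_distrib sum_negf)
      then have "norm ((\<Prod>k<n. \<phi> (a k)) - complex_of_real (exp (- (\<Sum>k<n. (a k)\<^sup>2) / 2))) =
         norm ((\<Prod>k<n. \<phi> (a k)) - (\<Prod>k<n. complex_of_real (exp (- (a k)\<^sup>2 / 2))))" by (simp only: of_real_prod)
      also have "\<dots> \<le> (\<Sum>k<n. norm (\<phi> (a k) - complex_of_real (exp (- (a k)\<^sup>2 / 2))))"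
        by (rule norm_prod_diff) (simp_all only: norm_phi_le_1 norm_of_real abs_exp_cancel exp_le_one_iff, simp)
      also have "\<dots> \<le> (\<Sum>k<n. \<delta> * (a k)\<^sup>2)"
        by (intro sum_mono u0(2) a(2))
      finally show ?thesis by (simp add: sum_distrib_left)
    qed
    then show "\<exists>N. \<forall>n\<ge>N. norm ((\<Prod>k<n. \<phi> (a k)) - complex_of_real (exp (- (\<Sum>k<n. (a k)\<^sup>2) / 2))) \<le> \<delta> * (\<Sum>k<n. (a k)\<^sup>2)" by blast
  qed
  then show ?thesis using u0(1) by blast
qed

end

section \<open>Jensen's inequality\<close>

text \<open>The mean square over the circle, with the angle measured in full turns. As an
  \<open>ennreal\<close> it can be integrated over outcomes without a prior proof of
  finiteness.\<close>

definition circle_energy :: "(complex \<Rightarrow> complex) \<Rightarrow> complex \<Rightarrow> real \<Rightarrow> ennreal" where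
  "circle_energy f z0 R = (\<integral>\<^sup>+t\<in>{0..1}. ennreal ((norm (f (z0 + of_real R * exp (2 * of_real pi * \<i> * of_real t))))\<^sup>2) \<partial>lborel)"

text \<open>Cauchy's formula is applied to the square of \<open>f\<close>, so that the triangle
  inequality for integrals already yields the mean of the squared modulus.\<close>

lemma norm_square_le_circle_energy:
  assumes "f holomorphic_on U" "open U" "cball z0 R \<subseteq> U" "R > 0"
  shows "ennreal ((norm (f z0))\<^sup>2) \<le> circle_energy f z0 R"
proof -
  let ?g = "\<lambda>t. z0 + of_real R * exp (2 * of_real pi * \<i> * of_real t)"
  have cont: "continuous_on {0..1} (\<lambda>t::real. f (?g t))"
  proof (rule continuous_on_compose2[OF holomorphic_on_imp_continuous_on[OF assms(1)]])
    show "?g ` {0..1} \<subseteq> U"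
      using assms(3,4) by (auto simp: dist_norm norm_mult subset_iff)
  qed (intro continuous_intros)
  have h2: "(\<lambda>z. (f z)\<^sup>2) holomorphic_on cball z0 R"
    using holomorphic_on_subset[OF assms(1,3)] by (intro holomorphic_intros)
  have "((\<lambda>u. (f u)\<^sup>2 / (u - z0)) has_contour_integral (2 * of_real pi * \<i> * (f z0)\<^sup>2)) (circlepath z0 R)"
    using h2 assms(4) Cauchy_integral_circlepath_simple[of "\<lambda>z. (f z)\<^sup>2" z0 R z0] by simp
  then have "((\<lambda>t. (f (circlepath z0 R t))\<^sup>2 / (circlepath z0 R t - z0) * (2 * of_real pi * \<i> * of_real R * exp (2 * of_real pi * \<i> * of_real t)))
      has_integral (2 * of_real pi * \<i> * (f z0)\<^sup>2)) {0..1}"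
    by (simp add: has_contour_integral vector_derivative_circlepath)
  then have "((\<lambda>t. (2 * of_real pi * \<i>) * (f (?g t))\<^sup>2) has_integral (2 * of_real pi * \<i> * (f z0)\<^sup>2)) {0..1}"
    by (rule has_integral_eq[rotated]) (use assms(4) in \<open>auto simp: circlepath field_simps\<close>)
  from has_integral_mult_right[OF this, of "inverse (2 * of_real pi * \<i>)"]
  have "((\<lambda>t. (f (?g t))\<^sup>2) has_integral (f z0)\<^sup>2) {0..1}"
    by (simp add: field_simps)
  then have eq: "(f z0)\<^sup>2 = integral {0..1} (\<lambda>t. (f (?g t))\<^sup>2)" by (simp add: integral_unique)
  have "(norm (f z0))\<^sup>2 \<le> integral {0..1} (\<lambda>t. (norm (f (?g t)))\<^sup>2)"
    unfolding norm_power[symmetric] eq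
    by (rule integral_norm_bound_integral) (auto intro!: integrable_continuous_real continuous_intros cont simp: norm_power)
  also have "\<dots> = set_lebesgue_integral lborel {0..1} (\<lambda>t. (norm (f (?g t)))\<^sup>2)"
    by (rule set_borel_integral_eq_integral(2)[symmetric]) (auto intro!: borel_integrable_atLeastAtMost' continuous_intros cont)
  finally have le: "(norm (f z0))\<^sup>2 \<le> set_lebesgue_integral lborel {0..1} (\<lambda>t. (norm (f (?g t)))\<^sup>2)" .
  have "circle_energy f z0 R = ennreal (set_lebesgue_integral lborel {0..1} (\<lambda>t. (norm (f (?g t)))\<^sup>2))"
    unfolding circle_energy_def
    unfolding set_lebesgue_integral_def
  proof (subst nn_integral_eq_integral[symmetric])
    show "integrable lborel (\<lambda>t. indicat_real {0..1} t *\<^sub>R (norm (f (?g t)))\<^sup>2)"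
      using borel_integrable_atLeastAtMost'[of 0 1 "\<lambda>t. (norm (f (?g t)))\<^sup>2"] continuous_on_power[OF continuous_on_norm[OF cont]]
      unfolding set_integrable_def by simp
  qed (auto intro!: nn_integral_cong simp: indicator_def)
  then show ?thesis using le by (simp add: ennreal_leI)
qed

lemma circle_energy_cong:
  assumes "\<And>z. dist z0 z = R \<Longrightarrow> norm (f z) = norm (g z)" "R \<ge> 0"
  shows "circle_energy f z0 R = circle_energy g z0 R"
  unfolding circle_energy_def using assms(2)
  by (intro nn_integral_cong) (simp add: assms(1) dist_norm norm_mult)

text \<open>Jensen's inequality at the centre: on the circle \<open>|z - z0| = R\<close> the factor \<open>z - x\<close> has the same
  modulus as \<open>R - cnj (x - z0) (z - z0) / R\<close>, which equals \<open>R\<close> at the centre.\<close>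

lemma jensen_zeros:
  fixes xs :: "complex list"
  assumes U: "open U" "cball z0 R \<subseteq> U" "R > 0" and H: "H holomorphic_on U"
    and fac: "\<And>z. z \<in> U \<Longrightarrow> G z = H z * (\<Prod>x\<leftarrow>xs. z - x)"
    and xs: "\<And>x. x \<in> set xs \<Longrightarrow> dist x z0 \<le> q * R"
  shows "ennreal ((norm (G z0))\<^sup>2) \<le> ennreal (q ^ (2 * length xs)) * circle_energy G z0 R"
proof -
  define B where "B ys z = (\<Prod>x\<leftarrow>ys. of_real R - cnj (x - z0) * (z - z0) / of_real R)" for ys z
  define K where "K z = H z * B xs z" for z
  have holB: "(B ys) holomorphic_on U" for ys
    unfolding B_def by (induction ys) (auto intro!: holomorphic_intros simp: U(3) less_imp_neq[symmetric])
  have K: "K holomorphic_on U" unfolding K_def by (intro holomorphic_intros H holB)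
  have z0: "z0 \<in> U" using U by (auto intro: subsetD)
  have Bc: "B ys z0 = of_real R ^ length ys" for ys
    unfolding B_def by (induction ys) auto
  have circ: "norm (B ys z) = norm (\<Prod>x\<leftarrow>ys. z - x)" if z: "dist z0 z = R" for ys z
  proof (induction ys)
    case (Cons x ys)
    define w where "w = z - z0"
    have w: "norm w = R" "w \<noteq> 0" using z U(3) unfolding w_def by (auto simp: dist_norm norm_minus_commute)
    have Rw: "of_real R * of_real R = w * cnj w" using w(1) by (metis complex_norm_square of_real_mult of_real_power power2_eq_square)
    have "of_real R - cnj (x - z0) * w / of_real R = w * cnj (w - (x - z0)) / of_real R"
      using U(3) Rw by (simp add: field_simps)
    then have "norm (of_real R - cnj (x - z0) * (z - z0) / of_real R) = norm (w * cnj (w - (x - z0)) / of_real R)" unfolding w_def by simp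
    also have "\<dots> = norm w * norm (w - (x - z0)) / R" using U(3) by (simp only: norm_mult norm_divide complex_mod_cnj norm_of_real abs_of_pos)
    also have "\<dots> = norm (z - x)" using w U(3) unfolding w_def by simp
    finally show ?case using Cons unfolding B_def by (simp add: norm_mult)
  qed (simp add: B_def)
  have "circle_energy K z0 R = circle_energy G z0 R"
  proof (rule circle_energy_cong)
    fix z assume "dist z0 z = R"
    moreover from this have "z \<in> U" using U(2) by auto
    ultimately show "norm (K z) = norm (G z)" unfolding K_def by (simp add: fac circ norm_mult)
  qed (use U in auto)
  then have 1: "ennreal ((norm (H z0) * R ^ length xs)\<^sup>2) \<le> circle_energy G z0 R"
    using norm_square_le_circle_energy[OF K U] unfolding K_def Bc using U(3) by (simp add: norm_mult norm_power)
  have pr: "norm (\<Prod>x\<leftarrow>ys. z0 - x) \<le> (q * R) ^ length ys" if "\<And>x. x \<in> set ys \<Longrightarrow> dist x z0 \<le> q * R" for ys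
    using that
  proof (induction ys)
    case (Cons x ys)
    have "dist x z0 \<le> q * R" using Cons.prems by simp
    then have "norm (z0 - x) \<le> q * R" "0 \<le> q * R"
      using order_trans[OF zero_le_dist \<open>dist x z0 \<le> q * R\<close>] by (auto simp: dist_norm norm_minus_commute)
    then have "norm (z0 - x) * norm (\<Prod>x\<leftarrow>ys. z0 - x) \<le> (q * R) * (q * R) ^ length ys"
      using Cons by (intro mult_mono) auto
    then show ?case by (simp add: norm_mult)
  qed simp
  have "norm (G z0) \<le> norm (H z0) * (q * R) ^ length xs"
    using pr[OF xs] z0 by (simp add: fac norm_mult mult_left_mono)
  then have "(norm (G z0))\<^sup>2 \<le> (norm (H z0) * (q * R) ^ length xs)\<^sup>2" by (rule power_mono) simp
  also have "\<dots> = q ^ (2 * length xs) * (norm (H z0) * R ^ length xs)\<^sup>2"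
    by (simp add: power_mult_distrib power_mult[symmetric] mult_ac)
  finally have "ennreal ((norm (G z0))\<^sup>2) \<le> ennreal (q ^ (2 * length xs) * (norm (H z0) * R ^ length xs)\<^sup>2)" by (rule ennreal_leI)
  also have "\<dots> = ennreal (q ^ (2 * length xs)) * ennreal ((norm (H z0) * R ^ length xs)\<^sup>2)"
    by (rule ennreal_mult) (auto simp: zero_le_even_power)
  also have "\<dots> \<le> ennreal (q ^ (2 * length xs)) * circle_energy G z0 R"
    using 1 by (rule mult_left_mono) simp
  finally show ?thesis .
qed

text \<open>The value of the quotient at \<open>a\<close> is recorded because a vanishing derivative
  then allows the same factor to be split off once more.\<close>

lemma factor_zero:
  assumes "G holomorphic_on U" "open U" "a \<in> U" "G a = 0"
  shows "\<exists>H. H holomorphic_on U \<and> (\<forall>z. G z = (z - a) * H z) \<and> H a = deriv G a"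
proof -
  define H where "H z = (if z = a then deriv G a else G z / (z - a))" for z
  have "H holomorphic_on U"
    by (rule pole_theorem_0[OF assms(1), of a]) (use assms interior_open in \<open>auto simp: H_def\<close>)
  then show ?thesis using assms(4) by (intro exI[of _ H]) (auto simp: H_def)
qed

lemma factor_distinct_zeros:
  assumes "G holomorphic_on U" "open U" "distinct xs" "set xs \<subseteq> U" "\<And>x. x \<in> set xs \<Longrightarrow> G x = 0"
  shows "\<exists>H. H holomorphic_on U \<and> (\<forall>z. G z = H z * (\<Prod>x\<leftarrow>xs. z - x))"
  using assms(3-)
proof (induction xs)
  case Nil
  then show ?case using assms(1) by auto
next
  case (Cons a xs)
  then obtain H where H: "H holomorphic_on U" "\<And>z. G z = H z * (\<Prod>x\<leftarrow>xs. z - x)" by auto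
  have "(\<Prod>x\<leftarrow>xs. a - x) \<noteq> 0" using Cons.prems(1) by (auto simp: prod_list_zero_iff)
  then have "H a = 0" using H(2)[of a] Cons.prems(3)[of a] by simp
  then obtain H' where "H' holomorphic_on U" "\<And>z. H z = (z - a) * H' z"
    using factor_zero[OF H(1) assms(2), of a] Cons.prems by auto
  then show ?case using H(2) by (intro exI[of _ H']) (auto simp: mult_ac)
qed

lemma jensen_distinct_zeros:
  fixes X :: "complex set"
  assumes U: "open U" "cball z0 R \<subseteq> U" "R > 0" and G: "G holomorphic_on U"
    and X: "finite X" "card X = m" "\<And>x. x \<in> X \<Longrightarrow> G x = 0 \<and> dist x z0 \<le> q * R" and q: "q \<le> 1"
  shows "ennreal ((norm (G z0))\<^sup>2) \<le> ennreal (q ^ (2 * m)) * circle_energy G z0 R"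
proof -
  obtain xs where xs: "set xs = X" "distinct xs" using finite_distinct_list[OF X(1)] by blast
  have "q * R \<le> 1 * R" using U q by (intro mult_right_mono) auto
  then have "set xs \<subseteq> U" using X(3) U(2) unfolding xs(1) by (auto simp: subset_iff dist_commute) (metis order_trans)
  then obtain H where "H holomorphic_on U" "\<forall>z. G z = H z * (\<Prod>x\<leftarrow>xs. z - x)"
    using factor_distinct_zeros[OF G U(1) xs(2)] X(3) xs(1) by blast
  moreover have "length xs = m" using xs X(2) distinct_card by fastforce
  ultimately show ?thesis using jensen_zeros[OF U, of H G xs q] X(3) xs(1) by auto
qed

text \<open>\<open>jensen_zeros\<close> takes a list of zeros, in which a double zero may be entered
  twice.\<close>

lemma jensen_double_zero:
  assumes U: "open U" "cball z0 R \<subseteq> U" "R > 0" and G: "G holomorphic_on U"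
    and x: "G x = 0" "deriv G x = 0" "dist x z0 \<le> q * R" and q: "q \<le> 1"
  shows "ennreal ((norm (G z0))\<^sup>2) \<le> ennreal (q ^ (2 * 2)) * circle_energy G z0 R"
proof -
  have "q * R \<le> 1 * R" using U q by (intro mult_right_mono) auto
  then have xU: "x \<in> U" using x(3) U(2) by (auto simp: subset_iff dist_commute)
  obtain H where H: "H holomorphic_on U" "\<And>z. G z = (z - x) * H z" "H x = 0"
    using factor_zero[OF G U(1) xU x(1)] x(2) by auto
  obtain H' where "H' holomorphic_on U" "\<And>z. H z = (z - x) * H' z"
    using factor_zero[OF H(1) U(1) xU H(3)] by auto
  then show ?thesis using jensen_zeros[OF U, of H' G "[x, x]" q] H x(3) by (auto simp: mult_ac)
qed

section \<open>Small ball estimates\<close>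

abbreviation std_normal_vector :: "nat \<Rightarrow> (nat \<Rightarrow> real) measure" where
  "std_normal_vector d \<equiv> Pi\<^sub>M {..<d} (\<lambda>_. std_normal_distribution)"

lemma product_prob_space_std_normal: "product_prob_space (\<lambda>_::nat. std_normal_distribution)"
proof -
  interpret real_distribution std_normal_distribution by (rule real_dist_normal_dist)
  show ?thesis by unfold_locales
qed

lemma prob_space_std_normal_vector: "prob_space (std_normal_vector d)"
  by (rule prob_space_PiM) (rule prob_space_normal_density, simp)

text \<open>The Gaussian bump is its own Fourier transform up to scaling. A smoothed indicator of a
  small ball thus becomes an average of exponentials, whose expectations are characteristic
  functions.\<close>

lemma gaussian_as_characteristic_function:
  "complex_of_real (\<Prod>i<d. exp (- (x i)\<^sup>2 / 2)) = (CLINT z|std_normal_vector d. iexp (\<Sum>i<d. x i * z i))"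
proof -
  interpret product_prob_space "\<lambda>_::nat. std_normal_distribution" by (rule product_prob_space_std_normal)
  interpret N: real_distribution std_normal_distribution by (rule real_dist_normal_dist)
  have "(CLINT z|std_normal_vector d. iexp (\<Sum>i<d. x i * z i)) = (CLINT z|std_normal_vector d. (\<Prod>i<d. iexp (x i * z i)))"
    by (simp add: exp_sum sum_distrib_left)
  also have "\<dots> = (\<Prod>i<d. CLINT z|std_normal_distribution. iexp (x i * z))"
    by (rule product_integral_prod) (auto intro!: prob_space.integrable_iexp prob_space_normal_density)
  also have "\<dots> = (\<Prod>i<d. complex_of_real (exp (- (x i)\<^sup>2 / 2)))"
  proof (intro prod.cong refl)
    fix i
    show "(CLINT z|std_normal_distribution. iexp (x i * z)) = complex_of_real (exp (- (x i)\<^sup>2 / 2))"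
      using fun_cong[OF char_std_normal_distribution, of "x i"] unfolding char_def by simp
  qed
  finally show ?thesis by simp
qed

text \<open>Discarding \<open>exp (- z\<^sup>2 / 2)\<close> from the standard density leaves exactly
  \<open>2 * \<eta>\<close> times the centred normal density of standard deviation
  \<open>2 * \<eta>\<close>.\<close>

lemma std_normal_gaussian_integral:
  assumes "\<eta> > 0"
  shows "integrable std_normal_distribution (\<lambda>z. exp (- z\<^sup>2 / (8 * \<eta>\<^sup>2)))"
    and "(LINT z|std_normal_distribution. exp (- z\<^sup>2 / (8 * \<eta>\<^sup>2))) \<le> 2 * \<eta>"
proof -
  interpret N: real_distribution std_normal_distribution by (rule real_dist_normal_dist)
  show int: "integrable std_normal_distribution (\<lambda>z. exp (- z\<^sup>2 / (8 * \<eta>\<^sup>2)))"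
    by (rule N.integrable_const_bound[of _ 1]) auto
  have "(LINT z|std_normal_distribution. exp (- z\<^sup>2 / (8 * \<eta>\<^sup>2))) = (LINT z|lborel. std_normal_density z * exp (- z\<^sup>2 / (8 * \<eta>\<^sup>2)))"
    by (subst integral_density) auto
  also have "\<dots> \<le> (LINT z|lborel. 2 * \<eta> * normal_density 0 (2 * \<eta>) z)"
  proof (rule integral_mono)
    show "integrable lborel (\<lambda>z. std_normal_density z * exp (- z\<^sup>2 / (8 * \<eta>\<^sup>2)))"
      using int by (subst (asm) integrable_density) auto
    show "integrable lborel (\<lambda>z. 2 * \<eta> * normal_density 0 (2 * \<eta>) z)"
      using assms by auto
    fix z :: real
    have e: "2 * (2 * \<eta>)\<^sup>2 = 8 * \<eta>\<^sup>2" by (simp add: power2_eq_square)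
    have "2 * \<eta> * normal_density 0 (2 * \<eta>) z = 2 * \<eta> / sqrt (2 * pi * (2 * \<eta>)\<^sup>2) * exp (- z\<^sup>2 / (8 * \<eta>\<^sup>2))"
      unfolding normal_density_def e by simp
    also have "2 * \<eta> / sqrt (2 * pi * (2 * \<eta>)\<^sup>2) = 1 / sqrt (2 * pi)"
      using assms by (subst mult.commute) (simp only: real_sqrt_mult real_sqrt_abs abs_mult, simp)
    finally have eq: "2 * \<eta> * normal_density 0 (2 * \<eta>) z = 1 / sqrt (2 * pi) * exp (- z\<^sup>2 / (8 * \<eta>\<^sup>2))" .
    have "std_normal_density z \<le> 1 / sqrt (2 * pi)" unfolding normal_density_def by (simp add: divide_right_mono)
    then show "std_normal_density z * exp (- z\<^sup>2 / (8 * \<eta>\<^sup>2)) \<le> 2 * \<eta> * normal_density 0 (2 * \<eta>) z"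
      unfolding eq by (intro mult_right_mono) auto
  qed
  also have "\<dots> = 2 * \<eta>" using assms by simp
  finally show "(LINT z|std_normal_distribution. exp (- z\<^sup>2 / (8 * \<eta>\<^sup>2))) \<le> 2 * \<eta>" .
qed

lemma std_normal_vector_component:
  assumes "i < d" "integrable std_normal_distribution g"
  shows "integrable (std_normal_vector d) (\<lambda>z. g (z i) :: real)"
    "(LINT z|std_normal_vector d. g (z i)) = (LINT z|std_normal_distribution. g z)"
proof -
  interpret product_prob_space "\<lambda>_::nat. std_normal_distribution" by (rule product_prob_space_std_normal)
  have d: "distr (std_normal_vector d) std_normal_distribution (\<lambda>z. z i) = std_normal_distribution"
    using distr_PiM_component[of "{..<d}" "\<lambda>_. std_normal_distribution" i] assms(1) prob_space_normal_density by simp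
  have m: "(\<lambda>z. z i) \<in> measurable (std_normal_vector d) std_normal_distribution"
    using assms(1) by (intro measurable_component_singleton) auto
  show "integrable (std_normal_vector d) (\<lambda>z. g (z i) :: real)"
    by (rule integrable_distr[OF m]) (unfold d, rule assms(2))
  show "(LINT z|std_normal_vector d. g (z i)) = (LINT z|std_normal_distribution. g z)"
    using integral_distr[OF m, of g] assms(2) unfolding d by simp
qed

context iid_standard
begin

lemma S_linear_combination:
  fixes d :: nat
  assumes "\<And>i. i < d \<Longrightarrow> summable (\<lambda>k. \<bar>w i k\<bar>)"
  shows "AE \<omega> in M. S (\<lambda>k. \<Sum>i<d. t i * w i k) \<omega> = (\<Sum>i<d. t i * S (w i) \<omega>)"
proof -
  have "AE \<omega> in M. \<forall>i\<in>{..<d}. summable (\<lambda>k. \<bar>w i k * \<xi> k \<omega>\<bar>)"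
    by (rule AE_finite_allI) (use AE_summable[OF assms] in auto)
  then show ?thesis
  proof eventually_elim
    case (elim \<omega>)
    have s: "summable (\<lambda>k. w i k * \<xi> k \<omega>)" if "i \<in> {..<d}" for i using elim that by (auto intro: summable_rabs_cancel)
    have "S (\<lambda>k. \<Sum>i<d. t i * w i k) \<omega> = (\<Sum>k. \<Sum>i<d. t i * (w i k * \<xi> k \<omega>))"
      unfolding S_def by (simp only: sum_distrib_right mult.assoc)
    also have "\<dots> = (\<Sum>i<d. \<Sum>k. t i * (w i k * \<xi> k \<omega>))"
      using s by (intro suminf_sum summable_mult) auto
    also have "\<dots> = (\<Sum>i<d. t i * S (w i) \<omega>)"
      unfolding S_def using s by (intro sum.cong refl suminf_mult) auto
    finally show ?case .
  qed
qed

text \<open>Fubini moves the expectation inside the Gaussian average, where a bound \<open>h\<close>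
  on the characteristic function applies pointwise.\<close>

lemma small_ball_smoothing:
  assumes "\<And>i. i < d \<Longrightarrow> S' i \<in> borel_measurable M"
    and h: "integrable (std_normal_vector d) h"
    and bound: "\<And>z. norm (CLINT \<omega>|M. iexp (\<Sum>i<d. S' i \<omega> * z i)) \<le> h z"
  shows "expectation (\<lambda>\<omega>. \<Prod>i<d. exp (- (S' i \<omega>)\<^sup>2 / 2)) \<le> (LINT z|std_normal_vector d. h z)"
proof -
  let ?N = "std_normal_vector d"
  interpret N: prob_space ?N by (rule prob_space_std_normal_vector)
  interpret pair_sigma_finite M ?N by unfold_locales
  interpret P: pair_prob_space M ?N by unfold_locales
  note assms(1)[measurable]
  have [measurable]: "(\<lambda>p. snd p i) \<in> borel_measurable (M \<Otimes>\<^sub>M ?N)" if "i < d" for i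
  proof -
    have "(\<lambda>z. z i) \<in> measurable ?N std_normal_distribution" using that by (intro measurable_component_singleton) auto
    then have "(\<lambda>z. z i) \<in> borel_measurable ?N" by simp
    then show ?thesis by measurable
  qed
  have meas: "(\<lambda>p. iexp (\<Sum>i<d. S' i (fst p) * snd p i)) \<in> borel_measurable (M \<Otimes>\<^sub>M ?N)"
  proof -
    have "(\<lambda>p. \<Sum>i<d. S' i (fst p) * snd p i) \<in> borel_measurable (M \<Otimes>\<^sub>M ?N)"
      by (intro borel_measurable_sum) auto
    then show ?thesis by measurable
  qed
  have int: "integrable (M \<Otimes>\<^sub>M ?N) (\<lambda>(\<omega>, z). iexp (\<Sum>i<d. S' i \<omega> * z i))"
    by (rule P.integrable_const_bound[of _ 1]) (use meas in \<open>auto simp: case_prod_beta\<close>)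
  have "complex_of_real (expectation (\<lambda>\<omega>. \<Prod>i<d. exp (- (S' i \<omega>)\<^sup>2 / 2))) =
      (CLINT \<omega>|M. complex_of_real (\<Prod>i<d. exp (- (S' i \<omega>)\<^sup>2 / 2)))"
    by (rule integral_complex_of_real[symmetric])
  also have "\<dots> = (CLINT \<omega>|M. (CLINT z|?N. iexp (\<Sum>i<d. S' i \<omega> * z i)))"
    by (simp only: gaussian_as_characteristic_function)
  also have "\<dots> = (CLINT z|?N. (CLINT \<omega>|M. iexp (\<Sum>i<d. S' i \<omega> * z i)))"
    using Fubini_integral[OF int] by simp
  finally have eq: "complex_of_real (expectation (\<lambda>\<omega>. \<Prod>i<d. exp (- (S' i \<omega>)\<^sup>2 / 2))) = \<dots>" .
  have "expectation (\<lambda>\<omega>. \<Prod>i<d. exp (- (S' i \<omega>)\<^sup>2 / 2)) \<le> norm (complex_of_real (expectation (\<lambda>\<omega>. \<Prod>i<d. exp (- (S' i \<omega>)\<^sup>2 / 2))))"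
    unfolding norm_of_real by simp
  also have "\<dots> \<le> (LINT z|?N. norm (CLINT \<omega>|M. iexp (\<Sum>i<d. S' i \<omega> * z i)))"
    unfolding eq by (rule integral_norm_bound)
  also have "\<dots> \<le> (LINT z|?N. h z)"
    using integrable_norm[OF integrable_snd[OF int]] by (intro integral_mono bound h)
  finally show ?thesis .
qed

text \<open>Esseen-type bound with Gaussian smoothing: the weights must be small compared with \<open>\<eta>\<close>
  so that the characteristic function decays up to frequencies of order \<open>1 / \<eta>\<^sup>2\<close>.\<close>

lemma small_ball:
  assumes d: "d \<ge> 1"
  shows "\<exists>C>0. \<forall>w W \<eta>. (\<forall>i<d. summable (\<lambda>k. \<bar>w i k\<bar>)) \<longrightarrow> (\<forall>i<d. \<forall>k. \<bar>w i k\<bar> \<le> W) \<longrightarrow>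
      (\<forall>z. (\<Sum>i<d. (z i)\<^sup>2) / 2 \<le> (\<Sum>k. (\<Sum>i<d. z i * w i k)\<^sup>2)) \<longrightarrow> 0 < \<eta> \<longrightarrow> \<eta> \<le> 1 \<longrightarrow> W \<le> \<eta>\<^sup>2 \<longrightarrow>
      prob {\<omega>\<in>space M. \<forall>i<d. \<bar>S (w i) \<omega>\<bar> \<le> \<eta>} \<le> C * \<eta> ^ d"
proof -
  obtain u0 where u0: "u0 > 0" "\<And>a. summable (\<lambda>k. \<bar>a k\<bar>) \<Longrightarrow> (\<And>k. \<bar>a k\<bar> \<le> u0) \<Longrightarrow>
      norm (CLINT \<omega>|M. iexp (S a \<omega>)) \<le> exp (- (\<Sum>k. (a k)\<^sup>2) / 4)"
    using char_series_decay by blast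
  interpret N: product_prob_space "\<lambda>_::nat. std_normal_distribution" by (rule product_prob_space_std_normal)
  define m where "m = (LINT x|std_normal_distribution. x ^ (2 * d))"
  have m: "m \<ge> 0" unfolding m_def by (intro integral_nonneg_AE) (auto simp: zero_le_even_power)
  define C where "C = exp (real d / 2) * (2 ^ d + real d * (m * (real d / u0) ^ (2 * d)))"
  have "prob {\<omega>\<in>space M. \<forall>i<d. \<bar>S (w i) \<omega>\<bar> \<le> \<eta>} \<le> C * \<eta> ^ d"
    if s: "\<And>i. i < d \<Longrightarrow> summable (\<lambda>k. \<bar>w i k\<bar>)" and W: "\<And>i k. i < d \<Longrightarrow> \<bar>w i k\<bar> \<le> W"
      and nd: "\<And>z. (\<Sum>i<d. (z i)\<^sup>2) / 2 \<le> (\<Sum>k. (\<Sum>i<d. z i * w i k)\<^sup>2)" and \<eta>: "0 < \<eta>" "\<eta> \<le> 1" "W \<le> \<eta>\<^sup>2"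
    for w W \<eta>
  proof -
    \<comment> \<open>The largest frequency for which all combined weights stay below
      \<open>u0\<close>: each of the \<open>d\<close> summands is at most
      \<open>Z / \<eta> * \<eta>\<^sup>2\<close>. Since \<open>Z\<close> is of order
      \<open>1 / \<eta>\<close>, the excluded frequencies cost a moment of order
      \<open>2 * d\<close> divided by \<open>Z ^ (2 * d)\<close>, which is of order
      \<open>\<eta> ^ (2 * d)\<close>.\<close>
    define Z where "Z = u0 / (real d * \<eta>)"
    have Z: "Z > 0" unfolding Z_def using u0 d \<eta> by simp
    define S' where "S' i \<omega> = S (w i) \<omega> / \<eta>" for i \<omega>
    have [measurable]: "S' i \<in> borel_measurable M" for i unfolding S'_def by measurable
    \<comment> \<open>The product is the decay bound below frequency \<open>Z\<close>; the sum of
      powers exceeds \<open>1\<close> as soon as one frequency is larger, so that it dominates the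
      trivial bound there.\<close>
    define h where "h z = (\<Prod>i<d. exp (- (z i)\<^sup>2 / (8 * \<eta>\<^sup>2))) + (\<Sum>i<d. (z i) ^ (2 * d) / Z ^ (2 * d))" for z :: "nat \<Rightarrow> real"
    have W0: "W \<ge> 0" using W[of 0 0] d by linarith
    have bound: "norm (CLINT \<omega>|M. iexp (\<Sum>i<d. S' i \<omega> * z i)) \<le> h z" for z
    proof -
      define a where "a k = (\<Sum>i<d. (z i / \<eta>) * w i k)" for k
      have "(CLINT \<omega>|M. iexp (\<Sum>i<d. S' i \<omega> * z i)) = (CLINT \<omega>|M. iexp (S a \<omega>))"
      proof (rule integral_cong_AE)
        show "AE \<omega> in M. iexp (\<Sum>i<d. S' i \<omega> * z i) = iexp (S a \<omega>)"
          using S_linear_combination[of d w "\<lambda>i. z i / \<eta>"] s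
          by (auto elim!: eventually_mono simp: a_def[abs_def] S'_def mult_ac) 
      qed measurable
      moreover have "norm (CLINT \<omega>|M. iexp (S a \<omega>)) \<le> h z"
      proof (cases "\<forall>i<d. \<bar>z i\<bar> \<le> Z")
        case True
        have sa: "summable (\<lambda>k. \<bar>a k\<bar>)"
        proof (rule summable_comparison_test')
          show "summable (\<lambda>k. \<Sum>i<d. \<bar>z i / \<eta>\<bar> * \<bar>w i k\<bar>)"
            by (intro summable_sum summable_mult s) auto
          show "norm \<bar>a k\<bar> \<le> (\<Sum>i<d. \<bar>z i / \<eta>\<bar> * \<bar>w i k\<bar>)" for k
            unfolding a_def using sum_abs[of "\<lambda>i. (z i / \<eta>) * w i k" "{..<d}"] by (simp add: abs_mult)
        qed
        have "\<bar>a k\<bar> \<le> u0" for k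
        proof -
          have "\<bar>a k\<bar> \<le> (\<Sum>i<d. \<bar>z i / \<eta>\<bar> * \<bar>w i k\<bar>)"
            unfolding a_def using sum_abs[of "\<lambda>i. (z i / \<eta>) * w i k" "{..<d}"] by (simp add: abs_mult)
          also have "\<dots> \<le> (\<Sum>i<d. (Z / \<eta>) * \<eta>\<^sup>2)"
          proof (intro sum_mono mult_mono)
            fix i assume i: "i \<in> {..<d}"
            show "\<bar>z i / \<eta>\<bar> \<le> Z / \<eta>" using True i \<eta> by (simp add: divide_right_mono)
            show "\<bar>w i k\<bar> \<le> \<eta>\<^sup>2" using W[of i k] i \<eta>(3) by simp
          qed (use Z \<eta> in auto)
          also have "\<dots> = u0" using \<eta> d unfolding Z_def by (simp add: power2_eq_square)
          finally show ?thesis .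
        qed
        from u0(2)[OF sa this] have "norm (CLINT \<omega>|M. iexp (S a \<omega>)) \<le> exp (- (\<Sum>k. (a k)\<^sup>2) / 4)" .
        also have "\<dots> \<le> exp (\<Sum>i<d. - (z i)\<^sup>2 / (8 * \<eta>\<^sup>2))"
        proof -
          \<comment> \<open>The hypothesis that the Gram matrix of the weights is at least half the
            identity is applied to the scaled vector.\<close>
          have "(\<Sum>i<d. (z i / \<eta>)\<^sup>2) / 2 \<le> (\<Sum>k. (a k)\<^sup>2)" unfolding a_def by (rule nd)
          moreover have "(\<Sum>i<d. - (z i)\<^sup>2 / (8 * \<eta>\<^sup>2)) = - ((\<Sum>i<d. (z i / \<eta>)\<^sup>2) / 2) / 4"
            by (simp add: power_divide sum_negf sum_divide_distrib[symmetric])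
          ultimately show ?thesis by simp
        qed
        also have "\<dots> = (\<Prod>i<d. exp (- (z i)\<^sup>2 / (8 * \<eta>\<^sup>2)))" by (simp add: exp_sum)
        also have "\<dots> \<le> h z" unfolding h_def using Z by (auto intro!: sum_nonneg divide_nonneg_pos simp: zero_le_even_power)
        finally show ?thesis .
      next
        case False
        then obtain i where i: "i < d" "\<bar>z i\<bar> > Z" by auto
        have "norm (CLINT \<omega>|M. iexp (S a \<omega>)) \<le> (LINT \<omega>|M. norm (iexp (S a \<omega>)))"
          by (rule integral_norm_bound)
        also have "\<dots> = 1" by (simp add: prob_space)
        also have "1 \<le> (z i) ^ (2 * d) / Z ^ (2 * d)"
          using power_mono[of Z "\<bar>z i\<bar>" "2 * d"] i Z by (simp add: power_even_abs)
        also have "\<dots> \<le> (\<Sum>i<d. (z i) ^ (2 * d) / Z ^ (2 * d))"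
          using i Z by (intro member_le_sum) (auto intro!: divide_nonneg_pos simp: zero_le_even_power)
        also have "\<dots> \<le> h z" unfolding h_def by (auto intro!: prod_nonneg)
        finally show ?thesis .
      qed
      ultimately show ?thesis by simp
    qed
    have inth1: "integrable (std_normal_vector d) (\<lambda>z. \<Prod>i<d. exp (- (z i)\<^sup>2 / (8 * \<eta>\<^sup>2)))"
      using N.product_integrable_prod[of "{..<d}" "\<lambda>_ z. exp (- z\<^sup>2 / (8 * \<eta>\<^sup>2))"] std_normal_gaussian_integral(1)[OF \<eta>(1)] by simp
    have intx: "integrable std_normal_distribution (\<lambda>x. x ^ (2 * d) / Z ^ (2 * d))"
      by (intro integrable_divide) (rule integrable_std_normal_distribution_moment)
    have inth2: "integrable (std_normal_vector d) (\<lambda>z. (z i) ^ (2 * d) / Z ^ (2 * d))" if "i < d" for i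
      using std_normal_vector_component(1)[OF that intx] .
    have inth: "integrable (std_normal_vector d) h"
      unfolding h_def by (intro Bochner_Integration.integrable_add inth1 Bochner_Integration.integrable_sum inth2) auto
    have "expectation (\<lambda>\<omega>. \<Prod>i<d. exp (- (S' i \<omega>)\<^sup>2 / 2)) \<le> (LINT z|std_normal_vector d. h z)"
      by (rule small_ball_smoothing[OF _ inth bound]) measurable
    also have "\<dots> = (LINT z|std_normal_vector d. (\<Prod>i<d. exp (- (z i)\<^sup>2 / (8 * \<eta>\<^sup>2)))) + (\<Sum>i<d. (LINT z|std_normal_vector d. (z i) ^ (2 * d) / Z ^ (2 * d)))"
      unfolding h_def using inth1 inth2
      by (subst Bochner_Integration.integral_add) (auto intro!: Bochner_Integration.integral_sum Bochner_Integration.integrable_sum)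
    also have "(LINT z|std_normal_vector d. (\<Prod>i<d. exp (- (z i)\<^sup>2 / (8 * \<eta>\<^sup>2)))) = (LINT z|std_normal_distribution. exp (- z\<^sup>2 / (8 * \<eta>\<^sup>2))) ^ d"
      using N.product_integral_prod[of "{..<d}" "\<lambda>_ z. exp (- z\<^sup>2 / (8 * \<eta>\<^sup>2))"] std_normal_gaussian_integral(1)[OF \<eta>(1)] by simp
    also have "\<dots> \<le> (2 * \<eta>) ^ d"
      by (intro power_mono std_normal_gaussian_integral \<eta> integral_nonneg_AE) auto
    also have "(\<Sum>i<d. (LINT z|std_normal_vector d. (z i) ^ (2 * d) / Z ^ (2 * d))) = (\<Sum>i<d. m / Z ^ (2 * d))"
    proof (rule sum.cong[OF refl])
      fix i assume "i \<in> {..<d}"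
      then have "i < d" by simp
      from std_normal_vector_component(2)[OF this intx]
      show "(LINT z|std_normal_vector d. (z i) ^ (2 * d) / Z ^ (2 * d)) = m / Z ^ (2 * d)"
        unfolding m_def by simp
    qed
    also have "\<dots> = real d * (m * (real d / u0) ^ (2 * d)) * \<eta> ^ (2 * d)"
      unfolding Z_def using u0 d \<eta> by (simp add: power_divide power_mult_distrib)
    also have "\<dots> \<le> real d * (m * (real d / u0) ^ (2 * d)) * \<eta> ^ d"
      using \<eta> m u0 by (intro mult_left_mono power_decreasing) auto
    finally have E: "expectation (\<lambda>\<omega>. \<Prod>i<d. exp (- (S' i \<omega>)\<^sup>2 / 2)) \<le> (2 ^ d + real d * (m * (real d / u0) ^ (2 * d))) * \<eta> ^ d"
      by (simp add: power_mult_distrib algebra_simps)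
    let ?A = "{\<omega>\<in>space M. \<forall>i<d. \<bar>S (w i) \<omega>\<bar> \<le> \<eta>}"
    have "prob ?A = expectation (indicator ?A)" by simp
    \<comment> \<open>On the event each normalised value is at most \<open>1\<close>, so each of the
      \<open>d\<close> Gaussian factors is at least \<open>exp (- (1/2))\<close>.\<close>
    also have "\<dots> \<le> expectation (\<lambda>\<omega>. exp (real d / 2) * (\<Prod>i<d. exp (- (S' i \<omega>)\<^sup>2 / 2)))"
    proof (rule integral_mono)
      show "integrable M (\<lambda>\<omega>. exp (real d / 2) * (\<Prod>i<d. exp (- (S' i \<omega>)\<^sup>2 / 2)))"
        by (intro integrable_mult_right integrable_const_bound[of _ 1]) (auto intro!: prod_le_1 simp: abs_prod)
      fix \<omega>
      show "indicat_real ?A \<omega> \<le> exp (real d / 2) * (\<Prod>i<d. exp (- (S' i \<omega>)\<^sup>2 / 2))"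
      proof (cases "\<omega> \<in> ?A")
        case True
        have "exp (- (1/2)) ^ d \<le> (\<Prod>i<d. exp (- (S' i \<omega>)\<^sup>2 / 2))"
        proof -
          have "(\<Prod>i<d. exp (- (1/2))) \<le> (\<Prod>i<d. exp (- (S' i \<omega>)\<^sup>2 / 2))"
          proof (intro prod_mono conjI)
            fix i assume "i \<in> {..<d}"
            then have "\<bar>S' i \<omega>\<bar> \<le> 1" using True \<eta> unfolding S'_def by simp
            then have "(S' i \<omega>)\<^sup>2 \<le> 1" by (simp add: abs_square_le_1)
            then show "exp (- (1/2)) \<le> exp (- (S' i \<omega>)\<^sup>2 / 2)" by simp
          qed simp
          then show ?thesis by simp
        qed
        moreover have "exp (real d / 2) * exp (- (1/2)) ^ d = 1"
          by (simp add: exp_of_nat_mult[symmetric] exp_add[symmetric])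
        ultimately show ?thesis using True mult_left_mono[of "exp (- (1/2)) ^ d" _ "exp (real d / 2)"] by fastforce
      qed (auto intro!: mult_nonneg_nonneg prod_nonneg)
    qed (auto simp: integrable_indicator_iff emeasure_eq_measure)
    also have "\<dots> = exp (real d / 2) * expectation (\<lambda>\<omega>. \<Prod>i<d. exp (- (S' i \<omega>)\<^sup>2 / 2))" by simp
    also have "\<dots> \<le> exp (real d / 2) * ((2 ^ d + real d * (m * (real d / u0) ^ (2 * d))) * \<eta> ^ d)"
      by (intro mult_left_mono E) auto
    finally show ?thesis unfolding C_def by (simp add: mult.assoc)
  qed
  moreover have "C > 0" unfolding C_def using m u0 by (intro mult_pos_pos add_pos_nonneg mult_nonneg_nonneg) auto
  ultimately show ?thesis by (intro exI[of _ C]) blast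
qed

end

section \<open>Sign changes of asymptotically Gaussian pairs\<close>

lemma nn_integral_even_half_line:
  fixes g :: "real \<Rightarrow> ennreal"
  assumes [measurable]: "g \<in> borel_measurable borel" and even: "\<And>x. g (- x) = g x"
  shows "2 * (\<integral>\<^sup>+x. g x * indicator {0<..} x \<partial>lborel) = (\<integral>\<^sup>+x. g x \<partial>lborel)"
proof -
  have "(\<integral>\<^sup>+x. g x * indicator {0<..} x \<partial>lborel) = (\<integral>\<^sup>+x. g x * indicator {..<0} x \<partial>lborel)"
    using nn_integral_real_affine[of "\<lambda>x. g x * indicator {0<..} x" "-1" 0]
    by (simp add: even indicator_def cong: nn_integral_cong)
  then have "2 * (\<integral>\<^sup>+x. g x * indicator {0<..} x \<partial>lborel) =
      (\<integral>\<^sup>+x. g x * indicator {0<..} x + g x * indicator {..<0} x \<partial>lborel)"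
    by (subst nn_integral_add) (auto simp: mult_2)
  also have "\<dots> = (\<integral>\<^sup>+x. g x \<partial>lborel)"
    by (rule nn_integral_cong_AE, use AE_lborel_singleton[of 0] in eventually_elim) (auto simp: indicator_def)
  finally show ?thesis .
qed

lemma borel_measurable_cosh [measurable]: "(cosh :: real \<Rightarrow> real) \<in> borel_measurable borel"
  by (intro borel_measurable_continuous_onI continuous_intros)

lemma borel_measurable_sinh [measurable]: "(sinh :: real \<Rightarrow> real) \<in> borel_measurable borel"
  by (intro borel_measurable_continuous_onI continuous_intros)

lemma nn_integral_gaussian:
  assumes "\<sigma> > 0"
  shows "(\<integral>\<^sup>+x. ennreal (exp (- (x - m)\<^sup>2 / (2 * \<sigma>\<^sup>2))) \<partial>lborel) = ennreal (sqrt (2 * pi) * \<sigma>)"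
proof -
  have eq: "exp (- (x - m)\<^sup>2 / (2 * \<sigma>\<^sup>2)) = sqrt (2 * pi) * \<sigma> * normal_density m \<sigma> x" for x
    using assms by (simp add: normal_density_def real_sqrt_mult)
  have "(\<integral>\<^sup>+x. ennreal (normal_density m \<sigma> x) \<partial>lborel) = 1"
    using integral_normal_density[OF assms, of m] integrable_normal_density[OF assms, of m]
    by (subst nn_integral_eq_integral) auto
  then show ?thesis unfolding eq using assms by (simp add: ennreal_mult nn_integral_cmult)
qed

text \<open>Completing the square in the two exponentials of \<open>cosh\<close> gives Gaussians
  centred at \<open>a\<close> and \<open>- a\<close>.\<close>

lemma nn_integral_gaussian_cosh:
  "(\<integral>\<^sup>+u. ennreal (exp (- u\<^sup>2 / 2) * cosh (a * u)) \<partial>lborel) = ennreal (sqrt (2 * pi) * exp (a\<^sup>2 / 2))"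
proof -
  have e: "exp (- u\<^sup>2 / 2) * cosh (a * u) = exp (a\<^sup>2 / 2) / 2 * exp (- (u - a)\<^sup>2 / (2 * 1\<^sup>2)) + exp (a\<^sup>2 / 2) / 2 * exp (- (u - (- a))\<^sup>2 / (2 * 1\<^sup>2))" for u
  proof -
    have "exp (a\<^sup>2 / 2) * exp (- (u - a)\<^sup>2 / (2 * 1\<^sup>2)) = exp (- u\<^sup>2 / 2) * exp (a * u)"
      unfolding exp_add[symmetric] by (simp add: power2_eq_square field_simps)
    moreover have "exp (a\<^sup>2 / 2) * exp (- (u - (-a))\<^sup>2 / (2 * 1\<^sup>2)) = exp (- u\<^sup>2 / 2) * exp (- (a * u))"
      unfolding exp_add[symmetric] by (simp add: power2_eq_square field_simps)
    ultimately show ?thesis by (simp add: cosh_field_def field_simps)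
  qed
  have "(\<integral>\<^sup>+u. ennreal (exp (- u\<^sup>2 / 2) * cosh (a * u)) \<partial>lborel) =
    (\<integral>\<^sup>+u. ennreal (exp (a\<^sup>2 / 2) / 2) * ennreal (exp (- (u - a)\<^sup>2 / (2 * 1\<^sup>2))) +
        ennreal (exp (a\<^sup>2 / 2) / 2) * ennreal (exp (- (u - (- a))\<^sup>2 / (2 * 1\<^sup>2))) \<partial>lborel)"
    unfolding e by (intro nn_integral_cong) (simp add: ennreal_mult[symmetric] ennreal_plus[symmetric] del: ennreal_plus)
  also have "\<dots> = ennreal (exp (a\<^sup>2 / 2) / 2) * ennreal (sqrt (2 * pi) * 1) + ennreal (exp (a\<^sup>2 / 2) / 2) * ennreal (sqrt (2 * pi) * 1)"
    by (subst nn_integral_add, measurable, subst (1 2) nn_integral_cmult, measurable, simp only: nn_integral_gaussian zero_less_one)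
  also have "\<dots> = ennreal (sqrt (2 * pi) * exp (a\<^sup>2 / 2))"
    by (simp add: ennreal_mult[symmetric] ennreal_plus[symmetric] del: ennreal_plus)
  finally show ?thesis .
qed

text \<open>The integrand is even in each variable, so four times the quadrant integral is the
  integral over the plane. Integrating out \<open>u\<close> leaves a Gaussian in \<open>t\<close>
  with variance \<open>1 / (1 - r\<^sup>2)\<close>.\<close>

lemma nn_integral_quadrant_cosh:
  assumes r: "0 \<le> r" "r < 1"
  shows "(\<integral>\<^sup>+t. (\<integral>\<^sup>+u. ennreal (exp (- t\<^sup>2 / 2) * exp (- u\<^sup>2 / 2) * cosh (r * t * u)) * indicator {0<..} u \<partial>lborel) * indicator {0<..} t \<partial>lborel)
     = ennreal (pi / 2 * inverse (sqrt (1 - r\<^sup>2)))"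
proof -
  have r2: "1 - r\<^sup>2 > 0" using r by (simp add: abs_square_less_1)
  define \<sigma> where "\<sigma> = inverse (sqrt (1 - r\<^sup>2))"
  have \<sigma>: "\<sigma> > 0" "1 / \<sigma>\<^sup>2 = 1 - r\<^sup>2" using r2 unfolding \<sigma>_def by (auto simp: power_inverse divide_inverse)
  have inner: "2 * (\<integral>\<^sup>+u. ennreal (exp (- t\<^sup>2 / 2) * exp (- u\<^sup>2 / 2) * cosh (r * t * u)) * indicator {0<..} u \<partial>lborel)
      = ennreal (sqrt (2 * pi)) * ennreal (exp (- (t - 0)\<^sup>2 / (2 * \<sigma>\<^sup>2)))" for t
  proof -
    have "2 * (\<integral>\<^sup>+u. ennreal (exp (- t\<^sup>2 / 2) * exp (- u\<^sup>2 / 2) * cosh (r * t * u)) * indicator {0<..} u \<partial>lborel)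
       = (\<integral>\<^sup>+u. ennreal (exp (- t\<^sup>2 / 2) * exp (- u\<^sup>2 / 2) * cosh (r * t * u)) \<partial>lborel)"
      by (rule nn_integral_even_half_line) simp_all
    also have "\<dots> = (\<integral>\<^sup>+u. ennreal (exp (- t\<^sup>2 / 2)) * ennreal (exp (- u\<^sup>2 / 2) * cosh ((r * t) * u)) \<partial>lborel)"
      by (intro nn_integral_cong) (simp add: ennreal_mult[symmetric] mult_ac)
    also have "\<dots> = ennreal (exp (- t\<^sup>2 / 2)) * ennreal (sqrt (2 * pi) * exp ((r * t)\<^sup>2 / 2))"
      by (subst nn_integral_cmult, measurable, simp only: nn_integral_gaussian_cosh)
    also have "\<dots> = ennreal (sqrt (2 * pi) * (exp (- t\<^sup>2 / 2) * exp ((r * t)\<^sup>2 / 2)))"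
      by (simp add: ennreal_mult[symmetric] mult_ac)
    also have "exp (- t\<^sup>2 / 2) * exp ((r * t)\<^sup>2 / 2) = exp (- (t - 0)\<^sup>2 / (2 * \<sigma>\<^sup>2))"
    proof -
      have "- (t - 0)\<^sup>2 / (2 * \<sigma>\<^sup>2) = - (t\<^sup>2 / 2) * (1 / \<sigma>\<^sup>2)" by simp
      also have "\<dots> = - t\<^sup>2 / 2 + (r * t)\<^sup>2 / 2" unfolding \<sigma>(2) by (simp add: power_mult_distrib field_simps)
      finally show ?thesis by (simp add: exp_add[symmetric])
    qed
    finally show ?thesis by (simp add: ennreal_mult)
  qed
  let ?I = "\<lambda>t. (\<integral>\<^sup>+u. ennreal (exp (- t\<^sup>2 / 2) * exp (- u\<^sup>2 / 2) * cosh (r * t * u)) * indicator {0<..} u \<partial>lborel)"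
  have Imeas [measurable]: "?I \<in> borel_measurable borel"
    by simp
  have "4 * (\<integral>\<^sup>+t. ?I t * indicator {0<..} t \<partial>lborel) = 2 * (\<integral>\<^sup>+t. (2 * ?I t) * indicator {0<..} t \<partial>lborel)"
  proof -
    have "(\<integral>\<^sup>+t. (2 * ?I t) * indicator {0<..} t \<partial>lborel) = 2 * (\<integral>\<^sup>+t. ?I t * indicator {0<..} t \<partial>lborel)"
      by (subst nn_integral_cmult[symmetric], measurable, simp only: mult.assoc)
    then show ?thesis by (simp only: mult.assoc[symmetric]) simp
  qed
  also have "\<dots> = (\<integral>\<^sup>+t. ennreal (sqrt (2 * pi)) * ennreal (exp (- (t - 0)\<^sup>2 / (2 * \<sigma>\<^sup>2))) \<partial>lborel)"
    unfolding inner by (rule nn_integral_even_half_line) auto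
  also have "\<dots> = ennreal (sqrt (2 * pi)) * ennreal (sqrt (2 * pi) * \<sigma>)"
    by (subst nn_integral_cmult) (simp_all only: nn_integral_gaussian[OF \<sigma>(1)], measurable)
  also have "\<dots> = ennreal (4 * (pi / 2 * \<sigma>))"
    using \<sigma>(1) by (simp add: ennreal_mult[symmetric] mult.assoc[symmetric])
  also have "\<dots> = 4 * ennreal (pi / 2 * \<sigma>)" using \<sigma>(1) by (subst ennreal_mult) auto
  finally show ?thesis unfolding \<sigma>_def by (simp add: ennreal_mult_cancel_left)
qed

text \<open>Half the difference of the bivariate Gaussian characteristic function at
  \<open>(t, - u)\<close> and at \<open>(t, u)\<close>, divided by \<open>t * u\<close>: the
  Gaussian value of the expectation of \<open>sin (t * X) * sin (u * Y) / (t * u)\<close>.\<close>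

definition sinh_kernel :: "real \<Rightarrow> real \<times> real \<Rightarrow> real" where
  "sinh_kernel \<rho> = (\<lambda>(t, u). exp (- t\<^sup>2 / 2) * exp (- u\<^sup>2 / 2) * sinh (\<rho> * t * u) / (t * u))"

text \<open>The derivative in the correlation replaces \<open>sinh (r * t * u) / (t * u)\<close> by
  \<open>cosh (r * t * u)\<close>. By Tonelli the integral is that of the derivative over
  \<open>[0, \<rho>]\<close>, where the quadrant integral is \<open>pi / 2\<close> times the
  derivative of \<open>arcsin\<close>.\<close>

lemma sinh_kernel_integral:
  assumes \<rho>: "0 \<le> \<rho>" "\<rho> < 1"
  shows "(\<integral>\<^sup>+z. ennreal (sinh_kernel \<rho> z) * indicator ({0<..} \<times> {0<..}) z \<partial>(lborel \<Otimes>\<^sub>M lborel)) = ennreal (pi / 2 * arcsin \<rho>)"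
proof -
  define g where "g r t u = ennreal (exp (- t\<^sup>2 / 2) * exp (- u\<^sup>2 / 2) * cosh (r * t * u))" for r t u :: real
  have gm [measurable]: "(\<lambda>x. g (f1 x) (f2 x) (f3 x)) \<in> borel_measurable N" 
    if [measurable]: "f1 \<in> borel_measurable N" "f2 \<in> borel_measurable N" "f3 \<in> borel_measurable N" for f1 f2 f3 and N :: "'c measure"
    unfolding g_def by measurable
  have k: "ennreal (sinh_kernel \<rho> (t, u)) = (\<integral>\<^sup>+r. g r t u * indicator {0..\<rho>} r \<partial>lborel)" if tu: "t > 0" "u > 0" for t u
  proof -
    have "(\<integral>\<^sup>+r. g r t u * indicator {0..\<rho>} r \<partial>lborel) = 
        ennreal (exp (- t\<^sup>2 / 2) * exp (- u\<^sup>2 / 2) * sinh (\<rho> * t * u) / (t * u) - exp (- t\<^sup>2 / 2) * exp (- u\<^sup>2 / 2) * sinh (0 * t * u) / (t * u))"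
      unfolding g_def using \<rho>(1) tu
      by (intro nn_integral_FTC_Icc[of _ 0 \<rho> "\<lambda>r. exp (- t\<^sup>2 / 2) * exp (- u\<^sup>2 / 2) * sinh (r * t * u) / (t * u)"])
         (auto intro!: derivative_eq_intros)
    then show ?thesis unfolding sinh_kernel_def by simp
  qed
  have "(\<integral>\<^sup>+z. ennreal (sinh_kernel \<rho> z) * indicator ({0<..} \<times> {0<..}) z \<partial>(lborel \<Otimes>\<^sub>M lborel)) =
     (\<integral>\<^sup>+t. \<integral>\<^sup>+u. ennreal (sinh_kernel \<rho> (t, u)) * indicator ({0<..} \<times> {0<..}) (t, u) \<partial>lborel \<partial>lborel)"
    unfolding sinh_kernel_def by (subst lborel.nn_integral_fst[symmetric]) (auto simp: case_prod_beta)
  also have "\<dots> = (\<integral>\<^sup>+t. \<integral>\<^sup>+u. \<integral>\<^sup>+r. g r t u * indicator {0..\<rho>} r * indicator {0<..} t * indicator {0<..} u \<partial>lborel \<partial>lborel \<partial>lborel)"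
    by (intro nn_integral_cong) (auto simp: k indicator_def)
  also have "\<dots> = (\<integral>\<^sup>+t. \<integral>\<^sup>+r. \<integral>\<^sup>+u. g r t u * indicator {0..\<rho>} r * indicator {0<..} t * indicator {0<..} u \<partial>lborel \<partial>lborel \<partial>lborel)"
    by (intro nn_integral_cong lborel_pair.Fubini') measurable
  also have "\<dots> = (\<integral>\<^sup>+r. \<integral>\<^sup>+t. \<integral>\<^sup>+u. g r t u * indicator {0..\<rho>} r * indicator {0<..} t * indicator {0<..} u \<partial>lborel \<partial>lborel \<partial>lborel)"
    by (intro lborel_pair.Fubini') measurable
  also have "\<dots> = (\<integral>\<^sup>+r. ennreal (pi / 2 * inverse (sqrt (1 - r\<^sup>2))) * indicator {0..\<rho>} r \<partial>lborel)"
  proof (rule nn_integral_cong)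
    fix r :: real
    show "(\<integral>\<^sup>+t. \<integral>\<^sup>+u. g r t u * indicator {0..\<rho>} r * indicator {0<..} t * indicator {0<..} u \<partial>lborel \<partial>lborel)
      = ennreal (pi / 2 * inverse (sqrt (1 - r\<^sup>2))) * indicator {0..\<rho>} r"
    proof (cases "r \<in> {0..\<rho>}")
      case True
      then have "(\<integral>\<^sup>+t. \<integral>\<^sup>+u. g r t u * indicator {0..\<rho>} r * indicator {0<..} t * indicator {0<..} u \<partial>lborel \<partial>lborel) =
        (\<integral>\<^sup>+t. (\<integral>\<^sup>+u. g r t u * indicator {0<..} u \<partial>lborel) * indicator {0<..} t \<partial>lborel)"
        by (intro nn_integral_cong) (auto simp: indicator_def)
      then show ?thesis unfolding g_def using nn_integral_quadrant_cosh[of r] True \<rho> by simp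
    qed auto
  qed
  also have "\<dots> = ennreal (pi / 2 * arcsin \<rho> - pi / 2 * arcsin 0)"
  proof (rule nn_integral_FTC_Icc)
    fix r assume "r \<in> {0..\<rho>}"
    then have r: "-1 < r" "r < 1" using \<rho> by auto
    show "((\<lambda>r. pi / 2 * arcsin r) has_real_derivative pi / 2 * inverse (sqrt (1 - r\<^sup>2))) (at r)"
      by (intro DERIV_cmult DERIV_arcsin r)
    have "r\<^sup>2 \<le> 1" using r by (simp add: abs_square_le_1)
    then show "0 \<le> pi / 2 * inverse (sqrt (1 - r\<^sup>2))" by simp
  qed (use \<rho> in auto)
  finally show ?thesis by simp
qed

section \<open>Truncated Dirichlet integrals and the correlation of signs\<close>

text \<open>It tends to \<open>\<pi>/2 * sgn x\<close> as \<open>T\<close> grows.\<close>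

definition dirichlet_sgn :: "real \<Rightarrow> real \<Rightarrow> real" where
  "dirichlet_sgn T x = (LINT t|lborel. indicator {0<..<T} t * (sin (t * x) / t))"

lemma dirichlet_sgn_eq: "T \<ge> 0 \<Longrightarrow> dirichlet_sgn T x = sgn x * Si (T * \<bar>x\<bar>)"
  using LBINT_I0c_sin_scale_divide[of T x] 
  by (simp add: dirichlet_sgn_def interval_lebesgue_integral_def set_lebesgue_integral_def zero_ereal_def)

text \<open>Open at the axes, where the kernels would divide by \<open>0\<close>.\<close>

definition sqr :: "real \<Rightarrow> (real \<times> real) set" where "sqr T = {0<..<T} \<times> {0<..<T}"

lemma sqr_finite: "emeasure (lborel \<Otimes>\<^sub>M lborel) (sqr T) < \<infinity>"
  by (cases "T \<ge> 0") (auto simp: sqr_def lborel.emeasure_pair_measure_Times ennreal_mult_less_top)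

lemma sqr_sets [measurable]: "sqr T \<in> sets (lborel \<Otimes>\<^sub>M lborel)" "sqr T \<in> sets (borel \<Otimes>\<^sub>M borel)"
  unfolding sqr_def by auto

lemma abs_sin_div_le: "t > 0 \<Longrightarrow> \<bar>sin (t * x) / t\<bar> \<le> \<bar>x :: real\<bar>"
  using abs_sin_x_le_abs_x[of "t * x"] by (simp add: abs_mult divide_le_eq mult.commute)

lemma integrable_sqr_const: "integrable (lborel \<Otimes>\<^sub>M lborel) (\<lambda>z. indicator (sqr T) z * (K::real))"
  using sqr_finite[of T] by (auto intro!: integrable_mult_left simp: integrable_indicator_iff)

text \<open>Everything follows from \<open>\<bar>sin (t * x) / t\<bar> \<le> \<bar>x\<bar>\<close>
  on a square of finite measure. The third claim is the bound by which Fubini is justified when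
  \<open>x\<close> and \<open>y\<close> become random.\<close>

lemma dirichlet_sgn_product:
  shows "integrable (lborel \<Otimes>\<^sub>M lborel) (\<lambda>z. indicator (sqr T) z * (sin (fst z * x) / fst z * (sin (snd z * y) / snd z)))"
    "dirichlet_sgn T x * dirichlet_sgn T y =
     (LINT z|(lborel \<Otimes>\<^sub>M lborel). indicator (sqr T) z * (sin (fst z * x) / fst z * (sin (snd z * y) / snd z)))"
    "(LINT z|(lborel \<Otimes>\<^sub>M lborel). norm (indicator (sqr T) z * (sin (fst z * x) / fst z * (sin (snd z * y) / snd z)))) \<le> measure (lborel \<Otimes>\<^sub>M lborel) (sqr T) * (\<bar>x\<bar> * \<bar>y\<bar>)"
proof -
  let ?f = "\<lambda>z. indicator (sqr T) z * (sin (fst z * x) / fst z * (sin (snd z * y) / snd z)) :: real"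
  have bound: "norm (?f z) \<le> indicator (sqr T) z * (\<bar>x\<bar> * \<bar>y\<bar>)" for z
    using abs_sin_div_le[of "fst z" x] abs_sin_div_le[of "snd z" y]
  proof (cases "z \<in> sqr T")
    case True
    then have "\<bar>sin (fst z * x) / fst z\<bar> \<le> \<bar>x\<bar>" "\<bar>sin (snd z * y) / snd z\<bar> \<le> \<bar>y\<bar>"
      by (auto simp only: sqr_def mem_Times_iff greaterThanLessThan_iff intro!: abs_sin_div_le)
    then have "\<bar>sin (fst z * x) / fst z\<bar> * \<bar>sin (snd z * y) / snd z\<bar> \<le> \<bar>x\<bar> * \<bar>y\<bar>"
      by (rule mult_mono) auto
    then show ?thesis using True by (simp only: indicator_simps mult_1 real_norm_def abs_mult)
  qed simp
  show int: "integrable (lborel \<Otimes>\<^sub>M lborel) ?f"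
    by (rule Bochner_Integration.integrable_bound[OF integrable_sqr_const[of T "\<bar>x\<bar> * \<bar>y\<bar>"]])
       (use bound in \<open>auto simp: abs_mult\<close>)
  have "(LINT z|(lborel \<Otimes>\<^sub>M lborel). ?f z) = (LINT t|lborel. LINT u|lborel. ?f (t, u))"
    by (rule lborel_pair.integral_fst'[OF int, symmetric])
  also have "\<dots> = (LINT t|lborel. LINT u|lborel. (indicator {0<..<T} t * (sin (t * x) / t)) * (indicator {0<..<T} u * (sin (u * y) / u)))"
    by (intro Bochner_Integration.integral_cong) (auto simp: sqr_def indicator_def)
  also have "\<dots> = dirichlet_sgn T x * dirichlet_sgn T y"
    unfolding dirichlet_sgn_def by (simp only: integral_mult_right_zero integral_mult_left_zero)
  finally show "dirichlet_sgn T x * dirichlet_sgn T y = (LINT z|(lborel \<Otimes>\<^sub>M lborel). ?f z)" by simp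
  have "(LINT z|(lborel \<Otimes>\<^sub>M lborel). norm (?f z)) \<le> (LINT z|(lborel \<Otimes>\<^sub>M lborel). indicator (sqr T) z * (\<bar>x\<bar> * \<bar>y\<bar>))"
    by (intro integral_mono integrable_norm int integrable_sqr_const bound)
  also have "\<dots> = measure (lborel \<Otimes>\<^sub>M lborel) (sqr T) * (\<bar>x\<bar> * \<bar>y\<bar>)" by simp
  finally show "(LINT z|(lborel \<Otimes>\<^sub>M lborel). norm (?f z)) \<le> measure (lborel \<Otimes>\<^sub>M lborel) (sqr T) * (\<bar>x\<bar> * \<bar>y\<bar>)" .
qed

context prob_space
begin

lemma sin_sin_char:
  assumes [measurable]: "X \<in> borel_measurable M" "Y \<in> borel_measurable M"
  shows "expectation (\<lambda>\<omega>. sin (t * X \<omega>) * sin (u * Y \<omega>)) =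
     (Re (CLINT \<omega>|M. iexp (t * X \<omega> + (- u) * Y \<omega>)) - Re (CLINT \<omega>|M. iexp (t * X \<omega> + u * Y \<omega>))) / 2"
proof -
  have int: "complex_integrable M (\<lambda>\<omega>. iexp (t * X \<omega> + v * Y \<omega>))" for v by (intro integrable_iexp) measurable
  have Re: "Re (CLINT \<omega>|M. iexp (t * X \<omega> + v * Y \<omega>)) = expectation (\<lambda>\<omega>. cos (t * X \<omega> + v * Y \<omega>))" for v
    by (subst integral_Re[OF int[of v], symmetric]) (simp add: Re_exp)
  have intc: "integrable M (\<lambda>\<omega>. cos (t * X \<omega> + v * Y \<omega>))" for v
    by (rule integrable_const_bound[of _ 1]) auto
  have "expectation (\<lambda>\<omega>. sin (t * X \<omega>) * sin (u * Y \<omega>)) =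
      expectation (\<lambda>\<omega>. (cos (t * X \<omega> + (- u) * Y \<omega>) - cos (t * X \<omega> + u * Y \<omega>)) / 2)"
    by (simp add: cos_add cos_diff)
  also have "\<dots> = (expectation (\<lambda>\<omega>. cos (t * X \<omega> + (- u) * Y \<omega>)) - expectation (\<lambda>\<omega>. cos (t * X \<omega> + u * Y \<omega>))) / 2"
    by (simp only: Bochner_Integration.integral_diff[OF intc intc] integral_divide_zero)
  finally show ?thesis unfolding Re .
qed

text \<open>The second moments make \<open>\<bar>X \<omega>\<bar> * \<bar>Y \<omega>\<bar>\<close>
  integrable, and a multiple of it dominates the double integral over the square.\<close>

lemma dirichlet_expectation:
  assumes [measurable]: "X \<in> borel_measurable M" "Y \<in> borel_measurable M"
    and int: "integrable M (\<lambda>\<omega>. (X \<omega>)\<^sup>2)" "integrable M (\<lambda>\<omega>. (Y \<omega>)\<^sup>2)"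
  shows "expectation (\<lambda>\<omega>. dirichlet_sgn T (X \<omega>) * dirichlet_sgn T (Y \<omega>)) =
     (LINT z|(lborel \<Otimes>\<^sub>M lborel). indicator (sqr T) z * (expectation (\<lambda>\<omega>. sin (fst z * X \<omega>) * sin (snd z * Y \<omega>)) / (fst z * snd z)))"
proof -
  let ?N = "lborel \<Otimes>\<^sub>M lborel :: (real \<times> real) measure"
  have P: "pair_sigma_finite M ?N"
    by (rule pair_sigma_finite.intro[OF sigma_finite_measure_axioms lborel_pair.sigma_finite_measure_axioms])
  let ?f = "\<lambda>\<omega> z. indicator (sqr T) z * (sin (fst z * X \<omega>) / fst z * (sin (snd z * Y \<omega>) / snd z))"
  have intXY: "integrable M (\<lambda>\<omega>. \<bar>X \<omega>\<bar> * \<bar>Y \<omega>\<bar>)"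
  proof (rule Bochner_Integration.integrable_bound[of M "\<lambda>\<omega>. (X \<omega>)\<^sup>2 + (Y \<omega>)\<^sup>2"])
    show "AE \<omega> in M. norm (\<bar>X \<omega>\<bar> * \<bar>Y \<omega>\<bar>) \<le> norm ((X \<omega>)\<^sup>2 + (Y \<omega>)\<^sup>2)"
    proof (rule AE_I2)
      fix \<omega>
      have "0 \<le> (\<bar>X \<omega>\<bar> - \<bar>Y \<omega>\<bar>)\<^sup>2" by simp
      then have "2 * (\<bar>X \<omega>\<bar> * \<bar>Y \<omega>\<bar>) \<le> (X \<omega>)\<^sup>2 + (Y \<omega>)\<^sup>2" by (simp add: power2_diff)
      moreover have "0 \<le> \<bar>X \<omega>\<bar> * \<bar>Y \<omega>\<bar>" by (rule mult_nonneg_nonneg) auto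
      ultimately have "\<bar>X \<omega>\<bar> * \<bar>Y \<omega>\<bar> \<le> (X \<omega>)\<^sup>2 + (Y \<omega>)\<^sup>2" by linarith
      then show "norm (\<bar>X \<omega>\<bar> * \<bar>Y \<omega>\<bar>) \<le> norm ((X \<omega>)\<^sup>2 + (Y \<omega>)\<^sup>2)" by simp
    qed
  qed (use int in auto)
  have intf: "integrable (M \<Otimes>\<^sub>M ?N) (\<lambda>(\<omega>, z). ?f \<omega> z)"
  proof (rule pair_sigma_finite.Fubini_integrable[OF P])
    show "(\<lambda>(\<omega>, z). ?f \<omega> z) \<in> borel_measurable (M \<Otimes>\<^sub>M ?N)" unfolding case_prod_beta by measurable
    show "AE \<omega> in M. integrable ?N (\<lambda>z. case (\<omega>, z) of (\<omega>, z) \<Rightarrow> ?f \<omega> z)"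
      using dirichlet_sgn_product(1) by simp
    show "integrable M (\<lambda>\<omega>. LINT z|?N. norm (case (\<omega>, z) of (\<omega>, z) \<Rightarrow> ?f \<omega> z))"
    proof (rule Bochner_Integration.integrable_bound[OF integrable_mult_right[OF intXY, of "measure ?N (sqr T)"]])
      show "(\<lambda>\<omega>. LINT z|?N. norm (case (\<omega>, z) of (\<omega>, z) \<Rightarrow> ?f \<omega> z)) \<in> borel_measurable M"
        by (intro sigma_finite_measure.borel_measurable_lebesgue_integral[OF lborel_pair.sigma_finite_measure_axioms]) (unfold case_prod_beta, measurable)
      show "AE \<omega> in M. norm (LINT z|?N. norm (case (\<omega>, z) of (\<omega>, z) \<Rightarrow> ?f \<omega> z)) \<le> norm (measure ?N (sqr T) * (\<bar>X \<omega>\<bar> * \<bar>Y \<omega>\<bar>))"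
        using dirichlet_sgn_product(3) by (auto simp: abs_mult)
    qed
  qed
  have "expectation (\<lambda>\<omega>. dirichlet_sgn T (X \<omega>) * dirichlet_sgn T (Y \<omega>)) = expectation (\<lambda>\<omega>. LINT z|?N. ?f \<omega> z)"
    by (simp only: dirichlet_sgn_product(2))
  also have "\<dots> = (LINT z|?N. expectation (\<lambda>\<omega>. ?f \<omega> z))"
    by (rule pair_sigma_finite.Fubini_integral[OF P intf, symmetric])
  also have "\<dots> = (LINT z|?N. indicator (sqr T) z * (expectation (\<lambda>\<omega>. sin (fst z * X \<omega>) * sin (snd z * Y \<omega>)) / (fst z * snd z)))"
    by (intro Bochner_Integration.integral_cong refl) simp
  finally show ?thesis .
qed

text \<open>At fixed \<open>T\<close> only pointwise convergence of the characteristic functions is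
  needed: the second moment bounds keep the integrand below \<open>1\<close> on the square, and
  dominated convergence applies.\<close>

lemma dirichlet_expectation_limit:
  fixes X Y :: "nat \<Rightarrow> 'a \<Rightarrow> real"
  assumes [measurable]: "\<And>n. X n \<in> borel_measurable M" "\<And>n. Y n \<in> borel_measurable M"
    and int: "\<And>n. integrable M (\<lambda>\<omega>. (X n \<omega>)\<^sup>2)" "\<And>n. integrable M (\<lambda>\<omega>. (Y n \<omega>)\<^sup>2)"
    and le1: "\<And>n. expectation (\<lambda>\<omega>. (X n \<omega>)\<^sup>2) \<le> 1" "\<And>n. expectation (\<lambda>\<omega>. (Y n \<omega>)\<^sup>2) \<le> 1"
    and char: "\<And>t u. (\<lambda>n. CLINT \<omega>|M. iexp (t * X n \<omega> + u * Y n \<omega>)) \<longlonglongrightarrow> complex_of_real (exp (- (t\<^sup>2 + 2 * \<rho> * t * u + u\<^sup>2) / 2))"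
  shows "(\<lambda>n. expectation (\<lambda>\<omega>. dirichlet_sgn T (X n \<omega>) * dirichlet_sgn T (Y n \<omega>))) \<longlonglongrightarrow>
     (LINT z|(lborel \<Otimes>\<^sub>M lborel). indicator (sqr T) z * sinh_kernel \<rho> z)"
  unfolding dirichlet_expectation[OF assms(1,2) int]
proof (rule integral_dominated_convergence[where w = "\<lambda>z. indicator (sqr T) z * 1"])
  let ?E = "\<lambda>n t u. expectation (\<lambda>\<omega>. sin (t * X n \<omega>) * sin (u * Y n \<omega>))"
  have lim: "(\<lambda>n. ?E n t u) \<longlonglongrightarrow> exp (- t\<^sup>2 / 2) * exp (- u\<^sup>2 / 2) * sinh (\<rho> * t * u)" for t u
  proof -
    have "(\<lambda>n. ?E n t u) \<longlonglongrightarrow> (Re (complex_of_real (exp (- (t\<^sup>2 + 2 * \<rho> * t * (- u) + (- u)\<^sup>2) / 2))) - 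
        Re (complex_of_real (exp (- (t\<^sup>2 + 2 * \<rho> * t * u + u\<^sup>2) / 2)))) / 2"
      unfolding sin_sin_char[OF assms(1,2)] by (intro tendsto_intros char) simp
    also have "(Re (complex_of_real (exp (- (t\<^sup>2 + 2 * \<rho> * t * (- u) + (- u)\<^sup>2) / 2))) - 
        Re (complex_of_real (exp (- (t\<^sup>2 + 2 * \<rho> * t * u + u\<^sup>2) / 2)))) / 2 = exp (- t\<^sup>2 / 2) * exp (- u\<^sup>2 / 2) * sinh (\<rho> * t * u)"
    proof -
      have "exp (- (t\<^sup>2 + 2 * \<rho> * t * (- u) + (- u)\<^sup>2) / 2) = exp (- t\<^sup>2 / 2) * exp (- u\<^sup>2 / 2) * exp (\<rho> * t * u)"
        unfolding exp_add[symmetric] by (simp add: field_simps)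
      moreover have "exp (- (t\<^sup>2 + 2 * \<rho> * t * u + u\<^sup>2) / 2) = exp (- t\<^sup>2 / 2) * exp (- u\<^sup>2 / 2) * exp (- (\<rho> * t * u))"
        unfolding exp_add[symmetric] by (simp add: field_simps)
      ultimately show ?thesis unfolding Re_complex_of_real by (simp add: sinh_field_def field_simps)
    qed
    finally show ?thesis .
  qed
  show "AE z in lborel \<Otimes>\<^sub>M lborel. (\<lambda>n. indicator (sqr T) z * (?E n (fst z) (snd z) / (fst z * snd z))) \<longlonglongrightarrow> indicator (sqr T) z * sinh_kernel \<rho> z"
  proof (rule AE_I2)
    fix z :: "real \<times> real"
    show "(\<lambda>n. indicator (sqr T) z * (?E n (fst z) (snd z) / (fst z * snd z))) \<longlonglongrightarrow> indicator (sqr T) z * sinh_kernel \<rho> z"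
    proof (cases "z \<in> sqr T")
      case True
      then have "fst z * snd z \<noteq> 0" unfolding sqr_def by auto
      then have "(\<lambda>n. ?E n (fst z) (snd z) / (fst z * snd z)) \<longlonglongrightarrow> exp (- (fst z)\<^sup>2 / 2) * exp (- (snd z)\<^sup>2 / 2) * sinh (\<rho> * fst z * snd z) / (fst z * snd z)"
        by (intro tendsto_divide lim tendsto_const)
      then show ?thesis using True by (simp add: sinh_kernel_def case_prod_beta)
    qed simp
  qed
  show "AE z in lborel \<Otimes>\<^sub>M lborel. norm (indicator (sqr T) z * (?E n (fst z) (snd z) / (fst z * snd z))) \<le> indicator (sqr T) z * 1" for n
  proof (rule AE_I2)
    fix z :: "real \<times> real"
    show "norm (indicator (sqr T) z * (?E n (fst z) (snd z) / (fst z * snd z))) \<le> indicator (sqr T) z * 1"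
    proof (cases "z \<in> sqr T")
      case True
      then have z: "fst z > 0" "snd z > 0" unfolding sqr_def by auto
      have "norm (?E n (fst z) (snd z)) \<le> expectation (\<lambda>\<omega>. norm (sin (fst z * X n \<omega>) * sin (snd z * Y n \<omega>)))"
        by (rule integral_norm_bound)
      also have "\<dots> \<le> expectation (\<lambda>\<omega>. fst z * snd z * (((X n \<omega>)\<^sup>2 + (Y n \<omega>)\<^sup>2) / 2))"
      proof (rule integral_mono)
        show "integrable M (\<lambda>\<omega>. norm (sin (fst z * X n \<omega>) * sin (snd z * Y n \<omega>)))"
          by (rule integrable_const_bound[of _ 1]) (auto simp: abs_mult intro!: mult_le_one)
        show "integrable M (\<lambda>\<omega>. fst z * snd z * (((X n \<omega>)\<^sup>2 + (Y n \<omega>)\<^sup>2) / 2))"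
          using int by auto
        fix \<omega>
        have "norm (sin (fst z * X n \<omega>) * sin (snd z * Y n \<omega>)) \<le> \<bar>fst z * X n \<omega>\<bar> * \<bar>snd z * Y n \<omega>\<bar>"
          unfolding real_norm_def abs_mult[of "sin _"] by (intro mult_mono abs_sin_x_le_abs_x) auto
        also have "\<dots> = fst z * snd z * (\<bar>X n \<omega>\<bar> * \<bar>Y n \<omega>\<bar>)" using z by (simp add: abs_mult)
        also have "\<dots> \<le> fst z * snd z * (((X n \<omega>)\<^sup>2 + (Y n \<omega>)\<^sup>2) / 2)"
        proof (rule mult_left_mono)
          have "0 \<le> (\<bar>X n \<omega>\<bar> - \<bar>Y n \<omega>\<bar>)\<^sup>2" by simp
          then show "\<bar>X n \<omega>\<bar> * \<bar>Y n \<omega>\<bar> \<le> ((X n \<omega>)\<^sup>2 + (Y n \<omega>)\<^sup>2) / 2" by (simp add: power2_diff)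
        qed (use z in auto)
        finally show "norm (sin (fst z * X n \<omega>) * sin (snd z * Y n \<omega>)) \<le> fst z * snd z * (((X n \<omega>)\<^sup>2 + (Y n \<omega>)\<^sup>2) / 2)" .
      qed
      also have "\<dots> = fst z * snd z * ((expectation (\<lambda>\<omega>. (X n \<omega>)\<^sup>2) + expectation (\<lambda>\<omega>. (Y n \<omega>)\<^sup>2)) / 2)"
        using int by simp
      also have "\<dots> \<le> fst z * snd z * 1" using le1[of n] z by (intro mult_left_mono) auto
      finally show ?thesis using True z by (simp add: abs_mult)
    qed simp
  qed
  show "integrable (lborel \<Otimes>\<^sub>M lborel) (\<lambda>z. indicator (sqr T) z * (1::real))" by (rule integrable_sqr_const)
  show "(\<lambda>z. indicator (sqr T) z * sinh_kernel \<rho> z) \<in> borel_measurable (lborel \<Otimes>\<^sub>M lborel)"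
    unfolding sinh_kernel_def case_prod_beta by measurable
  show "(\<lambda>z. indicator (sqr T) z * (?E n (fst z) (snd z) / (fst z * snd z))) \<in> borel_measurable (lborel \<Otimes>\<^sub>M lborel)" for n
  proof -
    have "(\<lambda>z. ?E n (fst z) (snd z)) \<in> borel_measurable (lborel \<Otimes>\<^sub>M lborel)"
      by (rule borel_measurable_lebesgue_integral) (unfold case_prod_beta, measurable)
    then show ?thesis by measurable
  qed
qed

end

text \<open>For nonnegative \<open>\<rho>\<close> the kernel is nonnegative on the quadrant and
  dominates all its truncations.\<close>

lemma sinh_kernel_limit:
  assumes \<rho>: "0 \<le> \<rho>" "\<rho> < 1"
  shows "(\<lambda>N. LINT z|(lborel \<Otimes>\<^sub>M lborel). indicator (sqr (real N)) z * sinh_kernel \<rho> z) \<longlonglongrightarrow> pi / 2 * arcsin \<rho>"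
proof -
  let ?Q = "{0<..} \<times> {0<..} :: (real \<times> real) set"
  have m [measurable]: "sinh_kernel \<rho> \<in> borel_measurable (lborel \<Otimes>\<^sub>M lborel)"
    unfolding sinh_kernel_def by measurable
  have Q [measurable]: "?Q \<in> sets (lborel \<Otimes>\<^sub>M lborel)" by auto
  have nn: "indicator ?Q z * sinh_kernel \<rho> z \<ge> 0" for z
    using \<rho> by (auto simp: sinh_kernel_def indicator_def)
  have nni: "(\<integral>\<^sup>+z. ennreal (indicator ?Q z * sinh_kernel \<rho> z) \<partial>(lborel \<Otimes>\<^sub>M lborel)) = ennreal (pi / 2 * arcsin \<rho>)"
    unfolding sinh_kernel_integral[OF \<rho>, symmetric] by (intro nn_integral_cong) (auto simp: indicator_def)
  have as: "arcsin \<rho> \<ge> 0" using arcsin_le_arcsin[of 0 \<rho>] \<rho> by simp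
  have hbi: "has_bochner_integral (lborel \<Otimes>\<^sub>M lborel) (\<lambda>z. indicator ?Q z * sinh_kernel \<rho> z) (pi / 2 * arcsin \<rho>)"
    by (rule has_bochner_integral_nn_integral[OF _ _ _ nni]) (use nn as in auto)
  have "(\<lambda>N. LINT z|(lborel \<Otimes>\<^sub>M lborel). indicator (sqr (real N)) z * sinh_kernel \<rho> z) \<longlonglongrightarrow> (LINT z|(lborel \<Otimes>\<^sub>M lborel). indicator ?Q z * sinh_kernel \<rho> z)"
  proof (rule integral_dominated_convergence[where w = "\<lambda>z. indicator ?Q z * sinh_kernel \<rho> z"])
    show "integrable (lborel \<Otimes>\<^sub>M lborel) (\<lambda>z. indicator ?Q z * sinh_kernel \<rho> z)"
      using hbi by (simp add: has_bochner_integral_iff)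
    show "AE z in lborel \<Otimes>\<^sub>M lborel. (\<lambda>N. indicator (sqr (real N)) z * sinh_kernel \<rho> z) \<longlonglongrightarrow> indicator ?Q z * sinh_kernel \<rho> z"
    proof (rule AE_I2)
      fix z :: "real \<times> real"
      obtain N where N: "max (fst z) (snd z) < real N" using reals_Archimedean2 by blast
      have "\<forall>\<^sub>F n in sequentially. indicator ?Q z * sinh_kernel \<rho> z = indicator (sqr (real n)) z * sinh_kernel \<rho> z"
        using eventually_ge_at_top[of N]
      proof eventually_elim
        case (elim n)
        then have "real N \<le> real n" by simp
        then have "fst z < real n" "snd z < real n" using N by auto
        then have "z \<in> sqr (real n) \<longleftrightarrow> z \<in> ?Q" unfolding sqr_def by (auto simp: mem_Times_iff)
        then show ?case by (simp add: indicator_def)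
      qed
      then show "(\<lambda>N. indicator (sqr (real N)) z * sinh_kernel \<rho> z) \<longlonglongrightarrow> indicator ?Q z * sinh_kernel \<rho> z"
        by (rule Lim_transform_eventually[OF tendsto_const])
    qed
    show "AE z in lborel \<Otimes>\<^sub>M lborel. norm (indicator (sqr (real N)) z * sinh_kernel \<rho> z) \<le> indicator ?Q z * sinh_kernel \<rho> z" for N
    proof (rule AE_I2)
      fix z
      show "norm (indicator (sqr (real N)) z * sinh_kernel \<rho> z) \<le> indicator ?Q z * sinh_kernel \<rho> z"
      proof (cases "z \<in> sqr (real N)")
        case True
        then have "z \<in> ?Q" unfolding sqr_def by auto
        then show ?thesis using True nn[of z] by simp
      qed (use nn[of z] in simp)
    qed
  qed measurable
  then show ?thesis unfolding has_bochner_integral_integral_eq[OF hbi] .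
qed

text \<open>A limit for characteristic functions says nothing directly about the discontinuous sign.
  The truncated Dirichlet integral replaces \<open>sgn\<close> with an error that matters only near
  \<open>0\<close>, and the small ball hypothesis makes this error uniform in \<open>n\<close>, so
  that \<open>T\<close> may be sent to infinity. The expected product of signs tends to
  \<open>2 / pi * arcsin \<rho>\<close>, and products equal to \<open>0\<close> are
  negligible.\<close>

lemma (in prob_space) sign_change_limit:
  fixes X Y :: "nat \<Rightarrow> 'a \<Rightarrow> real"
  assumes [measurable]: "\<And>n. X n \<in> borel_measurable M" "\<And>n. Y n \<in> borel_measurable M"
    and int: "\<And>n. integrable M (\<lambda>\<omega>. (X n \<omega>)\<^sup>2)" "\<And>n. integrable M (\<lambda>\<omega>. (Y n \<omega>)\<^sup>2)"
    and le1: "\<And>n. expectation (\<lambda>\<omega>. (X n \<omega>)\<^sup>2) \<le> 1" "\<And>n. expectation (\<lambda>\<omega>. (Y n \<omega>)\<^sup>2) \<le> 1"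
    and char: "\<And>t u. (\<lambda>n. CLINT \<omega>|M. iexp (t * X n \<omega> + u * Y n \<omega>)) \<longlonglongrightarrow> complex_of_real (exp (- (t\<^sup>2 + 2 * \<rho> * t * u + u\<^sup>2) / 2))"
    and \<rho>: "0 \<le> \<rho>" "\<rho> < 1"
    and small: "C > 0" "\<And>\<eta>. 0 < \<eta> \<Longrightarrow> \<eta> \<le> 1 \<Longrightarrow> \<forall>\<^sub>F n in sequentially. prob {\<omega>\<in>space M. \<bar>X n \<omega>\<bar> \<le> \<eta>} \<le> C * \<eta> \<and> prob {\<omega>\<in>space M. \<bar>Y n \<omega>\<bar> \<le> \<eta>} \<le> C * \<eta>"
  shows "(\<lambda>n. prob {\<omega>\<in>space M. X n \<omega> * Y n \<omega> < 0}) \<longlonglongrightarrow> arccos \<rho> / pi"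
proof -
  define D where "D T n = expectation (\<lambda>\<omega>. dirichlet_sgn T (X n \<omega>) * dirichlet_sgn T (Y n \<omega>))" for T n
  define G where "G n = expectation (\<lambda>\<omega>. sgn (X n \<omega>) * sgn (Y n \<omega>))" for n
  obtain B0 where B0: "\<And>T. \<bar>Si T\<bar> \<le> B0" using bounded_Si by blast
  define B where "B = max B0 2"
  have B: "\<bar>Si T\<bar> \<le> B" "B \<ge> 2" for T using B0[of T] unfolding B_def by auto
  have pi2: "pi / 2 \<le> B" using pi_half_less_two B(2) by linarith
  have D_meas: "(\<lambda>\<omega>. dirichlet_sgn T (X n \<omega>) * dirichlet_sgn T (Y n \<omega>)) \<in> borel_measurable M" if "T \<ge> 0" for T n
    using that by (simp add: dirichlet_sgn_eq)
  have dB: "\<bar>dirichlet_sgn T x\<bar> \<le> B" if "T \<ge> 0" for T x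
    using that B(1)[of "T * \<bar>x\<bar>"] B(2) by (auto simp: dirichlet_sgn_eq abs_mult sgn_if)
  have Gint: "integrable M (\<lambda>\<omega>. sgn (X n \<omega>) * sgn (Y n \<omega>))" for n
    by (rule integrable_const_bound[of _ 1]) (auto simp: sgn_if)
  have close: "\<forall>\<^sub>F n in sequentially. \<bar>D T n - (pi / 2)\<^sup>2 * G n\<bar> \<le> 2 * B * \<delta> + 2 * B\<^sup>2 * (2 * (C * (Z / T)))"
    if \<delta>: "\<delta> > 0" and Z: "Z > 0" "\<And>y. y \<ge> Z \<Longrightarrow> \<bar>Si y - pi / 2\<bar> \<le> \<delta>" and T: "T \<ge> Z" for \<delta> Z T
  proof -
    have T0: "T > 0" using Z T by linarith
    \<comment> \<open>If \<open>\<bar>X n \<omega>\<bar>\<close> exceeds \<open>\<eta>\<close>, then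
      \<open>T * \<bar>X n \<omega>\<bar>\<close> exceeds \<open>Z\<close>, where \<open>Si\<close>
      is within \<open>\<delta>\<close> of \<open>pi / 2\<close>.\<close>
    define \<eta> where "\<eta> = Z / T"
    have \<eta>: "\<eta> > 0" "\<eta> \<le> 1" using T Z T0 unfolding \<eta>_def by auto
    show ?thesis using small(2)[OF \<eta>]
    proof eventually_elim
      case (elim n)
      let ?A = "{\<omega>\<in>space M. \<bar>X n \<omega>\<bar> \<le> \<eta>}" and ?A' = "{\<omega>\<in>space M. \<bar>Y n \<omega>\<bar> \<le> \<eta>}"
      have pw: "\<bar>dirichlet_sgn T (X n \<omega>) * dirichlet_sgn T (Y n \<omega>) - (pi / 2)\<^sup>2 * (sgn (X n \<omega>) * sgn (Y n \<omega>))\<bar>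
         \<le> 2 * B * \<delta> + 2 * B\<^sup>2 * (indicator ?A \<omega> + indicator ?A' \<omega>)" if \<omega>: "\<omega> \<in> space M" for \<omega>
      proof (cases "\<omega> \<in> ?A \<union> ?A'")
        case True
        have "\<bar>dirichlet_sgn T (X n \<omega>) * dirichlet_sgn T (Y n \<omega>)\<bar> \<le> B * B"
          unfolding abs_mult using dB T0 B(2) by (intro mult_mono) auto
        moreover have "\<bar>(pi / 2)\<^sup>2 * (sgn (X n \<omega>) * sgn (Y n \<omega>))\<bar> \<le> B * B"
        proof -
          have "(pi / 2) * (pi / 2) \<le> B * B" using pi2 B(2) by (intro mult_mono) auto
          then show ?thesis using B(2) by (auto simp: sgn_if power2_eq_square abs_mult)
        qed
        ultimately have "\<bar>dirichlet_sgn T (X n \<omega>) * dirichlet_sgn T (Y n \<omega>) - (pi / 2)\<^sup>2 * (sgn (X n \<omega>) * sgn (Y n \<omega>))\<bar> \<le> 2 * B\<^sup>2 * 1"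
          unfolding power2_eq_square by linarith
        also have "\<dots> \<le> 2 * B\<^sup>2 * (indicator ?A \<omega> + indicator ?A' \<omega>)"
          using True by (intro mult_left_mono) (auto simp: indicator_def)
        finally have "\<bar>dirichlet_sgn T (X n \<omega>) * dirichlet_sgn T (Y n \<omega>) - (pi / 2)\<^sup>2 * (sgn (X n \<omega>) * sgn (Y n \<omega>))\<bar>
          \<le> 2 * B\<^sup>2 * (indicator ?A \<omega> + indicator ?A' \<omega>)" .
        moreover have "0 \<le> 2 * B * \<delta>" using \<delta> B(2) by simp
        ultimately show ?thesis by linarith
      next
        case False
        then have xy: "\<bar>X n \<omega>\<bar> > \<eta>" "\<bar>Y n \<omega>\<bar> > \<eta>" using \<omega> by auto
        have big: "T * \<bar>x\<bar> \<ge> Z" if "\<bar>x\<bar> > \<eta>" for x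
          using that T0 unfolding \<eta>_def by (simp add: divide_less_eq mult.commute)
        define p q where "p = Si (T * \<bar>X n \<omega>\<bar>)" and "q = Si (T * \<bar>Y n \<omega>\<bar>)"
        have pq: "\<bar>p - pi / 2\<bar> \<le> \<delta>" "\<bar>q - pi / 2\<bar> \<le> \<delta>" "\<bar>q\<bar> \<le> B"
          unfolding p_def q_def using Z(2) big xy B by auto
        have "\<bar>p * q - (pi / 2)\<^sup>2\<bar> = \<bar>(p - pi / 2) * q + (pi / 2) * (q - pi / 2)\<bar>"
          by (simp add: algebra_simps power2_eq_square)
        also have "\<dots> \<le> \<bar>p - pi / 2\<bar> * \<bar>q\<bar> + \<bar>pi / 2\<bar> * \<bar>q - pi / 2\<bar>"
          unfolding abs_mult[symmetric] by (rule abs_triangle_ineq)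
        also have "\<dots> \<le> \<delta> * B + B * \<delta>"
          using pq pi2 \<delta> by (intro add_mono mult_mono) auto
        finally have pqb: "\<bar>p * q - (pi / 2)\<^sup>2\<bar> \<le> 2 * B * \<delta>" by simp
        have "\<bar>dirichlet_sgn T (X n \<omega>) * dirichlet_sgn T (Y n \<omega>) - (pi / 2)\<^sup>2 * (sgn (X n \<omega>) * sgn (Y n \<omega>))\<bar> = \<bar>(sgn (X n \<omega>) * sgn (Y n \<omega>)) * (p * q - (pi / 2)\<^sup>2)\<bar>"
          unfolding p_def q_def using T0 by (simp add: dirichlet_sgn_eq algebra_simps)
        also have "\<dots> = \<bar>p * q - (pi / 2)\<^sup>2\<bar>" using xy \<eta> by (auto simp: abs_mult sgn_if)
        finally show ?thesis using pqb xy by simp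
      qed
      have Dint: "integrable M (\<lambda>\<omega>. dirichlet_sgn T (X n \<omega>) * dirichlet_sgn T (Y n \<omega>))"
        using D_meas T0 dB B(2) by (intro integrable_const_bound[of _ "B * B"]) (auto simp: abs_mult intro!: mult_mono)
      have "D T n - (pi / 2)\<^sup>2 * G n = expectation (\<lambda>\<omega>. dirichlet_sgn T (X n \<omega>) * dirichlet_sgn T (Y n \<omega>) - (pi / 2)\<^sup>2 * (sgn (X n \<omega>) * sgn (Y n \<omega>)))"
        unfolding D_def G_def using Dint Gint by simp
      then have "\<bar>D T n - (pi / 2)\<^sup>2 * G n\<bar> \<le> expectation (\<lambda>\<omega>. \<bar>dirichlet_sgn T (X n \<omega>) * dirichlet_sgn T (Y n \<omega>) - (pi / 2)\<^sup>2 * (sgn (X n \<omega>) * sgn (Y n \<omega>))\<bar>)"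
        by (simp only: integral_abs_bound)
      also have "\<dots> \<le> expectation (\<lambda>\<omega>. 2 * B * \<delta> + 2 * B\<^sup>2 * (indicator ?A \<omega> + indicator ?A' \<omega>))"
        by (intro integral_mono integrable_abs Bochner_Integration.integrable_diff Dint integrable_mult_right Gint pw
             Bochner_Integration.integrable_add integrable_const integrable_real_indicator) (auto simp: emeasure_eq_measure)
      also have "\<dots> = 2 * B * \<delta> + 2 * B\<^sup>2 * (prob ?A + prob ?A')"
        by (subst Bochner_Integration.integral_add) (auto simp: emeasure_eq_measure prob_space
             intro!: integrable_mult_right Bochner_Integration.integrable_add integrable_real_indicator)
      also have "\<dots> \<le> 2 * B * \<delta> + 2 * B\<^sup>2 * (C * \<eta> + C * \<eta>)"
        using elim by (intro add_left_mono mult_left_mono add_mono) auto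
      finally show ?case unfolding \<eta>_def by simp
    qed
  qed
  have Glim: "(\<lambda>n. (pi / 2)\<^sup>2 * G n) \<longlonglongrightarrow> pi / 2 * arcsin \<rho>"
    unfolding tendsto_iff dist_real_def
  proof (intro allI impI)
    fix e :: real assume e: "e > 0"
    \<comment> \<open>Four errors of size \<open>e / 4\<close> are collected: the accuracy of
      \<open>Si\<close>, the small ball part, the limit in \<open>n\<close> at fixed
      \<open>T\<close>, and the truncation of the kernel integral.\<close>
    define \<delta> where "\<delta> = e / (8 * B)"
    have \<delta>: "\<delta> > 0" "2 * B * \<delta> = e / 4" using e B(2) unfolding \<delta>_def by auto
    have "\<forall>\<^sub>F y in at_top. \<bar>Si y - pi / 2\<bar> < \<delta>"
      using Si_at_top \<delta>(1) unfolding tendsto_iff dist_real_def by blast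
    then obtain Z0 where Z0: "\<And>y. y \<ge> Z0 \<Longrightarrow> \<bar>Si y - pi / 2\<bar> < \<delta>" unfolding eventually_at_top_linorder by blast
    define Z where "Z = max Z0 1"
    have Z: "Z > 0" "\<And>y. y \<ge> Z \<Longrightarrow> \<bar>Si y - pi / 2\<bar> \<le> \<delta>" using Z0 unfolding Z_def by (auto intro: less_imp_le)
    have "(\<lambda>N. 2 * B\<^sup>2 * (2 * (C * (Z / real N)))) \<longlonglongrightarrow> 2 * B\<^sup>2 * (2 * (C * 0))"
      by (intro tendsto_intros lim_const_over_n)
    then have e1: "\<forall>\<^sub>F N in sequentially. 2 * B\<^sup>2 * (2 * (C * (Z / real N))) < e / 4"
      using e by (intro order_tendstoD(2)) auto
    have e2: "\<forall>\<^sub>F N in sequentially. \<bar>(LINT z|(lborel \<Otimes>\<^sub>M lborel). indicator (sqr (real N)) z * sinh_kernel \<rho> z) - pi / 2 * arcsin \<rho>\<bar> < e / 4"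
      using tendstoD[OF sinh_kernel_limit[OF \<rho>], of "e / 4"] e by (simp add: dist_real_def)
    have "\<forall>\<^sub>F N in sequentially. real N \<ge> Z"
      using filterlim_real_sequentially unfolding filterlim_at_top by blast
    with e1 e2 have "\<forall>\<^sub>F N in sequentially. 2 * B\<^sup>2 * (2 * (C * (Z / real N))) < e / 4 \<and> 
        \<bar>(LINT z|(lborel \<Otimes>\<^sub>M lborel). indicator (sqr (real N)) z * sinh_kernel \<rho> z) - pi / 2 * arcsin \<rho>\<bar> < e / 4 \<and> real N \<ge> Z"
      by eventually_elim simp
    then obtain N where N: "2 * B\<^sup>2 * (2 * (C * (Z / real N))) < e / 4"
        "\<bar>(LINT z|(lborel \<Otimes>\<^sub>M lborel). indicator (sqr (real N)) z * sinh_kernel \<rho> z) - pi / 2 * arcsin \<rho>\<bar> < e / 4" "real N \<ge> Z"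
      unfolding eventually_sequentially by blast
    define T where "T = real N"
    have "(\<lambda>n. D T n) \<longlonglongrightarrow> (LINT z|(lborel \<Otimes>\<^sub>M lborel). indicator (sqr T) z * sinh_kernel \<rho> z)"
      unfolding D_def by (rule dirichlet_expectation_limit[OF assms(1,2) int le1 char])
    then have "\<forall>\<^sub>F n in sequentially. \<bar>D T n - (LINT z|(lborel \<Otimes>\<^sub>M lborel). indicator (sqr T) z * sinh_kernel \<rho> z)\<bar> < e / 4"
      using e by (auto simp: dist_real_def dest!: tendstoD[of _ _ _ "e / 4"])
    moreover have "\<forall>\<^sub>F n in sequentially. \<bar>D T n - (pi / 2)\<^sup>2 * G n\<bar> \<le> 2 * B * \<delta> + 2 * B\<^sup>2 * (2 * (C * (Z / T)))"
      by (rule close) (use \<delta>(1) Z N(3) in \<open>auto simp: T_def\<close>)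
    ultimately show "\<forall>\<^sub>F n in sequentially. \<bar>(pi / 2)\<^sup>2 * G n - pi / 2 * arcsin \<rho>\<bar> < e"
    proof eventually_elim
      case (elim n)
      then show ?case using N(1,2) \<delta>(2) unfolding T_def by linarith
    qed
  qed
  have "(\<lambda>n. ((pi / 2)\<^sup>2 * G n) / (pi / 2)\<^sup>2) \<longlonglongrightarrow> (pi / 2 * arcsin \<rho>) / (pi / 2)\<^sup>2"
    by (intro tendsto_divide Glim tendsto_const) simp
  then have Glim': "G \<longlonglongrightarrow> 2 / pi * arcsin \<rho>" by (simp add: power2_eq_square field_simps)
  define P0 where "P0 n = prob {\<omega>\<in>space M. X n \<omega> * Y n \<omega> = 0}" for n
  have P0lim: "P0 \<longlonglongrightarrow> 0"
    unfolding tendsto_iff dist_real_def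
  proof (intro allI impI)
    fix e :: real assume e: "e > 0"
    define \<eta> where "\<eta> = min 1 (e / (4 * C))"
    have \<eta>: "\<eta> > 0" "\<eta> \<le> 1" "2 * C * \<eta> < e" using e small(1) unfolding \<eta>_def by (auto simp: min_def field_simps)
    show "\<forall>\<^sub>F n in sequentially. \<bar>P0 n - 0\<bar> < e"
      using small(2)[OF \<eta>(1,2)]
    proof eventually_elim
      case (elim n)
      have "P0 n \<le> prob ({\<omega>\<in>space M. \<bar>X n \<omega>\<bar> \<le> \<eta>} \<union> {\<omega>\<in>space M. \<bar>Y n \<omega>\<bar> \<le> \<eta>})"
        unfolding P0_def using \<eta>(1) by (intro finite_measure_mono) auto
      also have "\<dots> \<le> prob {\<omega>\<in>space M. \<bar>X n \<omega>\<bar> \<le> \<eta>} + prob {\<omega>\<in>space M. \<bar>Y n \<omega>\<bar> \<le> \<eta>}"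
        by (rule measure_Un_le) auto
      finally have "P0 n < e" using elim \<eta>(3) by linarith
      then show ?case unfolding P0_def by simp
    qed
  qed
  have eq: "prob {\<omega>\<in>space M. X n \<omega> * Y n \<omega> < 0} = (1 - G n - P0 n) / 2" for n
  proof -
    let ?N = "{\<omega>\<in>space M. X n \<omega> * Y n \<omega> < 0}" and ?Z = "{\<omega>\<in>space M. X n \<omega> * Y n \<omega> = 0}"
    \<comment> \<open>The product of signs is \<open>1\<close>, \<open>- 1\<close> or
      \<open>0\<close>, so it is \<open>1\<close> minus twice the indicator of \<open>?N\<close>
      minus the indicator of \<open>?Z\<close>.\<close>
    have "G n = expectation (\<lambda>\<omega>. 1 - 2 * indicator ?N \<omega> - indicator ?Z \<omega>)"
      unfolding G_def by (intro Bochner_Integration.integral_cong refl) (auto simp: sgn_if indicator_def mult_less_0_iff)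
    also have "\<dots> = 1 - 2 * prob ?N - prob ?Z"
      by (subst Bochner_Integration.integral_diff) (auto simp: emeasure_eq_measure prob_space
             intro!: integrable_mult_right Bochner_Integration.integrable_diff integrable_real_indicator)
    finally show ?thesis unfolding P0_def by simp
  qed
  have "(\<lambda>n. (1 - G n - P0 n) / 2) \<longlonglongrightarrow> (1 - 2 / pi * arcsin \<rho> - 0) / 2"
    by (intro tendsto_intros Glim' P0lim) simp
  also have "(1 - 2 / pi * arcsin \<rho> - 0) / 2 = arccos \<rho> / pi"
    using arccos_arcsin_eq[of \<rho>] \<rho> by (simp add: diff_divide_distrib)
  finally show ?thesis unfolding eq .
qed

section \<open>The random power series\<close>

locale random_series = iid_standard M \<xi> + regvar_coeffs c \<gamma>
  for M :: "'a measure" and \<xi> :: "nat \<Rightarrow> 'a \<Rightarrow> real" and c :: "nat \<Rightarrow> real" and \<gamma> :: real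
begin

definition weight :: "real \<Rightarrow> nat \<Rightarrow> real" where "weight s k = c k * exp (- (s * real k))"

definition X :: "real \<Rightarrow> 'a \<Rightarrow> real" where "X s = S (weight s)"

definition sd :: "real \<Rightarrow> real" where "sd s = sqrt (V (2 * s))"

text \<open>The series in the logarithmic coordinate, holomorphic on the right half plane and equal
  to \<open>X s \<omega>\<close> at real \<open>s\<close>. A change of scale in \<open>s\<close> is
  an approximate symmetry there, so circles about \<open>s\<close> have radius proportional to
  \<open>s\<close>.\<close>

definition F :: "'a \<Rightarrow> complex \<Rightarrow> complex" where "F \<omega> z = random_taylor \<xi> c \<omega> (exp (- z))"

text \<open>One almost sure event, free of \<open>s\<close>, on which all statements about zeros and
  derivatives hold for every argument at once.\<close>

definition good :: "'a \<Rightarrow> bool" where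
  "good \<omega> \<longleftrightarrow> (\<forall>u>0. summable (\<lambda>k. \<bar>\<xi> k \<omega> * c k\<bar> * exp (- (u * real k))))"

lemma measurable_X [measurable]: "X s \<in> borel_measurable M" unfolding X_def by measurable

lemma sd_pos: "s > 0 \<Longrightarrow> sd s > 0" unfolding sd_def using V_pos by simp

lemma sd_square: "s > 0 \<Longrightarrow> (sd s)\<^sup>2 = V (2 * s)"
  unfolding sd_def using V_pos[of "2 * s"] by simp

lemma summable_weight: "s > 0 \<Longrightarrow> summable (\<lambda>k. \<bar>weight s k\<bar>)"
  using summable_abs_coeffs_exp[of s] by (simp add: weight_def abs_mult)

lemma weight_mult: "weight s k * weight t k = (c k)\<^sup>2 * exp (- ((s + t) * real k))"
  by (simp add: weight_def power2_eq_square exp_add[symmetric] algebra_simps)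

lemma weight_mult_sums: "s > 0 \<Longrightarrow> t > 0 \<Longrightarrow> (\<lambda>k. weight s k * weight t k) sums V (s + t)"
  unfolding weight_mult V_def by (intro summable_sums summable_V) auto

lemma weight_square_sums: "s > 0 \<Longrightarrow> (\<lambda>k. (weight s k)\<^sup>2) sums V (2 * s)"
  using weight_mult_sums[of s s] by (simp add: power2_eq_square)

text \<open>Countably many radii suffice, by comparison with some \<open>1 / real (Suc n)\<close>
  below \<open>u\<close>.\<close>

lemma AE_good: "AE \<omega> in M. good \<omega>"
proof -
  have "AE \<omega> in M. \<forall>n. summable (\<lambda>k. \<bar>weight (1 / real (Suc n)) k * \<xi> k \<omega>\<bar>)"
    unfolding AE_all_countable by (intro allI AE_summable summable_weight) auto
  then show ?thesis
  proof eventually_elim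
    case (elim \<omega>)
    show ?case unfolding good_def
    proof (intro allI impI)
      fix u :: real assume "u > 0"
      then obtain n where n: "1 / real (Suc n) < u" using nat_approx_posE by (metis of_nat_Suc)
      show "summable (\<lambda>k. \<bar>\<xi> k \<omega> * c k\<bar> * exp (- (u * real k)))"
      proof (rule summable_comparison_test')
        show "summable (\<lambda>k. \<bar>weight (1 / real (Suc n)) k * \<xi> k \<omega>\<bar>)" using elim by blast
        show "norm (\<bar>\<xi> k \<omega> * c k\<bar> * exp (- (u * real k))) \<le> \<bar>weight (1 / real (Suc n)) k * \<xi> k \<omega>\<bar>" for k
        proof -
          have "exp (- (u * real k)) \<le> exp (- (1 / real (Suc n) * real k))"
            using n by (intro exp_le_cancel_iff[THEN iffD2] le_imp_neg_le mult_right_mono) auto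
          then have "\<bar>\<xi> k \<omega> * c k\<bar> * exp (- (u * real k)) \<le> \<bar>\<xi> k \<omega> * c k\<bar> * exp (- (1 / real (Suc n) * real k))"
            by (intro mult_left_mono) auto
          then show ?thesis unfolding weight_def by (simp add: abs_mult mult_ac)
        qed
      qed
    qed
  qed
qed

lemma good_summable_power:
  assumes "good \<omega>" "norm (z :: complex) < 1"
  shows "summable (\<lambda>k. norm (complex_of_real (\<xi> k \<omega> * c k) * z ^ k))"
proof -
  define q where "q = (1 + norm z) / 2"
  have q: "0 < q" "q < 1" "norm z \<le> q" using assms(2) norm_ge_zero[of z] unfolding q_def by (auto simp del: norm_ge_zero) 
  define u where "u = - ln q"
  have u: "u > 0" "exp (- u) = q" using q unfolding u_def by auto
  show ?thesis
  proof (rule summable_comparison_test')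
    show "summable (\<lambda>k. \<bar>\<xi> k \<omega> * c k\<bar> * exp (- (u * real k)))" using assms(1) u(1) unfolding good_def by blast
    show "norm (norm (complex_of_real (\<xi> k \<omega> * c k) * z ^ k)) \<le> \<bar>\<xi> k \<omega> * c k\<bar> * exp (- (u * real k))" for k
    proof -
      have "norm z ^ k \<le> q ^ k" using q(3) by (intro power_mono) auto
      then have "\<bar>\<xi> k \<omega> * c k\<bar> * norm z ^ k \<le> \<bar>\<xi> k \<omega> * c k\<bar> * q ^ k" by (intro mult_left_mono) auto
      then show ?thesis unfolding exp_minus_mult_nat u(2) by (simp add: norm_mult norm_power abs_mult)
    qed
  qed
qed

lemma good_summable:
  assumes "good \<omega>" "norm (z :: complex) < 1"
  shows "summable (\<lambda>k. complex_of_real (\<xi> k \<omega> * c k) * z ^ k)"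
  using good_summable_power[OF assms] by (rule summable_norm_cancel)

lemma good_holomorphic:
  assumes "good \<omega>"
  shows "random_taylor \<xi> c \<omega> holomorphic_on ball 0 1"
proof (rule power_series_holomorphic[where a = "\<lambda>k. complex_of_real (\<xi> k \<omega> * c k)"])
  fix w :: complex assume "w \<in> ball 0 1"
  then have "summable (\<lambda>k. complex_of_real (\<xi> k \<omega> * c k) * w ^ k)" by (intro good_summable[OF assms]) auto
  then show "(\<lambda>n. complex_of_real (\<xi> n \<omega> * c n) * (w - 0) ^ n) sums random_taylor \<xi> c \<omega> w"
    unfolding random_taylor_def using summable_sums by simp
qed

lemma F_holomorphic:
  assumes "good \<omega>"
  shows "F \<omega> holomorphic_on {z. Re z > 0}"
proof -
  have "(\<lambda>z. exp (- z)) ` {z. Re z > 0} \<subseteq> ball 0 1" by auto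
  then have "random_taylor \<xi> c \<omega> holomorphic_on (\<lambda>z. exp (- z)) ` {z. Re z > 0}"
    using good_holomorphic[OF assms] holomorphic_on_subset by blast
  moreover have "(\<lambda>z::complex. exp (- z)) holomorphic_on {z. Re z > 0}" by (intro holomorphic_intros)
  ultimately have "(random_taylor \<xi> c \<omega> \<circ> (\<lambda>z. exp (- z))) holomorphic_on {z. Re z > 0}"
    by (intro holomorphic_on_compose)
  then show ?thesis unfolding F_def comp_def .
qed

lemma F_of_real:
  assumes "good \<omega>" "s > 0"
  shows "F \<omega> (of_real s) = of_real (X s \<omega>)"
proof -
  have "summable (\<lambda>k. complex_of_real (\<xi> k \<omega> * c k) * exp (- complex_of_real s) ^ k)"
    using assms by (intro good_summable) auto
  then have "(\<lambda>k. complex_of_real (\<xi> k \<omega> * c k) * exp (- complex_of_real s) ^ k) sums F \<omega> (of_real s)"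
    unfolding F_def random_taylor_def by (rule summable_sums)
  also have "(\<lambda>k. complex_of_real (\<xi> k \<omega> * c k) * exp (- complex_of_real s) ^ k) = (\<lambda>k. complex_of_real (weight s k * \<xi> k \<omega>))"
    by (rule ext) (simp add: weight_def exp_minus_mult_nat exp_of_real[symmetric] mult_ac del: exp_of_real)
  finally have 1: "(\<lambda>k. complex_of_real (weight s k * \<xi> k \<omega>)) sums F \<omega> (of_real s)" .
  then have "(\<lambda>k. weight s k * \<xi> k \<omega>) sums Re (F \<omega> (of_real s))" using sums_Re[OF 1] by simp
  then have "(\<lambda>k. complex_of_real (weight s k * \<xi> k \<omega>)) sums of_real (X s \<omega>)"
    unfolding X_def S_def by (intro sums_of_real) (auto simp: sums_iff)
  with 1 show ?thesis by (rule sums_unique2)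
qed

section \<open>Mean square on circles\<close>

definition energy :: "real \<Rightarrow> real \<Rightarrow> 'a \<Rightarrow> ennreal" where
  "energy t R \<omega> = circle_energy (F \<omega>) (of_real t) R"

lemma F_measurable [measurable]: "(\<lambda>(\<omega>, z). F \<omega> z) \<in> borel_measurable (M \<Otimes>\<^sub>M borel)"
  unfolding F_def random_taylor_def case_prod_beta by measurable

lemma energy_integrand_measurable:
  "(\<lambda>(\<omega>, \<theta>). ennreal ((norm (F \<omega> (of_real t + of_real R * exp (2 * of_real pi * \<i> * of_real \<theta>))))\<^sup>2) * indicator {0..1} \<theta>) \<in> borel_measurable (M \<Otimes>\<^sub>M lborel)"
proof -
  have m: "(\<lambda>\<theta>. of_real t + of_real R * exp (2 * of_real pi * \<i> * of_real \<theta>) :: complex) \<in> borel_measurable lborel"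
    using borel_measurable_continuous_onI[of "\<lambda>\<theta>. of_real t + of_real R * exp (2 * of_real pi * \<i> * of_real \<theta>) :: complex"]
    by (simp add: continuous_intros)
  have "(\<lambda>p. F (fst p) (of_real t + of_real R * exp (2 * of_real pi * \<i> * of_real (snd p)))) \<in> borel_measurable (M \<Otimes>\<^sub>M lborel)"
    using measurable_compose[OF _ F_measurable, of "\<lambda>p. (fst p, of_real t + of_real R * exp (2 * of_real pi * \<i> * of_real (snd p)))" "M \<Otimes>\<^sub>M lborel"]
      measurable_compose[OF measurable_snd m] by simp
  then show ?thesis unfolding case_prod_beta by measurable
qed

lemma energy_measurable [measurable]: "energy t R \<in> borel_measurable M"
  unfolding energy_def circle_energy_def
  using lborel.borel_measurable_nn_integral[OF energy_integrand_measurable] by simp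

text \<open>Real and imaginary part are weighted sums whose weights carry a cosine and a sine of the
  same angle, so the squares add up to those of the weight at \<open>Re z\<close>.\<close>

lemma second_moment_F:
  assumes "Re z > 0"
  shows "(\<integral>\<^sup>+\<omega>. ennreal ((norm (F \<omega> z))\<^sup>2) \<partial>M) \<le> ennreal (V (2 * Re z))"
proof -
  define a where "a k = c k * exp (- (Re z * real k)) * cos (Im z * real k)" for k
  define b where "b k = - (c k * exp (- (Re z * real k)) * sin (Im z * real k))" for k
  have sa: "summable (\<lambda>k. \<bar>a k\<bar>)"
    by (rule summable_comparison_test'[OF summable_weight[OF assms]])
       (auto simp: a_def weight_def abs_mult mult_left_le)
  have sb: "summable (\<lambda>k. \<bar>b k\<bar>)"
    by (rule summable_comparison_test'[OF summable_weight[OF assms]])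
       (auto simp: b_def weight_def abs_mult mult_left_le)
  have "(\<integral>\<^sup>+\<omega>. ennreal ((norm (F \<omega> z))\<^sup>2) \<partial>M) = (\<integral>\<^sup>+\<omega>. ennreal ((S a \<omega>)\<^sup>2) + ennreal ((S b \<omega>)\<^sup>2) \<partial>M)"
  proof (rule nn_integral_cong_AE, use AE_good in eventually_elim)
    case (elim \<omega>)
    have "(\<lambda>k. complex_of_real (\<xi> k \<omega> * c k) * exp (- z) ^ k) sums F \<omega> z"
      unfolding F_def random_taylor_def using assms elim by (intro summable_sums good_summable) auto
    moreover have "complex_of_real (\<xi> k \<omega> * c k) * exp (- z) ^ k = Complex (a k * \<xi> k \<omega>) (b k * \<xi> k \<omega>)" for k
    proof -
      have "exp (- z) ^ k = exp (of_nat k * (- z))" by (rule exp_of_nat_mult[symmetric])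
      then show ?thesis by (simp add: complex_eq_iff a_def b_def Re_exp Im_exp mult_ac)
    qed
    ultimately have "(\<lambda>k. Complex (a k * \<xi> k \<omega>) (b k * \<xi> k \<omega>)) sums F \<omega> z" by simp
    then have "(\<lambda>k. a k * \<xi> k \<omega>) sums Re (F \<omega> z)" "(\<lambda>k. b k * \<xi> k \<omega>) sums Im (F \<omega> z)"
      by (auto dest: sums_Re sums_Im)
    then have "Re (F \<omega> z) = S a \<omega>" "Im (F \<omega> z) = S b \<omega>" unfolding S_def by (auto simp: sums_iff)
    then show ?case by (simp add: cmod_power2)
  qed
  also have "\<dots> = (\<integral>\<^sup>+\<omega>. ennreal ((S a \<omega>)\<^sup>2) \<partial>M) + (\<integral>\<^sup>+\<omega>. ennreal ((S b \<omega>)\<^sup>2) \<partial>M)"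
    by (rule nn_integral_add) auto
  also have "\<dots> \<le> ennreal (\<Sum>k. (a k)\<^sup>2) + ennreal (\<Sum>k. (b k)\<^sup>2)"
    by (intro add_mono second_moment_S sa sb)
  also have "\<dots> = ennreal ((\<Sum>k. (a k)\<^sup>2) + (\<Sum>k. (b k)\<^sup>2))"
    by (intro ennreal_plus[symmetric] suminf_nonneg summable_square_of_abs sa sb) auto
  also have "(\<Sum>k. (a k)\<^sup>2) + (\<Sum>k. (b k)\<^sup>2) = (\<Sum>k. (a k)\<^sup>2 + (b k)\<^sup>2)"
    by (intro suminf_add summable_square_of_abs sa sb)
  also have "\<dots> = (\<Sum>k. (weight (Re z) k)\<^sup>2)"
  proof (rule suminf_cong)
    fix k
    have "(a k)\<^sup>2 + (b k)\<^sup>2 = (weight (Re z) k)\<^sup>2 * ((cos (Im z * real k))\<^sup>2 + (sin (Im z * real k))\<^sup>2)"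
      unfolding a_def b_def weight_def by algebra
    then show "(a k)\<^sup>2 + (b k)\<^sup>2 = (weight (Re z) k)\<^sup>2" by simp
  qed
  also have "\<dots> = V (2 * Re z)" using weight_square_sums[OF assms] by (simp add: sums_iff)
  finally show ?thesis .
qed

text \<open>The leftmost point of the circle has real part \<open>t - R\<close>, and
  \<open>V\<close> is decreasing.\<close>

lemma energy_expectation:
  assumes "0 < R" "R < t"
  shows "(\<integral>\<^sup>+\<omega>. energy t R \<omega> \<partial>M) \<le> ennreal (V (2 * (t - R)))"
proof -
  interpret pair_sigma_finite M lborel by unfold_locales
  let ?z = "\<lambda>\<theta>. of_real t + of_real R * exp (2 * of_real pi * \<i> * of_real \<theta>) :: complex"
  have "(\<integral>\<^sup>+\<omega>. energy t R \<omega> \<partial>M) = (\<integral>\<^sup>+\<theta>. (\<integral>\<^sup>+\<omega>. ennreal ((norm (F \<omega> (?z \<theta>)))\<^sup>2) * indicator {0..1} \<theta> \<partial>M) \<partial>lborel)"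
    unfolding energy_def circle_energy_def by (rule Fubini'[symmetric]) (rule energy_integrand_measurable)
  also have "\<dots> \<le> (\<integral>\<^sup>+\<theta>. ennreal (V (2 * (t - R))) * indicator {0..1::real} \<theta> \<partial>lborel)"
  proof (rule nn_integral_mono)
    fix \<theta> :: real
    have "\<bar>cos (2 * pi * \<theta>)\<bar> \<le> 1" by simp
    then have "- R \<le> R * cos (2 * pi * \<theta>)" using assms(1) mult_left_mono[of "-1" "cos (2 * pi * \<theta>)" R] by (simp add: abs_le_iff)
    then have Re: "Re (?z \<theta>) \<ge> t - R" by (simp add: Re_exp)
    then have "Re (?z \<theta>) > 0" using assms by linarith
    have "(\<integral>\<^sup>+\<omega>. ennreal ((norm (F \<omega> (?z \<theta>)))\<^sup>2) \<partial>M) \<le> ennreal (V (2 * Re (?z \<theta>)))"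
      by (rule second_moment_F) fact
    also have "\<dots> \<le> ennreal (V (2 * (t - R)))" using Re assms by (intro ennreal_leI V_antimono) auto
    finally show "(\<integral>\<^sup>+\<omega>. ennreal ((norm (F \<omega> (?z \<theta>)))\<^sup>2) * indicator {0..1} \<theta> \<partial>M) \<le> ennreal (V (2 * (t - R))) * indicator {0..1} \<theta>"
      by (auto simp: indicator_def)
  qed
  also have "\<dots> = ennreal (V (2 * (t - R)))" by (subst nn_integral_cmult_indicator) auto
  finally show ?thesis .
qed

section \<open>Normalised weights, correlations and small balls\<close>

definition unit_weight :: "real \<Rightarrow> nat \<Rightarrow> real" where "unit_weight s k = weight s k / sd s"

definition corr :: "real \<Rightarrow> real \<Rightarrow> real" where "corr s t = V (s + t) / (sd s * sd t)"

lemma summable_unit_weight: "s > 0 \<Longrightarrow> summable (\<lambda>k. \<bar>unit_weight s k\<bar>)"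
  unfolding unit_weight_def abs_divide by (intro summable_divide summable_weight)

lemma unit_weight_mult_sums: "s > 0 \<Longrightarrow> t > 0 \<Longrightarrow> (\<lambda>k. unit_weight s k * unit_weight t k) sums corr s t"
  using sums_divide[OF weight_mult_sums[of s t], of "sd s * sd t"] unfolding unit_weight_def corr_def by simp

lemma corr_self: "s > 0 \<Longrightarrow> corr s s = 1"
  using sd_square[of s] sd_pos[of s] V_pos[of "2 * s"] unfolding corr_def by (simp add: power2_eq_square)

lemma corr_commute: "corr s t = corr t s"
  unfolding corr_def by (simp add: add.commute mult.commute)

lemma AE_S_unit_weight: "s > 0 \<Longrightarrow> AE \<omega> in M. S (unit_weight s) \<omega> = X s \<omega> / sd s"
proof -
  assume s: "s > 0"
  show ?thesis using AE_summable[OF summable_weight[OF s]]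
  proof eventually_elim
    case (elim \<omega>)
    then have "summable (\<lambda>k. weight s k * \<xi> k \<omega>)" by (rule summable_rabs_cancel)
    from suminf_divide[OF this, of "sd s"] show ?case
      unfolding S_def X_def unit_weight_def by simp
  qed
qed

text \<open>The Lindeberg condition with a rate: this power of \<open>s\<close> is what decides how
  small a ball the characteristic function can resolve.\<close>

lemma max_unit_weight: "\<exists>\<kappa> s1. 0 < \<kappa> \<and> \<kappa> \<le> 1/2 \<and> 0 < s1 \<and> s1 \<le> 1 \<and> (\<forall>s. 0 < s \<longrightarrow> s < s1 \<longrightarrow> (\<forall>k. \<bar>unit_weight s k\<bar> \<le> s powr \<kappa>))"
proof -
  obtain \<kappa> C v0 where k: "\<kappa> > 0" "C > 0" "v0 > 0" "\<And>u k. 0 < u \<Longrightarrow> u \<le> v0 \<Longrightarrow> (c k)\<^sup>2 * exp (- (u * real k)) \<le> C * u powr \<kappa> * V u"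
    using max_weight by blast
  \<comment> \<open>The condition \<open>2 * \<kappa>' < \<kappa>\<close> leaves a positive power of
    \<open>s\<close> to absorb the constant. The cap \<open>1/2\<close> later gives
    \<open>s \<le> \<eta>\<^sup>2\<close> for \<open>\<eta> = s powr \<kappa>\<close>.\<close>
  define \<kappa>' where "\<kappa>' = min (1/2) (\<kappa> / 4)"
  have k': "0 < \<kappa>'" "\<kappa>' \<le> 1/2" "2 * \<kappa>' < \<kappa>" using k unfolding \<kappa>'_def by auto
  have "((\<lambda>s. C * 2 powr \<kappa> * s powr (\<kappa> - 2 * \<kappa>')) \<longlongrightarrow> C * 2 powr \<kappa> * 0) (at_right 0)"
  proof (intro tendsto_mult tendsto_const)
    show "((\<lambda>s. s powr (\<kappa> - 2 * \<kappa>')) \<longlongrightarrow> 0) (at_right 0)"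
      using k' tendsto_powr'[OF tendsto_ident_at tendsto_const, of 0 "\<kappa> - 2 * \<kappa>'" "{0<..}"]
      by (auto simp: eventually_at_filter)
  qed
  then have "\<forall>\<^sub>F s in at_right 0. C * 2 powr \<kappa> * s powr (\<kappa> - 2 * \<kappa>') < 1"
    by (intro order_tendstoD(2)) auto
  then obtain b where b: "b > 0" "\<And>s. 0 < s \<Longrightarrow> s < b \<Longrightarrow> C * 2 powr \<kappa> * s powr (\<kappa> - 2 * \<kappa>') < 1"
    unfolding eventually_at_right_field by auto
  define s1 where "s1 = min 1 (min b (v0 / 2))"
  have "\<bar>unit_weight s k\<bar> \<le> s powr \<kappa>'" if s: "0 < s" "s < s1" for s k
  proof -
    have "(unit_weight s k)\<^sup>2 = ((c k)\<^sup>2 * exp (- (2 * s * real k))) / V (2 * s)"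
      using weight_mult[of s k s] sd_square[of s] s by (simp add: unit_weight_def power_divide power2_eq_square)
    also have "\<dots> \<le> C * (2 * s) powr \<kappa>"
      using k(4)[of "2 * s" k] s V_pos[of "2 * s"] unfolding s1_def by (simp add: divide_le_eq)
    also have "\<dots> = (C * 2 powr \<kappa> * s powr (\<kappa> - 2 * \<kappa>')) * s powr (2 * \<kappa>')"
      using s by (simp add: powr_mult powr_diff)
    also have "\<dots> \<le> 1 * s powr (2 * \<kappa>')"
      using b(2)[of s] s unfolding s1_def by (intro mult_right_mono) auto
    also have "\<dots> = (s powr \<kappa>')\<^sup>2" using s by (simp add: power2_eq_square powr_add[symmetric])
    finally show ?thesis by (simp add: abs_le_square_iff[symmetric])
  qed
  then show ?thesis using k' b k unfolding s1_def by (intro exI[of _ \<kappa>'] exI[of _ "min 1 (min b (v0 / 2))"]) (auto simp: s1_def)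
qed

text \<open>The limit is the quotient of the geometric and the arithmetic mean of \<open>a\<close>
  and \<open>b\<close>, to the power \<open>\<gamma>\<close>. It depends only on
  \<open>a / b\<close>, which is why geometric grids in \<open>s\<close> are asymptotically
  stationary.\<close>

lemma corr_limit:
  assumes a: "a > 0" "b > 0"
  shows "((\<lambda>s. corr (a * s) (b * s)) \<longlongrightarrow> (2 * sqrt (a * b) / (a + b)) powr \<gamma>) (at_right 0)"
proof -
  have "((\<lambda>s. (V ((a + b) * s) / V s) / sqrt ((V ((2 * a) * s) / V s) * (V ((2 * b) * s) / V s))) \<longlongrightarrow>
     (a + b) powr (- \<gamma>) / sqrt ((2 * a) powr (- \<gamma>) * (2 * b) powr (- \<gamma>))) (at_right 0)"
    using a by (intro tendsto_intros V_regularly_varying) auto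
  also have "(a + b) powr (- \<gamma>) / sqrt ((2 * a) powr (- \<gamma>) * (2 * b) powr (- \<gamma>)) = (2 * sqrt (a * b) / (a + b)) powr \<gamma>"
  proof -
    have sq: "sqrt ((2 * a) powr (- \<gamma>) * (2 * b) powr (- \<gamma>)) = (2 * sqrt (a * b)) powr (- \<gamma>)"
    proof -
      have "(2 * a) powr (- \<gamma>) * (2 * b) powr (- \<gamma>) = ((2 * a) * (2 * b)) powr (- \<gamma>)" by (rule powr_mult[symmetric])
      also have "(2 * a) * (2 * b) = (2 * sqrt (a * b)) * (2 * sqrt (a * b))" using a by simp
      also have "\<dots> powr (- \<gamma>) = ((2 * sqrt (a * b)) powr (- \<gamma>))\<^sup>2" using a by (subst powr_mult) (auto simp: power2_eq_square)
      finally show ?thesis by simp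
    qed
    show ?thesis by (subst sq, subst powr_divide) (simp add: powr_minus field_simps)
  qed
  finally show ?thesis
  proof (rule Lim_transform_eventually)
    show "\<forall>\<^sub>F s in at_right 0. (V ((a + b) * s) / V s) / sqrt ((V ((2 * a) * s) / V s) * (V ((2 * b) * s) / V s)) = corr (a * s) (b * s)"
      using eventually_at_right_less[of 0]
    proof eventually_elim
      case (elim s)
      then have "V s > 0" by (rule V_pos)
      then show ?case unfolding corr_def sd_def by (simp add: real_sqrt_mult real_sqrt_divide field_simps)
    qed
  qed
qed

text \<open>Points in geometric progression with a large ratio \<open>l\<close> are so weakly
  correlated that their Gram matrix is at least half the identity, whence \<open>small_ball\<close>
  applies. The exponent \<open>\<kappa>\<close> is chosen before \<open>d\<close>, so that
  \<open>d\<close> may later be taken large in terms of \<open>\<kappa>\<close>.\<close>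

lemma small_ball_X:
  "\<exists>\<kappa>. 0 < \<kappa> \<and> \<kappa> \<le> 1/2 \<and> (\<forall>d\<ge>1. \<exists>l C s1. 1 \<le> l \<and> 0 < C \<and> 0 < s1 \<and> s1 \<le> 1 \<and>
     (\<forall>s \<eta>. 0 < s \<longrightarrow> s < s1 \<longrightarrow> s powr \<kappa> \<le> \<eta> \<longrightarrow> \<eta> \<le> 1 \<longrightarrow>
        prob {\<omega>\<in>space M. \<forall>i<d. \<bar>X (l ^ i * s) \<omega>\<bar> \<le> \<eta> * sd (l ^ i * s)} \<le> C * \<eta> ^ d))"
proof -
  obtain \<kappa>0 s0 where k0: "0 < \<kappa>0" "\<kappa>0 \<le> 1/2" "0 < s0" "s0 \<le> 1" "\<And>s k. 0 < s \<Longrightarrow> s < s0 \<Longrightarrow> \<bar>unit_weight s k\<bar> \<le> s powr \<kappa>0"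
    using max_unit_weight by blast
  \<comment> \<open>For small \<open>s\<close> all points \<open>l ^ i * s\<close> are at most
    \<open>s powr (1/2)\<close>, where weights are at most \<open>s powr (\<kappa>0 / 2)\<close>. A
    quarter of \<open>\<kappa>0\<close> makes this the square of \<open>s powr \<kappa>\<close>,
    hence at most \<open>\<eta>\<^sup>2\<close>.\<close>
  define \<kappa> where "\<kappa> = \<kappa>0 / 4"
  have "\<exists>l C s1. 1 \<le> l \<and> 0 < C \<and> 0 < s1 \<and> s1 \<le> 1 \<and>
     (\<forall>s \<eta>. 0 < s \<longrightarrow> s < s1 \<longrightarrow> s powr \<kappa> \<le> \<eta> \<longrightarrow> \<eta> \<le> 1 \<longrightarrow>
        prob {\<omega>\<in>space M. \<forall>i<d. \<bar>X (l ^ i * s) \<omega>\<bar> \<le> \<eta> * sd (l ^ i * s)} \<le> C * \<eta> ^ d)" if d: "d \<ge> 1" for d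
  proof -
    \<comment> \<open>Chosen so that \<open>(2 / sqrt l) powr \<gamma> = 1 / (4 * real d)\<close>;
      limiting correlations of distinct points are then strictly below the required
      \<open>1 / (2 * real d)\<close>.\<close>
    define l where "l = (2 * (4 * real d) powr (1 / \<gamma>))\<^sup>2"
    have "(4 * real d) powr (1 / \<gamma>) \<ge> 1" using d gamma_pos by (intro ge_one_powr_ge_zero) auto
    then have l2: "2 * (4 * real d) powr (1 / \<gamma>) \<ge> 2" by simp
    then have l1: "l \<ge> 1" unfolding l_def by (intro one_le_power) linarith
    have corr_small: "\<forall>\<^sub>F s in at_right 0. \<bar>corr (l ^ i * s) (l ^ j * s)\<bar> \<le> 1 / (2 * real d)" if ij: "i < j" for i j
    proof -
      have "2 * sqrt (l ^ i * l ^ j) / (l ^ i + l ^ j) \<le> 2 / sqrt l"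
      proof -
        have "sqrt l > 0" "sqrt l \<ge> 1" using l1 by auto
        have "l ^ Suc i \<le> l ^ j" using l1 ij by (intro power_increasing) auto
        then have "l ^ i * l ^ j * l \<le> l ^ j * l ^ j" using l1 by (simp add: mult_ac mult_left_mono)
        then have "sqrt (l ^ i * l ^ j * l) \<le> sqrt (l ^ j * l ^ j)" by (rule real_sqrt_le_mono)
        then have "sqrt (l ^ i * l ^ j) * sqrt l \<le> l ^ j" using l1 by (simp add: real_sqrt_mult)
        moreover have "0 < l ^ i" using l1 by simp
        ultimately have "sqrt (l ^ i * l ^ j) * sqrt l \<le> l ^ i + l ^ j" by linarith
        moreover have "0 < l ^ i + l ^ j" using l1 by (simp add: add_pos_pos)
        ultimately show ?thesis using \<open>sqrt l > 0\<close> by (simp add: field_simps)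
      qed
      then have "(2 * sqrt (l ^ i * l ^ j) / (l ^ i + l ^ j)) powr \<gamma> \<le> (2 / sqrt l) powr \<gamma>"
        using l1 gamma_pos by (intro powr_mono2) auto
      also have "sqrt l = 2 * (4 * real d) powr (1 / \<gamma>)" unfolding l_def by (subst real_sqrt_abs) (use l2 in linarith)
      also have "(2 / (2 * (4 * real d) powr (1 / \<gamma>))) powr \<gamma> = 1 / (4 * real d)"
        using d gamma_pos by (simp add: powr_divide powr_powr)
      also have "\<dots> < 1 / (2 * real d)" using d by (simp add: field_simps)
      finally have "\<forall>\<^sub>F s in at_right 0. corr (l ^ i * s) (l ^ j * s) < 1 / (2 * real d)"
        using l1 by (intro order_tendstoD(2)[OF corr_limit]) auto
      then show ?thesis using eventually_at_right_less[of 0]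
      proof eventually_elim
        case (elim s)
        then have "corr (l ^ i * s) (l ^ j * s) \<ge> 0" unfolding corr_def
          using l1 by (intro divide_nonneg_pos mult_pos_pos sd_pos less_imp_le[OF V_pos] add_pos_pos) auto
        then show ?case using elim by simp
      qed
    qed
    have "\<forall>\<^sub>F s in at_right 0. \<forall>p\<in>{(i, j). i < d \<and> j < d \<and> i < j}. \<bar>corr (l ^ fst p * s) (l ^ snd p * s)\<bar> \<le> 1 / (2 * real d)"
    proof (rule eventually_ball_finite)
      show "finite {(i, j). i < d \<and> j < d \<and> i < j}" by (rule finite_subset[of _ "{..<d} \<times> {..<d}"]) auto
    qed (auto intro: corr_small)
    then obtain b1 where b1: "b1 > 0" "\<And>s i j. 0 < s \<Longrightarrow> s < b1 \<Longrightarrow> i < d \<Longrightarrow> j < d \<Longrightarrow> i < j \<Longrightarrow> \<bar>corr (l ^ i * s) (l ^ j * s)\<bar> \<le> 1 / (2 * real d)"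
      unfolding eventually_at_right_field by fastforce
    from small_ball[OF d] obtain C where C: "C > 0" and small: "\<forall>w W \<eta>. (\<forall>i<d. summable (\<lambda>k. \<bar>w i k\<bar>)) \<longrightarrow> (\<forall>i<d. \<forall>k. \<bar>w i k\<bar> \<le> W) \<longrightarrow>
      (\<forall>z. (\<Sum>i<d. (z i)\<^sup>2) / 2 \<le> (\<Sum>k. (\<Sum>i<d. z i * w i k)\<^sup>2)) \<longrightarrow> 0 < \<eta> \<longrightarrow> \<eta> \<le> 1 \<longrightarrow> W \<le> \<eta>\<^sup>2 \<longrightarrow>
      prob {\<omega>\<in>space M. \<forall>i<d. \<bar>S (w i) \<omega>\<bar> \<le> \<eta>} \<le> C * \<eta> ^ d"
      by (elim exE conjE) (rule that)
    \<comment> \<open>The third entry keeps every \<open>l ^ i * s\<close> in the range of the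
      weight bound; the last one gives \<open>l ^ d * s \<le> sqrt s\<close>.\<close>
    define s1 where "s1 = min (min 1 b1) (min (s0 / l ^ d) (1 / (l ^ d)\<^sup>2))"
    have ld: "l ^ d \<ge> 1" using l1 by simp
    have "prob {\<omega>\<in>space M. \<forall>i<d. \<bar>X (l ^ i * s) \<omega>\<bar> \<le> \<eta> * sd (l ^ i * s)} \<le> C * \<eta> ^ d"
      if s: "0 < s" "s < s1" and \<eta>: "s powr \<kappa> \<le> \<eta>" "\<eta> \<le> 1" for s \<eta>
    proof -
      have t: "0 < l ^ i * s" "l ^ i * s \<le> l ^ d * s" if "i < d" for i
        using l1 s that by (auto intro!: mult_right_mono power_increasing)
      have tp: "0 < l ^ i * s" for i using l1 s by simp
      have lds: "l ^ d * s < s0" "l ^ d * s \<le> s powr (1/2)"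
      proof -
        show "l ^ d * s < s0" using s(2) ld unfolding s1_def by (auto simp: field_simps)
        have "s \<le> 1 / (l ^ d)\<^sup>2" using s(2) unfolding s1_def by simp
        then have "sqrt s \<le> sqrt (1 / (l ^ d)\<^sup>2)" by (rule real_sqrt_le_mono)
        then have "sqrt s \<le> 1 / l ^ d" using ld by (simp add: real_sqrt_divide)
        then have "l ^ d * sqrt s \<le> 1" using ld by (simp add: field_simps)
        then have "l ^ d * sqrt s * sqrt s \<le> 1 * sqrt s" using s by (intro mult_right_mono) auto
        then show "l ^ d * s \<le> s powr (1/2)" using s by (simp add: powr_half_sqrt mult.assoc)
      qed
      have \<eta>0: "\<eta> > 0" using \<eta>(1) s by (intro less_le_trans[OF _ \<eta>(1)]) simp
      let ?w = "\<lambda>i. unit_weight (l ^ i * s)"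
      have W: "\<bar>?w i k\<bar> \<le> \<eta>\<^sup>2" if i: "i < d" for i k
      proof -
        have "\<bar>?w i k\<bar> \<le> (l ^ i * s) powr \<kappa>0" using k0(5)[of "l ^ i * s" k] t[OF i] lds by simp
        also have "\<dots> \<le> (s powr (1/2)) powr \<kappa>0" using t[OF i] lds k0 by (intro powr_mono2) auto
        also have "\<dots> = (s powr \<kappa>)\<^sup>2" using s unfolding \<kappa>_def by (simp add: powr_powr power2_eq_square powr_add[symmetric])
        also have "\<dots> \<le> \<eta>\<^sup>2" using \<eta> by (intro power_mono) auto
        finally show ?thesis .
      qed
      \<comment> \<open>Diagonal dominance: an off-diagonal term is at least
        \<open>- ((z i)\<^sup>2 + (z j)\<^sup>2) / (4 * real d)\<close>. Subtracting this for all
        pairs, the diagonal included, costs exactly half of the sum of squares.\<close>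
      have nd: "(\<Sum>i<d. (z i)\<^sup>2) / 2 \<le> (\<Sum>k. (\<Sum>i<d. z i * ?w i k)\<^sup>2)" for z
      proof -
        have eq: "(\<Sum>i<d. z i * ?w i k)\<^sup>2 = (\<Sum>i<d. \<Sum>j<d. z i * z j * (?w i k * ?w j k))" for k
          by (simp add: power2_eq_square sum_product mult_ac)
        have "(\<lambda>k. \<Sum>i<d. \<Sum>j<d. z i * z j * (?w i k * ?w j k)) sums (\<Sum>i<d. \<Sum>j<d. z i * z j * corr (l ^ i * s) (l ^ j * s))"
          by (intro sums_sum sums_mult unit_weight_mult_sums tp)
        then have "(\<Sum>k. (\<Sum>i<d. z i * ?w i k)\<^sup>2) = (\<Sum>i<d. \<Sum>j<d. z i * z j * corr (l ^ i * s) (l ^ j * s))"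
          unfolding eq by (simp add: sums_iff)
        also have "\<dots> \<ge> (\<Sum>i<d. \<Sum>j<d. (if i = j then (z i)\<^sup>2 else 0) - ((z i)\<^sup>2 + (z j)\<^sup>2) / (4 * real d))"
        proof (intro sum_mono)
          fix i j assume ij: "i \<in> {..<d}" "j \<in> {..<d}"
          show "(if i = j then (z i)\<^sup>2 else 0) - ((z i)\<^sup>2 + (z j)\<^sup>2) / (4 * real d) \<le> z i * z j * corr (l ^ i * s) (l ^ j * s)"
          proof (cases "i = j")
            case True
            then show ?thesis using corr_self[OF tp[of i]] by (simp add: power2_eq_square)
          next
            case False
            have c: "\<bar>corr (l ^ i * s) (l ^ j * s)\<bar> \<le> 1 / (2 * real d)"
              using b1(2)[of s i j] b1(2)[of s j i] ij s False corr_commute[of "l ^ i * s" "l ^ j * s"] unfolding s1_def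
              by (cases "i < j") auto
            have "\<bar>z i * z j * corr (l ^ i * s) (l ^ j * s)\<bar> = \<bar>z i * z j\<bar> * \<bar>corr (l ^ i * s) (l ^ j * s)\<bar>" by (rule abs_mult)
            also have "\<dots> \<le> (((z i)\<^sup>2 + (z j)\<^sup>2) / 2) * (1 / (2 * real d))"
            proof (intro mult_mono c)
              have "0 \<le> (\<bar>z i\<bar> - \<bar>z j\<bar>)\<^sup>2" by simp
              then show "\<bar>z i * z j\<bar> \<le> ((z i)\<^sup>2 + (z j)\<^sup>2) / 2" by (simp add: power2_diff abs_mult)
            qed auto
            also have "\<dots> = ((z i)\<^sup>2 + (z j)\<^sup>2) / (4 * real d)" by simp
            finally have "- (z i * z j * corr (l ^ i * s) (l ^ j * s)) \<le> ((z i)\<^sup>2 + (z j)\<^sup>2) / (4 * real d)" by linarith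
            then show ?thesis using False by simp
          qed
        qed
        also have "(\<Sum>i<d. \<Sum>j<d. (if i = j then (z i)\<^sup>2 else 0) - ((z i)\<^sup>2 + (z j)\<^sup>2) / (4 * real d)) = 
           (\<Sum>i<d. (z i)\<^sup>2) - (\<Sum>i<d. \<Sum>j<d. ((z i)\<^sup>2 + (z j)\<^sup>2) / (4 * real d))"
          by (simp add: sum_subtractf)
        also have "(\<Sum>i<d. \<Sum>j<d. ((z i)\<^sup>2 + (z j)\<^sup>2) / (4 * real d)) = (\<Sum>i<d. (z i)\<^sup>2) / 2"
          using d by (simp add: sum_divide_distrib[symmetric] sum.distrib sum_distrib_left[symmetric] field_simps)
        finally show ?thesis by simp
      qed
      have "prob {\<omega>\<in>space M. \<forall>i<d. \<bar>X (l ^ i * s) \<omega>\<bar> \<le> \<eta> * sd (l ^ i * s)} = prob {\<omega>\<in>space M. \<forall>i<d. \<bar>S (?w i) \<omega>\<bar> \<le> \<eta>}"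
      proof (rule finite_measure_eq_AE)
        have "AE \<omega> in M. \<forall>i\<in>{..<d}. S (?w i) \<omega> = X (l ^ i * s) \<omega> / sd (l ^ i * s)"
          by (intro AE_finite_allI AE_S_unit_weight tp) auto
        then show "AE \<omega> in M. (\<omega> \<in> {\<omega>\<in>space M. \<forall>i<d. \<bar>X (l ^ i * s) \<omega>\<bar> \<le> \<eta> * sd (l ^ i * s)}) = (\<omega> \<in> {\<omega>\<in>space M. \<forall>i<d. \<bar>S (?w i) \<omega>\<bar> \<le> \<eta>})"
        proof eventually_elim
          case (elim \<omega>)
          have "\<bar>S (?w i) \<omega>\<bar> \<le> \<eta> \<longleftrightarrow> \<bar>X (l ^ i * s) \<omega>\<bar> \<le> \<eta> * sd (l ^ i * s)" if "i < d" for i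
            using elim that sd_pos[OF tp[of i]] by (simp add: divide_le_eq)
          then show ?case by auto
        qed
      qed measurable
      also have "\<dots> \<le> C * \<eta> ^ d"
        by (rule small[rule_format, of ?w "\<eta>\<^sup>2" \<eta>]) (use W nd \<eta>0 \<eta> summable_unit_weight tp in auto)
      finally show ?thesis .
    qed
    moreover have "s1 > 0" unfolding s1_def using b1 k0 l1 by simp
    moreover have "s1 \<le> 1" unfolding s1_def by simp
    ultimately show ?thesis using l1 C by blast
  qed
  then show ?thesis using k0 unfolding \<kappa>_def by (intro exI[of _ "\<kappa>0 / 4"]) auto
qed

lemma energy_tail:
  assumes "0 < R" "R < t" "x > 0"
  shows "prob {\<omega>\<in>space M. ennreal x \<le> energy t R \<omega>} \<le> V (2 * (t - R)) / x"
proof -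
  have "{\<omega>\<in>space M. ennreal x \<le> energy t R \<omega>} = {\<omega>\<in>space M. 1 \<le> ennreal (1 / x) * energy t R \<omega>}"
  proof (rule Collect_cong, rule conj_cong[OF refl])
    fix \<omega>
    have "ennreal x \<le> energy t R \<omega> \<longleftrightarrow> ennreal (1/x) * ennreal x \<le> ennreal (1 / x) * energy t R \<omega>"
      using assms(3) by (simp add: ennreal_mult_le_mult_iff)
    also have "ennreal (1/x) * ennreal x = 1" using assms(3) by (simp add: ennreal_mult[symmetric])
    finally show "ennreal x \<le> energy t R \<omega> \<longleftrightarrow> 1 \<le> ennreal (1 / x) * energy t R \<omega>" .
  qed
  then have "emeasure M {\<omega>\<in>space M. ennreal x \<le> energy t R \<omega>} \<le> ennreal (1 / x) * (\<integral>\<^sup>+\<omega>. energy t R \<omega> * indicator (space M) \<omega> \<partial>M)"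
    using nn_integral_Markov_inequality[of "energy t R" "space M" M "ennreal (1 / x)"] by simp
  also have "(\<integral>\<^sup>+\<omega>. energy t R \<omega> * indicator (space M) \<omega> \<partial>M) = (\<integral>\<^sup>+\<omega>. energy t R \<omega> \<partial>M)"
    by (intro nn_integral_cong) auto
  also have "ennreal (1 / x) * \<dots> \<le> ennreal (1 / x) * ennreal (V (2 * (t - R)))"
    by (intro mult_left_mono energy_expectation assms) auto
  also have "\<dots> = ennreal (V (2 * (t - R)) / x)"
    using assms V_pos[of "2 * (t - R)"] by (simp add: ennreal_mult[symmetric])
  finally show ?thesis using assms V_pos[of "2 * (t - R)"] by (simp add: emeasure_eq_measure)
qed

section \<open>Probabilities of the Jensen events\<close>

text \<open>The event forced by \<open>m\<close> zeros whose distance to \<open>t\<close> is at most \<open>q * R\<close>.\<close>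

definition jensen_event :: "real \<Rightarrow> real \<Rightarrow> real \<Rightarrow> nat \<Rightarrow> 'a set" where
  "jensen_event q t R m = {\<omega>\<in>space M. ennreal ((X t \<omega>)\<^sup>2) \<le> ennreal (q ^ (2 * m)) * energy t R \<omega>}"

lemma jensen_event_sets [measurable]: "jensen_event q t R m \<in> sets M"
  unfolding jensen_event_def by measurable

lemma jensen_event_subset:
  assumes "q > 0" "y > 0"
  shows "jensen_event q t R m \<subseteq> {\<omega>\<in>space M. \<bar>X t \<omega>\<bar> \<le> y} \<union> {\<omega>\<in>space M. ennreal (y\<^sup>2 / q ^ (2 * m)) \<le> energy t R \<omega>}"
proof
  fix \<omega> assume w: "\<omega> \<in> jensen_event q t R m"
  show "\<omega> \<in> {\<omega>\<in>space M. \<bar>X t \<omega>\<bar> \<le> y} \<union> {\<omega>\<in>space M. ennreal (y\<^sup>2 / q ^ (2 * m)) \<le> energy t R \<omega>}"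
  proof (cases "\<bar>X t \<omega>\<bar> \<le> y")
    case False
    then have "y\<^sup>2 \<le> (X t \<omega>)\<^sup>2" using assms(2) abs_le_square_iff[of y "X t \<omega>"] by simp
    then have "ennreal (y\<^sup>2) \<le> ennreal (q ^ (2 * m)) * energy t R \<omega>"
      using w unfolding jensen_event_def by (auto intro: order_trans[OF ennreal_leI])
    moreover have "ennreal (y\<^sup>2) = ennreal (q ^ (2 * m)) * ennreal (y\<^sup>2 / q ^ (2 * m))"
      using assms by (simp add: ennreal_mult[symmetric])
    ultimately have "ennreal (y\<^sup>2 / q ^ (2 * m)) \<le> energy t R \<omega>"
      using assms(1) by (simp add: ennreal_mult_le_mult_iff)
    then show ?thesis using w unfolding jensen_event_def by simp
  qed (use w in \<open>simp add: jensen_event_def\<close>)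
qed

lemma small_ball_one:
  "\<exists>\<kappa> C s1. 0 < \<kappa> \<and> 0 < C \<and> 0 < s1 \<and> s1 \<le> 1 \<and> (\<forall>s \<eta>. 0 < s \<longrightarrow> s < s1 \<longrightarrow> s powr \<kappa> \<le> \<eta> \<longrightarrow> \<eta> \<le> 1 \<longrightarrow>
     prob {\<omega>\<in>space M. \<bar>X s \<omega>\<bar> \<le> \<eta> * sd s} \<le> C * \<eta>)"
proof -
  obtain \<kappa> where k: "0 < \<kappa>" and sb: "\<forall>d\<ge>1. \<exists>l C s1. 1 \<le> l \<and> 0 < C \<and> 0 < s1 \<and> s1 \<le> 1 \<and>
     (\<forall>s \<eta>. 0 < s \<longrightarrow> s < s1 \<longrightarrow> s powr \<kappa> \<le> \<eta> \<longrightarrow> \<eta> \<le> 1 \<longrightarrow>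
        prob {\<omega>\<in>space M. \<forall>i<d. \<bar>X (l ^ i * s) \<omega>\<bar> \<le> \<eta> * sd (l ^ i * s)} \<le> C * \<eta> ^ d)"
    using small_ball_X by (elim exE conjE) (rule that)
  obtain l :: real and C s1 where C: "0 < C" "0 < s1" "s1 \<le> 1" and P: "\<forall>s \<eta>. 0 < s \<longrightarrow> s < s1 \<longrightarrow> s powr \<kappa> \<le> \<eta> \<longrightarrow> \<eta> \<le> 1 \<longrightarrow>
        prob {\<omega>\<in>space M. \<forall>i<1. \<bar>X (l ^ i * s) \<omega>\<bar> \<le> \<eta> * sd (l ^ i * s)} \<le> C * \<eta> ^ 1"
    using sb[rule_format, of 1, OF order_refl] by (elim exE conjE) auto
  show ?thesis
    by (rule exI[of _ \<kappa>], rule exI[of _ C], rule exI[of _ s1]) (use k C P in simp)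
qed

text \<open>A circle whose leftmost point is \<open>s / 2\<close> has expected mean square at most
  \<open>V s\<close>; this compares it with the variance at the centre \<open>a * s\<close>.\<close>

lemma V_le_sd_square:
  assumes a: "a > 0"
  shows "\<exists>K s1. 0 < K \<and> 0 < s1 \<and> (\<forall>s. 0 < s \<longrightarrow> s < s1 \<longrightarrow> V s \<le> K * (sd (a * s))\<^sup>2)"
proof -
  define b where "b = (2 * a) powr (- \<gamma>)"
  have b: "b > 0" using a unfolding b_def by simp
  have "((\<lambda>u. V ((2 * a) * u) / V u) \<longlongrightarrow> b) (at_right 0)"
    unfolding b_def using a by (intro V_regularly_varying) auto
  then have "\<forall>\<^sub>F u in at_right 0. V ((2 * a) * u) / V u > b / 2"
    using b by (intro order_tendstoD(1)) auto
  then obtain s1 where s1: "s1 > 0" "\<And>u. 0 < u \<Longrightarrow> u < s1 \<Longrightarrow> V ((2 * a) * u) / V u > b / 2"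
    unfolding eventually_at_right_field by auto
  have "V s \<le> 2 / b * (sd (a * s))\<^sup>2" if s: "0 < s" "s < s1" for s
    using s1(2)[OF s] V_pos[OF s(1)] b sd_square[of "a * s"] a s by (simp add: field_simps)
  then show ?thesis using b s1(1) by (intro exI[of _ "2 / b"] exI[of _ s1]) auto
qed

lemma jensen_event_prob:
  assumes "q > 0" "y > 0" "0 < R" "R < t"
  shows "prob (jensen_event q t R m) \<le> prob {\<omega>\<in>space M. \<bar>X t \<omega>\<bar> \<le> y} + q ^ (2 * m) * V (2 * (t - R)) / y\<^sup>2"
proof -
  have "prob (jensen_event q t R m) \<le> prob ({\<omega>\<in>space M. \<bar>X t \<omega>\<bar> \<le> y} \<union> {\<omega>\<in>space M. ennreal (y\<^sup>2 / q ^ (2 * m)) \<le> energy t R \<omega>})"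
    by (intro finite_measure_mono jensen_event_subset assms) measurable
  also have "\<dots> \<le> prob {\<omega>\<in>space M. \<bar>X t \<omega>\<bar> \<le> y} + prob {\<omega>\<in>space M. ennreal (y\<^sup>2 / q ^ (2 * m)) \<le> energy t R \<omega>}"
    by (intro measure_Un_le) measurable
  also have "prob {\<omega>\<in>space M. ennreal (y\<^sup>2 / q ^ (2 * m)) \<le> energy t R \<omega>} \<le> V (2 * (t - R)) / (y\<^sup>2 / q ^ (2 * m))"
    using assms by (intro energy_tail) auto
  also have "V (2 * (t - R)) / (y\<^sup>2 / q ^ (2 * m)) = q ^ (2 * m) * V (2 * (t - R)) / y\<^sup>2" by simp
  finally show ?thesis by simp
qed

text \<open>At level \<open>\<eta> = p ^ (2 * m)\<close> the small ball costs a multiple of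
  \<open>p ^ (2 * m)\<close>, and Markov's inequality for the energy costs a multiple of
  \<open>p ^ (6 * m) / \<eta>\<^sup>2\<close>, which is the same. The level cannot go below
  \<open>s powr \<kappa>\<close>, whence the second term.\<close>

lemma local_zeros_bound:
  "\<exists>\<kappa> C s1. 0 < \<kappa> \<and> 0 < C \<and> 0 < s1 \<and> s1 \<le> 1 \<and> (\<forall>p s m. 0 < p \<longrightarrow> p \<le> 1 \<longrightarrow> 0 < s \<longrightarrow> s < s1 \<longrightarrow>
     prob (jensen_event (p ^ 3) s (s / 2) m) \<le> C * (p ^ (2 * m) + s powr \<kappa>))"
proof -
  obtain \<kappa> C s1 where k: "0 < \<kappa>" "0 < C" "0 < s1" "s1 \<le> 1"
     and sb: "\<And>s \<eta>. 0 < s \<Longrightarrow> s < s1 \<Longrightarrow> s powr \<kappa> \<le> \<eta> \<Longrightarrow> \<eta> \<le> 1 \<Longrightarrow> prob {\<omega>\<in>space M. \<bar>X s \<omega>\<bar> \<le> \<eta> * sd s} \<le> C * \<eta>"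
    using small_ball_one by blast
  obtain K s2 where K: "0 < K" "0 < s2" "\<And>s. 0 < s \<Longrightarrow> s < s2 \<Longrightarrow> V s \<le> K * (sd (1 * s))\<^sup>2"
    using V_le_sd_square[of 1] by auto
  have "prob (jensen_event (p ^ 3) s (s / 2) m) \<le> (C + K) * (p ^ (2 * m) + s powr \<kappa>)"
    if p: "0 < p" "p \<le> 1" and s: "0 < s" "s < min s1 s2" for p s m
  proof -
    define \<eta> where "\<eta> = max (p ^ (2 * m)) (s powr \<kappa>)"
    have pm: "0 < p ^ (2 * m)" "p ^ (2 * m) \<le> 1" using p by (auto intro: power_le_one)
    have "s powr \<kappa> \<le> 1 powr \<kappa>" using s k by (intro powr_mono2) auto
    then have \<eta>: "0 < \<eta>" "\<eta> \<le> 1" "s powr \<kappa> \<le> \<eta>" "p ^ (2 * m) \<le> \<eta>" using pm unfolding \<eta>_def by auto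
    have sds: "sd s > 0" using s sd_pos by simp
    have "prob (jensen_event (p ^ 3) s (s / 2) m) \<le> prob {\<omega>\<in>space M. \<bar>X s \<omega>\<bar> \<le> \<eta> * sd s} + (p ^ 3) ^ (2 * m) * V (2 * (s - s / 2)) / (\<eta> * sd s)\<^sup>2"
      using p s \<eta> sds by (intro jensen_event_prob) auto
    also have "\<dots> \<le> C * \<eta> + K * p ^ (2 * m)"
    proof (rule add_mono)
      show "prob {\<omega>\<in>space M. \<bar>X s \<omega>\<bar> \<le> \<eta> * sd s} \<le> C * \<eta>" using s \<eta> by (intro sb) auto
      have "(p ^ 3) ^ (2 * m) * V (2 * (s - s / 2)) / (\<eta> * sd s)\<^sup>2 = ((p ^ 3) ^ (2 * m) / \<eta>\<^sup>2) * (V s / (sd s)\<^sup>2)"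
        by (simp add: power_mult_distrib)
      also have "\<dots> \<le> p ^ (2 * m) * K"
      proof (rule mult_mono)
        have "(p ^ 3) ^ (2 * m) = p ^ (2 * m) * (p ^ (2 * m))\<^sup>2"
          by (simp add: power_mult[symmetric] power_add[symmetric] mult.commute)
        also have "\<dots> \<le> p ^ (2 * m) * \<eta>\<^sup>2" using \<eta> pm by (intro mult_left_mono power_mono) auto
        finally show "(p ^ 3) ^ (2 * m) / \<eta>\<^sup>2 \<le> p ^ (2 * m)" using \<eta> by (simp add: divide_le_eq)
        show "V s / (sd s)\<^sup>2 \<le> K" using K(3)[of s] s sds by (simp add: divide_le_eq)
      qed (use pm s V_pos[of s] in auto)
      finally show "(p ^ 3) ^ (2 * m) * V (2 * (s - s / 2)) / (\<eta> * sd s)\<^sup>2 \<le> K * p ^ (2 * m)" by (simp add: mult.commute)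
    qed
    also have "\<dots> \<le> C * (p ^ (2 * m) + s powr \<kappa>) + K * (p ^ (2 * m) + s powr \<kappa>)"
      using k K pm unfolding \<eta>_def by (intro add_mono mult_left_mono) auto
    finally show ?thesis by (simp add: algebra_simps)
  qed
  then show ?thesis using k K
    by (rule_tac x = \<kappa> in exI, rule_tac x = "C + K" in exI, rule_tac x = "min s1 s2" in exI) auto
qed

text \<open>Evaluating at \<open>d\<close> well separated points gives a polynomial bound of high degree, which a single
  small-ball estimate cannot provide.\<close>

lemma many_zeros_bound:
  "\<exists>l d A C s1. 1 \<le> l \<and> 1 \<le> (d::nat) \<and> 0 < A \<and> 0 < C \<and> 0 < s1 \<and> s1 \<le> 1 \<and> (\<forall>s m. 0 < s \<longrightarrow> s < s1 \<longrightarrow> real m \<ge> A * ln (1 / s) \<longrightarrow>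
     prob (\<Inter>i<d. jensen_event (1 - 1 / (4 * l ^ d)) (l ^ i * s) (l ^ i * s - s / 2) m) \<le> C * s ^ 5)"
proof -
  obtain \<kappa> where k: "0 < \<kappa>" "\<kappa> \<le> 1/2" and sb: "\<forall>d\<ge>1. \<exists>l C s1. 1 \<le> l \<and> 0 < C \<and> 0 < s1 \<and> s1 \<le> 1 \<and>
     (\<forall>s \<eta>. 0 < s \<longrightarrow> s < s1 \<longrightarrow> s powr \<kappa> \<le> \<eta> \<longrightarrow> \<eta> \<le> 1 \<longrightarrow>
        prob {\<omega>\<in>space M. \<forall>i<d. \<bar>X (l ^ i * s) \<omega>\<bar> \<le> \<eta> * sd (l ^ i * s)} \<le> C * \<eta> ^ d)"
    using small_ball_X by (elim exE conjE) (rule that)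
  \<comment> \<open>With \<open>\<eta> = s powr \<kappa>\<close>, the bound
    \<open>\<eta> ^ d\<close> is then at most \<open>s ^ 5\<close>.\<close>
  define d where "d = nat \<lceil>5 / \<kappa>\<rceil> + 1"
  have d: "1 \<le> d" "real d * \<kappa> \<ge> 5" 
  proof -
    show "1 \<le> d" unfolding d_def by simp
    have "real d \<ge> 5 / \<kappa>" unfolding d_def by linarith
    then show "real d * \<kappa> \<ge> 5" using k by (simp add: field_simps)
  qed
  obtain l C s1 where l: "1 \<le> l" and C: "0 < C" "0 < s1" "s1 \<le> 1" and P: "\<forall>s \<eta>. 0 < s \<longrightarrow> s < s1 \<longrightarrow> s powr \<kappa> \<le> \<eta> \<longrightarrow> \<eta> \<le> 1 \<longrightarrow>
        prob {\<omega>\<in>space M. \<forall>i<d. \<bar>X (l ^ i * s) \<omega>\<bar> \<le> \<eta> * sd (l ^ i * s)} \<le> C * \<eta> ^ d"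
    using sb[rule_format, OF d(1)] by (elim exE conjE) (rule that)
  have "\<forall>i. \<exists>K s2. 0 < K \<and> 0 < s2 \<and> (\<forall>s. 0 < s \<longrightarrow> s < s2 \<longrightarrow> V s \<le> K * (sd (l ^ i * s))\<^sup>2)"
    using V_le_sd_square l by (auto simp: zero_less_power less_le_trans[OF zero_less_one])
  then obtain K s2 where K: "\<And>i. 0 < K i" "\<And>i. 0 < s2 i" "\<And>i s. 0 < s \<Longrightarrow> s < s2 i \<Longrightarrow> V s \<le> K i * (sd (l ^ i * s))\<^sup>2"
    by metis
  define s3 where "s3 = Min (insert s1 (s2 ` {..<d}))"
  have s3: "0 < s3" "s3 \<le> s1" "\<And>i. i < d \<Longrightarrow> s3 \<le> s2 i"
    unfolding s3_def using C K(2) by auto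
  \<comment> \<open>The circle about \<open>l ^ i * s\<close> of radius
    \<open>l ^ i * s - s / 2\<close> passes through \<open>s / 2\<close> for every \<open>i\<close>,
    so all energies are compared with \<open>V s\<close>. A point between \<open>3 / 4 * s\<close>
    and \<open>s\<close> is within \<open>\<theta>\<close> times each of these radii of the
    centre.\<close>
  define \<theta> where "\<theta> = 1 - 1 / (4 * l ^ d)"
  have ld: "l ^ d \<ge> 1" using l by simp
  have "1 / (4 * l ^ d) \<le> 1/4" using ld by (simp add: field_simps)
  then have \<theta>: "3/4 \<le> \<theta>" "\<theta> < 1" using ld unfolding \<theta>_def by auto
  \<comment> \<open>Gives \<open>\<theta> ^ (2 * m) \<le> s ^ 6\<close> for
    \<open>real m \<ge> A * ln (1 / s)\<close>; one factor \<open>s\<close> is spent on the division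
    by \<open>\<eta>\<^sup>2\<close>.\<close>
  define A where "A = 3 / ln (1 / \<theta>)"
  have lt: "ln (1 / \<theta>) > 0" using \<theta> by (intro ln_gt_zero) auto
  have A: "A > 0" unfolding A_def using lt by simp
  have "prob (\<Inter>i<d. jensen_event \<theta> (l ^ i * s) (l ^ i * s - s / 2) m) \<le> (C + (\<Sum>i<d. K i)) * s ^ 5"
    if s: "0 < s" "s < s3" and m: "real m \<ge> A * ln (1 / s)" for s m
  proof -
    define \<eta> where "\<eta> = s powr \<kappa>"
    have s1: "s < 1" using s s3 C by linarith
    have "s powr \<kappa> \<le> 1 powr \<kappa>" using s s1 k by (intro powr_mono2) auto
    then have \<eta>: "0 < \<eta>" "\<eta> \<le> 1" using s unfolding \<eta>_def by auto
    have t: "0 < l ^ i * s" "s \<le> l ^ i * s" for i using l s by auto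
    let ?y = "\<lambda>i. \<eta> * sd (l ^ i * s)"
    have y: "?y i > 0" for i using \<eta> sd_pos[OF t(1)] by simp
    let ?B = "\<lambda>i. {\<omega>\<in>space M. ennreal ((?y i)\<^sup>2 / \<theta> ^ (2 * m)) \<le> energy (l ^ i * s) (l ^ i * s - s / 2) \<omega>}"
    have "(\<Inter>i<d. jensen_event \<theta> (l ^ i * s) (l ^ i * s - s / 2) m) \<subseteq> {\<omega>\<in>space M. \<forall>i<d. \<bar>X (l ^ i * s) \<omega>\<bar> \<le> ?y i} \<union> (\<Union>i<d. ?B i)"
    proof
      fix \<omega> assume w: "\<omega> \<in> (\<Inter>i<d. jensen_event \<theta> (l ^ i * s) (l ^ i * s - s / 2) m)"
      then have "\<omega> \<in> {\<omega>\<in>space M. \<bar>X (l ^ i * s) \<omega>\<bar> \<le> ?y i} \<union> ?B i" if "i < d" for i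
        using jensen_event_subset[of \<theta> "?y i"] that \<theta> y by (intro subsetD[OF jensen_event_subset]) auto
      moreover have "\<omega> \<in> space M" using INT_D[OF w, of 0] d(1) unfolding jensen_event_def by simp
      ultimately show "\<omega> \<in> {\<omega>\<in>space M. \<forall>i<d. \<bar>X (l ^ i * s) \<omega>\<bar> \<le> ?y i} \<union> (\<Union>i<d. ?B i)" by auto
    qed
    then have "prob (\<Inter>i<d. jensen_event \<theta> (l ^ i * s) (l ^ i * s - s / 2) m) \<le> prob ({\<omega>\<in>space M. \<forall>i<d. \<bar>X (l ^ i * s) \<omega>\<bar> \<le> ?y i} \<union> (\<Union>i<d. ?B i))"
      by (intro finite_measure_mono) measurable
    also have "\<dots> \<le> prob {\<omega>\<in>space M. \<forall>i<d. \<bar>X (l ^ i * s) \<omega>\<bar> \<le> ?y i} + prob (\<Union>i<d. ?B i)"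
      by (intro measure_Un_le) measurable
    also have "\<dots> \<le> C * \<eta> ^ d + (\<Sum>i<d. K i * s ^ 5)"
    proof (rule add_mono)
      show "prob {\<omega>\<in>space M. \<forall>i<d. \<bar>X (l ^ i * s) \<omega>\<bar> \<le> ?y i} \<le> C * \<eta> ^ d"
        by (rule P[rule_format]) (use s s3 \<eta> in \<open>auto simp: \<eta>_def\<close>)
      have "prob (\<Union>i<d. ?B i) \<le> (\<Sum>i<d. prob (?B i))"
        by (rule finite_measure_subadditive_finite) auto
      also have "\<dots> \<le> (\<Sum>i<d. K i * s ^ 5)"
      proof (rule sum_mono)
        fix i assume i: "i \<in> {..<d}"
        have "prob (?B i) \<le> V (2 * (l ^ i * s - (l ^ i * s - s / 2))) / ((?y i)\<^sup>2 / \<theta> ^ (2 * m))"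
          using t[of i] y[of i] \<theta> s by (intro energy_tail divide_pos_pos zero_less_power) auto
        also have "\<dots> = (\<theta> ^ (2 * m) / \<eta>\<^sup>2) * (V s / (sd (l ^ i * s))\<^sup>2)"
          by (simp add: power_mult_distrib)
        also have "\<dots> \<le> s ^ 5 * K i"
        proof (rule mult_mono)
          show "V s / (sd (l ^ i * s))\<^sup>2 \<le> K i"
            using K(3)[of s i] s s3(3)[of i] i sd_pos[OF t(1)[of i]] by (simp add: divide_le_eq)
          have "\<theta> ^ (2 * m) \<le> s ^ 6"
          proof -
            have "3 * ln (1 / s) \<le> real m * ln (1 / \<theta>)" using m lt unfolding A_def by (simp add: field_simps)
            then have "real (2 * m) * ln \<theta> \<le> real 6 * ln s" using \<theta> s by (simp add: ln_div)
            then have "ln (\<theta> ^ (2 * m)) \<le> ln (s ^ 6)" using \<theta> s by (simp only: ln_realpow)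
            then show ?thesis using \<theta> s by (subst (asm) ln_le_cancel_iff) auto
          qed
          moreover have "s \<le> \<eta>\<^sup>2"
          proof -
            have "s powr 1 \<le> s powr (2 * \<kappa>)" using s s1 k by (intro powr_mono') auto
            then show ?thesis using s unfolding \<eta>_def by (simp add: power2_eq_square powr_add[symmetric])
          qed
          moreover have "s ^ 6 = s ^ 5 * s" by (simp add: eval_nat_numeral)
          moreover have "s ^ 5 * s \<le> s ^ 5 * \<eta>\<^sup>2"
            using \<open>s \<le> \<eta>\<^sup>2\<close> s by (intro mult_left_mono) auto
          ultimately have "\<theta> ^ (2 * m) \<le> s ^ 5 * \<eta>\<^sup>2" by linarith
          then show "\<theta> ^ (2 * m) / \<eta>\<^sup>2 \<le> s ^ 5" using \<eta> by (simp add: divide_le_eq)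
        qed (use s V_pos[OF s(1)] in auto)
        finally show "prob (?B i) \<le> K i * s ^ 5" by (simp add: mult.commute)
      qed
      finally show "prob (\<Union>i<d. ?B i) \<le> (\<Sum>i<d. K i * s ^ 5)" .
    qed
    also have "C * \<eta> ^ d \<le> C * s ^ 5"
    proof -
      have "\<eta> ^ d = s powr (real d * \<kappa>)" using s unfolding \<eta>_def by (simp add: powr_realpow[symmetric] powr_powr mult.commute)
      also have "\<dots> \<le> s powr 5" using s s1 d by (intro powr_mono') auto
      also have "\<dots> = s ^ 5" using s powr_realpow[of s 5] by simp
      finally show ?thesis using C by simp
    qed
    finally show ?thesis by (simp add: sum_distrib_right[symmetric] algebra_simps)
  qed
  moreover have "0 < C + (\<Sum>i<d. K i)" using C K(1) by (intro add_pos_nonneg sum_nonneg) (auto intro: less_imp_le)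
  ultimately show ?thesis using l d A s3 C unfolding \<theta>_def
    by (rule_tac x = l in exI, rule_tac x = d in exI, rule_tac x = A in exI,
        rule_tac x = "C + (\<Sum>i<d. K i)" in exI, rule_tac x = s3 in exI) auto
qed

end

section \<open>Zeros away from the unit circle\<close>

lemma power_series_coeff_bound:
  fixes f :: "complex \<Rightarrow> complex" and a :: "nat \<Rightarrow> complex"
  assumes sums: "\<And>z. norm z < 1 \<Longrightarrow> (\<lambda>n. a n * z ^ n) sums f z" and r: "0 < r" "r < 1"
    and B: "\<And>z. norm z = r \<Longrightarrow> norm (f z) \<le> B"
  shows "norm (a k) * r ^ k \<le> B"
proof -
  have hol: "f holomorphic_on ball 0 1"
    by (rule power_series_holomorphic[where a = a]) (use sums in auto)
  have "\<forall>\<^sub>F u in nhds 0. (\<lambda>n. fps_nth (Abs_fps a) n * u ^ n) sums f u"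
    unfolding eventually_nhds by (rule exI[of _ "ball 0 1"]) (use sums in auto)
  then have "f has_fps_expansion Abs_fps a" by (rule has_fps_expansionI)
  from fps_nth_fps_expansion[OF this, of k] have ak: "a k = (deriv ^^ k) f 0 / fact k" by simp
  have "norm ((deriv ^^ k) f 0) \<le> fact k * B / r ^ k"
  proof (rule Cauchy_inequality)
    show "f holomorphic_on ball 0 r" using hol r by (auto intro: holomorphic_on_subset)
    show "continuous_on (cball 0 r) f" using hol r 
      by (intro holomorphic_on_imp_continuous_on) (auto intro: holomorphic_on_subset)
  qed (use r B in auto)
  then show ?thesis unfolding ak using r by (simp add: norm_divide field_simps)
qed

context random_series
begin

definition majorant :: "real \<Rightarrow> 'a \<Rightarrow> real" where
  "majorant q \<omega> = (\<Sum>k. \<bar>\<xi> k \<omega> * c k\<bar> * q ^ k)"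

lemma majorant_measurable [measurable]: "majorant q \<in> borel_measurable M"
  unfolding majorant_def by measurable

lemma good_summable_majorant:
  assumes "good \<omega>" "0 \<le> q" "q < 1"
  shows "summable (\<lambda>k. \<bar>\<xi> k \<omega> * c k\<bar> * q ^ k)"
  using good_summable_power[OF assms(1), of "of_real q"] assms(2,3) by (simp add: norm_mult norm_power abs_mult)

lemma norm_random_taylor_le:
  assumes "good \<omega>" "norm z \<le> q" "q < 1"
  shows "norm (random_taylor \<xi> c \<omega> z) \<le> majorant q \<omega>"
proof -
  have q: "0 \<le> q" using assms(2) norm_ge_zero order_trans by blast
  have z1: "norm z < 1" using assms(2,3) by linarith
  have "norm (random_taylor \<xi> c \<omega> z) \<le> (\<Sum>k. norm (complex_of_real (\<xi> k \<omega> * c k) * z ^ k))"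
    unfolding random_taylor_def by (rule summable_norm[OF good_summable_power[OF assms(1) z1]])
  also have "\<dots> \<le> majorant q \<omega>"
    unfolding majorant_def
  proof (rule suminf_le)
    fix k
    have "norm z ^ k \<le> q ^ k" using assms by (intro power_mono) auto
    then have "\<bar>\<xi> k \<omega> * c k\<bar> * norm z ^ k \<le> \<bar>\<xi> k \<omega> * c k\<bar> * q ^ k" by (intro mult_left_mono) auto
    then show "norm (complex_of_real (\<xi> k \<omega> * c k) * z ^ k) \<le> \<bar>\<xi> k \<omega> * c k\<bar> * q ^ k"
      by (simp add: norm_mult norm_power abs_mult)
  qed (rule good_summable_power[OF assms(1) z1], rule good_summable_majorant[OF assms(1) q assms(3)])
  finally show ?thesis .
qed

lemma majorant_expectation:
  assumes "0 \<le> q" "q < 1"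
  shows "(\<integral>\<^sup>+\<omega>. ennreal (majorant q \<omega>) \<partial>M) \<le> ennreal (\<Sum>k. \<bar>c k\<bar> * q ^ k)"
proof -
  have "(\<integral>\<^sup>+\<omega>. ennreal (majorant q \<omega>) \<partial>M) = (\<integral>\<^sup>+\<omega>. (\<Sum>k. ennreal (\<bar>\<xi> k \<omega> * c k\<bar> * q ^ k)) \<partial>M)"
    by (rule nn_integral_cong_AE, use AE_good in eventually_elim)
       (use assms in \<open>auto simp: majorant_def intro!: suminf_ennreal2[symmetric] good_summable_majorant\<close>)
  also have "\<dots> = (\<Sum>k. \<integral>\<^sup>+\<omega>. ennreal (\<bar>\<xi> k \<omega> * c k\<bar> * q ^ k) \<partial>M)"
    by (rule nn_integral_suminf) measurable
  also have "\<dots> = (\<Sum>k. ennreal (\<bar>c k\<bar> * q ^ k) * (\<integral>\<^sup>+\<omega>. ennreal \<bar>\<xi> k \<omega>\<bar> \<partial>M))"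
  proof (rule suminf_cong)
    fix k
    have "(\<integral>\<^sup>+\<omega>. ennreal (\<bar>\<xi> k \<omega> * c k\<bar> * q ^ k) \<partial>M) = (\<integral>\<^sup>+\<omega>. ennreal (\<bar>c k\<bar> * q ^ k) * ennreal \<bar>\<xi> k \<omega>\<bar> \<partial>M)"
      using assms by (intro nn_integral_cong) (simp add: ennreal_mult[symmetric] abs_mult mult_ac)
    then show "(\<integral>\<^sup>+\<omega>. ennreal (\<bar>\<xi> k \<omega> * c k\<bar> * q ^ k) \<partial>M) = ennreal (\<bar>c k\<bar> * q ^ k) * (\<integral>\<^sup>+\<omega>. ennreal \<bar>\<xi> k \<omega>\<bar> \<partial>M)"
      by (simp add: nn_integral_cmult)
  qed
  also have "\<dots> \<le> (\<Sum>k. ennreal (\<bar>c k\<bar> * q ^ k) * 1)"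
    by (intro suminf_le mult_left_mono abs_moment_le_1) auto
  also have "\<dots> = ennreal (\<Sum>k. \<bar>c k\<bar> * q ^ k)"
    using assms by (simp add: suminf_ennreal2 summable_abs_coeffs)
  finally show ?thesis .
qed

text \<open>Jensen's inequality is centred at every point \<open>w\<close> of the circle of radius
  \<open>e / 8\<close>, not at a single point, so that Cauchy's inequality turns the bound on the
  series into a bound on each coefficient.\<close>

lemma many_zeros_coeff_bound:
  assumes g: "good \<omega>" and e: "0 < e" "e < 1" and Z: "finite Z" "card Z = m"
    "\<And>x. x \<in> Z \<Longrightarrow> 0 \<le> x \<and> x \<le> 1 - e \<and> random_taylor \<xi> c \<omega> (of_real x) = 0"
  shows "\<bar>\<xi> k \<omega> * c k\<bar> * (e / 8) ^ k \<le> (1 - 3 * e / 8) ^ m * majorant (1 - 3 * e / 8) \<omega>"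
proof -
  define q where "q = 1 - 3 * e / 8"
  have q: "0 < q" "q < 1" using e unfolding q_def by auto
  have maj: "majorant q \<omega> \<ge> 0"
    unfolding majorant_def using g q by (intro suminf_nonneg good_summable_majorant) auto
  have "norm (random_taylor \<xi> c \<omega> w) \<le> q ^ m * majorant q \<omega>" if w: "norm w = e / 8" for w
  proof -
    \<comment> \<open>The disk of radius \<open>R\<close> about \<open>w\<close> stays within norm
      \<open>q = 1 - e / 2 + e / 8\<close>. Zeros in \<open>[0, 1 - e]\<close> are at distance at
      most \<open>1 - e + e / 8\<close> from \<open>w\<close>, which is just below
      \<open>q * R\<close>.\<close>
    define R where "R = 1 - e / 2"
    have R: "R > 0" using e unfolding R_def by simp
    have cb: "norm z \<le> q" if "z \<in> cball w R" for z
    proof -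
      have "norm z \<le> norm w + norm (z - w)" using norm_triangle_ineq[of w "z - w"] by simp
      also have "norm (z - w) \<le> R" using that by (simp add: dist_norm norm_minus_commute)
      finally show ?thesis using w unfolding q_def R_def by simp
    qed
    have inj: "inj_on complex_of_real Z" by (simp add: inj_on_def)
    have "ennreal ((norm (random_taylor \<xi> c \<omega> w))\<^sup>2) \<le> ennreal (q ^ (2 * m)) * circle_energy (random_taylor \<xi> c \<omega>) w R"
    proof (rule jensen_distinct_zeros[where U = "ball 0 1" and X = "complex_of_real ` Z"])
      show "cball w R \<subseteq> ball 0 1" using cb q by (force simp: dist_norm)
      show "card (complex_of_real ` Z) = m" using card_image[OF inj] Z(2) by simp
      fix x assume "x \<in> complex_of_real ` Z"
      then obtain y where y: "y \<in> Z" "x = of_real y" by auto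
      have "dist x w \<le> norm x + norm w" by (simp add: dist_norm norm_triangle_ineq4)
      also have "\<dots> \<le> 1 - e + e / 8" using Z(3)[OF y(1)] y(2) w by simp
      also have "\<dots> \<le> q * R"
      proof -
        have "q * R = 1 - e + e / 8 + 3 * (e * e) / 16" unfolding q_def R_def by (simp add: field_simps)
        then show ?thesis by simp
      qed
      finally show "random_taylor \<xi> c \<omega> x = 0 \<and> dist x w \<le> q * R" using Z(3)[OF y(1)] y(2) by simp
    qed (use Z R q good_holomorphic[OF g] in auto)
    also have "circle_energy (random_taylor \<xi> c \<omega>) w R \<le> ennreal ((majorant q \<omega>)\<^sup>2)"
    proof -
      have "circle_energy (random_taylor \<xi> c \<omega>) w R \<le> (\<integral>\<^sup>+t. ennreal ((majorant q \<omega>)\<^sup>2) * indicator {0..1::real} t \<partial>lborel)"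
        unfolding circle_energy_def
      proof (intro nn_integral_mono mult_right_mono ennreal_leI power_mono)
        fix t :: real
        have "w + of_real R * exp (2 * of_real pi * \<i> * of_real t) \<in> cball w R"
          using R by (simp add: dist_norm norm_mult)
        from cb[OF this] show "norm (random_taylor \<xi> c \<omega> (w + of_real R * exp (2 * of_real pi * \<i> * of_real t))) \<le> majorant q \<omega>"
          by (intro norm_random_taylor_le g q)
      qed auto
      also have "\<dots> = ennreal ((majorant q \<omega>)\<^sup>2)" by (subst nn_integral_cmult_indicator) auto
      finally show ?thesis .
    qed
    then have "ennreal (q ^ (2 * m)) * circle_energy (random_taylor \<xi> c \<omega>) w R \<le> ennreal (q ^ (2 * m)) * ennreal ((majorant q \<omega>)\<^sup>2)"
      by (rule mult_left_mono) simp
    also have "\<dots> = ennreal ((q ^ m * majorant q \<omega>)\<^sup>2)"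
      using q by (simp add: ennreal_mult[symmetric] power_mult_distrib power_mult[symmetric] mult.commute)
    finally have "(norm (random_taylor \<xi> c \<omega> w))\<^sup>2 \<le> (q ^ m * majorant q \<omega>)\<^sup>2"
      by (simp add: ennreal_le_iff)
    then show ?thesis by (rule power2_le_imp_le) (use q maj in auto)
  qed
  moreover have sums: "(\<lambda>n. complex_of_real (\<xi> n \<omega> * c n) * z ^ n) sums random_taylor \<xi> c \<omega> z" if "norm z < 1" for z
    unfolding random_taylor_def by (rule summable_sums[OF good_summable[OF g that]])
  ultimately have "norm (complex_of_real (\<xi> k \<omega> * c k)) * (e / 8) ^ k \<le> q ^ m * majorant q \<omega>"
    using e by (intro power_series_coeff_bound[OF sums]) auto
  then show ?thesis unfolding q_def by (simp only: norm_of_real)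
qed

lemma nontrivial: "\<exists>\<delta>>0. prob {\<omega>\<in>space M. \<bar>\<xi> 0 \<omega>\<bar> < \<delta>} < 1"
proof (rule ccontr)
  assume "\<not> ?thesis"
  then have one: "prob {\<omega>\<in>space M. \<bar>\<xi> 0 \<omega>\<bar> < \<delta>} = 1" if "\<delta> > 0" for \<delta>
    using that prob_le_1[of "{\<omega>\<in>space M. \<bar>\<xi> 0 \<omega>\<bar> < \<delta>}"] by (meson linorder_not_less order_antisym)
  have "AE \<omega> in M. \<bar>\<xi> 0 \<omega>\<bar> < 1 / real (Suc n)" for n
    using one[of "1 / real (Suc n)"] prob_Collect_eq_1[of "\<lambda>\<omega>. \<bar>\<xi> 0 \<omega>\<bar> < 1 / real (Suc n)"] by simp
  then have "AE \<omega> in M. \<forall>n. \<bar>\<xi> 0 \<omega>\<bar> < 1 / real (Suc n)" unfolding AE_all_countable by blast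
  then have "AE \<omega> in M. (\<xi> 0 \<omega>)\<^sup>2 = 0"
  proof eventually_elim
    case (elim \<omega>)
    have "\<not> \<bar>\<xi> 0 \<omega>\<bar> > 0" using elim nat_approx_posE by (metis not_less_iff_gr_or_eq of_nat_Suc)
    then show ?case by simp
  qed
  then have "expectation (\<lambda>\<omega>. (\<xi> 0 \<omega>)\<^sup>2) = expectation (\<lambda>\<omega>. 0)"
    by (intro integral_cong_AE) auto
  then show False using second_moment_0 by simp
qed

lemma prob_block_small:
  "prob {\<omega>\<in>space M. \<forall>k\<in>{a..<a + j}. \<bar>\<xi> k \<omega>\<bar> < \<delta>} = (prob {\<omega>\<in>space M. \<bar>\<xi> 0 \<omega>\<bar> < \<delta>}) ^ j"
proof (cases "j = 0")
  case True
  then show ?thesis by (simp add: prob_space)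
next
  case False
  have same: "prob {\<omega>\<in>space M. \<bar>\<xi> k \<omega>\<bar> < \<delta>} = prob {\<omega>\<in>space M. \<bar>\<xi> 0 \<omega>\<bar> < \<delta>}" for k
  proof -
    have "prob (\<xi> k -` {x. \<bar>x\<bar> < \<delta>} \<inter> space M) = measure (distr M borel (\<xi> k)) {x. \<bar>x\<bar> < \<delta>}" for k
      by (rule measure_distr[symmetric]) auto
    then show ?thesis using ident[of k] by (simp add: vimage_def Int_def conj_commute)
  qed
  have "prob (\<Inter>k\<in>{a..<a + j}. \<xi> k -` {x. \<bar>x\<bar> < \<delta>} \<inter> space M) = (\<Prod>k\<in>{a..<a + j}. prob (\<xi> k -` {x. \<bar>x\<bar> < \<delta>} \<inter> space M))"
    by (rule indep_varsD[OF indep]) (use False in auto)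
  also have "\<dots> = (\<Prod>k\<in>{a..<a + j}. prob {\<omega>\<in>space M. \<bar>\<xi> 0 \<omega>\<bar> < \<delta>})"
    using same by (intro prod.cong refl) (simp add: vimage_def Int_def conj_commute)
  also have "(\<Inter>k\<in>{a..<a + j}. \<xi> k -` {x. \<bar>x\<bar> < \<delta>} \<inter> space M) = {\<omega>\<in>space M. \<forall>k\<in>{a..<a + j}. \<bar>\<xi> k \<omega>\<bar> < \<delta>}"
    using False by auto
  finally show ?thesis by simp
qed

end

lemma suminf_exp_tail_le:
  fixes y :: real
  assumes "0 < y" "y \<le> 1"
  shows "summable (\<lambda>m. exp (- (y * real (m + N))))" "(\<Sum>m. exp (- (y * real (m + N)))) \<le> 2 / y * exp (- (y * real N))"
proof -
  have eq: "exp (- (y * real (m + N))) = exp (- (y * real N)) * exp (- y) ^ m" for m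
    by (simp add: exp_of_nat_mult[symmetric] exp_add[symmetric] algebra_simps)
  have s: "(\<lambda>m. exp (- (y * real N)) * exp (- y) ^ m) sums (exp (- (y * real N)) * (1 / (1 - exp (- y))))"
    using assms by (intro sums_mult geometric_sums) auto
  show "summable (\<lambda>m. exp (- (y * real (m + N))))" unfolding eq using s by (rule sums_summable)
  have "(1 + y) * (1 - y / 2) \<ge> 1" using assms mult_left_mono[of y 1 y] by (simp add: algebra_simps)
  moreover have "(1 + y) * (1 - y / 2) \<le> exp y * (1 - y / 2)"
    using assms exp_ge_add_one_self[of y] by (intro mult_right_mono) auto
  ultimately have "exp (- y) \<le> 1 - y / 2" by (simp add: exp_minus field_simps)
  then have "1 / (1 - exp (- y)) \<le> 2 / y" using assms by (simp add: field_simps)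
  then have "exp (- (y * real N)) * (1 / (1 - exp (- y))) \<le> exp (- (y * real N)) * (2 / y)" by (intro mult_left_mono) auto
  then show "(\<Sum>m. exp (- (y * real (m + N)))) \<le> 2 / y * exp (- (y * real N))"
    unfolding eq using s by (simp add: sums_iff mult.commute)
qed

context random_series
begin

text \<open>Either the first block of coefficients is exceptionally small, or the majorant is
  exceptionally large.\<close>

definition crude_event :: "nat \<Rightarrow> real \<Rightarrow> real \<Rightarrow> real \<Rightarrow> nat \<Rightarrow> 'a set" where
  "crude_event k0 c0 \<delta> e m = 
     {\<omega>\<in>space M. \<forall>k\<in>{k0..<k0 + nat \<lfloor>e\<^sup>2 * real m / 100\<rfloor>}. \<bar>\<xi> k \<omega>\<bar> < \<delta>} \<union>
     {\<omega>\<in>space M. \<delta> * c0 * (exp (-1) * (e / 8)) ^ (k0 + nat \<lfloor>e\<^sup>2 * real m / 100\<rfloor>) / (1 - 3 * e / 8) ^ m \<le> majorant (1 - 3 * e / 8) \<omega>}"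

lemma crude_event_sets [measurable]: "crude_event k0 c0 \<delta> e m \<in> sets M"
  unfolding crude_event_def by measurable

text \<open>If the block contains some \<open>\<xi> k\<close> of size at least
  \<open>\<delta>\<close>, the lower bound for \<open>c k\<close> and the coefficient bound for
  \<open>m\<close> zeros leave only a huge majorant.\<close>

lemma crude_eventI:
  assumes g: "good \<omega>" "\<omega> \<in> space M" and e: "0 < e" "e < 1" and Z: "finite Z" "card Z = m"
    "\<And>x. x \<in> Z \<Longrightarrow> 0 \<le> x \<and> x \<le> 1 - e \<and> random_taylor \<xi> c \<omega> (of_real x) = 0"
    and c0: "c0 > 0" "\<And>k. k \<ge> k0 \<Longrightarrow> \<bar>c k\<bar> \<ge> c0 * exp (- real k)" and \<delta>: "\<delta> > 0"
  shows "\<omega> \<in> crude_event k0 c0 \<delta> e m"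
proof (rule ccontr)
  assume no: "\<omega> \<notin> crude_event k0 c0 \<delta> e m"
  let ?j = "nat \<lfloor>e\<^sup>2 * real m / 100\<rfloor>" and ?q = "1 - 3 * e / 8"
  have q: "?q > 0" using e by simp
  obtain k where k: "k \<ge> k0" "k < k0 + ?j" "\<bar>\<xi> k \<omega>\<bar> \<ge> \<delta>"
    using no g(2) unfolding crude_event_def by (auto simp: not_less)
  have "\<delta> * c0 * (exp (-1) * (e / 8)) ^ (k0 + ?j) \<le> \<delta> * c0 * (exp (-1) * (e / 8)) ^ k"
    using k e c0 \<delta> mult_le_one[of "exp (-1)" "e / 8"] by (intro mult_left_mono power_decreasing) auto
  also have "\<dots> = \<delta> * (c0 * exp (- real k)) * (e / 8) ^ k"
  proof -
    have "(exp (-1) * (e / 8)) ^ k = exp (- real k) * (e / 8) ^ k"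
      by (simp only: power_mult_distrib exp_of_nat_mult[symmetric] mult_minus_right mult_1_right)
    then show ?thesis by (simp only: mult.assoc)
  qed
  also have "\<dots> \<le> \<bar>\<xi> k \<omega>\<bar> * \<bar>c k\<bar> * (e / 8) ^ k"
    using k c0 \<delta> e by (intro mult_right_mono mult_mono) auto
  also have "\<dots> \<le> ?q ^ m * majorant ?q \<omega>"
    using many_zeros_coeff_bound[OF g(1) e Z, of k] by (simp add: abs_mult)
  finally have "\<delta> * c0 * (exp (-1) * (e / 8)) ^ (k0 + ?j) / ?q ^ m \<le> majorant ?q \<omega>"
    using q by (simp add: divide_le_eq mult.commute)
  then show False using no g(2) unfolding crude_event_def by auto
qed

lemma majorant_tail:
  assumes "0 \<le> q" "q < 1" "x > 0"
  shows "prob {\<omega>\<in>space M. x \<le> majorant q \<omega>} \<le> (\<Sum>k. \<bar>c k\<bar> * q ^ k) / x"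
proof -
  have sum0: "(\<Sum>k. \<bar>c k\<bar> * q ^ k) \<ge> 0"
    using assms by (intro suminf_nonneg summable_abs_coeffs) auto
  have "{\<omega>\<in>space M. x \<le> majorant q \<omega>} \<subseteq> {\<omega>\<in>space M. 1 \<le> ennreal (1 / x) * ennreal (majorant q \<omega>)}"
    using assms(3) by (auto simp: ennreal_mult'[symmetric] field_simps)
  then have "emeasure M {\<omega>\<in>space M. x \<le> majorant q \<omega>} \<le> emeasure M {\<omega>\<in>space M. 1 \<le> ennreal (1 / x) * ennreal (majorant q \<omega>)}"
    by (intro emeasure_mono) measurable
  also have "\<dots> \<le> ennreal (1 / x) * (\<integral>\<^sup>+\<omega>. ennreal (majorant q \<omega>) * indicator (space M) \<omega> \<partial>M)"
    by (rule nn_integral_Markov_inequality) auto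
  also have "(\<integral>\<^sup>+\<omega>. ennreal (majorant q \<omega>) * indicator (space M) \<omega> \<partial>M) = (\<integral>\<^sup>+\<omega>. ennreal (majorant q \<omega>) \<partial>M)"
    by (intro nn_integral_cong) auto
  also have "ennreal (1 / x) * \<dots> \<le> ennreal (1 / x) * ennreal (\<Sum>k. \<bar>c k\<bar> * q ^ k)"
    by (intro mult_left_mono majorant_expectation assms) auto
  also have "\<dots> = ennreal ((\<Sum>k. \<bar>c k\<bar> * q ^ k) / x)"
    using assms sum0 by (simp add: ennreal_mult[symmetric])
  finally show ?thesis using assms sum0 by (simp add: emeasure_eq_measure)
qed

text \<open>The block length, about \<open>e\<^sup>2 * real m / 100\<close>, is a compromise. It is
  long enough for independence to give decay in \<open>e\<^sup>2 * real m\<close>, and short enough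
  that the loss \<open>(8 / e * exp 1) ^ j\<close> is at most \<open>exp (e * real m / 8)\<close>.
  The gain \<open>(1 - 3 * e / 8) ^ m \<le> exp (- (3 * e / 8 * real m))\<close> beats this and
  leaves \<open>exp (- (e / 4 * real m))\<close>.\<close>

lemma crude_event_prob:
  assumes "c0 > 0" "\<delta> > 0" and p1: "prob {\<omega>\<in>space M. \<bar>\<xi> 0 \<omega>\<bar> < \<delta>} < 1"
  shows "\<exists>K b B e0. 0 < K \<and> 0 < B \<and> 0 < b \<and> 0 < e0 \<and> e0 < 1 \<and> (\<forall>e m. 0 < e \<longrightarrow> e < e0 \<longrightarrow>
    prob (crude_event k0 c0 \<delta> e m) \<le> K * exp (- (b * e\<^sup>2 * real m)) + K * e powr (- B) * exp (8 * real k0 / e) * exp (- (e / 4 * real m)))"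
proof -
  obtain B C v0 where BC: "C > 0" "v0 > 0" "B > 0" "\<And>u. 0 < u \<Longrightarrow> u \<le> v0 \<Longrightarrow> (\<Sum>k. \<bar>c k\<bar> * exp (- (u * real k))) \<le> C * u powr (- B)"
    using abs_coeffs_poly_bound by blast
  \<comment> \<open>The lower bound \<open>1/2\<close> keeps \<open>p\<close> positive, so that its
    logarithm is meaningful.\<close>
  define p where "p = max (1/2) (prob {\<omega>\<in>space M. \<bar>\<xi> 0 \<omega>\<bar> < \<delta>})"
  have p: "0 < p" "p < 1" "prob {\<omega>\<in>space M. \<bar>\<xi> 0 \<omega>\<bar> < \<delta>} \<le> p" using p1 unfolding p_def by auto
  define b where "b = - ln p"
  have b: "b > 0" "p = exp (- b)" using p unfolding b_def by auto
  define K where "K = max (exp b) (C * (3/8) powr (- B) / (\<delta> * c0))"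
  define e0 where "e0 = min (1/2) v0"
  have "prob (crude_event k0 c0 \<delta> e m) \<le> K * exp (- (b / 100 * e\<^sup>2 * real m)) + K * e powr (- B) * exp (8 * real k0 / e) * exp (- (e / 4 * real m))"
    if e: "0 < e" "e < e0" for e m
  proof -
    let ?j = "nat \<lfloor>e\<^sup>2 * real m / 100\<rfloor>" and ?q = "1 - 3 * e / 8"
    have e1: "e < 1" "e \<le> v0" using e unfolding e0_def by auto
    have q: "0 < ?q" "?q < 1" using e e1 by auto
    have "0 \<le> e\<^sup>2 * real m / 100" by simp
    then have j: "real ?j \<le> e\<^sup>2 * real m / 100" "real ?j \<ge> e\<^sup>2 * real m / 100 - 1" by linarith+
    let ?n = "k0 + ?j"
    define x where "x = \<delta> * c0 * (exp (-1) * (e / 8)) ^ ?n / ?q ^ m"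
    have x: "x > 0" unfolding x_def using assms q e by simp
    have "prob (crude_event k0 c0 \<delta> e m) \<le> prob {\<omega>\<in>space M. \<forall>k\<in>{k0..<k0 + ?j}. \<bar>\<xi> k \<omega>\<bar> < \<delta>} + prob {\<omega>\<in>space M. x \<le> majorant ?q \<omega>}"
      unfolding crude_event_def x_def by (intro measure_Un_le) measurable
    also have "prob {\<omega>\<in>space M. \<forall>k\<in>{k0..<k0 + ?j}. \<bar>\<xi> k \<omega>\<bar> < \<delta>} \<le> p ^ ?j"
      unfolding prob_block_small using p by (intro power_mono) auto
    also have "p ^ ?j \<le> K * exp (- (b / 100 * e\<^sup>2 * real m))"
    proof -
      have "p ^ ?j = exp (- (b * real ?j))" unfolding b(2) by (simp add: exp_of_nat_mult[symmetric] mult.commute)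
      also have "\<dots> \<le> exp (b + - (b / 100 * e\<^sup>2 * real m))"
        using mult_left_mono[OF j(2), of b] b(1) by (simp add: algebra_simps)
      also have "\<dots> = exp b * exp (- (b / 100 * e\<^sup>2 * real m))" by (rule exp_add)
      also have "\<dots> \<le> K * exp (- (b / 100 * e\<^sup>2 * real m))" unfolding K_def by (intro mult_right_mono) auto
      finally show ?thesis .
    qed
    also have "prob {\<omega>\<in>space M. x \<le> majorant ?q \<omega>} \<le> (\<Sum>k. \<bar>c k\<bar> * ?q ^ k) / x"
      using q x by (intro majorant_tail) auto
    also have "\<dots> \<le> (C * (3 * e / 8) powr (- B)) * (1 / x)"
    proof -
      have "(\<Sum>k. \<bar>c k\<bar> * ?q ^ k) \<le> (\<Sum>k. \<bar>c k\<bar> * exp (- (3 * e / 8 * real k)))"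
      proof (rule suminf_le)
        fix k
        have "?q ^ k \<le> exp (- (3 * e / 8)) ^ k" using exp_ge_add_one_self[of "- (3 * e / 8)"] q by (intro power_mono) auto
        then show "\<bar>c k\<bar> * ?q ^ k \<le> \<bar>c k\<bar> * exp (- (3 * e / 8 * real k))"
          unfolding exp_minus_mult_nat by (intro mult_left_mono) auto
      qed (use q e in \<open>auto intro!: summable_abs_coeffs summable_abs_coeffs_exp simp del: times_divide_eq_left\<close>)
      also have "\<dots> \<le> C * (3 * e / 8) powr (- B)" using e e1 by (intro BC(4)) auto
      finally show ?thesis using x by (simp add: divide_right_mono)
    qed
    also have "C * (3 * e / 8) powr (- B) * (1 / x) \<le> C * (3 * e / 8) powr (- B) * (1 / (\<delta> * c0) * (exp (8 * real k0 / e) * exp (- (e / 4 * real m))))"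
    proof (rule mult_left_mono)
    show "1 / x \<le> 1 / (\<delta> * c0) * (exp (8 * real k0 / e) * exp (- (e / 4 * real m)))"
    proof -
      have "8 / e * exp 1 \<le> exp (8 / e)"
      proof -
        have "8 / e \<le> exp (8 / e - 1)" using exp_ge_add_one_self[of "8 / e - 1"] by simp
        then have "8 / e * exp 1 \<le> exp (8 / e - 1) * exp 1" by (intro mult_right_mono) auto
        then show ?thesis by (simp add: exp_add[symmetric])
      qed
      then have "(8 / e * exp 1) ^ ?n \<le> exp (8 / e) ^ ?n" using e by (intro power_mono) auto
      also have "\<dots> = exp (real ?n * (8 / e))" by (rule exp_of_nat_mult[symmetric])
      finally have 1: "(8 / e * exp 1) ^ ?n \<le> exp (real ?n * (8 / e))" .
      have 2: "?q ^ m \<le> exp (- (3 * e / 8 * real m))"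
        unfolding exp_minus_mult_nat using exp_ge_add_one_self[of "- (3 * e / 8)"] q by (intro power_mono) auto
      have "1 / x = 1 / (\<delta> * c0) * ((8 / e * exp 1) ^ ?n * ?q ^ m)"
      proof -
        have "(exp (-1) * (e / 8)) ^ ?n * (8 / e * exp 1) ^ ?n = 1"
          unfolding power_mult_distrib[symmetric] using e by (simp add: exp_minus)
        then have "1 / (exp (-1) * (e / 8)) ^ ?n = (8 / e * exp 1) ^ ?n"
          by (metis mult_zero_left nonzero_eq_divide_eq zero_neq_one mult.commute)
        moreover have "1 / x = 1 / (\<delta> * c0) * (1 / (exp (-1) * (e / 8)) ^ ?n * ?q ^ m)" unfolding x_def by simp
        ultimately show ?thesis by simp
      qed
      also have "\<dots> \<le> 1 / (\<delta> * c0) * (exp (real ?n * (8 / e)) * exp (- (3 * e / 8 * real m)))"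
        using 1 2 assms q by (intro mult_left_mono mult_mono) auto
      also have "\<dots> \<le> 1 / (\<delta> * c0) * (exp (8 * real k0 / e) * exp (- (e / 4 * real m)))"
      proof (rule mult_left_mono)
        have "real ?j * (8 / e) \<le> (e\<^sup>2 * real m / 100) * (8 / e)" using j(1) e by (intro mult_right_mono) auto
        also have "\<dots> = e * real m * (8 / 100)" using e by (simp add: power2_eq_square)
        also have "\<dots> \<le> e * real m * (1 / 8)" using e by (intro mult_left_mono) auto
        finally have "real ?j * (8 / e) \<le> e * real m / 8" by simp
        then have "real ?n * (8 / e) + - (3 * e / 8 * real m) \<le> 8 * real k0 / e + - (e / 4 * real m)"
          by (simp add: algebra_simps)
        then show "exp (real ?n * (8 / e)) * exp (- (3 * e / 8 * real m)) \<le> exp (8 * real k0 / e) * exp (- (e / 4 * real m))"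
          unfolding exp_add[symmetric] by simp
      qed (use assms in auto)
      finally show "1 / x \<le> 1 / (\<delta> * c0) * (exp (8 * real k0 / e) * exp (- (e / 4 * real m)))" .
    qed
    qed (use BC in auto)
    also have "C * (3 * e / 8) powr (- B) * (1 / (\<delta> * c0) * (exp (8 * real k0 / e) * exp (- (e / 4 * real m)))) =
       (C * (3/8) powr (- B) / (\<delta> * c0)) * e powr (- B) * exp (8 * real k0 / e) * exp (- (e / 4 * real m))"
      using e powr_mult[of "3/8" e "- B"] by simp
    also have "\<dots> \<le> K * e powr (- B) * exp (8 * real k0 / e) * exp (- (e / 4 * real m))"
      unfolding K_def by (intro mult_right_mono) auto
    finally show ?thesis using BC(1) by simp
  qed
  moreover have "K > 0" unfolding K_def by (simp add: less_max_iff_disj)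
  moreover have "0 < e0" "e0 < 1" using BC unfolding e0_def by auto
  ultimately show ?thesis using b(1) BC(3)
    by (rule_tac x = K in exI, rule_tac x = "b / 100" in exI, rule_tac x = B in exI, rule_tac x = e0 in exI) auto
qed

text \<open>The events \<open>E e m\<close> capture \<open>m\<close> zeros in \<open>[0, 1 - e]\<close>.\<close>

lemma crude_zeros_bound:
  "\<exists>E e0. 0 < e0 \<and> e0 < 1 \<and> (\<forall>e m. E e m \<in> sets M) \<and>
    (\<forall>e m \<omega> Z. 0 < e \<longrightarrow> e < e0 \<longrightarrow> good \<omega> \<longrightarrow> \<omega> \<in> space M \<longrightarrow> finite Z \<longrightarrow> card Z = m \<longrightarrow>
       (\<forall>x\<in>Z. 0 \<le> x \<and> x \<le> 1 - e \<and> random_taylor \<xi> c \<omega> (of_real x) = 0) \<longrightarrow> \<omega> \<in> E e m) \<and>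
    (\<forall>e. 0 < e \<longrightarrow> e < e0 \<longrightarrow> summable (\<lambda>m. prob (E e m))) \<and>
    ((\<lambda>e. \<Sum>m. prob (E e (m + nat \<lceil>1 / e ^ 4\<rceil>))) \<longlongrightarrow> 0) (at_right 0)"
proof -
  obtain k0 c0 where c0: "c0 > 0" "\<And>k. k \<ge> k0 \<Longrightarrow> \<bar>c k\<bar> \<ge> c0 * exp (- real k)" using coeff_lower by blast
  obtain \<delta> where \<delta>: "\<delta> > 0" "prob {\<omega>\<in>space M. \<bar>\<xi> 0 \<omega>\<bar> < \<delta>} < 1" using nontrivial by blast
  obtain K b B e0 where K: "0 < K" "0 < b" "0 < e0" "e0 < 1" and B: "0 < B" and
    P: "\<And>e m. 0 < e \<Longrightarrow> e < e0 \<Longrightarrow> prob (crude_event k0 c0 \<delta> e m) \<le> K * exp (- (b * e\<^sup>2 * real m)) + K * e powr (- B) * exp (8 * real k0 / e) * exp (- (e / 4 * real m))"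
    using crude_event_prob[OF c0(1) \<delta>, of k0] by blast
  define E where "E = crude_event k0 c0 \<delta>"
  \<comment> \<open>Ensures \<open>b * e\<^sup>2 \<le> 1\<close>, as
    \<open>suminf_exp_tail_le\<close> requires.\<close>
  define e1 where "e1 = min e0 (1 / (1 + b))"
  have e1: "0 < e1" "e1 < 1" "e1 \<le> e0" using K unfolding e1_def by auto
  have be: "0 < b * e\<^sup>2" "b * e\<^sup>2 \<le> 1" if "0 < e" "e < e1" for e
  proof -
    show "0 < b * e\<^sup>2" using K that by simp
    have "e < 1 / (1 + b)" using that unfolding e1_def by simp
    then have "b * e \<le> 1" using K that by (simp add: field_simps)
    moreover have "e\<^sup>2 \<le> e" using that e1 by (simp add: power2_eq_square mult_left_le)
    then have "b * e\<^sup>2 \<le> b * e" using K by simp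
    ultimately show "b * e\<^sup>2 \<le> 1" by linarith
  qed
  have bound_sums: "summable (\<lambda>m. K * exp (- (b * e\<^sup>2 * real (m + N))) + K * e powr (- B) * exp (8 * real k0 / e) * exp (- (e / 4 * real (m + N))))"
     "(\<Sum>m. K * exp (- (b * e\<^sup>2 * real (m + N))) + K * e powr (- B) * exp (8 * real k0 / e) * exp (- (e / 4 * real (m + N)))) \<le>
        K * (2 / (b * e\<^sup>2) * exp (- (b * e\<^sup>2 * real N))) + K * e powr (- B) * exp (8 * real k0 / e) * (2 / (e / 4) * exp (- (e / 4 * real N)))"
    if e: "0 < e" "e < e1" for e N
  proof -
    note s1 = suminf_exp_tail_le[OF be[OF e], of N]
    have "0 < e / 4" "e / 4 \<le> 1" using e e1 by auto
    note s2 = suminf_exp_tail_le[OF this, of N]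
    show "summable (\<lambda>m. K * exp (- (b * e\<^sup>2 * real (m + N))) + K * e powr (- B) * exp (8 * real k0 / e) * exp (- (e / 4 * real (m + N))))"
      by (intro summable_add summable_mult s1 s2)
    have "(\<Sum>m. K * exp (- (b * e\<^sup>2 * real (m + N))) + K * e powr (- B) * exp (8 * real k0 / e) * exp (- (e / 4 * real (m + N)))) =
      K * (\<Sum>m. exp (- (b * e\<^sup>2 * real (m + N)))) + K * e powr (- B) * exp (8 * real k0 / e) * (\<Sum>m. exp (- (e / 4 * real (m + N))))"
      by (subst suminf_add[symmetric]) (intro summable_mult s1 s2 | simp only: suminf_mult s1 s2)+
    also have "\<dots> \<le> K * (2 / (b * e\<^sup>2) * exp (- (b * e\<^sup>2 * real N))) + K * e powr (- B) * exp (8 * real k0 / e) * (2 / (e / 4) * exp (- (e / 4 * real N)))"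
      using K by (intro add_mono mult_left_mono s1 s2) auto
    finally show "(\<Sum>m. K * exp (- (b * e\<^sup>2 * real (m + N))) + K * e powr (- B) * exp (8 * real k0 / e) * exp (- (e / 4 * real (m + N)))) \<le>
        K * (2 / (b * e\<^sup>2) * exp (- (b * e\<^sup>2 * real N))) + K * e powr (- B) * exp (8 * real k0 / e) * (2 / (e / 4) * exp (- (e / 4 * real N)))" .
  qed
  have summ: "summable (\<lambda>m. prob (E e (m + N)))" if e: "0 < e" "e < e1" for e N
  proof (rule summable_comparison_test'[OF bound_sums(1)[OF e, of N]])
    show "norm (prob (E e (m + N))) \<le> K * exp (- (b * e\<^sup>2 * real (m + N))) + K * e powr (- B) * exp (8 * real k0 / e) * exp (- (e / 4 * real (m + N)))" for m
      unfolding E_def using P[of e "m + N"] e e1 by (simp del: of_nat_add)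
  qed
  have lim: "((\<lambda>e. \<Sum>m. prob (E e (m + nat \<lceil>1 / e ^ 4\<rceil>))) \<longlongrightarrow> 0) (at_right 0)"
  proof (rule tendsto_sandwich[OF _ _ tendsto_const])
    \<comment> \<open>From index \<open>1 / e ^ 4\<close> on, the two exponents are at least
      \<open>b / e\<^sup>2\<close> and \<open>1 / (4 * e ^ 3)\<close>. The latter outweighs the
      growth \<open>exp (8 * real k0 / e)\<close>, and both outweigh the powers of
      \<open>1 / e\<close>; this is the reason for the fourth power.\<close>
    define up where "up e = K * (2 / (b * e\<^sup>2) * exp (- (b * (1 / e\<^sup>2)))) + K * e powr (- B) * exp (8 * (real k0 + 1) / e) * (8 / e * exp (- (1 / (4 * e ^ 3))))" for e :: real
    have near: "\<forall>\<^sub>F e in at_right 0. 0 < e \<and> e < e1" 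
      using e1 by (auto simp: eventually_at_right_field)
    then show "\<forall>\<^sub>F e in at_right 0. 0 \<le> (\<Sum>m. prob (E e (m + nat \<lceil>1 / e ^ 4\<rceil>)))"
      by eventually_elim (auto intro!: suminf_nonneg summ)
    show "\<forall>\<^sub>F e in at_right 0. (\<Sum>m. prob (E e (m + nat \<lceil>1 / e ^ 4\<rceil>))) \<le> up e"
      using near
    proof eventually_elim
      case (elim e)
      let ?N = "nat \<lceil>1 / e ^ 4\<rceil>"
      have N: "1 / e ^ 4 \<le> real ?N" by linarith
      have le: "(\<Sum>m. prob (E e (m + ?N))) \<le> (\<Sum>m. K * exp (- (b * e\<^sup>2 * real (m + ?N))) + K * e powr (- B) * exp (8 * real k0 / e) * exp (- (e / 4 * real (m + ?N))))"
      proof (rule suminf_le)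
        show "prob (E e (m + ?N)) \<le> K * exp (- (b * e\<^sup>2 * real (m + ?N))) + K * e powr (- B) * exp (8 * real k0 / e) * exp (- (e / 4 * real (m + ?N)))" for m
          unfolding E_def by (rule P) (use elim e1 in auto)
      qed (rule summ bound_sums(1); use elim in blast)+
      note le
      also have "(\<Sum>m. K * exp (- (b * e\<^sup>2 * real (m + ?N))) + K * e powr (- B) * exp (8 * real k0 / e) * exp (- (e / 4 * real (m + ?N)))) \<le>
          K * (2 / (b * e\<^sup>2) * exp (- (b * e\<^sup>2 * real ?N))) + K * e powr (- B) * exp (8 * real k0 / e) * (2 / (e / 4) * exp (- (e / 4 * real ?N)))"
        by (rule bound_sums(2)) (use elim in auto)
      also have "\<dots> \<le> up e"
      proof -
        have "b * (1 / e\<^sup>2) = b * e\<^sup>2 * (1 / e ^ 4)" using elim by (simp add: eval_nat_numeral)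
        also have "\<dots> \<le> b * e\<^sup>2 * real ?N" using N K by (intro mult_left_mono) auto
        finally have a: "exp (- (b * e\<^sup>2 * real ?N)) \<le> exp (- (b * (1 / e\<^sup>2)))" by simp
        have "1 / (4 * e ^ 3) = e / 4 * (1 / e ^ 4)" using elim by (simp add: eval_nat_numeral)
        also have "\<dots> \<le> e / 4 * real ?N" using N elim by (intro mult_left_mono) auto
        finally have a2: "exp (- (e / 4 * real ?N)) \<le> exp (- (1 / (4 * e ^ 3)))" by simp
        have a3: "exp (8 * real k0 / e) \<le> exp (8 * (real k0 + 1) / e)" using elim by (simp add: divide_right_mono)
        have "2 / (e / 4) = 8 / e" by simp
        then show ?thesis unfolding up_def using elim K
          by (intro add_mono mult_mono a a2 a3 order_refl mult_nonneg_nonneg) auto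
      qed
      finally show ?case .
    qed
    \<comment> \<open>The shift from \<open>k0\<close> to \<open>k0 + 1\<close> provides a strictly
      positive parameter for the asymptotic expansion.\<close>
    define k where "k = real k0 + 1"
    have k: "k > 0" unfolding k_def by simp
    show "(up \<longlongrightarrow> 0) (at_right 0)"
      unfolding up_def k_def[symmetric] using K(1,2) B k by real_asymp
  qed
  show ?thesis
  proof (rule exI[of _ E], rule exI[of _ e1], intro conjI allI impI)
    show "E e m \<in> sets M" for e m unfolding E_def by measurable
    show "summable (\<lambda>m. prob (E e m))" if "0 < e" "e < e1" for e using summ[OF that, of 0] by simp
    show "\<omega> \<in> E e m" if "0 < e" "e < e1" "good \<omega>" "\<omega> \<in> space M" "finite Z" "card Z = m"
       "\<forall>x\<in>Z. 0 \<le> x \<and> x \<le> 1 - e \<and> random_taylor \<xi> c \<omega> (of_real x) = 0" for e m \<omega> and Z :: "real set"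
      unfolding E_def by (rule crude_eventI[where Z = Z]) (use that c0 \<delta> e1 in auto)
  qed (use e1 lim in auto)
qed

end

section \<open>Zeros in short intervals\<close>

lemma emeasure_count_image:
  assumes "inj_on f Z"
  shows "emeasure (count_space UNIV) (f ` Z) = emeasure (count_space UNIV) Z"
  using assms by (simp add: emeasure_count_space card_image finite_image_iff)

text \<open>A set of \<open>n \<ge> 2\<close> zeros triggers \<open>A 2\<close>, ...,
  \<open>A n\<close>, and \<open>n\<close> is at most twice \<open>n - 1\<close>. A single zero is
  charged to \<open>P\<close> or to \<open>A 2\<close>; an infinite set triggers every
  \<open>A m\<close> and makes the right-hand side infinite.\<close>

lemma zeros_count_bound:
  fixes Z :: "real set" and A :: "nat \<Rightarrow> bool"
  assumes many: "\<And>m Y. m \<ge> 2 \<Longrightarrow> finite Y \<Longrightarrow> Y \<subseteq> Z \<Longrightarrow> card Y = m \<Longrightarrow> A m"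
    and one: "\<And>x. Z = {x} \<Longrightarrow> P \<or> A 2"
  shows "emeasure (count_space UNIV) Z \<le> of_bool P + 2 * (\<Sum>m. of_bool (A (m + 2)))"
proof -
  have partial: "of_nat n \<le> (\<Sum>m. of_bool (A (m + 2)) :: ennreal)" if "\<And>m. m < n \<Longrightarrow> A (m + 2)" for n
  proof -
    have "(of_nat n :: ennreal) = (\<Sum>m<n. of_bool (A (m + 2)))" using that by simp
    also have "\<dots> \<le> (\<Sum>m. of_bool (A (m + 2)))" by (rule sum_le_suminf) auto
    finally show ?thesis .
  qed
  show ?thesis
  proof (cases "finite Z")
    case False
    have A: "A m" if "m \<ge> 2" for m
      using infinite_arbitrarily_large[OF False, of m] many[OF that] by blast
    have "(\<Sum>m. of_bool (A (m + 2)) :: ennreal) = top"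
    proof (rule ccontr)
      assume "(\<Sum>m. of_bool (A (m + 2)) :: ennreal) \<noteq> top"
      then obtain n where "(\<Sum>m. of_bool (A (m + 2)) :: ennreal) < of_nat n" using ennreal_Ex_less_of_nat by (auto simp: less_top)
      with partial[of n] A show False by (simp add: leD)
    qed
    then show ?thesis by (simp add: ennreal_mult_top)
  next
    case True
    then have e: "emeasure (count_space UNIV) Z = of_nat (card Z)" by simp
    consider "card Z = 0" | "card Z = 1" | n where "card Z = Suc (Suc n)" by (metis One_nat_def not0_implies_Suc)
    then show ?thesis
    proof cases
      case 1 then show ?thesis unfolding e by simp
    next
      case 2
      then obtain x where "Z = {x}" by (auto simp: card_1_singleton_iff)
      from one[OF this] show ?thesis
      proof
        assume P
        then have "of_bool P = (1 :: ennreal)" by simp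
        then show ?thesis unfolding e 2 by (simp add: add_increasing2)
      next
        assume "A 2"
        then have "(1 :: ennreal) \<le> (\<Sum>m. of_bool (A (m + 2)))" using partial[of 1] \<open>A 2\<close> by (simp add: numeral_2_eq_2)
        then have "(1 :: ennreal) \<le> 2 * (\<Sum>m. of_bool (A (m + 2)))"
          using mult_mono[of 1 "2::ennreal" 1 "\<Sum>m. of_bool (A (m + 2))"] by simp
        then show ?thesis unfolding e 2 by (simp add: add_increasing)
      qed
    next
      case (3 n)
      have "A (m + 2)" if "m < Suc n" for m
      proof -
        have "m + 2 \<le> card Z" using that 3 by simp
        then obtain Y where "Y \<subseteq> Z" "card Y = m + 2" by (meson obtain_subset_with_card_n)
        then show ?thesis using many[of "m + 2" Y] finite_subset[OF _ True] by auto
      qed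
      then have "of_nat (Suc n) \<le> (\<Sum>m. of_bool (A (m + 2)) :: ennreal)" by (rule partial)
      then have "2 * of_nat (Suc n) \<le> 2 * (\<Sum>m. of_bool (A (m + 2)) :: ennreal)" by (rule mult_left_mono) simp
      moreover have "(of_nat (card Z) :: ennreal) \<le> 2 * of_nat (Suc n)"
      proof -
        have "(of_nat (Suc (Suc n)) :: ennreal) \<le> of_nat (2 * Suc n)" by (rule of_nat_mono) simp
        also have "\<dots> = 2 * of_nat (Suc n)" by (simp only: of_nat_mult of_nat_numeral)
        finally show ?thesis unfolding 3 .
      qed
      ultimately show ?thesis unfolding e by (meson add_increasing order_trans zero_le)
    qed
  qed
qed

section \<open>From zeros of the series to sign changes of \<open>X\<close>\<close>

context random_series
begin

lemma random_taylor_exp_zero_iff: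
  assumes "good \<omega>" "s > 0"
  shows "random_taylor \<xi> c \<omega> (of_real (exp (- s))) = 0 \<longleftrightarrow> X s \<omega> = 0"
proof -
  have "random_taylor \<xi> c \<omega> (of_real (exp (- s))) = F \<omega> (of_real s)"
    unfolding F_def by (simp add: exp_of_real[symmetric] del: exp_of_real)
  then show ?thesis using F_of_real[OF assms] by simp
qed

lemma open_half_plane: "open {z::complex. Re z > 0}"
  by (simp add: open_halfspace_Re_gt)

text \<open>The vanishing imaginary part allows a critical real zero of \<open>X\<close> to be read
  as a double zero of \<open>F \<omega>\<close>.\<close>

lemma X_derivative:
  assumes "good \<omega>" "s > 0"
  shows "((\<lambda>t. X t \<omega>) has_real_derivative Re (deriv (F \<omega>) (of_real s))) (at s)" and "Im (deriv (F \<omega>) (of_real s)) = 0"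
proof -
  have "(F \<omega> has_field_derivative deriv (F \<omega>) (of_real s)) (at (of_real s))"
    using F_holomorphic[OF assms(1)] assms(2) by (intro holomorphic_derivI[OF _ open_half_plane]) auto
  then have v: "((\<lambda>t. F \<omega> (of_real t)) has_vector_derivative deriv (F \<omega>) (of_real s)) (at s)"
    by (rule has_vector_derivative_real_field)
  have v2: "((\<lambda>t. complex_of_real (X t \<omega>)) has_vector_derivative deriv (F \<omega>) (of_real s)) (at s)"
    by (rule has_vector_derivative_transform_within_open[OF v, of "{0<..}"]) (use assms F_of_real in auto)
  show "((\<lambda>t. X t \<omega>) has_real_derivative Re (deriv (F \<omega>) (of_real s))) (at s)"
    using bounded_linear.has_vector_derivative[OF bounded_linear_Re v2] by (simp add: has_real_derivative_iff_has_vector_derivative)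
  have "((\<lambda>t::real. 0::real) has_vector_derivative Im (deriv (F \<omega>) (of_real s))) (at s)"
    using bounded_linear.has_vector_derivative[OF bounded_linear_Im v2] by simp
  then show "Im (deriv (F \<omega>) (of_real s)) = 0"
    using vector_derivative_unique_at has_vector_derivative_const by blast
qed

lemma X_continuous: "good \<omega> \<Longrightarrow> s > 0 \<Longrightarrow> isCont (\<lambda>t. X t \<omega>) s"
  using X_derivative(1) DERIV_isCont by blast

lemma cball_half_plane:
  assumes "R < t"
  shows "cball (complex_of_real t) R \<subseteq> {z. Re z > 0}"
proof
  fix z assume "z \<in> cball (complex_of_real t) R"
  then have "\<bar>Re (of_real t - z)\<bar> \<le> R" using abs_Re_le_cmod[of "of_real t - z"] by (simp add: dist_norm)
  then show "z \<in> {z. Re z > 0}" using assms by auto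
qed

lemma jensen_event_zeros:
  assumes g: "good \<omega>" "\<omega> \<in> space M" and R: "0 < R" "R < t" and Y: "finite Y" "card Y = m"
    "\<And>x. x \<in> Y \<Longrightarrow> x > 0 \<and> X x \<omega> = 0 \<and> \<bar>x - t\<bar> \<le> q * R" and q: "q \<le> 1"
  shows "\<omega> \<in> jensen_event q t R m"
proof -
  have inj: "inj_on complex_of_real Y" by (simp add: inj_on_def)
  have "ennreal ((norm (F \<omega> (of_real t)))\<^sup>2) \<le> ennreal (q ^ (2 * m)) * circle_energy (F \<omega>) (of_real t) R"
  proof (rule jensen_distinct_zeros[OF open_half_plane cball_half_plane[OF R(2)] R(1) F_holomorphic[OF g(1)], of "complex_of_real ` Y"])
    show "card (complex_of_real ` Y) = m" using card_image[OF inj] Y(2) by simp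
    fix x assume "x \<in> complex_of_real ` Y"
    then obtain y where "y \<in> Y" "x = of_real y" by auto
    then show "F \<omega> x = 0 \<and> dist x (complex_of_real t) \<le> q * R"
      using Y(3)[of y] F_of_real[OF g(1), of y] by (auto simp: dist_real_def[symmetric] dist_of_real)
  qed (use Y q in auto)
  then show ?thesis using g(2) R F_of_real[OF g(1), of t] unfolding jensen_event_def energy_def by simp
qed

lemma jensen_event_double_zero:
  assumes g: "good \<omega>" "\<omega> \<in> space M" and R: "0 < R" "R < t"
    and x: "x > 0" "X x \<omega> = 0" "\<bar>x - t\<bar> \<le> q * R" "((\<lambda>t. X t \<omega>) has_real_derivative 0) (at x)" and q: "q \<le> 1"
  shows "\<omega> \<in> jensen_event q t R 2"
proof -
  have "Re (deriv (F \<omega>) (of_real x)) = 0" using DERIV_unique[OF X_derivative(1)[OF g(1) x(1)] x(4)] .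
  then have d: "deriv (F \<omega>) (of_real x) = 0" using X_derivative(2)[OF g(1) x(1)] by (simp add: complex_eq_iff)
  have "ennreal ((norm (F \<omega> (of_real t)))\<^sup>2) \<le> ennreal (q ^ (2 * 2)) * circle_energy (F \<omega>) (of_real t) R"
    by (rule jensen_double_zero[OF open_half_plane cball_half_plane[OF R(2)] R(1) F_holomorphic[OF g(1)] _ d])
       (use x q F_of_real[OF g(1) x(1)] in \<open>auto simp: dist_real_def[symmetric] dist_of_real\<close>)
  then show ?thesis using g(2) R F_of_real[OF g(1), of t] unfolding jensen_event_def energy_def by simp
qed

text \<open>If no sign changes and no end point is a zero, the intermediate value theorem keeps
  \<open>X\<close> of one sign on both sides of \<open>x\<close>, so \<open>x\<close> is an interior
  extremum.\<close>

lemma single_zero_cases: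
  assumes g: "good \<omega>" and a: "0 < a" "a < b" and Z: "{x\<in>{a..b}. X x \<omega> = 0} = {x}"
  shows "X b \<omega> * X a \<omega> < 0 \<or> X b \<omega> = 0 \<or> X a \<omega> = 0 \<or> ((\<lambda>t. X t \<omega>) has_real_derivative 0) (at x)"
proof (rule ccontr)
  assume neg: "\<not> ?thesis"
  then have nz: "X b \<omega> \<noteq> 0" "X a \<omega> \<noteq> 0" and pos: "X b \<omega> * X a \<omega> > 0" by (auto simp: not_less order_less_le)
  have x: "x \<in> {a..b}" "X x \<omega> = 0" using Z by auto
  then have xab: "a < x" "x < b" using nz by (auto simp: less_eq_real_def)
  \<comment> \<open>Multiplication by the end value makes both ends positive, so that one case
    covers both signs.\<close>
  define h where "h y = X b \<omega> * X y \<omega>" for y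
  have hc: "isCont h y" if "y \<ge> a" for y unfolding h_def using X_continuous[OF g] that a by (intro continuous_intros) auto
  have zero: "y = x" if "a \<le> y" "y \<le> b" "h y = 0" for y
    using Z that nz unfolding h_def by auto
  have hb: "h b > 0" "h a > 0" using nz pos unfolding h_def by (auto simp: power2_eq_square[symmetric])
  have hx: "h x = 0" unfolding h_def using x by simp
  have nonneg: "h y \<ge> 0" if y: "a \<le> y" "y \<le> b" for y
  proof (rule ccontr)
    assume "\<not> h y \<ge> 0"
    then have hy: "h y < 0" by simp
    obtain u where u: "a \<le> u" "u \<le> y" "h u = 0" using IVT2[of h y 0 a] hy hb y hc by force
    obtain v where v: "y \<le> v" "v \<le> b" "h v = 0" using IVT[of h y 0 b] hy hb y hc by force
    have "u = x" by (rule zero) (use u y in auto)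
    have "v = x" by (rule zero) (use v y in auto)
    then have "y = x" using u v \<open>u = x\<close> by simp
    then show False using hy hx by simp
  qed
  have "(h has_real_derivative X b \<omega> * Re (deriv (F \<omega>) (of_real x))) (at x)"
    unfolding h_def using X_derivative(1)[OF g, of x] xab a by (intro DERIV_cmult) auto
  moreover have "0 < min (x - a) (b - x)" using xab by simp
  moreover have "\<forall>y. \<bar>x - y\<bar> < min (x - a) (b - x) \<longrightarrow> h x \<le> h y"
    unfolding hx by (intro allI impI nonneg) (auto simp: abs_less_iff)
  ultimately have "X b \<omega> * Re (deriv (F \<omega>) (of_real x)) = 0" by (rule DERIV_local_min)
  then have "Re (deriv (F \<omega>) (of_real x)) = 0" using nz by simp
  then have "((\<lambda>t. X t \<omega>) has_real_derivative 0) (at x)" using X_derivative(1)[OF g, of x] xab a by simp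
  then show False using neg by simp
qed

lemma sign_change_zero:
  assumes g: "good \<omega>" and a: "0 < a" "a < b" and s: "X b \<omega> * X a \<omega> < 0"
  shows "\<exists>x. a < x \<and> x < b \<and> X x \<omega> = 0"
proof -
  have c: "isCont (\<lambda>t. X t \<omega>) y" if "y \<ge> a" for y using X_continuous[OF g] that a by auto
  have nz: "X a \<omega> \<noteq> 0" "X b \<omega> \<noteq> 0" using s by auto
  have "\<exists>x\<ge>a. x \<le> b \<and> X x \<omega> = 0"
  proof (cases "X a \<omega> < 0")
    case True
    then have "0 < X b \<omega>" using s by (auto simp: mult_less_0_iff)
    then show ?thesis using IVT[of "\<lambda>t. X t \<omega>" a 0 b] True a c by auto
  next
    case False
    then have "0 < X a \<omega>" "X b \<omega> < 0" using s nz by (auto simp: mult_less_0_iff)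
    then show ?thesis using IVT2[of "\<lambda>t. X t \<omega>" b 0 a] a c by auto
  qed
  then obtain x where "a \<le> x" "x \<le> b" "X x \<omega> = 0" by blast
  with nz show ?thesis by (intro exI[of _ x]) (auto simp: less_le)
qed

lemma X_second_moment:
  assumes "s > 0"
  shows "integrable M (\<lambda>\<omega>. (X s \<omega>)\<^sup>2)" "expectation (\<lambda>\<omega>. (X s \<omega>)\<^sup>2) \<le> (sd s)\<^sup>2"
proof -
  have le: "(\<integral>\<^sup>+\<omega>. ennreal ((X s \<omega>)\<^sup>2) \<partial>M) \<le> ennreal ((sd s)\<^sup>2)"
    using second_moment_S[OF summable_weight[OF assms]] weight_square_sums[OF assms] sd_square[OF assms]
    by (simp add: X_def sums_iff)
  show int: "integrable M (\<lambda>\<omega>. (X s \<omega>)\<^sup>2)"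
    by (rule integrableI_nonneg) (use le in \<open>auto intro: le_less_trans\<close>)
  have "ennreal (expectation (\<lambda>\<omega>. (X s \<omega>)\<^sup>2)) \<le> ennreal ((sd s)\<^sup>2)"
    using le nn_integral_eq_integral[OF int] by simp
  then show "expectation (\<lambda>\<omega>. (X s \<omega>)\<^sup>2) \<le> (sd s)\<^sup>2" by (simp add: ennreal_le_iff)
qed

text \<open>The combination with coefficients \<open>t\<close> and \<open>u\<close> is again a
  weighted sum, with weights tending to \<open>0\<close> uniformly in \<open>k\<close>, so the
  one-dimensional Gaussian comparison handles the pair.\<close>

lemma joint_char_limit:
  assumes s: "\<And>n. s n > 0" "\<And>n. s' n > 0" "filterlim s (at_right 0) sequentially" "filterlim s' (at_right 0) sequentially"
    and corr: "(\<lambda>n. corr (s n) (s' n)) \<longlonglongrightarrow> \<rho>"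
  shows "(\<lambda>n. CLINT \<omega>|M. iexp (t * (X (s n) \<omega> / sd (s n)) + u * (X (s' n) \<omega> / sd (s' n)))) \<longlonglongrightarrow>
     complex_of_real (exp (- (t\<^sup>2 + 2 * \<rho> * t * u + u\<^sup>2) / 2))"
proof -
  define a where "a n k = t * unit_weight (s n) k + u * unit_weight (s' n) k" for n k
  have sa: "summable (\<lambda>k. \<bar>a n k\<bar>)" for n
    unfolding a_def
    by (rule summable_comparison_test'[where N = 0 and g = "\<lambda>k. \<bar>t\<bar> * \<bar>unit_weight (s n) k\<bar> + \<bar>u\<bar> * \<bar>unit_weight (s' n) k\<bar>"],
        intro summable_add summable_mult summable_unit_weight s)
       (simp add: order_trans[OF abs_triangle_ineq] abs_mult)
  define v where "v n = t\<^sup>2 + 2 * corr (s n) (s' n) * t * u + u\<^sup>2" for n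
  have sq: "(\<lambda>k. (a n k)\<^sup>2) sums v n" for n
  proof -
    have "(\<lambda>k. t\<^sup>2 * (unit_weight (s n) k * unit_weight (s n) k) + 2 * t * u * (unit_weight (s n) k * unit_weight (s' n) k) +
         u\<^sup>2 * (unit_weight (s' n) k * unit_weight (s' n) k)) sums (t\<^sup>2 * corr (s n) (s n) + 2 * t * u * corr (s n) (s' n) + u\<^sup>2 * corr (s' n) (s' n))"
      by (intro sums_add sums_mult unit_weight_mult_sums s)
    then show ?thesis unfolding a_def v_def using corr_self s by (simp add: power2_eq_square algebra_simps)
  qed
  have ch: "(CLINT \<omega>|M. iexp (t * (X (s n) \<omega> / sd (s n)) + u * (X (s' n) \<omega> / sd (s' n)))) = (CLINT \<omega>|M. iexp (S (a n) \<omega>))" for n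
  proof (rule integral_cong_AE)
    show "AE \<omega> in M. iexp (t * (X (s n) \<omega> / sd (s n)) + u * (X (s' n) \<omega> / sd (s' n))) = iexp (S (a n) \<omega>)"
      using AE_S_unit_weight[OF s(1)[of n]] AE_S_unit_weight[OF s(2)[of n]]
        AE_summable[OF summable_unit_weight[OF s(1)[of n]]] AE_summable[OF summable_unit_weight[OF s(2)[of n]]]
    proof eventually_elim
      case (elim \<omega>)
      have "(\<lambda>k. t * (unit_weight (s n) k * \<xi> k \<omega>) + u * (unit_weight (s' n) k * \<xi> k \<omega>)) sums (t * S (unit_weight (s n)) \<omega> + u * S (unit_weight (s' n)) \<omega>)"
        unfolding S_def using elim(3,4) by (intro sums_add sums_mult summable_sums) (auto intro: summable_rabs_cancel)
      then have "S (a n) \<omega> = t * S (unit_weight (s n)) \<omega> + u * S (unit_weight (s' n)) \<omega>"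
        unfolding S_def a_def by (simp add: sums_iff algebra_simps)
      then show ?case using elim(1,2) by simp
    qed
  qed measurable
  obtain \<kappa> s1 where k: "0 < \<kappa>" "0 < s1" "\<And>s k. 0 < s \<Longrightarrow> s < s1 \<Longrightarrow> \<bar>unit_weight s k\<bar> \<le> s powr \<kappa>"
    using max_unit_weight by blast
  have vlim: "v \<longlonglongrightarrow> t\<^sup>2 + 2 * \<rho> * t * u + u\<^sup>2" unfolding v_def by (intro tendsto_intros corr)
  have small: "\<forall>\<^sub>F n in sequentially. \<forall>k. \<bar>a n k\<bar> \<le> u0" if "u0 > 0" for u0
  proof -
    define e where "e = u0 / (\<bar>t\<bar> + \<bar>u\<bar> + 1)"
    have e: "e > 0" "(\<bar>t\<bar> + \<bar>u\<bar>) * e \<le> u0" using that unfolding e_def by (auto simp: field_simps)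
    define s2 where "s2 = min s1 (e powr (1 / \<kappa>))"
    have s2: "s2 > 0" unfolding s2_def using k e by simp
    have w: "\<bar>unit_weight r k\<bar> \<le> e" if "0 < r" "r < s2" for r k
    proof -
      have "\<bar>unit_weight r k\<bar> \<le> r powr \<kappa>" using k(3) that unfolding s2_def by simp
      also have "\<dots> \<le> (e powr (1 / \<kappa>)) powr \<kappa>" using that k unfolding s2_def by (intro powr_mono2) auto
      also have "\<dots> = e" using k e by (simp add: powr_powr)
      finally show ?thesis .
    qed
    have ev: "\<forall>\<^sub>F r in at_right 0. 0 < r \<and> r < s2" using s2 by (auto simp: eventually_at_right_field)
    have "\<forall>\<^sub>F n in sequentially. 0 < s n \<and> s n < s2" "\<forall>\<^sub>F n in sequentially. 0 < s' n \<and> s' n < s2"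
      using ev s(3,4) unfolding filterlim_iff by blast+
    then show ?thesis
    proof eventually_elim
      case (elim n)
      show ?case
      proof
        fix k
        have "\<bar>a n k\<bar> \<le> \<bar>t\<bar> * \<bar>unit_weight (s n) k\<bar> + \<bar>u\<bar> * \<bar>unit_weight (s' n) k\<bar>"
          unfolding a_def by (rule order_trans[OF abs_triangle_ineq]) (simp add: abs_mult)
        also have "\<dots> \<le> \<bar>t\<bar> * e + \<bar>u\<bar> * e" using w elim by (intro add_mono mult_left_mono) auto
        also have "\<dots> \<le> u0" using e(2) by (simp add: algebra_simps)
        finally show "\<bar>a n k\<bar> \<le> u0" .
      qed
    qed
  qed
  have diff: "(\<lambda>n. (CLINT \<omega>|M. iexp (S (a n) \<omega>)) - complex_of_real (exp (- v n / 2))) \<longlonglongrightarrow> 0"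
    unfolding tendsto_iff dist_complex_def diff_0_right
  proof (intro allI impI)
    fix e :: real assume e: "e > 0"
    define L where "L = t\<^sup>2 + 2 * \<rho> * t * u + u\<^sup>2"
    define \<delta> where "\<delta> = e / (\<bar>L\<bar> + 2)"
    have \<delta>: "\<delta> > 0" "\<delta> * (\<bar>L\<bar> + 1) < e" using e unfolding \<delta>_def by (auto simp: field_simps)
    from char_series_gaussian[OF \<delta>(1)] obtain u0 where u0: "u0 > 0" and G: "\<forall>a. summable (\<lambda>k. \<bar>a k\<bar>) \<longrightarrow> (\<forall>k. \<bar>a k\<bar> \<le> u0) \<longrightarrow>
      norm ((CLINT \<omega>|M. iexp (S a \<omega>)) - complex_of_real (exp (- (\<Sum>k. (a k)\<^sup>2) / 2))) \<le> \<delta> * (\<Sum>k. (a k)\<^sup>2)"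
      by (elim exE conjE) (rule that)
    have "\<forall>\<^sub>F n in sequentially. v n < \<bar>L\<bar> + 1" using vlim unfolding L_def[symmetric] by (rule order_tendstoD) linarith
    with small[OF u0] show "\<forall>\<^sub>F n in sequentially. norm ((CLINT \<omega>|M. iexp (S (a n) \<omega>)) - complex_of_real (exp (- v n / 2))) < e"
    proof eventually_elim
      case (elim n)
      have sum: "(\<Sum>k. (a n k)\<^sup>2) = v n" using sq[of n] by (simp add: sums_iff)
      have "norm ((CLINT \<omega>|M. iexp (S (a n) \<omega>)) - complex_of_real (exp (- v n / 2))) \<le> \<delta> * v n"
        using G[rule_format, of "a n"] sa[of n] elim(1) unfolding sum by blast
      also have "\<dots> \<le> \<delta> * (\<bar>L\<bar> + 1)" using \<delta>(1) elim(2) by (intro mult_left_mono) auto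
      finally show ?case using \<delta>(2) by linarith
    qed
  qed
  have "(\<lambda>n. complex_of_real (exp (- v n / 2))) \<longlonglongrightarrow> complex_of_real (exp (- (t\<^sup>2 + 2 * \<rho> * t * u + u\<^sup>2) / 2))"
    by (intro tendsto_intros vlim) simp
  from tendsto_add[OF diff this] show ?thesis unfolding ch by simp
qed

lemma sign_change_prob_limit:
  assumes h: "h > 0"
  shows "(\<lambda>n. prob {\<omega>\<in>space M. X (exp (- (h * real n))) \<omega> * X (exp (- (h * real n)) * exp (- h)) \<omega> < 0}) \<longlonglongrightarrow>
     arccos ((2 * sqrt (exp (- h)) / (1 + exp (- h))) powr \<gamma>) / pi"
proof -
  define s where "s n = exp (- (h * real n))" for n
  define s' where "s' n = exp (- h) * s n" for n
  define \<rho> where "\<rho> = (2 * sqrt (1 * exp (- h)) / (1 + exp (- h))) powr \<gamma>"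
  have pos: "s n > 0" "s' n > 0" for n unfolding s_def s'_def by auto
  have "filterlim (\<lambda>n. h * real n) at_top sequentially"
    by (rule filterlim_tendsto_pos_mult_at_top[OF tendsto_const h filterlim_real_sequentially])
  then have "s \<longlonglongrightarrow> 0" unfolding s_def
    by (intro filterlim_compose[OF exp_at_bot] filterlim_compose[OF filterlim_uminus_at_bot_at_top])
  then have fs: "filterlim s (at_right 0) sequentially"
    using pos by (intro tendsto_imp_filterlim_at_right) auto
  have fs': "filterlim s' (at_right 0) sequentially"
    unfolding s'_def using filterlim_compose[OF filterlim_mult_at_right_0 fs, of "exp (- h)"] by simp
  have corr: "(\<lambda>n. corr (s n) (s' n)) \<longlonglongrightarrow> \<rho>"
    using filterlim_compose[OF corr_limit[of 1 "exp (- h)"] fs] unfolding \<rho>_def s'_def by simp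
  \<comment> \<open>With \<open>r = exp (- h / 2)\<close>, the inequality \<open>\<rho> < 1\<close>
    becomes the strict inequality \<open>2 * r < 1 + r\<^sup>2\<close>.\<close>
  define r where "r = sqrt (exp (- h))"
  have r: "0 < r" "r < 1" "r * r = exp (- h)" unfolding r_def using h by auto
  have "0 < (1 - r)\<^sup>2" using r by simp
  then have "2 * r < 1 + r * r" by (simp add: power2_eq_square algebra_simps)
  then have "2 * r / (1 + r * r) < 1" using r by (subst divide_less_eq) (auto simp: add_pos_pos)
  moreover have "0 \<le> 2 * r / (1 + r * r)" using r by (intro divide_nonneg_pos) (auto simp: add_pos_pos)
  ultimately have "(2 * r / (1 + r * r)) powr \<gamma> < 1 powr \<gamma>" using gamma_pos by (intro powr_less_mono2)
  then have \<rho>: "0 \<le> \<rho>" "\<rho> < 1" unfolding \<rho>_def r(3) r_def by auto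
  obtain \<kappa> C s1 where k: "0 < \<kappa>" "0 < C" "0 < s1"
     and sb: "\<And>s \<eta>. 0 < s \<Longrightarrow> s < s1 \<Longrightarrow> s powr \<kappa> \<le> \<eta> \<Longrightarrow> \<eta> \<le> 1 \<Longrightarrow> prob {\<omega>\<in>space M. \<bar>X s \<omega>\<bar> \<le> \<eta> * sd s} \<le> C * \<eta>"
    using small_ball_one by blast
  have scale: "{\<omega>\<in>space M. \<bar>X r \<omega> / sd r\<bar> \<le> \<eta>} = {\<omega>\<in>space M. \<bar>X r \<omega>\<bar> \<le> \<eta> * sd r}" if "r > 0" for r \<eta>
    using sd_pos[OF that] by (auto simp: divide_le_eq)
  have sm: "\<forall>\<^sub>F n in sequentially. prob {\<omega>\<in>space M. \<bar>X (r n) \<omega> / sd (r n)\<bar> \<le> \<eta>} \<le> C * \<eta>"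
    if r: "\<And>n. r n > 0" "filterlim r (at_right 0) sequentially" and \<eta>: "0 < \<eta>" "\<eta> \<le> 1" for r :: "nat \<Rightarrow> real" and \<eta>
  proof -
    have "0 < min s1 (\<eta> powr (1 / \<kappa>))" using k \<eta> by simp
    then have "\<forall>\<^sub>F x in at_right 0. 0 < x \<and> x < min s1 (\<eta> powr (1 / \<kappa>))"
      unfolding eventually_at_right_field by blast
    then have "\<forall>\<^sub>F n in sequentially. 0 < r n \<and> r n < min s1 (\<eta> powr (1 / \<kappa>))" using r(2) unfolding filterlim_iff by blast
    then show ?thesis
    proof eventually_elim
      case (elim n)
      have "r n powr \<kappa> \<le> (\<eta> powr (1 / \<kappa>)) powr \<kappa>" using elim k by (intro powr_mono2) auto
      then have "r n powr \<kappa> \<le> \<eta>" using k \<eta> by (simp add: powr_powr)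
      then show ?case unfolding scale[OF r(1)] using elim \<eta> by (intro sb) auto
    qed
  qed
  have le1: "integrable M (\<lambda>\<omega>. (X r \<omega> / sd r)\<^sup>2)" "expectation (\<lambda>\<omega>. (X r \<omega> / sd r)\<^sup>2) \<le> 1" if "r > 0" for r
    using X_second_moment[OF that] sd_pos[OF that] by (auto simp: power_divide divide_le_eq)
  have "(\<lambda>n. prob {\<omega>\<in>space M. (X (s n) \<omega> / sd (s n)) * (X (s' n) \<omega> / sd (s' n)) < 0}) \<longlonglongrightarrow> arccos \<rho> / pi"
    by (rule sign_change_limit[where C = C])
       (use le1 pos \<rho> k sm[OF pos(1) fs] sm[OF pos(2) fs'] joint_char_limit[OF pos fs fs' corr] in \<open>auto intro: eventually_conj\<close>)
  moreover have "{\<omega>\<in>space M. (X (s n) \<omega> / sd (s n)) * (X (s' n) \<omega> / sd (s' n)) < 0} = {\<omega>\<in>space M. X (s n) \<omega> * X (s n * exp (- h)) \<omega> < 0}" for n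
    using sd_pos[OF pos(1)[of n]] sd_pos[OF pos(2)[of n]]
    by (auto simp: s'_def mult.commute[of "exp _"] divide_less_0_iff zero_less_mult_iff mult_less_0_iff zero_less_divide_iff)
  ultimately show ?thesis unfolding \<rho>_def s_def by simp
qed

end

text \<open>The total error of the logarithmic range: about \<open>A * ln (1 / s)\<close> values of
  \<open>m\<close>, each with error \<open>C * s powr \<kappa>\<close>.\<close>

lemma log_times_power_limit:
  fixes \<kappa> A B C :: real
  assumes "\<kappa> > 0" "A > 0" "C > 0"
  shows "((\<lambda>s. (A * ln (1 / s) + B) * (C * s powr \<kappa>)) \<longlongrightarrow> 0) (at_right 0)"
  using assms by real_asymp

text \<open>The total over the middle range, whose length is at most \<open>16 / s ^ 4 + 1\<close>
  because the crude events take over at \<open>1 / e ^ 4\<close> with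
  \<open>e = s / 2\<close>.\<close>

lemma inverse_power_limit:
  fixes C :: real
  assumes "C > 0"
  shows "((\<lambda>s. (16 / s ^ 4 + 1) * (C * s ^ 5)) \<longlongrightarrow> 0) (at_right 0)"
  using assms by real_asymp

lemma power_limit_zero:
  fixes \<kappa> C :: real
  assumes "\<kappa> > 0" "C > 0"
  shows "((\<lambda>s. C * s powr \<kappa>) \<longlongrightarrow> 0) (at_right 0)"
  using assms by real_asymp

section \<open>Measurable majorants for zero counts\<close>

context random_series
begin

definition zero_count :: "'a \<Rightarrow> real \<Rightarrow> real \<Rightarrow> ennreal" where
  "zero_count \<omega> a b = emeasure (count_space UNIV) {x::real. a \<le> x \<and> x \<le> b \<and> random_taylor \<xi> c \<omega> (of_real x) = 0}"

text \<open>Measurability of \<open>zero_count\<close> in the outcome is not established, and for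
  arbitrary functions \<open>nn_integral\<close> is a lower integral, which need not be subadditive.
  A measurable majorant allows bounds on adjacent intervals to be added.\<close>

definition count_majorized :: "real \<Rightarrow> real \<Rightarrow> real \<Rightarrow> bool" where
  "count_majorized a b B \<longleftrightarrow>
     (\<exists>G\<in>borel_measurable M. (AE \<omega> in M. zero_count \<omega> a b \<le> G \<omega>) \<and> (\<integral>\<^sup>+\<omega>. G \<omega> \<partial>M) \<le> ennreal B)"

lemma count_majorizedI:
  assumes "\<And>m. A m \<in> sets M" "P \<in> sets M"
    and "AE \<omega> in M. zero_count \<omega> a b \<le> of_bool (\<omega> \<in> P) + 2 * (\<Sum>m. of_bool (\<omega> \<in> A m))"
    and "(\<integral>\<^sup>+\<omega>. of_bool (\<omega> \<in> P) + 2 * (\<Sum>m. of_bool (\<omega> \<in> A m)) \<partial>M) \<le> ennreal B"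
  shows "count_majorized a b B"
  unfolding count_majorized_def
proof (intro bexI conjI)
  have [measurable]: "P \<in> sets M" "\<And>m. A m \<in> sets M" using assms by auto
  have ind: "(of_bool (\<omega> \<in> B) :: ennreal) = indicator B \<omega>" for B and \<omega> :: 'a by (simp add: indicator_def)
  show "(\<lambda>\<omega>. of_bool (\<omega> \<in> P) + 2 * (\<Sum>m. of_bool (\<omega> \<in> A m)) :: ennreal) \<in> borel_measurable M"
    unfolding ind by measurable
qed (use assms in auto)

lemma zero_count_exp:
  assumes "good \<omega>" "0 < a"
  shows "zero_count \<omega> (exp (- b)) (exp (- a)) = emeasure (count_space UNIV) {s\<in>{a..b}. X s \<omega> = 0}"
proof -
  have "{x::real. exp (- b) \<le> x \<and> x \<le> exp (- a) \<and> random_taylor \<xi> c \<omega> (of_real x) = 0} = (\<lambda>s. exp (- s)) ` {s\<in>{a..b}. X s \<omega> = 0}"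
  proof (intro equalityI subsetI)
    fix x assume x: "x \<in> {x::real. exp (- b) \<le> x \<and> x \<le> exp (- a) \<and> random_taylor \<xi> c \<omega> (of_real x) = 0}"
    then have x0: "x > 0" by (auto intro: less_le_trans[OF exp_gt_zero])
    define s where "s = - ln x"
    have xs: "x = exp (- s)" unfolding s_def using x0 by simp
    have s: "a \<le> s" "s \<le> b" using x unfolding xs by auto
    then have "X s \<omega> = 0" using random_taylor_exp_zero_iff[OF assms(1), of s] x assms(2) unfolding xs by auto
    then show "x \<in> (\<lambda>s. exp (- s)) ` {s\<in>{a..b}. X s \<omega> = 0}" using s unfolding xs by auto
  next
    fix x assume "x \<in> (\<lambda>s. exp (- s)) ` {s\<in>{a..b}. X s \<omega> = 0}"
    then show "x \<in> {x::real. exp (- b) \<le> x \<and> x \<le> exp (- a) \<and> random_taylor \<xi> c \<omega> (of_real x) = 0}"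
      using random_taylor_exp_zero_iff[OF assms(1)] assms(2) by auto
  qed
  moreover have "inj_on (\<lambda>s::real. exp (- s)) {s\<in>{a..b}. X s \<omega> = 0}" by (simp add: inj_on_def)
  ultimately show ?thesis unfolding zero_count_def by (simp add: emeasure_count_image)
qed

text \<open>Places zeros with parameter at least \<open>3 / 4 * s\<close> in
  \<open>[0, 1 - s / 2]\<close>, the range of the crude events for \<open>e = s / 2\<close>.\<close>

lemma exp_minus_le_one_minus_half:
  fixes s :: real
  assumes "0 < s" "s \<le> 1/2"
  shows "exp (- (3 / 4 * s)) \<le> 1 - s / 2"
proof -
  have "(1 + 3 / 4 * s) * (1 - s / 2) \<ge> 1" using assms mult_left_mono[of s "1/2" s] by (simp add: algebra_simps)
  moreover have "(1 + 3 / 4 * s) * (1 - s / 2) \<le> exp (3 / 4 * s) * (1 - s / 2)"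
    using assms exp_ge_add_one_self[of "3 / 4 * s"] by (intro mult_right_mono) auto
  ultimately show ?thesis by (simp add: exp_minus field_simps)
qed

lemma zero_prob_small: 
  "\<exists>\<kappa> C s1. 0 < \<kappa> \<and> 0 < C \<and> 0 < s1 \<and> s1 \<le> 1 \<and> (\<forall>s. 0 < s \<longrightarrow> s < s1 \<longrightarrow> prob {\<omega>\<in>space M. X s \<omega> = 0} \<le> C * s powr \<kappa>)"
proof -
  obtain \<kappa> C s1 where k: "0 < \<kappa>" "0 < C" "0 < s1" "s1 \<le> 1"
     and sb: "\<And>s \<eta>. 0 < s \<Longrightarrow> s < s1 \<Longrightarrow> s powr \<kappa> \<le> \<eta> \<Longrightarrow> \<eta> \<le> 1 \<Longrightarrow> prob {\<omega>\<in>space M. \<bar>X s \<omega>\<bar> \<le> \<eta> * sd s} \<le> C * \<eta>"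
    using small_ball_one by blast
  have "prob {\<omega>\<in>space M. X s \<omega> = 0} \<le> C * s powr \<kappa>" if s: "0 < s" "s < s1" for s
  proof -
    have "s powr \<kappa> \<le> 1 powr \<kappa>" using s k by (intro powr_mono2) auto
    then have "prob {\<omega>\<in>space M. \<bar>X s \<omega>\<bar> \<le> s powr \<kappa> * sd s} \<le> C * s powr \<kappa>" using s by (intro sb) auto
    moreover have "prob {\<omega>\<in>space M. X s \<omega> = 0} \<le> prob {\<omega>\<in>space M. \<bar>X s \<omega>\<bar> \<le> s powr \<kappa> * sd s}"
      using sd_pos[OF s(1)] by (intro finite_measure_mono) auto
    ultimately show ?thesis by simp
  qed
  then show ?thesis using k by blast
qed

lemma nn_integral_count_bound:
  assumes P: "P \<in> sets M" and A: "\<And>m. A m \<in> sets M" and f: "\<And>m. prob (A m) \<le> f m" "f sums L"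
  shows "(\<integral>\<^sup>+\<omega>. of_bool (\<omega> \<in> P) + 2 * (\<Sum>m. of_bool (\<omega> \<in> A m)) \<partial>M) \<le> ennreal (prob P + 2 * L)"
proof -
  have ind: "(of_bool (\<omega> \<in> B) :: ennreal) = indicator B \<omega>" for B and \<omega> :: 'a by (simp add: indicator_def)
  have f0: "f m \<ge> 0" for m using f(1)[of m] measure_nonneg[of M "A m"] by linarith
  have "(\<integral>\<^sup>+\<omega>. of_bool (\<omega> \<in> P) + 2 * (\<Sum>m. of_bool (\<omega> \<in> A m)) \<partial>M) = emeasure M P + 2 * (\<Sum>m. emeasure M (A m))"
    unfolding ind using P A by (simp add: nn_integral_add nn_integral_cmult nn_integral_suminf)
  also have "\<dots> \<le> ennreal (prob P) + 2 * (\<Sum>m. ennreal (f m))"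
    using f(1) by (intro add_mono mult_left_mono suminf_le) (auto simp: emeasure_eq_measure ennreal_leI)
  also have "(\<Sum>m. ennreal (f m)) = ennreal L" using f f0 by (simp add: suminf_ennreal2 sums_iff)
  also have "ennreal (prob P) + 2 * ennreal L = ennreal (prob P + 2 * L)"
  proof -
    have "L \<ge> 0" using f(2) f0 suminf_nonneg[of f] by (auto simp: sums_iff)
    then show ?thesis by (simp add: ennreal_plus ennreal_mult)
  qed
  finally show ?thesis .
qed

text \<open>The relative length of the interval is \<open>h = p ^ 3 / 2\<close>, so the error \<open>p ^ 4\<close> is \<open>o(h)\<close>.\<close>

lemma interval_count_bound:
  "\<exists>C>0. \<forall>p. 0 < p \<longrightarrow> p \<le> 1/2 \<longrightarrow> (\<exists>s1>0. \<forall>s. 0 < s \<longrightarrow> s < s1 \<longrightarrow>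
     count_majorized (exp (- s)) (exp (- (s * exp (- (p ^ 3 / 2)))))
       (prob {\<omega>\<in>space M. X s \<omega> * X (s * exp (- (p ^ 3 / 2))) \<omega> < 0} + C * p ^ 4))"
proof -
  obtain \<kappa> C1 r1 where J1: "0 < \<kappa>" "0 < C1" "0 < r1" "r1 \<le> 1"
    and J1': "\<forall>p s m. 0 < p \<longrightarrow> p \<le> 1 \<longrightarrow> 0 < s \<longrightarrow> s < r1 \<longrightarrow> prob (jensen_event (p ^ 3) s (s / 2) m) \<le> C1 * (p ^ (2 * m) + s powr \<kappa>)"
    using local_zeros_bound by (elim exE conjE) (rule that)
  obtain l d A C2 r2 where J2: "1 \<le> l" "1 \<le> (d::nat)" "0 < A" "0 < C2" "0 < r2" "r2 \<le> 1"
    and J2': "\<forall>s m. 0 < s \<longrightarrow> s < r2 \<longrightarrow> real m \<ge> A * ln (1 / s) \<longrightarrow> prob (\<Inter>i<d. jensen_event (1 - 1 / (4 * l ^ d)) (l ^ i * s) (l ^ i * s - s / 2) m) \<le> C2 * s ^ 5"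
    using many_zeros_bound by (elim exE conjE) (rule that)
  obtain E e0 where E0: "0 < e0" "e0 < 1" "\<forall>e m. E e m \<in> sets M"
    and Emem: "\<forall>e m \<omega> Z. 0 < e \<longrightarrow> e < e0 \<longrightarrow> good \<omega> \<longrightarrow> \<omega> \<in> space M \<longrightarrow> finite Z \<longrightarrow> card Z = m \<longrightarrow>
       (\<forall>x\<in>Z. 0 \<le> x \<and> x \<le> 1 - e \<and> random_taylor \<xi> c \<omega> (of_real x) = 0) \<longrightarrow> \<omega> \<in> E e m"
    and Esum: "\<forall>e. 0 < e \<longrightarrow> e < e0 \<longrightarrow> summable (\<lambda>m. prob (E e m))"
    and Elim: "((\<lambda>e. \<Sum>m. prob (E e (m + nat \<lceil>1 / e ^ 4\<rceil>))) \<longlongrightarrow> 0) (at_right 0)"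
    using crude_zeros_bound by (elim exE conjE) (rule that)
  have [measurable]: "E e m \<in> sets M" for e m using E0(3) by blast
  obtain \<kappa>' C3 r3 where J0: "0 < \<kappa>'" "0 < C3" "0 < r3" "r3 \<le> 1"
    and J0': "\<forall>s. 0 < s \<longrightarrow> s < r3 \<longrightarrow> prob {\<omega>\<in>space M. X s \<omega> = 0} \<le> C3 * s powr \<kappa>'"
    using zero_prob_small by (elim exE conjE) (rule that)
  \<comment> \<open>Twice the sum \<open>4 / 3 * C1 + 3\<close> of the four ranges, plus
    \<open>1\<close> for zeros at the two end points.\<close>
  define C where "C = 7 + 8 / 3 * C1"
  have "\<exists>s1>0. \<forall>s. 0 < s \<longrightarrow> s < s1 \<longrightarrow>
     count_majorized (exp (- s)) (exp (- (s * exp (- (p ^ 3 / 2)))))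
       (prob {\<omega>\<in>space M. X s \<omega> * X (s * exp (- (p ^ 3 / 2))) \<omega> < 0} + C * p ^ 4)" if p: "0 < p" "p \<le> 1/2" for p
  proof -
    define h where "h = p ^ 3 / 2"
    have p3: "0 < p ^ 3" "p ^ 3 \<le> 1/8" using p power_mono[of p "1/2" 3] by (auto simp: eval_nat_numeral)
    have h: "0 < h" "h \<le> 1/16" using p3 unfolding h_def by auto
    have eh: "exp (- h) \<ge> 1 - h" "exp (- h) < 1" using exp_ge_add_one_self[of "- h"] h by auto
    have p4: "p ^ 4 > 0" using p by simp
    have lim1: "((\<lambda>s::real. (A * ln (1 / s) + 4) * (C1 * s powr \<kappa>)) \<longlongrightarrow> 0) (at_right 0)"
      by (rule log_times_power_limit) (use J1 J2 in simp_all)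
    have lim2: "((\<lambda>s::real. (16 / s ^ 4 + 1) * (C2 * s ^ 5)) \<longlongrightarrow> 0) (at_right 0)"
      by (rule inverse_power_limit) (use J2 in simp)
    have lim3: "((\<lambda>s. \<Sum>m. prob (E (1/2 * s) (m + nat \<lceil>1 / (1/2 * s) ^ 4\<rceil>))) \<longlongrightarrow> 0) (at_right 0)"
      using filterlim_compose[OF Elim filterlim_mult_at_right_0[of "1/2"]] by simp
    have lim4: "((\<lambda>s::real. 2 * (C3 * s powr \<kappa>')) \<longlongrightarrow> 0) (at_right 0)"
      using power_limit_zero[of \<kappa>' "2 * C3"] J0 by (simp add: mult.assoc)
    have "\<forall>\<^sub>F s in at_right 0. (A * ln (1 / s) + 4) * (C1 * s powr \<kappa>) < p ^ 4 \<and> (16 / s ^ 4 + 1) * (C2 * s ^ 5) < p ^ 4 \<and>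
        (\<Sum>m. prob (E (1/2 * s) (m + nat \<lceil>1 / (1/2 * s) ^ 4\<rceil>))) < p ^ 4 \<and> 2 * (C3 * s powr \<kappa>') < p ^ 4"
      by (intro eventually_conj) (rule order_tendstoD(2)[OF _ p4], rule lim1 lim2 lim3 lim4)+
    then obtain r4 where r4: "r4 > 0" and r4': "\<forall>s>0. s < r4 \<longrightarrow> (A * ln (1 / s) + 4) * (C1 * s powr \<kappa>) < p ^ 4 \<and> (16 / s ^ 4 + 1) * (C2 * s ^ 5) < p ^ 4 \<and>
        (\<Sum>m. prob (E (1/2 * s) (m + nat \<lceil>1 / (1/2 * s) ^ 4\<rceil>))) < p ^ 4 \<and> 2 * (C3 * s powr \<kappa>') < p ^ 4"
      unfolding eventually_at_right_field by (elim exE conjE) (rule that)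
    define T where "T = {1/2, r1, r2, r3, r4, e0}"
    define s1 where "s1 = Min T"
    have T: "finite T" "T \<noteq> {}" unfolding T_def by auto
    have le: "s1 \<le> x" if "x \<in> T" for x unfolding s1_def using T(1) that by (rule Min_le)
    have s1: "s1 \<le> 1/2" "s1 \<le> r1" "s1 \<le> r2" "s1 \<le> r3" "s1 \<le> r4" "s1 \<le> e0"
      by (rule le, simp add: T_def)+
    have "s1 \<in> T" unfolding s1_def by (rule Min_in[OF T])
    then have s1_pos: "s1 > 0" using J1(3) J2(5) J0(3) r4 E0(1) unfolding T_def by auto
    have main: "count_majorized (exp (- s)) (exp (- (s * exp (- h))))
       (prob {\<omega>\<in>space M. X s \<omega> * X (s * exp (- h)) \<omega> < 0} + C * p ^ 4)" if s: "0 < s" "s < s1" for s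
    proof -
      define s' where "s' = s * exp (- h)"
      define e where "e = 1/2 * s"
      define N where "N = nat \<lceil>1 / e ^ 4\<rceil>"
      \<comment> \<open>The summand \<open>3\<close> keeps \<open>M2\<close> above \<open>2\<close>.
        Together with \<open>N \<ge> 1\<close> it makes \<open>AA 0\<close> equal to
        \<open>B1 2\<close> within the space, which is all that a double zero provides.\<close>
      define M2 where "M2 = nat \<lceil>A * ln (1 / s)\<rceil> + 3"
      define \<theta> where "\<theta> = 1 - 1 / (4 * l ^ d)"
      define B1 where "B1 m = jensen_event (p ^ 3) s (s / 2) m" for m
      define B2 where "B2 m = (\<Inter>i<d. jensen_event \<theta> (l ^ i * s) (l ^ i * s - s / 2) m)" for m
      \<comment> \<open>Many zeros in the interval imply all these events, so the probability of
        \<open>AA m\<close> may be bounded by whichever is smallest in the range of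
        \<open>m\<close>. The index is shifted by \<open>2\<close> as in
        \<open>zeros_count_bound\<close>.\<close>
      define AA where "AA m = B1 (m + 2) \<inter> (if M2 \<le> m + 2 then B2 (m + 2) else space M) \<inter> (if N \<le> m then E e m else space M)" for m
      define P where "P = {\<omega>\<in>space M. X s \<omega> * X s' \<omega> < 0} \<union> ({\<omega>\<in>space M. X s \<omega> = 0} \<union> {\<omega>\<in>space M. X s' \<omega> = 0})"
      have s': "0 < s'" "s' < s" "s' \<ge> 15 / 16 * s" 
      proof -
        show "0 < s'" "s' < s" unfolding s'_def using s eh by auto
        show "s' \<ge> 15 / 16 * s" unfolding s'_def using eh h s mult_left_mono[of "15/16" "exp (- h)" s] by (simp add: mult.commute)
      qed
      have shs: "s - s' \<le> h * s" unfolding s'_def using eh(1) s mult_left_mono[of "1 - h" "exp (- h)" s] by (simp add: algebra_simps)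
      have e: "0 < e" "e < e0" unfolding e_def using s s1 by auto
      have N1: "N \<ge> 1" unfolding N_def using e(1) by (simp add: Suc_le_eq)
      have B1s [measurable]: "B1 m \<in> sets M" for m unfolding B1_def by measurable
      have B2s [measurable]: "B2 m \<in> sets M" for m unfolding B2_def using J2(2) by (intro sets.finite_INT) (auto simp: lessThan_empty_iff)
      have AAs [measurable]: "AA m \<in> sets M" for m
        by (cases "M2 \<le> m + 2"; cases "N \<le> m") (simp_all add: AA_def sets.Int)
      have Ps [measurable]: "P \<in> sets M" unfolding P_def by measurable
      have ld: "1 \<le> l ^ i" "i < d \<Longrightarrow> l ^ i \<le> l ^ d" for i using J2(1) by (auto intro: power_increasing)
      have \<theta>1: "\<theta> \<le> 1" unfolding \<theta>_def using ld(1)[of d] by simp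
      have near2: "\<bar>y - l ^ i * s\<bar> \<le> \<theta> * (l ^ i * s - s / 2)" if y: "s' \<le> y" "y \<le> s" and i: "i < d" for y i
      proof -
        have lis: "s \<le> l ^ i * s" "l ^ i * s \<le> l ^ d * s" using ld(1)[of i] ld(2)[OF i] s by auto
        have "1 / (4 * l ^ d) * (l ^ i * s - s / 2) \<le> 1 / (4 * l ^ d) * (l ^ d * s)"
        proof (rule mult_left_mono)
          show "l ^ i * s - s / 2 \<le> l ^ d * s" using lis s by linarith
        qed (use ld(1)[of d] in simp)
        also have "\<dots> = s / 4" using J2(1) by simp
        finally have "1 / (4 * l ^ d) * (l ^ i * s - s / 2) \<le> s / 4" .
        moreover have "\<theta> * (l ^ i * s - s / 2) = (l ^ i * s - s / 2) - 1 / (4 * l ^ d) * (l ^ i * s - s / 2)"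
          unfolding \<theta>_def by (simp add: algebra_simps)
        moreover have "\<bar>y - l ^ i * s\<bar> = l ^ i * s - y" using y lis by simp
        ultimately show ?thesis using y s'(3) s by linarith
      qed
      have near1: "\<bar>y - s\<bar> \<le> p ^ 3 * (s / 2)" if "s' \<le> y" "y \<le> s" for y
        using that shs unfolding h_def by simp
      have p31: "p ^ 3 \<le> 1" using p3 by simp
      have majorant: "AE \<omega> in M. zero_count \<omega> (exp (- s)) (exp (- s')) \<le> of_bool (\<omega> \<in> P) + 2 * (\<Sum>m. of_bool (\<omega> \<in> AA m))"
        using AE_good AE_space
      proof eventually_elim
        case (elim \<omega>)
        let ?Z = "{x\<in>{s'..s}. X x \<omega> = 0}"
        have "emeasure (count_space UNIV) ?Z \<le> of_bool (\<omega> \<in> P) + 2 * (\<Sum>m. of_bool (\<omega> \<in> AA (m + 2 - 2)))"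
        proof (rule zeros_count_bound[of ?Z "\<lambda>m. \<omega> \<in> AA (m - 2)" "\<omega> \<in> P"])
          fix m Y assume m: "2 \<le> m" and Y: "finite Y" "Y \<subseteq> ?Z" "card Y = m"
          have y: "s' \<le> y" "y \<le> s" "X y \<omega> = 0" "y > 0" if "y \<in> Y" for y using Y(2) that s' by auto
          have b1: "\<omega> \<in> B1 m" unfolding B1_def
            by (rule jensen_event_zeros[OF elim(1,2) _ _ Y(1,3) _ p31]) (use y near1 s in auto)
          have b2: "\<omega> \<in> B2 m" unfolding B2_def
          proof
            fix i assume i: "i \<in> {..<d}"
            have "s \<le> l ^ i * s" using ld(1)[of i] s by simp
            then show "\<omega> \<in> jensen_event \<theta> (l ^ i * s) (l ^ i * s - s / 2) m"
              by (intro jensen_event_zeros[OF elim(1,2) _ _ Y(1,3) _ \<theta>1]) (use y near2 s i in auto)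
          qed
          have b3: "\<omega> \<in> E e (m - 2)"
          proof -
            \<comment> \<open>Two zeros are dropped so that the index of \<open>E\<close> agrees
              with that of \<open>AA\<close> and the tail of the sum starts at
              \<open>N\<close>.\<close>
            obtain Y' where Y': "Y' \<subseteq> Y" "card Y' = m - 2" "finite Y'"
              using obtain_subset_with_card_n[of "m - 2" Y] Y(3) by auto
            have inj: "inj_on (\<lambda>y::real. exp (- y)) Y'" by (simp add: inj_on_def)
            have roots: "\<forall>x\<in>(\<lambda>y. exp (- y)) ` Y'. 0 \<le> x \<and> x \<le> 1 - e \<and> random_taylor \<xi> c \<omega> (of_real x) = 0"
            proof
              fix x assume "x \<in> (\<lambda>y. exp (- y)) ` Y'"
              then obtain z where z: "z \<in> Y'" "x = exp (- z)" by auto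
              then have z': "s' \<le> z" "X z \<omega> = 0" "z > 0" using y Y'(1) by auto
              have "3 / 4 * s \<le> z" using z' s' s by linarith
              then have "exp (- z) \<le> exp (- (3 / 4 * s))" by simp
              also have "\<dots> \<le> 1 - s / 2" using s s1 by (intro exp_minus_le_one_minus_half) auto
              finally show "0 \<le> x \<and> x \<le> 1 - e \<and> random_taylor \<xi> c \<omega> (of_real x) = 0"
                using random_taylor_exp_zero_iff[OF elim(1) z'(3)] z' z unfolding e_def by simp
            qed
            have card: "card ((\<lambda>y. exp (- y)) ` Y') = m - 2" using card_image[OF inj] Y' by simp
            have "finite ((\<lambda>y. exp (- y)) ` Y')" using Y'(3) by simp
            then show ?thesis by (rule Emem[rule_format, OF e elim(1,2) _ card]) (rule roots[rule_format])
          qed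
          have eq: "m - 2 + 2 = m" using m by simp
          show "\<omega> \<in> AA (m - 2)" unfolding AA_def eq using b1 b2 b3 elim(2) by simp
        next
          fix x assume Z: "?Z = {x}"
          have x: "s' \<le> x" "x \<le> s" "X x \<omega> = 0" using Z by auto
          have AA0: "\<omega> \<in> AA (2 - 2)" if "\<omega> \<in> B1 2"
          proof -
            have eq: "2 - 2 + 2 = (2::nat)" by simp
            show ?thesis unfolding AA_def eq using that N1 elim(2) unfolding M2_def by simp
          qed
          have "\<omega> \<in> B1 2" if "((\<lambda>t. X t \<omega>) has_real_derivative 0) (at x)"
            unfolding B1_def by (rule jensen_event_double_zero[OF elim(1,2) _ _ _ x(3) _ that p31]) (use x near1 s s' in auto)
          then show "\<omega> \<in> P \<or> \<omega> \<in> AA (2 - 2)"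
            using single_zero_cases[OF elim(1) s'(1,2) Z] elim(2) AA0 unfolding P_def by blast
        qed
        then show ?case unfolding zero_count_exp[OF elim(1) s'(1)] by simp
      qed
      have "(\<integral>\<^sup>+\<omega>. of_bool (\<omega> \<in> P) + 2 * (\<Sum>m. of_bool (\<omega> \<in> AA m)) \<partial>M) \<le> ennreal (prob P + 2 * (4 / 3 * C1 * p ^ 4 + 3 * p ^ 4))"
      proof -
        \<comment> \<open>The summands are the geometric part of \<open>B1\<close>, which is
          summable by itself; its error, charged only below \<open>M2\<close>; the bound for
          \<open>B2\<close>, charged below \<open>N\<close>; and the crude events from
          \<open>N\<close> on.\<close>
        define f where "f m = C1 * p ^ 4 * (p\<^sup>2) ^ m + (if m \<in> {..<M2} then C1 * s powr \<kappa> else 0) + (if m \<in> {..<N} then C2 * s ^ 5 else 0) + (if m < N then 0 else prob (E e m))" for m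
        have bnd: "prob (AA m) \<le> f m" for m
        proof -
          have a1: "prob (AA m) \<le> C1 * (p ^ (2 * (m + 2)) + s powr \<kappa>)"
          proof -
            have "prob (AA m) \<le> prob (B1 (m + 2))" unfolding AA_def by (intro finite_measure_mono) auto
            also have "\<dots> \<le> C1 * (p ^ (2 * (m + 2)) + s powr \<kappa>)" unfolding B1_def using p s s1 by (intro J1'[rule_format]) auto
            finally show ?thesis .
          qed
          have pp: "p ^ (2 * (m + 2)) = p ^ 4 * (p\<^sup>2) ^ m"
          proof -
            have "2 * (m + 2) = 4 + 2 * m" by simp
            then show ?thesis by (simp only: power_add power_mult)
          qed
          have nn: "0 \<le> C1 * p ^ 4 * (p\<^sup>2) ^ m" "0 \<le> C1 * s powr \<kappa>" "0 \<le> C2 * s ^ 5" using J1 J2 p s by auto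
          consider "m + 2 < M2" | "M2 \<le> m + 2" "m < N" | "M2 \<le> m + 2" "N \<le> m" by linarith
          then show ?thesis
          proof cases
            case 1
            have "prob (AA m) \<le> C1 * p ^ 4 * (p\<^sup>2) ^ m + C1 * s powr \<kappa>"
              using a1 unfolding pp by (simp add: algebra_simps)
            moreover have "0 \<le> (if m \<in> {..<N} then C2 * s ^ 5 else 0)" "0 \<le> (if m < N then 0 else prob (E e m))"
              using nn by auto
            moreover have "m \<in> {..<M2}" using 1 by simp
            ultimately show ?thesis unfolding f_def by (simp only: if_True)
          next
            case 2
            have "prob (AA m) \<le> prob (B2 (m + 2))" unfolding AA_def using 2 by (intro finite_measure_mono) auto
            also have "\<dots> \<le> C2 * s ^ 5" unfolding B2_def \<theta>_def
            proof (rule J2'[rule_format])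
              have "A * ln (1 / s) \<le> real M2" unfolding M2_def by linarith
              then show "A * ln (1 / s) \<le> real (m + 2)" using 2 by linarith
            qed (use s s1 in auto)
            finally show ?thesis unfolding f_def using 2 nn by auto
          next
            case 3
            have "prob (AA m) \<le> prob (E e m)" unfolding AA_def using 3 by (intro finite_measure_mono) auto
            then show ?thesis unfolding f_def using 3 nn by auto
          qed
        qed
        have g: "(\<lambda>m. C1 * p ^ 4 * (p\<^sup>2) ^ m) sums (C1 * p ^ 4 * (1 / (1 - p\<^sup>2)))"
          using p by (intro sums_mult geometric_sums) (auto simp: abs_square_less_1)
        have tail: "(\<lambda>m. if m < N then 0 else prob (E e m)) sums (\<Sum>m. prob (E e (m + N)))"
        proof -
          have "(\<lambda>m. prob (E e (m + N))) sums (\<Sum>m. prob (E e (m + N)))"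
            using Esum e by (intro summable_sums summable_ignore_initial_segment) auto
          then have "(\<lambda>m. if m + N < N then 0 else prob (E e (m + N))) sums (\<Sum>m. prob (E e (m + N)))" by simp
          then show ?thesis using sums_iff_shift[of "\<lambda>m. if m < N then 0 else prob (E e m)" N] by simp
        qed
        have sums: "f sums (C1 * p ^ 4 * (1 / (1 - p\<^sup>2)) + (\<Sum>m<M2. C1 * s powr \<kappa>) + (\<Sum>m<N. C2 * s ^ 5) + (\<Sum>m. prob (E e (m + N))))"
          unfolding f_def by (intro sums_add g tail sums_If_finite_set finite_lessThan)
        have "(\<integral>\<^sup>+\<omega>. of_bool (\<omega> \<in> P) + 2 * (\<Sum>m. of_bool (\<omega> \<in> AA m)) \<partial>M) \<le> ennreal (prob P + 2 * (C1 * p ^ 4 * (1 / (1 - p\<^sup>2)) + (\<Sum>m<M2. C1 * s powr \<kappa>) + (\<Sum>m<N. C2 * s ^ 5) + (\<Sum>m. prob (E e (m + N)))))"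
          by (rule nn_integral_count_bound[OF Ps AAs bnd sums])
        also have "\<dots> \<le> ennreal (prob P + 2 * (4 / 3 * C1 * p ^ 4 + 3 * p ^ 4))"
        proof (intro ennreal_leI add_left_mono mult_left_mono)
          have small: "(A * ln (1 / s) + 4) * (C1 * s powr \<kappa>) < p ^ 4" "(16 / s ^ 4 + 1) * (C2 * s ^ 5) < p ^ 4"
            "(\<Sum>m. prob (E e (m + N))) < p ^ 4"
            using r4'[rule_format, of s] s s1 unfolding e_def N_def by auto
          have "p\<^sup>2 \<le> (1/2)\<^sup>2" using p by (intro power_mono) auto
          then have "p\<^sup>2 \<le> 1/4" by (simp add: power2_eq_square)
          then have "1 / (1 - p\<^sup>2) \<le> 4 / 3" by (simp add: field_simps)
          then have "C1 * p ^ 4 * (1 / (1 - p\<^sup>2)) \<le> C1 * p ^ 4 * (4 / 3)" using J1 p by (intro mult_left_mono) auto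
          moreover have "(\<Sum>m<M2. C1 * s powr \<kappa>) \<le> (A * ln (1 / s) + 4) * (C1 * s powr \<kappa>)"
          proof -
            have "ln (1 / s) \<ge> 0" using s s1 by (intro ln_ge_zero) (auto simp: field_simps)
            then have "A * ln (1 / s) \<ge> 0" using J2 by simp
            then have "real M2 \<le> A * ln (1 / s) + 4" unfolding M2_def by linarith
            then have "real M2 * (C1 * s powr \<kappa>) \<le> (A * ln (1 / s) + 4) * (C1 * s powr \<kappa>)" using J1 by (intro mult_right_mono) auto
            then show ?thesis by simp
          qed
          moreover have "(\<Sum>m<N. C2 * s ^ 5) \<le> (16 / s ^ 4 + 1) * (C2 * s ^ 5)"
          proof -
            have "1 / e ^ 4 = 16 / s ^ 4" unfolding e_def by (simp add: power_mult_distrib eval_nat_numeral)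
            moreover have "1 / e ^ 4 \<ge> 0" using e by simp
            ultimately have "real N \<le> 16 / s ^ 4 + 1" unfolding N_def by linarith
            then have "real N * (C2 * s ^ 5) \<le> (16 / s ^ 4 + 1) * (C2 * s ^ 5)" using J2 s by (intro mult_right_mono) auto
            then show ?thesis by simp
          qed
          ultimately show "C1 * p ^ 4 * (1 / (1 - p\<^sup>2)) + (\<Sum>m<M2. C1 * s powr \<kappa>) + (\<Sum>m<N. C2 * s ^ 5) + (\<Sum>m. prob (E e (m + N))) \<le> 4 / 3 * C1 * p ^ 4 + 3 * p ^ 4"
            using small by linarith
        qed simp
        finally show ?thesis .
      qed
      also have "\<dots> \<le> ennreal (prob {\<omega>\<in>space M. X s \<omega> * X s' \<omega> < 0} + C * p ^ 4)"
      proof (rule ennreal_leI)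
        have "prob P \<le> prob {\<omega>\<in>space M. X s \<omega> * X s' \<omega> < 0} + prob ({\<omega>\<in>space M. X s \<omega> = 0} \<union> {\<omega>\<in>space M. X s' \<omega> = 0})"
          unfolding P_def by (intro measure_Un_le) measurable
        also have "prob ({\<omega>\<in>space M. X s \<omega> = 0} \<union> {\<omega>\<in>space M. X s' \<omega> = 0}) \<le> prob {\<omega>\<in>space M. X s \<omega> = 0} + prob {\<omega>\<in>space M. X s' \<omega> = 0}"
          by (intro measure_Un_le) measurable
        also have "\<dots> \<le> C3 * s powr \<kappa>' + C3 * s' powr \<kappa>'" using s s' s1 by (intro add_mono J0'[rule_format]) auto
        also have "\<dots> \<le> C3 * s powr \<kappa>' + C3 * s powr \<kappa>'" using s' J0 by (intro add_mono mult_left_mono powr_mono2) auto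
        also have "\<dots> \<le> p ^ 4" using r4'[rule_format, of s] s s1 by auto
        finally show "prob P + 2 * (4 / 3 * C1 * p ^ 4 + 3 * p ^ 4) \<le> prob {\<omega>\<in>space M. X s \<omega> * X s' \<omega> < 0} + C * p ^ 4"
          unfolding C_def by (simp add: algebra_simps)
      qed
      finally have "count_majorized (exp (- s)) (exp (- s')) (prob {\<omega>\<in>space M. X s \<omega> * X s' \<omega> < 0} + C * p ^ 4)"
        by (rule count_majorizedI[OF AAs Ps majorant])
      then show ?thesis by (simp only: s'_def)
    qed
    show ?thesis
    proof (intro exI[of _ s1] conjI allI impI)
      fix s assume "0 < s" "s < s1"
      from main[OF this] show "count_majorized (exp (- s)) (exp (- (s * exp (- (p ^ 3 / 2)))))
        (prob {\<omega>\<in>space M. X s \<omega> * X (s * exp (- (p ^ 3 / 2))) \<omega> < 0} + C * p ^ 4)" by (simp only: h_def)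
    qed (rule s1_pos)
  qed
  note main = this
  have "C > 0" unfolding C_def using J1 by simp
  then show ?thesis by (intro exI[of _ C] conjI allI impI main)
qed

lemma crude_count_finite:
  "\<exists>e0>0. e0 < 1 \<and> (\<forall>e. 0 < e \<longrightarrow> e < e0 \<longrightarrow> (\<exists>B\<ge>0. count_majorized 0 (1 - e) B))"
proof -
  obtain E e0 where E0: "0 < e0" "e0 < 1" "\<forall>e m. E e m \<in> sets M"
    and Emem: "\<forall>e m \<omega> Z. 0 < e \<longrightarrow> e < e0 \<longrightarrow> good \<omega> \<longrightarrow> \<omega> \<in> space M \<longrightarrow> finite Z \<longrightarrow> card Z = m \<longrightarrow>
       (\<forall>x\<in>Z. 0 \<le> x \<and> x \<le> 1 - e \<and> random_taylor \<xi> c \<omega> (of_real x) = 0) \<longrightarrow> \<omega> \<in> E e m"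
    and Esum: "\<forall>e. 0 < e \<longrightarrow> e < e0 \<longrightarrow> summable (\<lambda>m. prob (E e m))"
    using crude_zeros_bound by (elim exE conjE) (rule that)
  have "\<exists>B\<ge>0. count_majorized 0 (1 - e) B" if e: "0 < e" "e < e0" for e
  proof -
    have majorant: "AE \<omega> in M. zero_count \<omega> 0 (1 - e) \<le> of_bool (\<omega> \<in> space M) + 2 * (\<Sum>m. of_bool (\<omega> \<in> E e (m + 2)))"
      using AE_good AE_space
    proof eventually_elim
      case (elim \<omega>)
      let ?Z = "{x::real. 0 \<le> x \<and> x \<le> 1 - e \<and> random_taylor \<xi> c \<omega> (of_real x) = 0}"
      show ?case unfolding zero_count_def
      proof (rule zeros_count_bound[of ?Z "\<lambda>m. \<omega> \<in> E e m" "\<omega> \<in> space M"])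
        fix m Y assume "finite Y" "Y \<subseteq> ?Z" "card Y = m"
        then show "\<omega> \<in> E e m" by (intro Emem[rule_format, OF e elim(1,2), of Y m]) auto
      qed (use elim in auto)
    qed
    have Es: "E e (m + 2) \<in> sets M" for m using E0(3) by blast
    have "(\<integral>\<^sup>+\<omega>. of_bool (\<omega> \<in> space M) + 2 * (\<Sum>m. of_bool (\<omega> \<in> E e (m + 2))) \<partial>M) \<le> ennreal (prob (space M) + 2 * (\<Sum>m. prob (E e (m + 2))))"
    proof (rule nn_integral_count_bound[OF sets.top Es order_refl])
      show "(\<lambda>m. prob (E e (m + 2))) sums (\<Sum>m. prob (E e (m + 2)))"
        using Esum e by (intro summable_sums summable_ignore_initial_segment) auto
    qed
    then have "count_majorized 0 (1 - e) (prob (space M) + 2 * (\<Sum>m. prob (E e (m + 2))))"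
      by (rule count_majorizedI[OF Es sets.top majorant])
    moreover have "(\<Sum>m. prob (E e (m + 2))) \<ge> 0"
      using Esum e by (intro suminf_nonneg summable_ignore_initial_segment) auto
    ultimately show ?thesis by (intro exI[of _ "prob (space M) + 2 * (\<Sum>m. prob (E e (m + 2)))"]) simp
  qed
  note main = this
  show ?thesis by (rule exI[of _ e0]) (intro conjI allI impI main E0(1,2))
qed

end

section \<open>Asymptotics of the expected number of zeros\<close>

lemma cesaro_mean:
  fixes q :: "nat \<Rightarrow> real"
  assumes "q \<longlonglongrightarrow> l"
  shows "(\<lambda>n. (\<Sum>j<n. q j) / real n) \<longlonglongrightarrow> l"
proof (rule LIMSEQ_I)
  fix e :: real assume e: "0 < e"
  obtain k where k: "\<And>j. j \<ge> k \<Longrightarrow> \<bar>q j - l\<bar> < e / 2"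
    using LIMSEQ_D[OF assms, of "e / 2"] e by auto
  define A where "A = (\<Sum>j<k. \<bar>q j - l\<bar>)"
  have "((\<lambda>n. A / real n) \<longlongrightarrow> 0) sequentially" by real_asymp
  from LIMSEQ_D[OF this, of "e / 2"] e obtain n0 where n0: "\<And>n. n \<ge> n0 \<Longrightarrow> \<bar>A / real n\<bar> < e / 2" by auto
  show "\<exists>N. \<forall>n\<ge>N. norm ((\<Sum>j<n. q j) / real n - l) < e"
  proof (intro exI[of _ "max 1 (max k n0)"] allI impI)
    fix n assume n: "n \<ge> max 1 (max k n0)"
    have "\<bar>(\<Sum>j<n. q j) / real n - l\<bar> = \<bar>\<Sum>j<n. q j - l\<bar> / real n"
      using n by (simp add: sum_subtractf field_simps)
    also have "\<dots> \<le> (\<Sum>j<n. \<bar>q j - l\<bar>) / real n" by (intro divide_right_mono sum_abs) auto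
    also have "(\<Sum>j<n. \<bar>q j - l\<bar>) = A + (\<Sum>j=k..<n. \<bar>q j - l\<bar>)"
      unfolding A_def using n by (simp add: lessThan_atLeast0 sum.atLeastLessThan_concat)
    also have "(\<Sum>j=k..<n. \<bar>q j - l\<bar>) \<le> (\<Sum>j=k..<n. e / 2)" using k by (intro sum_mono less_imp_le) auto
    also have "(\<Sum>j=k..<n. e / 2) \<le> real n * (e / 2)" using e by (simp add: mult_right_mono)
    finally have "\<bar>(\<Sum>j<n. q j) / real n - l\<bar> \<le> A / real n + e / 2"
      using n by (simp add: add_divide_distrib divide_right_mono)
    moreover have "\<bar>A / real n\<bar> < e / 2" using n by (intro n0) simp
    ultimately show "norm ((\<Sum>j<n. q j) / real n - l) < e" unfolding real_norm_def by linarith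
  qed
qed

text \<open>An iterated limit: the parameter \<open>p\<close> is fixed according to the tolerance
  before \<open>r\<close> moves, so the bounds need no uniformity in \<open>p\<close>.\<close>

lemma tendsto_of_parametric_bounds:
  fixes g :: "'b \<Rightarrow> 'c::linorder_topology" and A B :: "real \<Rightarrow> 'c"
  assumes bounds: "\<And>p. 0 < p \<Longrightarrow> p \<le> 1/2 \<Longrightarrow> \<exists>lo up. (\<forall>\<^sub>F r in F. lo r \<le> g r \<and> g r \<le> up r) \<and> (lo \<longlongrightarrow> A p) F \<and> (up \<longlongrightarrow> B p) F"
    and A: "(A \<longlongrightarrow> l) (at_right 0)" and B: "(B \<longlongrightarrow> l) (at_right 0)"
  shows "(g \<longlongrightarrow> l) F"
proof (rule order_tendstoI)
  have small: "\<forall>\<^sub>F p::real in at_right 0. 0 < p \<and> p \<le> 1/2"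
    unfolding eventually_at_right_field by (intro exI[of _ "1/2"]) auto
  {
    fix a assume "a < l"
    from eventually_happens'[OF _ eventually_conj[OF small order_tendstoD(1)[OF A this]]]
    obtain p where p: "0 < p" "p \<le> 1/2" "a < A p" by auto
    obtain lo up where lu: "\<forall>\<^sub>F r in F. lo r \<le> g r \<and> g r \<le> up r" "(lo \<longlongrightarrow> A p) F" using bounds[OF p(1,2)] by blast
    from lu(1) order_tendstoD(1)[OF lu(2) p(3)] show "\<forall>\<^sub>F r in F. a < g r"
      by eventually_elim auto
  }
  {
    fix a assume "l < a"
    from eventually_happens'[OF _ eventually_conj[OF small order_tendstoD(2)[OF B this]]]
    obtain p where p: "0 < p" "p \<le> 1/2" "B p < a" by auto
    obtain lo up where lu: "\<forall>\<^sub>F r in F. lo r \<le> g r \<and> g r \<le> up r" "(up \<longlongrightarrow> B p) F" using bounds[OF p(1,2)] by blast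
    from lu(1) order_tendstoD(2)[OF lu(2) p(3)] show "\<forall>\<^sub>F r in F. g r < a"
      by eventually_elim auto
  }
qed

text \<open>The correlation is \<open>1 - \<gamma> * h\<^sup>2 / 8\<close> up to higher order, and
  \<open>arccos\<close> has a square root singularity at \<open>1\<close>.\<close>

lemma sign_change_rate:
  fixes \<gamma> :: real
  assumes "\<gamma> > 0"
  shows "((\<lambda>h. arccos ((2 * sqrt (exp (- h)) / (1 + exp (- h))) powr \<gamma>) / pi / h) \<longlongrightarrow> sqrt \<gamma> / (2 * pi)) (at_right 0)"
proof -
  define \<rho> where "\<rho> h = (2 * sqrt (exp (- h)) / (1 + exp (- h))) powr \<gamma>" for h :: real
  \<comment> \<open>The form with \<open>arctan\<close> moves the singularity into an explicit root,
    of an expression asymptotic to \<open>\<gamma> * h\<^sup>2 / 4\<close>.\<close>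
  have eq: "arccos (\<rho> h) = arctan (sqrt (1 / (\<rho> h)\<^sup>2 - 1))" for h
  proof -
    have pos: "2 * sqrt (exp (- h)) / (1 + exp (- h)) > 0" by (simp add: add_pos_pos)
    have "2 * sqrt (exp (- h)) \<le> 1 + exp (- h)"
      using sum_squares_ge_zero[of "1 - sqrt (exp (- h))" 0] by (simp add: algebra_simps)
    then have le: "2 * sqrt (exp (- h)) / (1 + exp (- h)) \<le> 1" by (simp add: add_pos_pos)
    have r: "0 < \<rho> h" "\<rho> h \<le> 1" unfolding \<rho>_def using pos le assms by (auto intro: powr_le1)
    define y where "y = sqrt (1 / (\<rho> h)\<^sup>2 - 1)"
    have "(\<rho> h)\<^sup>2 \<le> 1" using r by (simp add: power_le_one)
    then have y2: "y\<^sup>2 = 1 / (\<rho> h)\<^sup>2 - 1" "y \<ge> 0" unfolding y_def using r by (auto simp: field_simps)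
    have "cos (arctan y) = \<rho> h" unfolding cos_arctan y2(1) using r by (simp add: real_sqrt_divide)
    moreover have "arccos (cos (arctan y)) = arctan y"
      using y2(2) arctan_bounded[of y] pi_gt_zero by (intro arccos_cos) (simp, linarith)
    ultimately show ?thesis unfolding y_def by simp
  qed
  have root: "(\<gamma> / 4) powr (1/2) = sqrt \<gamma> / 2" using assms by (simp add: powr_half_sqrt real_sqrt_divide)
  have "(\<gamma> / 4) powr (1/2) * inverse pi = sqrt \<gamma> / (2 * pi)" unfolding root by (simp add: field_simps)
  moreover have "((\<lambda>h. arctan (sqrt (1 / (((2 * sqrt (exp (- h)) / (1 + exp (- h))) powr \<gamma>)\<^sup>2) - 1)) / pi / h) \<longlongrightarrow> (\<gamma> / 4) powr (1/2) * inverse pi) (at_right 0)"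
    using assms by real_asymp
  ultimately have "((\<lambda>h. arctan (sqrt (1 / (\<rho> h)\<^sup>2 - 1)) / pi / h) \<longlongrightarrow> sqrt \<gamma> / (2 * pi)) (at_right 0)"
    unfolding \<rho>_def by (simp only:)
  then show ?thesis unfolding eq[symmetric] unfolding \<rho>_def .
qed

lemma floor_quotient_limit:
  fixes h :: real
  assumes "h > 0"
  shows "((\<lambda>T. real (nat \<lfloor>T / h\<rfloor>) / T) \<longlongrightarrow> 1 / h) at_top"
proof -
  have "((\<lambda>T. real (nat \<lfloor>T / h\<rfloor>) / T) \<longlongrightarrow> inverse h) at_top" using assms by real_asymp
  then show ?thesis unfolding inverse_eq_divide .
qed

lemma ceiling_quotient_limit:
  fixes h :: real
  assumes "h > 0"
  shows "((\<lambda>T. real (nat \<lceil>T / h\<rceil>) / T) \<longlongrightarrow> 1 / h) at_top"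
proof -
  have "((\<lambda>T. real (nat \<lceil>T / h\<rceil>) / T) \<longlongrightarrow> inverse h) at_top" using assms by real_asymp
  then show ?thesis unfolding inverse_eq_divide .
qed

lemma log_log_at_top: "filterlim (\<lambda>r::real. - ln (- ln r)) at_top (at_left 1)"
  by real_asymp

text \<open>The grid lives in the coordinate \<open>s = - ln r\<close>, the theorem in
  \<open>1 - r\<close>; these are equivalent at \<open>r = 1\<close>, so their logarithms have ratio
  tending to \<open>1\<close>.\<close>

lemma log_log_ratio: "((\<lambda>r::real. (- ln (- ln r)) / (- ln (1 - r))) \<longlongrightarrow> 1) (at_left 1)"
  by real_asymp

text \<open>The quotient is the product of a Cesaro mean, the number of grid points per unit of
  \<open>T\<close>, and the ratio of the two logarithms.\<close>

lemma partial_sums_over_log: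
  fixes q :: "nat \<Rightarrow> real" and N :: "real \<Rightarrow> nat"
  assumes q: "q \<longlonglongrightarrow> l" and N: "filterlim N at_top at_top" "((\<lambda>T. real (N T) / T) \<longlongrightarrow> c) at_top"
  shows "((\<lambda>r. (\<Sum>j<N (- ln (- ln r)). q j) / (- ln (1 - r))) \<longlongrightarrow> l * c) (at_left 1)"
proof -
  let ?T = "\<lambda>r::real. - ln (- ln r)"
  have 1: "((\<lambda>r. (\<Sum>j<N (?T r). q j) / real (N (?T r))) \<longlongrightarrow> l) (at_left 1)"
    by (rule filterlim_compose[OF cesaro_mean[OF q] filterlim_compose[OF N(1) log_log_at_top]])
  have 2: "((\<lambda>r. real (N (?T r)) / ?T r) \<longlongrightarrow> c) (at_left 1)"
    by (rule filterlim_compose[OF N(2) log_log_at_top])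
  have "((\<lambda>r. (\<Sum>j<N (?T r). q j) / real (N (?T r)) * (real (N (?T r)) / ?T r) * (?T r / (- ln (1 - r)))) \<longlongrightarrow> l * c * 1) (at_left 1)"
    by (intro tendsto_mult 1 2 log_log_ratio)
  moreover have "\<forall>\<^sub>F r in at_left 1. ?T r > 0"
    using log_log_at_top unfolding filterlim_at_top_dense by (rule spec)
  then have "\<forall>\<^sub>F r in at_left 1. (\<Sum>j<N (?T r). q j) / real (N (?T r)) * (real (N (?T r)) / ?T r) * (?T r / (- ln (1 - r))) = (\<Sum>j<N (?T r). q j) / (- ln (1 - r))"
  proof eventually_elim
    case (elim r)
    then show ?case by (cases "N (?T r) = 0") auto
  qed
  ultimately have "((\<lambda>r. (\<Sum>j<N (?T r). q j) / (- ln (1 - r))) \<longlongrightarrow> l * c * 1) (at_left 1)"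
    by (rule Lim_transform_eventually)
  then show ?thesis unfolding mult_1_right .
qed

lemma card_le_emeasure_count:
  assumes "finite J" "inj_on f J" "f ` J \<subseteq> A"
  shows "of_nat (card J) \<le> emeasure (count_space UNIV) A"
proof -
  have "of_nat (card J) = emeasure (count_space UNIV) (f ` J)"
    using assms by (simp add: card_image emeasure_count_space_finite)
  also have "\<dots> \<le> emeasure (count_space UNIV) A" using assms(3) by (intro emeasure_mono) auto
  finally show ?thesis .
qed

section \<open>Upper and lower bounds for the expected count\<close>

context random_series
begin

text \<open>A zero at the common end point is counted twice, which is harmless for an upper
  bound.\<close>

lemma count_majorized_add:
  assumes "count_majorized a b B1" "count_majorized b d B2" "0 \<le> B1" "0 \<le> B2" 
  shows "count_majorized a d (B1 + B2)"
proof -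
  obtain G where G: "G \<in> borel_measurable M" "AE \<omega> in M. zero_count \<omega> a b \<le> G \<omega>" "(\<integral>\<^sup>+\<omega>. G \<omega> \<partial>M) \<le> ennreal B1"
    using assms(1) unfolding count_majorized_def by (elim bexE conjE) (rule that)
  obtain H where H: "H \<in> borel_measurable M" "AE \<omega> in M. zero_count \<omega> b d \<le> H \<omega>" "(\<integral>\<^sup>+\<omega>. H \<omega> \<partial>M) \<le> ennreal B2"
    using assms(2) unfolding count_majorized_def by (elim bexE conjE) (rule that)
  have le: "zero_count \<omega> a d \<le> zero_count \<omega> a b + zero_count \<omega> b d" for \<omega>
  proof -
    let ?Z = "\<lambda>u v. {x::real. u \<le> x \<and> x \<le> v \<and> random_taylor \<xi> c \<omega> (of_real x) = 0}"
    have "emeasure (count_space UNIV) (?Z a d) \<le> emeasure (count_space UNIV) (?Z a b \<union> ?Z b d)"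
      by (intro emeasure_mono) auto
    also have "\<dots> \<le> emeasure (count_space UNIV) (?Z a b) + emeasure (count_space UNIV) (?Z b d)"
      by (intro emeasure_subadditive) auto
    finally show ?thesis unfolding zero_count_def .
  qed
  show ?thesis unfolding count_majorized_def
  proof (intro bexI conjI)
    show "AE \<omega> in M. zero_count \<omega> a d \<le> G \<omega> + H \<omega>"
      using G(2) H(2)
    proof eventually_elim
      case (elim \<omega>)
      show ?case by (rule order_trans[OF le add_mono[OF elim]])
    qed
    have "(\<integral>\<^sup>+\<omega>. G \<omega> + H \<omega> \<partial>M) = (\<integral>\<^sup>+\<omega>. G \<omega> \<partial>M) + (\<integral>\<^sup>+\<omega>. H \<omega> \<partial>M)" by (rule nn_integral_add[OF G(1) H(1)])
    also have "\<dots> \<le> ennreal B1 + ennreal B2" by (rule add_mono[OF G(3) H(3)])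
    also have "\<dots> = ennreal (B1 + B2)" by (rule ennreal_plus[OF assms(3,4), symmetric])
    finally show "(\<integral>\<^sup>+\<omega>. G \<omega> + H \<omega> \<partial>M) \<le> ennreal (B1 + B2)" .
    show "(\<lambda>\<omega>. G \<omega> + H \<omega>) \<in> borel_measurable M" using G(1) H(1) by measurable
  qed
qed

lemma count_majorized_sum:
  assumes "j0 \<le> n" "count_majorized a (b j0) B" "0 \<le> B"
    and q: "\<And>j. j0 \<le> j \<Longrightarrow> count_majorized (b j) (b (Suc j)) (q j)" "\<And>j. 0 \<le> q j"
  shows "count_majorized a (b n) (B + (\<Sum>j=j0..<n. q j))"
  using assms(1)
proof (induction n rule: dec_induct)
  case base
  show ?case using assms(2) by simp
next
  case (step n)
  have "0 \<le> B + (\<Sum>j=j0..<n. q j)" by (intro add_nonneg_nonneg sum_nonneg assms(3) q(2))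
  from count_majorized_add[OF step.IH q(1)[OF step.hyps(1)] this q(2)]
  show ?case unfolding sum.atLeastLessThan_Suc[OF step.hyps(1)] add.assoc .
qed

lemma nn_integral_count_majorized:
  assumes "count_majorized a b B"
  shows "(\<integral>\<^sup>+\<omega>. zero_count \<omega> a b \<partial>M) \<le> ennreal B"
proof -
  obtain G where G: "AE \<omega> in M. zero_count \<omega> a b \<le> G \<omega>" "(\<integral>\<^sup>+\<omega>. G \<omega> \<partial>M) \<le> ennreal B"
    using assms unfolding count_majorized_def by (elim bexE conjE) (rule that)
  show ?thesis by (rule order_trans[OF nn_integral_mono_AE[OF G(1)] G(2)])
qed

definition sign_change_prob :: "real \<Rightarrow> nat \<Rightarrow> real" where
  "sign_change_prob h j = prob {\<omega>\<in>space M. X (exp (- (h * real j))) \<omega> * X (exp (- (h * real j)) * exp (- h)) \<omega> < 0}"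

lemma exp_step:
  fixes h :: real
  shows "exp (- (h * real j)) * exp (- h) = exp (- (h * real (Suc j)))"
proof -
  have "- (h * real (Suc j)) = - (h * real j) + - h" by (simp add: algebra_simps)
  then show ?thesis by (simp only: exp_add)
qed

text \<open>The order of the quantifiers matters: \<open>C\<close> is chosen before
  \<open>p\<close>, because its contribution \<open>C * p ^ 4\<close> per interval must be
  \<open>o(h)\<close> as \<open>p\<close> tends to \<open>0\<close>. \<open>j0\<close> and
  \<open>B\<close> may depend on \<open>p\<close>, since \<open>B\<close> vanishes after division by
  the logarithm at fixed \<open>p\<close>.\<close>

lemma expected_zeros_upper:
  "\<exists>C>0. \<forall>p. 0 < p \<longrightarrow> p \<le> 1/2 \<longrightarrow> (\<exists>j0 B. \<forall>n\<ge>j0.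
     (\<integral>\<^sup>+\<omega>. zero_count \<omega> 0 (exp (- exp (- (p ^ 3 / 2 * real n)))) \<partial>M)
       \<le> ennreal (B + (\<Sum>j<n. sign_change_prob (p ^ 3 / 2) j + C * p ^ 4)))"
proof -
  obtain C where C: "C > 0" and bnd: "\<forall>p. 0 < p \<longrightarrow> p \<le> 1/2 \<longrightarrow> (\<exists>s1>0. \<forall>s. 0 < s \<longrightarrow> s < s1 \<longrightarrow>
     count_majorized (exp (- s)) (exp (- (s * exp (- (p ^ 3 / 2)))))
       (prob {\<omega>\<in>space M. X s \<omega> * X (s * exp (- (p ^ 3 / 2))) \<omega> < 0} + C * p ^ 4))"
    using interval_count_bound by (elim exE conjE) (rule that)
  obtain e0 where e0: "e0 > 0" and crude: "\<forall>e. 0 < e \<longrightarrow> e < e0 \<longrightarrow> (\<exists>B\<ge>0. count_majorized 0 (1 - e) B)"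
    using crude_count_finite by (elim exE conjE) (rule that)
  have "\<exists>j0 B. \<forall>n\<ge>j0. (\<integral>\<^sup>+\<omega>. zero_count \<omega> 0 (exp (- exp (- (p ^ 3 / 2 * real n)))) \<partial>M)
       \<le> ennreal (B + (\<Sum>j<n. sign_change_prob (p ^ 3 / 2) j + C * p ^ 4))" if p: "0 < p" "p \<le> 1/2" for p
  proof -
    define h where "h = p ^ 3 / 2"
    define s where "s j = exp (- (h * real j))" for j
    have h: "h > 0" unfolding h_def using p by simp
    obtain s1 where s1: "s1 > 0" and maj_step: "\<forall>s. 0 < s \<longrightarrow> s < s1 \<longrightarrow>
       count_majorized (exp (- s)) (exp (- (s * exp (- h)))) (prob {\<omega>\<in>space M. X s \<omega> * X (s * exp (- h)) \<omega> < 0} + C * p ^ 4)"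
      using bnd[rule_format, OF p, folded h_def] by (elim exE conjE) (rule that)
    have "s \<longlonglongrightarrow> 0" unfolding s_def using h by real_asymp
    then have "\<forall>\<^sub>F j in sequentially. s j < min s1 e0" using s1 e0 by (intro order_tendstoD) auto
    then obtain j0 where j0: "\<And>j. j \<ge> j0 \<Longrightarrow> s j < min s1 e0" unfolding eventually_sequentially by auto
    have s_pos: "s j > 0" for j unfolding s_def by simp
    \<comment> \<open>The grid point \<open>j0\<close> ends the initial stretch
      \<open>[0, 1 - e]\<close>, and \<open>e \<le> s j0 < e0\<close> admits the crude count
      there.\<close>
    define e where "e = 1 - exp (- s j0)"
    have "s j0 < e0" using j0[OF order_refl] by (simp only: min_less_iff_conj)
    moreover have "exp (- s j0) < 1" using s_pos[of j0] by simp
    ultimately have e: "e > 0" "e < e0" using exp_ge_add_one_self[of "- s j0"] unfolding e_def by linarith+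
    have e_eq: "1 - e = exp (- s j0)" unfolding e_def by simp
    obtain B where B: "B \<ge> 0" "count_majorized 0 (exp (- s j0)) B"
      using crude[rule_format, OF e, unfolded e_eq] by (elim exE conjE) (rule that)
    have q0: "sign_change_prob h j + C * p ^ 4 \<ge> 0" for j
    proof -
      have "0 \<le> C * p ^ 4" using C p(1) by (intro mult_nonneg_nonneg zero_le_power less_imp_le)
      then show ?thesis unfolding sign_change_prob_def by (intro add_nonneg_nonneg measure_nonneg)
    qed
    have next_interval: "count_majorized (exp (- s j)) (exp (- s (Suc j))) (sign_change_prob h j + C * p ^ 4)" if "j0 \<le> j" for j
    proof -
      have "s j < s1" using j0[OF that] by (simp only: min_less_iff_conj)
      note bound = maj_step[rule_format, OF s_pos this]
      have step: "s j * exp (- h) = s (Suc j)" unfolding s_def by (rule exp_step)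
      have "sign_change_prob h j = prob {\<omega>\<in>space M. X (s j) \<omega> * X (s j * exp (- h)) \<omega> < 0}"
        unfolding sign_change_prob_def s_def by (rule refl)
      then show ?thesis using bound by (simp only: step)
    qed
    have maj: "count_majorized 0 (exp (- s n)) (B + (\<Sum>j=j0..<n. sign_change_prob h j + C * p ^ 4))" if "j0 \<le> n" for n
    proof (rule count_majorized_sum[where b = "\<lambda>n. exp (- s n)" and q = "\<lambda>j. sign_change_prob h j + C * p ^ 4"])
      show "count_majorized (exp (- s j)) (exp (- s (Suc j))) (sign_change_prob h j + C * p ^ 4)" if "j0 \<le> j" for j
        using that by (rule next_interval)
    qed (rule that B q0)+
    have "(\<integral>\<^sup>+\<omega>. zero_count \<omega> 0 (exp (- s n)) \<partial>M) \<le> ennreal (B + (\<Sum>j<n. sign_change_prob h j + C * p ^ 4))" if n: "n \<ge> j0" for n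
    proof -
      have "(\<Sum>j=j0..<n. sign_change_prob h j + C * p ^ 4) \<le> (\<Sum>j<n. sign_change_prob h j + C * p ^ 4)"
        by (intro sum_mono2 q0) auto
      then show ?thesis
        by (intro order_trans[OF nn_integral_count_majorized[OF maj[OF n]]] ennreal_leI add_left_mono)
    qed
    note bound = this[unfolded s_def h_def]
    show ?thesis by (rule exI[of _ j0], rule exI[of _ B], intro allI impI, rule bound)
  qed
  note main = this
  show ?thesis by (rule exI[of _ C]) (intro conjI allI impI main C)
qed

text \<open>Each sign change yields a zero in the open interval between neighbouring grid points, so
  different indices yield different zeros. The counting function of sign changes is measurable, and
  monotonicity of \<open>nn_integral\<close> suffices in this direction.\<close>

lemma expected_zeros_lower:
  assumes h: "h > 0"
  shows "ennreal (\<Sum>j<n. sign_change_prob h j) \<le> (\<integral>\<^sup>+\<omega>. zero_count \<omega> 0 (exp (- exp (- (h * real n)))) \<partial>M)"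
proof -
  define s where "s j = exp (- (h * real j))" for j
  define A where "A j = {\<omega>\<in>space M. X (s j) \<omega> * X (s (Suc j)) \<omega> < 0}" for j
  have s_pos: "s j > 0" for j unfolding s_def by simp
  have s_less: "s (Suc j) < s j" for j unfolding s_def using h by simp
  have s_mono: "s j \<le> s i" if "i \<le> j" for i j unfolding s_def using h that by simp
  have A: "A j \<in> sets M" for j unfolding A_def by measurable
  have prob_A: "prob (A j) = sign_change_prob h j" for j unfolding A_def sign_change_prob_def s_def exp_step ..
  have "ennreal (\<Sum>j<n. sign_change_prob h j) = (\<Sum>j<n. emeasure M (A j))"
    by (simp add: emeasure_eq_measure prob_A sum_ennreal[symmetric]) (simp add: sign_change_prob_def)
  also have "\<dots> = (\<integral>\<^sup>+\<omega>. (\<Sum>j<n. indicator (A j) \<omega>) \<partial>M)" using A by (simp add: nn_integral_sum)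
  also have "\<dots> \<le> (\<integral>\<^sup>+\<omega>. zero_count \<omega> 0 (exp (- s n)) \<partial>M)"
  proof (rule nn_integral_mono_AE)
    show "AE \<omega> in M. (\<Sum>j<n. indicator (A j) \<omega>) \<le> zero_count \<omega> 0 (exp (- s n))"
      using AE_good
    proof eventually_elim
      case (elim \<omega>)
      define J where "J = {j\<in>{..<n}. \<omega> \<in> A j}"
      have "\<exists>x. s (Suc j) < x \<and> x < s j \<and> X x \<omega> = 0" if "j \<in> J" for j
        using that sign_change_zero[OF elim s_pos s_less] unfolding J_def A_def by simp
      then obtain x where x: "s (Suc j) < x j" "x j < s j" "X (x j) \<omega> = 0" if "j \<in> J" for j by metis
      have less: "x j < x i" if "i \<in> J" "j \<in> J" "i < j" for i j
        using x(1)[OF that(1)] x(2)[OF that(2)] s_mono[of "Suc i" j] that(3) by simp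
      have "x i \<noteq> x j" if "i \<in> J" "j \<in> J" "i \<noteq> j" for i j
        using less[OF that(1,2)] less[OF that(2,1)] that(3) by (cases i j rule: linorder_cases) auto
      then have inj: "inj_on (\<lambda>j. exp (- x j)) J" by (auto simp: inj_on_def)
      have "(\<Sum>j<n. indicator (A j) \<omega> :: ennreal) = of_nat (card J)"
        unfolding J_def by (simp add: indicator_def sum.If_cases Collect_conj_eq lessThan_def)
      also have "\<dots> \<le> zero_count \<omega> 0 (exp (- s n))" unfolding zero_count_def
      proof (rule card_le_emeasure_count[OF _ inj])
        show "finite J" unfolding J_def by simp
        show "(\<lambda>j. exp (- x j)) ` J \<subseteq> {x. 0 \<le> x \<and> x \<le> exp (- s n) \<and> random_taylor \<xi> c \<omega> (of_real x) = 0}"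
        proof
          fix y assume "y \<in> (\<lambda>j. exp (- x j)) ` J"
          then obtain j where j: "j \<in> J" "y = exp (- x j)" by auto
          have xp: "x j > 0" using x(1)[OF j(1)] s_pos[of "Suc j"] by simp
          have "s n \<le> x j" using x(1)[OF j(1)] s_mono[of "Suc j" n] j(1) unfolding J_def by simp
          then show "y \<in> {x. 0 \<le> x \<and> x \<le> exp (- s n) \<and> random_taylor \<xi> c \<omega> (of_real x) = 0}"
            using random_taylor_exp_zero_iff[OF elim xp] x(3)[OF j(1)] j(2) by simp
        qed
      qed
      finally show ?case .
    qed
  qed
  finally show ?thesis unfolding s_def .
qed

lemma zero_count_mono: "b \<le> b' \<Longrightarrow> zero_count \<omega> a b \<le> zero_count \<omega> a b'"
  unfolding zero_count_def by (intro emeasure_mono) auto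

lemma expected_zeros_limit:
  "((\<lambda>r. (\<integral>\<^sup>+\<omega>. zero_count \<omega> 0 r \<partial>M) / ennreal (- ln (1 - r))) \<longlongrightarrow> ennreal (sqrt \<gamma> / (2 * pi))) (at_left 1)"
proof -
  obtain C where C: "C > 0" and upper: "\<forall>p. 0 < p \<longrightarrow> p \<le> 1/2 \<longrightarrow> (\<exists>j0 B. \<forall>n\<ge>j0.
     (\<integral>\<^sup>+\<omega>. zero_count \<omega> 0 (exp (- exp (- (p ^ 3 / 2 * real n)))) \<partial>M)
       \<le> ennreal (B + (\<Sum>j<n. sign_change_prob (p ^ 3 / 2) j + C * p ^ 4)))"
    using expected_zeros_upper by (elim exE conjE) (rule that)
  define P where "P h = arccos ((2 * sqrt (exp (- h)) / (1 + exp (- h))) powr \<gamma>) / pi" for h :: real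
  define T where "T r = - ln (- ln r)" for r :: real
  have rate: "((\<lambda>p. P (p ^ 3 / 2) * (1 / (p ^ 3 / 2))) \<longlongrightarrow> sqrt \<gamma> / (2 * pi)) (at_right 0)"
  proof -
    have "filterlim (\<lambda>p::real. p ^ 3 / 2) (at_right 0) (at_right 0)" by real_asymp
    from filterlim_compose[OF sign_change_rate[OF gamma_pos] this] show ?thesis unfolding P_def by simp
  qed
  have "((\<lambda>p::real. C * p ^ 4 / (p ^ 3 / 2)) \<longlongrightarrow> 0) (at_right 0)" by real_asymp
  from tendsto_add[OF rate this]
  have rate': "((\<lambda>p. (P (p ^ 3 / 2) + C * p ^ 4) * (1 / (p ^ 3 / 2))) \<longlongrightarrow> sqrt \<gamma> / (2 * pi)) (at_right 0)"
    by (simp add: add_divide_distrib ring_distribs)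
  show ?thesis
  proof (rule tendsto_of_parametric_bounds[where A = "\<lambda>p. ennreal (P (p ^ 3 / 2) * (1 / (p ^ 3 / 2)))"
        and B = "\<lambda>p. ennreal ((P (p ^ 3 / 2) + C * p ^ 4) * (1 / (p ^ 3 / 2)))"])
    fix p :: real assume p: "0 < p" "p \<le> 1/2"
    define h where "h = p ^ 3 / 2"
    have h: "h > 0" unfolding h_def using p by simp
    let ?q = "sign_change_prob h"
    obtain j0 B where up: "\<forall>n\<ge>j0. (\<integral>\<^sup>+\<omega>. zero_count \<omega> 0 (exp (- exp (- (h * real n)))) \<partial>M)
       \<le> ennreal (B + (\<Sum>j<n. ?q j + C * p ^ 4))"
      using upper[rule_format, OF p, folded h_def] by (elim exE) (rule that)
    have q: "?q \<longlonglongrightarrow> P h" unfolding P_def using sign_change_prob_limit[OF h] unfolding sign_change_prob_def .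
    then have q': "(\<lambda>j. ?q j + C * p ^ 4) \<longlonglongrightarrow> P h + C * p ^ 4" by (intro tendsto_add tendsto_const)
    have top: "filterlim (\<lambda>T. nat \<lfloor>T / h\<rfloor>) at_top at_top" "filterlim (\<lambda>T. nat \<lceil>T / h\<rceil>) at_top at_top"
      using h by real_asymp+
    have lo_lim: "((\<lambda>r. (\<Sum>j<nat \<lfloor>T r / h\<rfloor>. ?q j) / (- ln (1 - r))) \<longlongrightarrow> P h * (1 / h)) (at_left 1)"
      unfolding T_def by (rule partial_sums_over_log[OF q top(1) floor_quotient_limit[OF h]])
    have "((\<lambda>r::real. B / (- ln (1 - r))) \<longlongrightarrow> 0) (at_left 1)" by real_asymp
    from tendsto_add[OF this partial_sums_over_log[OF q' top(2) ceiling_quotient_limit[OF h]]]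
    have up_lim: "((\<lambda>r. (B + (\<Sum>j<nat \<lceil>T r / h\<rceil>. ?q j + C * p ^ 4)) / (- ln (1 - r))) \<longlongrightarrow> (P h + C * p ^ 4) * (1 / h)) (at_left 1)"
      unfolding T_def by (simp add: add_divide_distrib diff_divide_distrib)
    have "\<forall>\<^sub>F r in at_left (1::real). 0 < r \<and> r < 1"
      unfolding eventually_at_left_field by (intro exI[of _ 0]) auto
    moreover have "filterlim (\<lambda>r. nat \<lceil>T r / h\<rceil>) at_top (at_left 1)"
      unfolding T_def by (rule filterlim_compose[OF top(2) log_log_at_top])
    then have "\<forall>\<^sub>F r in at_left 1. j0 \<le> nat \<lceil>T r / h\<rceil>" by (simp add: filterlim_at_top)
    moreover have "\<forall>\<^sub>F r in at_left 1. 0 \<le> T r"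
      using log_log_at_top unfolding T_def filterlim_at_top by (rule spec)
    ultimately have bounds: "\<forall>\<^sub>F r in at_left 1.
        ennreal ((\<Sum>j<nat \<lfloor>T r / h\<rfloor>. ?q j) / (- ln (1 - r))) \<le> (\<integral>\<^sup>+\<omega>. zero_count \<omega> 0 r \<partial>M) / ennreal (- ln (1 - r)) \<and>
        (\<integral>\<^sup>+\<omega>. zero_count \<omega> 0 r \<partial>M) / ennreal (- ln (1 - r)) \<le> ennreal ((B + (\<Sum>j<nat \<lceil>T r / h\<rceil>. ?q j + C * p ^ 4)) / (- ln (1 - r)))"
    proof eventually_elim
      case (elim r)
      \<comment> \<open>The grid indices on either side of \<open>T r\<close>: the count over
        \<open>[0, r]\<close> lies between those over the intervals ending at grid points
        \<open>m\<close> and \<open>n\<close>.\<close>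
      define m n where "m = nat \<lfloor>T r / h\<rfloor>" and "n = nat \<lceil>T r / h\<rceil>"
      have r: "r = exp (- exp (- T r))" using elim(1) unfolding T_def by simp
      have D: "- ln (1 - r) > 0" using elim(1) by simp
      have "0 \<le> T r / h" using elim(3) h by simp
      then have "real m \<le> T r / h" "T r / h \<le> real n" unfolding m_def n_def by linarith+
      then have mn: "h * real m \<le> T r" "T r \<le> h * real n" using h by (simp_all add: field_simps)
      have low: "exp (- exp (- (h * real m))) \<le> r" using mn(1) by (subst r) simp
      have high: "r \<le> exp (- exp (- (h * real n)))" using mn(2) by (subst r) simp
      have L: "ennreal (\<Sum>j<m. ?q j) \<le> (\<integral>\<^sup>+\<omega>. zero_count \<omega> 0 r \<partial>M)"
        by (rule order_trans[OF expected_zeros_lower[OF h]]) (intro nn_integral_mono zero_count_mono low)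
      have "(\<integral>\<^sup>+\<omega>. zero_count \<omega> 0 r \<partial>M) \<le> (\<integral>\<^sup>+\<omega>. zero_count \<omega> 0 (exp (- exp (- (h * real n)))) \<partial>M)"
        by (intro nn_integral_mono zero_count_mono high)
      also have "\<dots> \<le> ennreal (B + (\<Sum>j<n. ?q j + C * p ^ 4))" by (rule up[rule_format]) (use elim in \<open>simp add: n_def\<close>)
      finally have U: "(\<integral>\<^sup>+\<omega>. zero_count \<omega> 0 r \<partial>M) \<le> ennreal (B + (\<Sum>j<n. ?q j + C * p ^ 4))" .
      \<comment> \<open>Negative numerators are possible because no sign is known for
        \<open>B\<close>; both sides are then \<open>0\<close> in \<open>ennreal\<close>.\<close>
      have div: "ennreal x / ennreal (- ln (1 - r)) = ennreal (x / (- ln (1 - r)))" for x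
      proof (cases "x \<ge> 0")
        case True
        then show ?thesis using D by (intro divide_ennreal)
      next
        case False
        then have "x / (- ln (1 - r)) \<le> 0" using D by (intro divide_nonpos_pos) auto
        then show ?thesis using False by (simp add: ennreal_neg)
      qed
      show ?case using divide_right_mono_ennreal[OF L, of "ennreal (- ln (1 - r))"] divide_right_mono_ennreal[OF U, of "ennreal (- ln (1 - r))"]
        unfolding div m_def n_def by (intro conjI)
    qed
    show "\<exists>lo up. (\<forall>\<^sub>F r in at_left 1. lo r \<le> (\<integral>\<^sup>+\<omega>. zero_count \<omega> 0 r \<partial>M) / ennreal (- ln (1 - r)) \<and>
        (\<integral>\<^sup>+\<omega>. zero_count \<omega> 0 r \<partial>M) / ennreal (- ln (1 - r)) \<le> up r) \<and>
        (lo \<longlongrightarrow> ennreal (P (p ^ 3 / 2) * (1 / (p ^ 3 / 2)))) (at_left 1) \<and>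
        (up \<longlongrightarrow> ennreal ((P (p ^ 3 / 2) + C * p ^ 4) * (1 / (p ^ 3 / 2)))) (at_left 1)"
      using bounds tendsto_ennrealI[OF lo_lim] tendsto_ennrealI[OF up_lim] unfolding h_def
      by (intro exI conjI)
  next
    show "((\<lambda>p. ennreal (P (p ^ 3 / 2) * (1 / (p ^ 3 / 2)))) \<longlongrightarrow> ennreal (sqrt \<gamma> / (2 * pi))) (at_right 0)"
      by (rule tendsto_ennrealI[OF rate])
    show "((\<lambda>p. ennreal ((P (p ^ 3 / 2) + C * p ^ 4) * (1 / (p ^ 3 / 2)))) \<longlongrightarrow> ennreal (sqrt \<gamma> / (2 * pi))) (at_right 0)"
      by (rule tendsto_ennrealI[OF rate'])
  qed
qed

theorem AE_analytic_and_zeros_asymptotics: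
  "(AE \<omega> in M. (\<forall>z\<in>ball 0 1. summable (\<lambda>k. complex_of_real (\<xi> k \<omega> * c k) * z ^ k)) \<and>
      random_taylor \<xi> c \<omega> analytic_on ball 0 1) \<and>
   ((\<lambda>r. (\<integral>\<^sup>+\<omega>. num_real_zeros (random_taylor \<xi> c \<omega>) r \<partial>M) / ennreal (- ln (1 - r)))
      \<longlongrightarrow> ennreal (sqrt \<gamma> / (2 * pi))) (at_left 1)"
proof
  show "AE \<omega> in M. (\<forall>z\<in>ball 0 1. summable (\<lambda>k. complex_of_real (\<xi> k \<omega> * c k) * z ^ k)) \<and>
      random_taylor \<xi> c \<omega> analytic_on ball 0 1"
    using AE_good
  proof eventually_elim
    case (elim \<omega>)
    then have "random_taylor \<xi> c \<omega> analytic_on ball 0 1"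
      using good_holomorphic by (simp only: analytic_on_open[OF open_ball])
    moreover have "summable (\<lambda>k. complex_of_real (\<xi> k \<omega> * c k) * z ^ k)" if "z \<in> ball 0 1" for z
    proof -
      have "norm z < 1" using that unfolding mem_ball_0 .
      then show ?thesis by (rule good_summable[OF elim])
    qed
    ultimately show ?case by (intro conjI ballI)
  qed
  show "((\<lambda>r. (\<integral>\<^sup>+\<omega>. num_real_zeros (random_taylor \<xi> c \<omega>) r \<partial>M) / ennreal (- ln (1 - r)))
      \<longlongrightarrow> ennreal (sqrt \<gamma> / (2 * pi))) (at_left 1)"
    unfolding num_real_zeros_def by (rule expected_zeros_limit[unfolded zero_count_def])
qed

end

theorem theorem1p1:
  fixes M :: "'a measure" and \<xi> :: "nat \<Rightarrow> 'a \<Rightarrow> real"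
    and \<gamma> :: real and L :: "real \<Rightarrow> real" and c :: "nat \<Rightarrow> real"
  assumes "prob_space M"
    and "prob_space.indep_vars M (\<lambda>_. borel) \<xi> UNIV"
    and "\<And>k. distr M borel (\<xi> k) = distr M borel (\<xi> 0)"
    and "integrable M (\<xi> 0)" and "prob_space.expectation M (\<xi> 0) = 0"
    and "integrable M (\<lambda>\<omega>. (\<xi> 0 \<omega>)\<^sup>2)" and "prob_space.expectation M (\<lambda>\<omega>. (\<xi> 0 \<omega>)\<^sup>2) = 1"
    and "\<gamma> > 0"
    and "slowly_varying L" and "L \<in> borel_measurable (lebesgue_on {0<..})"
    and "\<And>n. n \<ge> 1 \<Longrightarrow> (c n)\<^sup>2 = real n powr (\<gamma> - 1) / Gamma \<gamma> * L (real n)"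
  shows "(AE \<omega> in M. (\<forall>z\<in>ball 0 1. summable (\<lambda>k. complex_of_real (\<xi> k \<omega> * c k) * z ^ k)) \<and>
            random_taylor \<xi> c \<omega> analytic_on ball 0 1) \<and>
         ((\<lambda>r. (\<integral>\<^sup>+\<omega>. num_real_zeros (random_taylor \<xi> c \<omega>) r \<partial>M) / ennreal (- ln (1 - r)))
            \<longlongrightarrow> ennreal (sqrt \<gamma> / (2 * pi))) (at_left 1)"
proof -
  have iid: "iid_standard M \<xi>"
    by (intro iid_standard.intro iid_standard_axioms.intro) (rule assms(1-7))+
  have coeffs: "regvar_coeffs c \<gamma>"
    by (rule slowly_varying_imp_regvar_coeffs[where L = L]) (rule assms(8-11), assumption?)+
  show ?thesis
    by (rule random_series.AE_analytic_and_zeros_asymptotics[OF random_series.intro[OF iid coeffs]])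
qed

end
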